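(* Let $\mathsf A_4(t,\tau)=\frac{(1-\frac t\tau)(1-t\tau)}{t}$ and $\mathsf B_4(\tau)=-\frac{\tau}{(1-\tau)^2}$. For integers $n\ge0$ define $$\mathsf X_4^{(n)}(\tau)=\oint_1^{\tau}\frac{[\log\mathsf A_4(t,\tau)+\log\mathsf B_4(\tau)]^n\,dt}{t}-\pi i\,\delta_{n,0},\qquad \widetilde{\mathsf X}_4^{(n)}(\tau)=\oint_1^{\tau}\frac{\log^n\mathsf A_4(t,\tau)\,dt}{t},$$ $$\Xi_4^{(n)}(\tau)=\oint_1^{-1}\frac{[\log\mathsf A_4(t,\tau)+\log\mathsf B_4(\tau)]^n-\delta_{n,0}}{t}\,dt,\qquad \widetilde\Xi_4^{(n)}(\tau)=\oint_1^{-1}\frac{\log^n\mathsf A_4(t,\tau)}{t}\,dt.$$ Then for each positive integer $k$, $$\pi^2 m_k(1+x_1+x_2+x_3)-\pi^2 m_k(1+x_1)\in\mathrm{Span}_{\mathbb Q}\left\{\pi^{2n_1}\oint_1^{-1}\widetilde{\mathsf X}_4^{(n_2)}(\tau)\mathsf X_4^{(n_3)}(\tau)\frac{\tau+1}{\tau-1}\frac{d\tau}{\tau}\;\middle|\;n_1,n_2,n_3\in\mathbb Z_{\ge0},\ (2n_1+1)+n_2+n_3=k\right\}$$ $$+\mathrm{Span}_{\mathbb Q}\left\{\pi^{2n_1}\int_{-1}^{0}\widetilde\Xi_4^{(n_2)}(\tau)\Xi_4^{(n_3)}(\tau)\frac{\tau+1}{\tau-1}\frac{d\tau}{\tau}\;\middle|\;n_1,n_2,n_3\in\mathbb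 Z_{\ge0},\ (2n_1+1)+n_2+n_3=k\right\}\subseteq\mathfrak Z_{k+2}(2),$$ and consequently $\pi^2 m_k(1+x_1+x_2+x_3)\in\mathfrak Z_{k+2}(2)$.
   Context: $\oint_a^b$ denotes integration counterclockwise along the unit circle from $a$ to $b$; the $\tau$-integral from $-1$ to $0$ is along the real segment. On these paths $\mathsf A_4$ and $\mathsf B_4$ are positive real and the logarithms are real. $\delta_{a,b}$ is the Kronecker delta. For a nonzero Laurent polynomial $P$ in $n$ variables, $m_k(P)=\int_{[0,1]^n}\log^k|P(e^{2\pi i t_1},\dots,e^{2\pi i t_n})|\,dt$. $\mathrm{Li}_{a_1,\dots,a_n}(z_1,\dots,z_n)=\sum_{\ell_1>\dots>\ell_n>0}\prod_j z_j^{\ell_j}/\ell_j^{a_j}$; for integers $k,N\ge1$, $\mathfrak Z_k(N)$ is the $\mathbb Q$-span of all convergent values $\mathrm{Li}_{a_1,\dots,a_n}(z_1,\dots,z_n)$ with $n\ge1$, $a_j\in\mathbb Z_{>0}$, $z_j^N=1$, $\sum a_j=k$ (convergent iff $(a_1,z_1)\ne(1,1)$); $\mathfrak Z_0(N)=\mathbb Q$. Thus $\mathfrak Z_k(2)$ is spanned by alternating multiple zeta values of weight $k$. *)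

theory Defs
  imports "HOL-Complex_Analysis.Complex_Analysis"
begin

global_interpretation rat_complex: vector_space "\<lambda>(q::rat) (z::complex). of_rat q * z"
  by unfold_locales (auto simp: algebra_simps of_rat_add of_rat_mult)

text \<open>Counterclockwise integration along the unit circle, from \<open>a\<close> to the first point where
  \<open>b\<close> is met. The underlying integral is of Henstock--Kurzweil type, so integrable
  singularities at the endpoints are admitted.\<close>

definition ccw_integral :: "complex \<Rightarrow> complex \<Rightarrow> (complex \<Rightarrow> complex) \<Rightarrow> complex" where
  "ccw_integral a b f =
     contour_integral (part_circlepath 0 1 (Arg2pi a) (Arg2pi a + Arg2pi (b / a))) f"

definition A4 :: "complex \<Rightarrow> complex \<Rightarrow> complex" where
  "A4 t \<tau> = (1 - t / \<tau>) * (1 - t * \<tau>) / t"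

definition B4 :: "complex \<Rightarrow> complex" where
  "B4 \<tau> = - (\<tau> / (1 - \<tau>)\<^sup>2)"

definition kdelta :: "nat \<Rightarrow> nat \<Rightarrow> complex" where
  "kdelta a b = (if a = b then 1 else 0)"

text \<open>In the interior of all paths below \<open>A4\<close> and \<open>B4\<close> take positive real values, where the
  principal branch \<open>Ln\<close> is the real logarithm.\<close>

definition X4 :: "nat \<Rightarrow> complex \<Rightarrow> complex" where
  "X4 n \<tau> = ccw_integral 1 \<tau> (\<lambda>t. (Ln (A4 t \<tau>) + Ln (B4 \<tau>)) ^ n / t)
             - of_real pi * \<i> * kdelta n 0"

definition X4_tilde :: "nat \<Rightarrow> complex \<Rightarrow> complex" where
  "X4_tilde n \<tau> = ccw_integral 1 \<tau> (\<lambda>t. Ln (A4 t \<tau>) ^ n / t)"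

definition Xi4 :: "nat \<Rightarrow> complex \<Rightarrow> complex" where
  "Xi4 n \<tau> = ccw_integral 1 (-1) (\<lambda>t. ((Ln (A4 t \<tau>) + Ln (B4 \<tau>)) ^ n - kdelta n 0) / t)"

definition Xi4_tilde :: "nat \<Rightarrow> complex \<Rightarrow> complex" where
  "Xi4_tilde n \<tau> = ccw_integral 1 (-1) (\<lambda>t. Ln (A4 t \<tau>) ^ n / t)"

text \<open>The moment \<open>m\<^sub>k(P)\<close>; a Laurent polynomial enters through its evaluation function.\<close>

definition mahler_moment :: "nat \<Rightarrow> (complex ^ 'n \<Rightarrow> complex) \<Rightarrow> real" where
  "mahler_moment k P =
     (LINT t:cbox (0 :: real ^ 'n) 1|lborel.
        ln (cmod (P (\<chi> j. exp (2 * of_real pi * \<i> * of_real (t $ j))))) ^ k)"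

text \<open>The series may converge only conditionally, so it is the limit of its truncations
  to \<open>L \<ge> l\<^sub>1 > \<dots> > l\<^sub>n > 0\<close>.\<close>

definition multi_polylog_partial :: "nat list \<Rightarrow> complex list \<Rightarrow> nat \<Rightarrow> complex" where
  "multi_polylog_partial a z L =
     (\<Sum>l | length l = length a \<and> sorted_wrt (>) l \<and> set l \<subseteq> {1..L}.
        \<Prod>j<length a. z ! j ^ (l ! j) / of_nat (l ! j) ^ (a ! j))"

definition multi_polylog :: "nat list \<Rightarrow> complex list \<Rightarrow> complex" where
  "multi_polylog a z = lim (multi_polylog_partial a z)"

text \<open>The last condition selects the convergent series.\<close>

definition cyclotomic_mzv_space :: "nat \<Rightarrow> nat \<Rightarrow> complex set" where
  "cyclotomic_mzv_space k N =
     (if k = 0 then \<rat>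
      else rat_complex.span
        {multi_polylog a z | a z.
           a \<noteq> [] \<and> length z = length a \<and> (\<forall>c \<in> set a. c > 0) \<and> (\<forall>w \<in> set z. w ^ N = 1) \<and>
           sum_list a = k \<and> (hd a, hd z) \<noteq> (1, 1)})"

definition circle_span :: "nat \<Rightarrow> complex set" where
  "circle_span k = rat_complex.span
     {of_real pi ^ (2 * n1) *
        ccw_integral 1 (-1) (\<lambda>\<tau>. X4_tilde n2 \<tau> * X4 n3 \<tau> * ((\<tau> + 1) / (\<tau> - 1)) / \<tau>)
      | n1 n2 n3. (2 * n1 + 1) + n2 + n3 = k}"

definition segment_span :: "nat \<Rightarrow> complex set" where
  "segment_span k = rat_complex.span
     {of_real pi ^ (2 * n1) *
        contour_integral (linepath (-1) 0)
          (\<lambda>\<tau>. Xi4_tilde n2 \<tau> * Xi4 n3 \<tau> * ((\<tau> + 1) / (\<tau> - 1)) / \<tau>)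
      | n1 n2 n3. (2 * n1 + 1) + n2 + n3 = k}"

end

theory Submission imports Defs "HOL-Real_Asymp.Real_Asymp" begin

text \<open>Write \<open>c = 2 - \<tau> - 1/\<tau>\<close> and \<open>e = 2 - t - 1/t\<close>. Then \<open>A4 = c - e\<close> and \<open>A4 * B4 = 1 - e/c\<close>; the unit circle
and the segment are the ranges \<open>0 < c < 4\<close> and \<open>c > 4\<close>, and \<open>(\<tau>+1)/(\<tau>-1) d\<tau>/\<tau>\<close> is \<open>dc/c\<close>. So the sums of the two
integrals are the coefficients of \<open>p^n q^m\<close> in an integral over \<open>c > 0\<close> of a product of two averages of powers.
On the diagonal \<open>q = p = -s\<close>, Fubini and the identity (both sides are hypergeometric series in \<open>e'/e\<close>)
\<open>\<integral> ((c-e)(c-e')/c)^(-s) dc/c = pi/sin(pi s) * mean of |sqrt e + sqrt e' exp(i x)|^(-2s)\<close>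
turn it into the difference of the moments of \<open>|1+x1+x2+x3|^(2p)\<close> and \<open>|1+x1|^(2p)\<close> times \<open>-pi^3/sin(pi p)\<close>.
Comparing coefficients of \<open>p^k\<close> gives the first claim. For the second, the inner integrals solve differential
systems whose solutions are harmonic polylogarithms in \<open>\<tau>\<close>, and the limits at \<open>1\<close> of harmonic polylogarithms
of weight \<open>n\<close> are alternating multiple zeta values.\<close>

text \<open>The average of the second power tends to \<open>pi\<close> at order 0 as
  \<open>c\<close> grows, so only its difference from \<open>pi\<close> is integrable against
  \<open>dc/c\<close>; this is the origin of the Kronecker deltas. The subtracted term is the case
  \<open>e' = 0\<close> of the kernel identity, which is how the moment of \<open>1 + x1\<close>
  enters. The kernel identity is used for \<open>-1/8 < p < 0\<close> only, where every integrand is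
  nonnegative and Tonelli's theorem applies freely; both sides are power series in \<open>p\<close>,
  and a one-sided interval determines the coefficients. The sine is odd, hence the odd exponents
  \<open>2 n1 + 1\<close>. The obstacle for the second claim is that single words diverge at the
  endpoints although the whole integral converges. No primitive is estimated there: integrability of
  the integrand forces the primitive to have limits, and a convergent expansion in powers of a
  logarithm that tends to infinity equals its constant term, which has the right weight. On the arc
  the constants involve powers of \<open>i pi\<close>. The integrals are real, so odd powers drop
  out, and even powers are rational multiples of powers of zeta(2).\<close>

notation tendsto (infixr "--->" 55)

section \<open>Harmonic polylogarithms\<close>

definition hpl_dom :: "complex set" where
 "hpl_dom = - {t. Im t = 0 & 1 <= \<bar>Re t\<bar>}"

text \<open>For \<open>x = 1\<close> and \<open>x = -1\<close> this is the derivative of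
  \<open>- log (1 - x t)\<close>, so the letter -1 stands for \<open>-1 / (1 + t)\<close>. With this
  sign the substitution \<open>t -> -t\<close> permutes words without introducing signs.\<close>

definition hpl_form :: "int => complex => complex" where
 "hpl_form x t = (if x = 0 then 1 / t else of_int x / (1 - of_int x * t))"

text \<open>A last letter 0 would integrate \<open>1/t\<close> from the origin. Excluding it keeps
  every function holomorphic at 0; powers of \<open>log t\<close> enter separately through
  \<open>hpl_log\<close>.\<close>

definition hpl_word :: "int list => bool" where
 "hpl_word w \<longleftrightarrow> set w <= {-1, 0, 1} & (w ~= [] --> last w ~= 0)"

lemma hpl_word_Nil [simp]: "hpl_word []"
 by (simp add: hpl_word_def)

lemma hpl_word_Cons:
 "hpl_word (x # w) \<longleftrightarrow> x : {-1, 0, 1} & hpl_word w & (w = [] --> x ~= 0)"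
 by (auto simp: hpl_word_def)

lemma open_hpl_dom: "open hpl_dom"
proof -
 have "closed {t. Im t = 0 & 1 <= \<bar>Re t\<bar>}"
  by (intro closed_Collect_conj closed_Collect_eq closed_Collect_le continuous_intros)
 then show ?thesis by (simp add: hpl_dom_def open_Compl)
qed

lemma zero_in_hpl_dom [simp]: "0 : hpl_dom"
 by (simp add: hpl_dom_def)

lemma hpl_dom_scale:
 assumes "t : hpl_dom" "0 <= s" "s <= 1"
 shows "of_real s * t : hpl_dom"
proof -
 have "\<bar>s * Re t\<bar> <= \<bar>Re t\<bar>"
  using assms by (simp add: abs_mult mult_left_le_one_le)
 then show ?thesis using assms by (auto simp: hpl_dom_def)
qed

lemma starlike_hpl_dom: "starlike hpl_dom"
proof -
 have "closed_segment 0 t <= hpl_dom" if "t : hpl_dom" for t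
  using hpl_dom_scale[OF that] by (auto simp: closed_segment_def scaleR_conv_of_real)
 then show ?thesis unfolding starlike_def by (intro bexI[of _ 0]) auto
qed

lemma connected_hpl_dom: "connected hpl_dom"
 by (rule starlike_imp_connected[OF starlike_hpl_dom])

lemma hpl_dom_ne_sing: "t : hpl_dom ==> x : {-1, 1} ==> 1 - of_int x * t ~= 0"
 by (auto simp: hpl_dom_def complex_eq_iff)

lemma ball_subset_hpl_dom: "ball 0 1 <= hpl_dom"
proof
 fix t :: complex assume "t : ball 0 1"
 then show "t : hpl_dom" using abs_Re_le_cmod[of t] by (auto simp: hpl_dom_def)
qed

lemma cball_subset_hpl_dom: "cball 0 1 - {1, -1} <= hpl_dom"
proof
 fix t :: complex assume "t : cball 0 1 - {1, -1}"
 then show "t : hpl_dom" using abs_Re_le_cmod[of t]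
  by (auto simp: hpl_dom_def complex_eq_iff)
qed

text \<open>An iterated integral from 0, encoded as a chosen primitive that vanishes at 0. For the
  letter 0 the integrand has a removable singularity at the origin, with value
  \<open>deriv (hpl w) 0\<close> because the shorter word vanishes there.\<close>

primrec hpl :: "int list => complex => complex" where
 "hpl [] = (%_. 1)"
| "hpl (x # w) = (SOME g. g 0 = 0 & (ALL t:hpl_dom. (g has_field_derivative
  (if x = 0 & t = 0 then deriv (hpl w) 0 else hpl w t * hpl_form x t)) (at t)))"

declare hpl.simps(2) [simp del]

definition hpl_kernel :: "int => int list => complex => complex" where
 "hpl_kernel x w t = (if x = 0 & t = 0 then deriv (hpl w) 0 else hpl w t * hpl_form x t)"

lemma hpl_form_holomorphic: "x : {-1, 1} ==> hpl_form x holomorphic_on hpl_dom"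
proof -
 assume x: "x : {-1, 1}"
 have "(%t. of_int x / (1 - of_int x * t)) holomorphic_on hpl_dom"
  using hpl_dom_ne_sing[OF _ x] by (intro holomorphic_intros) auto
 then show ?thesis using x by (auto simp: hpl_form_def[abs_def])
qed

lemma primitive_on_hpl_dom:
 assumes "f holomorphic_on hpl_dom"
 shows "EX g. g 0 = 0 & (ALL t:hpl_dom. (g has_field_derivative f t) (at t))"
proof -
 have "EX g. ALL t:hpl_dom. (g has_field_derivative f t) (at t)"
  using assms open_hpl_dom
  by (intro holomorphic_starlike_primitive[OF _ starlike_hpl_dom open_hpl_dom finite.emptyI])
   (auto intro: holomorphic_on_imp_continuous_on holomorphic_on_imp_differentiable_at)
 then obtain g where g: "!!t. t : hpl_dom ==> (g has_field_derivative f t) (at t)" by blast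
 have "ALL t:hpl_dom. ((%t. g t - g 0) has_field_derivative f t) (at t)"
  using g by (auto intro!: derivative_eq_intros)
 then show ?thesis by (intro exI[of _ "%t. g t - g 0"]) auto
qed

text \<open>The facts are proved in one induction because they depend on each other: the primitive
  exists when the kernel is holomorphic, and for the letter 0 the kernel is holomorphic because the
  shorter word vanishes at 0.\<close>

lemma hpl_invariants:
 assumes "hpl_word w"
 shows "hpl w holomorphic_on hpl_dom"
  and "w ~= [] ==> hpl w 0 = 0"
  and "!!x v t. w = x # v ==> t : hpl_dom ==> (hpl w has_field_derivative hpl_kernel x v t) (at t)"
  and "!!x v. w = x # v ==> hpl_kernel x v holomorphic_on hpl_dom"
proof -
 have "hpl w holomorphic_on hpl_dom & (w ~= [] --> hpl w 0 = 0) &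
  (ALL x v. w = x # v --> hpl_kernel x v holomorphic_on hpl_dom &
   (ALL t:hpl_dom. (hpl w has_field_derivative hpl_kernel x v t) (at t)))"
  using assms
 proof (induction w)
  case Nil
  then show ?case by simp
 next
  case (Cons x v)
  have v: "hpl_word v" and x: "x : {-1,0,1}" "v = [] --> x ~= 0"
   using Cons.prems by (auto simp: hpl_word_Cons)
  have hv: "hpl v holomorphic_on hpl_dom" and v0: "v ~= [] --> hpl v 0 = 0"
   using Cons.IH[OF v] by auto
  have k: "hpl_kernel x v holomorphic_on hpl_dom"
  proof (cases "x = 0")
   case True
   have "(%z. if z = 0 then deriv (hpl v) 0 else (hpl v z - hpl v 0) / (z - 0)) holomorphic_on hpl_dom"
    by (rule pole_lemma_open[OF hv open_hpl_dom])
   then show ?thesis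
    by (rule holomorphic_transform) (use True x v0 in "auto simp: hpl_kernel_def hpl_form_def")
  next
   case False
   have "(%t. hpl v t * hpl_form x t) holomorphic_on hpl_dom"
    using hpl_form_holomorphic[of x] False x by (intro holomorphic_on_mult hv) auto
   then show ?thesis using False by (simp add: hpl_kernel_def[abs_def])
  qed
  have hpl_eq: "hpl (x # v) = (SOME g. g 0 = 0 & (ALL t:hpl_dom. (g has_field_derivative hpl_kernel x v t) (at t)))"
   by (simp add: hpl_kernel_def hpl.simps(2))
  have g: "hpl (x # v) 0 = 0 & (ALL t:hpl_dom. (hpl (x # v) has_field_derivative hpl_kernel x v t) (at t))"
   unfolding hpl_eq by (rule someI_ex[OF primitive_on_hpl_dom[OF k]])
  then have "hpl (x # v) holomorphic_on hpl_dom"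
   by (auto simp: holomorphic_on_open[OF open_hpl_dom])
  with g k show ?case by auto
 qed
 then show "hpl w holomorphic_on hpl_dom" "w ~= [] ==> hpl w 0 = 0"
  "!!x v t. w = x # v ==> t : hpl_dom ==> (hpl w has_field_derivative hpl_kernel x v t) (at t)"
  "!!x v. w = x # v ==> hpl_kernel x v holomorphic_on hpl_dom"
  by auto
qed

lemma hpl_holomorphic: "hpl_word w ==> hpl w holomorphic_on hpl_dom"
 by (rule hpl_invariants)

lemma hpl_at_0: "hpl_word w ==> w ~= [] ==> hpl w 0 = 0"
 by (rule hpl_invariants)

lemma hpl_has_derivative_kernel:
 "hpl_word (x # w) ==> t : hpl_dom ==> (hpl (x # w) has_field_derivative hpl_kernel x w t) (at t)"
 by (rule hpl_invariants) auto

lemma hpl_has_derivative: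
 "hpl_word (x # w) ==> t : hpl_dom ==> t ~= 0 ==>
  (hpl (x # w) has_field_derivative hpl w t * hpl_form x t) (at t)"
 using hpl_has_derivative_kernel[of x w t] by (simp add: hpl_kernel_def)

text \<open>The derivatives are only compared off the origin because \<open>hpl_form 0\<close> has a junk value there.\<close>

lemma eq_on_hpl_dom:
 assumes f: "f holomorphic_on hpl_dom" and g: "g holomorphic_on hpl_dom" and 0: "f 0 = g 0"
  and d: "!!t. t : hpl_dom ==> t ~= 0 ==> (f has_field_derivative D t) (at t)"
     "!!t. t : hpl_dom ==> t ~= 0 ==> (g has_field_derivative D t) (at t)"
  and t: "t : hpl_dom"
 shows "f t = g t"
proof -
 obtain c where c: "!!x. x : hpl_dom ==> f x - g x = c"
 proof (rule DERIV_zero_connected_constant[OF connected_hpl_dom open_hpl_dom, of "{0}" "%t. f t - g t"])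
  show "continuous_on hpl_dom (%t. f t - g t)"
   using f g by (intro continuous_intros holomorphic_on_imp_continuous_on)
  show "ALL x:hpl_dom - {0}. ((%t. f t - g t) has_field_derivative 0) (at x)"
   using DERIV_diff[OF d] by auto
 qed auto
 then show ?thesis using c[OF t] c[of 0] 0 by auto
qed

text \<open>A rational span graded by word length, as a predicate on functions. Closure under
  equality on \<open>hpl_dom\<close> absorbs arbitrary values outside. The predicate
  \<open>P\<close> records the first letter where regularisation has to know it.\<close>

inductive hpl_span :: "(int list => bool) => nat => (complex => complex) => bool" for P where
 word: "hpl_word w ==> P w ==> hpl_span P (length w) (%t. of_rat q * hpl w t)"
| zero: "hpl_span P n (%_. 0)"
| add: "hpl_span P n f ==> hpl_span P n g ==> hpl_span P n (%t. f t + g t)"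
| cong: "hpl_span P n f ==> (!!t. t : hpl_dom ==> f t = g t) ==> hpl_span P n g"

abbreviation "hpls \<equiv> hpl_span (%_. True)"

text \<open>The words whose polylogarithm has a finite limit at \<open>1\<close>.\<close>

definition tame :: "int list => bool" where
 "tame w \<longleftrightarrow> (w = [] | hd w ~= 1)"

lemma hpl_span_mono: "hpl_span P n f ==> (!!w. P w ==> Q w) ==> hpl_span Q n f"
proof (induction rule: hpl_span.induct)
 case (cong n f g)
 then show ?case using hpl_span.cong[of Q n f g] by blast
qed (auto intro: hpl_span.word hpl_span.zero hpl_span.add)

lemma hpl_span_scale: "hpl_span P n f ==> hpl_span P n (%t. of_rat q * f t)"
proof (induction rule: hpl_span.induct)
 case (word w q')
 show ?case
  by (rule hpl_span.cong[OF hpl_span.word[of w P "q * q'", OF word]]) (simp add: of_rat_mult)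
next
 case (zero n)
 show ?case by (rule hpl_span.cong[OF hpl_span.zero]) simp
next
 case (add n f g)
 show ?case by (rule hpl_span.cong[OF hpl_span.add[OF add.IH]]) (simp add: ring_distribs)
next
 case (cong n f g)
 show ?case by (rule hpl_span.cong[OF cong.IH]) (simp add: cong)
qed

lemma hpl_span_hpl: "hpl_word w ==> P w ==> hpl_span P (length w) (hpl w)"
 using hpl_span.word[of w P 1] by simp

lemma hpl_span_minus: "hpl_span P n f ==> hpl_span P n (%t. - f t)"
 by (rule hpl_span.cong[OF hpl_span_scale[of P n f "-1"]]) auto

lemma hpl_span_diff: "hpl_span P n f ==> hpl_span P n g ==> hpl_span P n (%t. f t - g t)"
 by (rule hpl_span.cong[OF hpl_span.add[OF _ hpl_span_minus, of P n f g]]) auto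

lemma hpl_span_holomorphic: "hpl_span P n f ==> f holomorphic_on hpl_dom"
proof (induction rule: hpl_span.induct)
 case (word w q)
 then show ?case by (intro holomorphic_intros hpl_holomorphic)
next
 case (cong n f g)
 then show ?case using holomorphic_transform by blast
qed (auto intro!: holomorphic_intros)

text \<open>Integration prepends the letter \<open>x\<close> to each word, and the first letter is
  kept in the conclusion so that tame primitives can be recognised later.\<close>

lemma hpls_primitive:
 assumes "hpls n f" "x : {-1, 0, 1}" "x = 0 ==> n > 0"
 obtains g where "hpl_span (%w. w ~= [] & hd w = x) (Suc n) g" "g 0 = 0"
  "!!t. t : hpl_dom ==> t ~= 0 ==> (g has_field_derivative f t * hpl_form x t) (at t)"
proof -
 have "EX g. hpl_span (%w. w ~= [] & hd w = x) (Suc n) g & g 0 = 0 &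
  (ALL t:hpl_dom. t ~= 0 --> (g has_field_derivative f t * hpl_form x t) (at t))"
  using assms
 proof (induction rule: hpl_span.induct)
  case (word w q)
  have w: "hpl_word (x # w)" using word by (auto simp: hpl_word_Cons)
  have "((%t. of_rat q * hpl (x # w) t) has_field_derivative of_rat q * hpl w t * hpl_form x t) (at t)"
   if "t : hpl_dom" "t ~= 0" for t
   using DERIV_cmult[OF hpl_has_derivative[OF w that], of "of_rat q"] by (simp add: mult.assoc)
  then show ?case
   using hpl_span.word[of "x # w" "%w. w ~= [] & hd w = x" q] hpl_at_0[of "x # w"] w
   by (intro exI[of _ "%t. of_rat q * hpl (x # w) t"]) auto
 next
  case (zero n)
  then show ?case by (intro exI[of _ "%_. 0"]) (auto intro: hpl_span.zero)
 next
  case (add n f g)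
  then obtain F G where *: "hpl_span (%w. w ~= [] & hd w = x) (Suc n) F" "F 0 = 0"
   "ALL t:hpl_dom. t ~= 0 --> (F has_field_derivative f t * hpl_form x t) (at t)"
   "hpl_span (%w. w ~= [] & hd w = x) (Suc n) G" "G 0 = 0"
   "ALL t:hpl_dom. t ~= 0 --> (G has_field_derivative g t * hpl_form x t) (at t)" by blast
  show ?case using *
   by (intro exI[of _ "%t. F t + G t"])
    (auto intro!: hpl_span.add derivative_eq_intros simp: ring_distribs)
 next
  case (cong n f g)
  then show ?case by auto
 qed
 then show ?thesis using that by blast
qed

text \<open>The shuffle product, by induction on the total length: differentiating the product
  removes the first letter of one factor at a time, and functions on the connected domain with the
  same derivative and the same value at 0 agree.\<close>

lemma hpls_mult_words:
 "hpl_word u ==> hpl_word v ==> hpls (length u + length v) (%t. hpl u t * hpl v t)"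
proof (induction "length u + length v" arbitrary: u v)
 case 0
 then show ?case using hpl_span_hpl[of "[]" "%_. True"] by simp
next
 case (Suc n)
 show ?case
 proof (cases "u = [] | v = []")
  case True
  then show ?thesis using hpl_span_hpl[of u "%_. True"] hpl_span_hpl[of v "%_. True"] Suc.prems by auto
 next
  case False
  then obtain x u' y v' where uv: "u = x # u'" "v = y # v'" by (meson neq_Nil_conv)
  have w: "hpl_word u'" "hpl_word v'" "x : {-1,0,1}" "y : {-1,0,1}"
   using Suc.prems uv by (auto simp: hpl_word_Cons)
  have a: "hpls (length u' + length v) (%t. hpl u' t * hpl v t)" "length u' + length v > 0"
   using Suc.hyps(1)[of u' v] Suc.hyps(2) Suc.prems w uv by auto
  obtain g where g: "hpl_span (%w. w ~= [] & hd w = x) (Suc (length u' + length v)) g" "g 0 = 0"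
   "!!t. t : hpl_dom ==> t ~= 0 ==> (g has_field_derivative hpl u' t * hpl v t * hpl_form x t) (at t)"
   by (rule hpls_primitive[OF a(1) w(3)]) (use a(2) in auto)
  have b: "hpls (length u + length v') (%t. hpl u t * hpl v' t)" "length u + length v' > 0"
   using Suc.hyps(1)[of u v'] Suc.hyps(2) Suc.prems w uv by auto
  obtain h where h: "hpl_span (%w. w ~= [] & hd w = y) (Suc (length u + length v')) h" "h 0 = 0"
   "!!t. t : hpl_dom ==> t ~= 0 ==> (h has_field_derivative hpl u t * hpl v' t * hpl_form y t) (at t)"
   by (rule hpls_primitive[OF b(1) w(4)]) (use b(2) in auto)
  have gh: "hpls (length u + length v) (%t. g t + h t)"
   using hpl_span_mono[OF g(1), of "%_. True"] hpl_span_mono[OF h(1), of "%_. True"] uv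
   by (auto intro!: hpl_span.add)
  show ?thesis
  proof (rule hpl_span.cong[OF gh])
   fix t assume t: "t : hpl_dom"
   show "g t + h t = hpl u t * hpl v t"
   proof (rule eq_on_hpl_dom[OF _ _ _ _ _ t, of _ _
      "%t. hpl u' t * hpl v t * hpl_form x t + hpl u t * hpl v' t * hpl_form y t"])
    show "(%t. g t + h t) holomorphic_on hpl_dom"
     using gh by (rule hpl_span_holomorphic)
    show "(%t. hpl u t * hpl v t) holomorphic_on hpl_dom"
     using Suc.prems by (intro holomorphic_intros hpl_holomorphic)
    show "g 0 + h 0 = hpl u 0 * hpl v 0" using g h hpl_at_0[of u] uv Suc.prems by auto
    fix t assume t: "t : hpl_dom" "t ~= 0"
    show "((%t. g t + h t) has_field_derivative hpl u' t * hpl v t * hpl_form x t + hpl u t * hpl v' t * hpl_form y t) (at t)"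
     using g(3)[OF t] h(3)[OF t] by (intro derivative_intros)
    show "((%t. hpl u t * hpl v t) has_field_derivative hpl u' t * hpl v t * hpl_form x t + hpl u t * hpl v' t * hpl_form y t) (at t)"
     using DERIV_mult'[OF hpl_has_derivative[of x u' t] hpl_has_derivative[of y v' t]] t Suc.prems uv
     by (simp add: algebra_simps del: hpl.simps)
   qed
  qed
 qed
qed

lemma hpls_mult:
 assumes "hpls m f" "hpls n g" shows "hpls (m + n) (%t. f t * g t)"
 using assms(1)
proof (induction rule: hpl_span.induct)
 case (word u q)
 show ?case using assms(2)
 proof (induction rule: hpl_span.induct)
  case (word v q')
  show ?case
   by (rule hpl_span.cong[OF hpl_span_scale[OF hpls_mult_words[OF \<open>hpl_word u\<close> \<open>hpl_word v\<close>], of "q * q'"]])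
    (simp add: of_rat_mult)
 next
  case (add n f g)
  show ?case by (rule hpl_span.cong[OF hpl_span.add[OF add.IH]]) (simp add: ring_distribs)
 next
  case (cong n f g)
  show ?case by (rule hpl_span.cong[OF cong.IH]) (simp add: cong)
 qed (auto intro: hpl_span.zero)
next
 case (add n f g)
 show ?case by (rule hpl_span.cong[OF hpl_span.add[OF add.IH]]) (simp add: ring_distribs)
next
 case (cong n f g)
 show ?case by (rule hpl_span.cong[OF cong.IH]) (simp add: cong)
qed (auto intro: hpl_span.zero)

lemma hpls_power: "hpls 1 f ==> hpls j (%t. f t ^ j)"
proof (induction j)
 case 0
 then show ?case using hpl_span_hpl[of "[]" "%_. True"] by simp
next
 case (Suc j)
 then show ?case using hpls_mult[of 1 f j "%t. f t ^ j"] by simp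
qed

section \<open>Shuffle regularisation at 1: divergence isolated in powers of log (1 - t)\<close>

inductive hpl_reg :: "nat => (complex => complex) => bool" where
 gen: "hpl_word w ==> tame w ==> hpl_reg (j + length w) (%t. of_rat q * hpl [1] t ^ j * hpl w t)"
| zero: "hpl_reg n (%_. 0)"
| add: "hpl_reg n f ==> hpl_reg n g ==> hpl_reg n (%t. f t + g t)"
| cong: "hpl_reg n f ==> (!!t. t : hpl_dom ==> f t = g t) ==> hpl_reg n g"

lemma hpl_reg_holomorphic: "hpl_reg n f ==> f holomorphic_on hpl_dom"
proof (induction rule: hpl_reg.induct)
 case (gen w j q)
 have "hpl_word [1]" by (simp add: hpl_word_def)
 with gen show ?case by (intro holomorphic_intros hpl_holomorphic)
next
 case (cong n f g)
 then show ?case using holomorphic_transform by blast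
qed (auto intro!: holomorphic_intros)

lemma hpl_reg_span: "hpl_span tame n f ==> hpl_reg n f"
proof (induction rule: hpl_span.induct)
 case (word w q)
 then show ?case using hpl_reg.gen[of w 0 q] by simp
next
 case (cong n f g)
 then show ?case using hpl_reg.cong[of n f g] by blast
qed (auto intro: hpl_reg.zero hpl_reg.add)

text \<open>Integration by parts: with \<open>l = - log (1 - t)\<close> and \<open>v = y # v'\<close>, \<open>y ~= 1\<close>, one has
 \<open>(j + 1) \<integral> l ^ j L v dl = l ^ (j + 1) L v - \<integral> l ^ (j + 1) L v' \<omega> y\<close>, and the last
 integral is a combination of words that start with \<open>y\<close>.\<close>

lemma hpl_reg_primitive_1:
 assumes "hpl_reg n f"
 shows "EX g. hpl_reg (Suc n) g & g 0 = 0 &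
  (ALL t:hpl_dom. t ~= 0 --> (g has_field_derivative f t * hpl_form 1 t) (at t))"
 using assms
proof (induction rule: hpl_reg.induct)
 case (gen w j q)
 let ?l = "hpl [1]"
 have w1: "hpl_word [1]" by (simp add: hpl_word_def)
 have dl: "(?l has_field_derivative hpl_form 1 t) (at t)" if "t : hpl_dom" "t ~= 0" for t
  using hpl_has_derivative[OF w1 that] by simp
 have l0: "?l 0 = 0" using hpl_at_0[OF w1] by simp
 show ?case
 proof (cases w)
  case Nil
  have r: "hpl_reg (Suc (j + length w)) (%t. of_rat (q / of_nat (Suc j)) * ?l t ^ Suc j * hpl [] t)"
   using hpl_reg.gen[of "[]" "Suc j" "q / of_nat (Suc j)"] Nil by (simp add: tame_def)
  have d: "((%t. of_rat (q / of_nat (Suc j)) * ?l t ^ Suc j * hpl [] t) has_field_derivative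
    of_rat q * ?l t ^ j * hpl w t * hpl_form 1 t) (at t)" if "t : hpl_dom" "t ~= 0" for t
  proof -
   define c :: complex where "c = of_rat (q / of_nat (Suc j))"
   have c: "c * of_nat (Suc j) = of_rat q"
    by (simp add: c_def of_rat_divide of_rat_add del: of_nat_Suc)
   have "((%t. c * ?l t ^ Suc j * 1) has_field_derivative
     c * (of_nat (Suc j) * (hpl_form 1 t * ?l t ^ j))) (at t)"
    using DERIV_cmult[OF DERIV_power[OF dl[OF that], of "Suc j"], of c] by (simp del: of_nat_Suc hpl.simps power_Suc)
   also have "c * (of_nat (Suc j) * (hpl_form 1 t * ?l t ^ j)) = of_rat q * ?l t ^ j * hpl w t * hpl_form 1 t"
    unfolding c[symmetric] Nil by (simp del: of_nat_Suc hpl.simps(2))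
   finally show ?thesis by (simp add: c_def del: hpl.simps(2) power_Suc of_nat_Suc)
  qed
  show ?thesis using r d l0
   by (intro exI[of _ "%t. of_rat (q / of_nat (Suc j)) * ?l t ^ Suc j * hpl [] t"]) (simp del: hpl.simps of_nat_Suc)
 next
  case (Cons y v)
  have yv: "y : {-1,0,1}" "y ~= 1" "hpl_word v" using gen Cons by (auto simp: hpl_word_Cons tame_def)
  have a: "hpls (Suc j + length v) (%t. ?l t ^ Suc j * hpl v t)"
   using hpl_span_hpl[OF w1] hpl_span_hpl[OF yv(3)] by (intro hpls_mult hpls_power) auto
  obtain h where h: "hpl_span (%w. w ~= [] & hd w = y) (Suc (Suc j + length v)) h" "h 0 = 0"
   "!!t. t : hpl_dom ==> t ~= 0 ==> (h has_field_derivative ?l t ^ Suc j * hpl v t * hpl_form y t) (at t)"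
   by (rule hpls_primitive[OF a yv(1)]) auto
  have "hpl_span tame (Suc (Suc j + length v)) h"
   by (rule hpl_span_mono[OF h(1)]) (use yv in "auto simp: tame_def")
  then have "hpl_reg (Suc (Suc j + length v)) (%t. of_rat (- q / of_nat (Suc j)) * h t)"
   by (intro hpl_reg_span hpl_span_scale)
  then have r: "hpl_reg (Suc (j + length w))
   (%t. of_rat (q / of_nat (Suc j)) * ?l t ^ Suc j * hpl w t + of_rat (- q / of_nat (Suc j)) * h t)"
   using hpl_reg.gen[of w "Suc j" "q / of_nat (Suc j)"] gen Cons by (intro hpl_reg.add) auto
  have d: "((%t. of_rat (q / of_nat (Suc j)) * ?l t ^ Suc j * hpl w t + of_rat (- q / of_nat (Suc j)) * h t)
   has_field_derivative of_rat q * ?l t ^ j * hpl w t * hpl_form 1 t) (at t)"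
   if t: "t : hpl_dom" "t ~= 0" for t
  proof -
   define c :: complex where "c = of_rat (q / of_nat (Suc j))"
   have c: "c * of_nat (Suc j) = of_rat q"
    by (simp add: c_def of_rat_divide of_rat_add del: of_nat_Suc)
   have c': "of_rat (- q / of_nat (Suc j)) = - c" by (simp add: c_def of_rat_minus)
   have dw: "(hpl w has_field_derivative hpl v t * hpl_form y t) (at t)"
    using hpl_has_derivative[of y v t] gen Cons t by simp
   have "((%t. c * (?l t ^ Suc j * hpl w t) + - c * h t) has_field_derivative
     c * (?l t ^ Suc j * (hpl v t * hpl_form y t) + of_nat (Suc j) * (hpl_form 1 t * ?l t ^ j) * hpl w t)
     + - c * (?l t ^ Suc j * hpl v t * hpl_form y t)) (at t)"
    using DERIV_add[OF DERIV_cmult[OF DERIV_mult'[OF DERIV_power[OF dl[OF t], of "Suc j"] dw], of c]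
      DERIV_cmult[OF h(3)[OF t], of "- c"]] by (simp del: of_nat_Suc hpl.simps power_Suc)
   also have "c * (?l t ^ Suc j * (hpl v t * hpl_form y t) + of_nat (Suc j) * (hpl_form 1 t * ?l t ^ j) * hpl w t)
     + - c * (?l t ^ Suc j * hpl v t * hpl_form y t) = (c * of_nat (Suc j)) * ?l t ^ j * hpl w t * hpl_form 1 t"
    by (simp add: algebra_simps del: of_nat_Suc hpl.simps power_Suc)
   finally show ?thesis unfolding c c' by (simp only: c_def mult.assoc)
  qed
  show ?thesis using r d l0 h(2)
   by (intro exI[of _ "%t. of_rat (q / of_nat (Suc j)) * ?l t ^ Suc j * hpl w t + of_rat (- q / of_nat (Suc j)) * h t"])
    (simp del: hpl.simps of_nat_Suc)
 qed
next
 case (zero n)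
 then show ?case by (intro exI[of _ "%_. 0"]) (auto intro: hpl_reg.zero)
next
 case (add n f g)
 then obtain F G where *: "hpl_reg (Suc n) F" "F 0 = 0"
  "ALL t:hpl_dom. t ~= 0 --> (F has_field_derivative f t * hpl_form 1 t) (at t)"
  "hpl_reg (Suc n) G" "G 0 = 0"
  "ALL t:hpl_dom. t ~= 0 --> (G has_field_derivative g t * hpl_form 1 t) (at t)" by blast
 show ?case using *
  by (intro exI[of _ "%t. F t + G t"])
   (auto intro!: hpl_reg.add derivative_eq_intros simp: ring_distribs)
next
 case (cong n f g)
 then show ?case by auto
qed

text \<open>A word whose first letter is not 1 is tame already. A leading 1 is an integration
  against \<open>dl\<close> with \<open>l = - log (1 - t)\<close>, under which the class is
  closed.\<close>

lemma hpl_reg_hpl: "hpl_word w ==> hpl_reg (length w) (hpl w)"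
proof (induction w)
 case Nil
 then show ?case using hpl_reg.gen[of "[]" 0 1] by (simp add: tame_def)
next
 case (Cons x w)
 show ?case
 proof (cases "x = 1")
  case False
  then show ?thesis using hpl_reg.gen[of "x # w" 0 1] Cons.prems by (simp add: tame_def del: hpl.simps)
 next
  case True
  have w: "hpl_word w" using Cons.prems by (simp add: hpl_word_Cons)
  obtain g where g: "hpl_reg (Suc (length w)) g" "g 0 = 0"
   "ALL t:hpl_dom. t ~= 0 --> (g has_field_derivative hpl w t * hpl_form 1 t) (at t)"
   using hpl_reg_primitive_1[OF Cons.IH[OF w]] by blast
  have "hpl_reg (Suc (length w)) (hpl (x # w))"
  proof (rule hpl_reg.cong[OF g(1)])
   fix t assume "t : hpl_dom"
   then show "g t = hpl (x # w) t"
   proof (rule eq_on_hpl_dom[OF hpl_reg_holomorphic[OF g(1)] hpl_holomorphic[OF Cons.prems], rotated 3])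
    show "g 0 = hpl (x # w) 0" using g(2) hpl_at_0[OF Cons.prems] by simp
    show "(g has_field_derivative hpl w t * hpl_form 1 t) (at t)" if "t : hpl_dom" "t ~= 0" for t
     using g(3) that by blast
    show "(hpl (x # w) has_field_derivative hpl w t * hpl_form 1 t) (at t)" if "t : hpl_dom" "t ~= 0" for t
     using hpl_has_derivative[OF Cons.prems that] True by simp
   qed
  qed
  then show ?thesis by simp
 qed
qed

subsection \<open>Behaviour near the singular points\<close>

text \<open>Applied with \<open>z = t^2\<close> along the ray from 0 to \<open>t\<close>: the first
  bound controls the integral over \<open>s\<close>, the second keeps the dependence on
  \<open>t\<close>. Both follow from \<open>1 - s^2 <= cmod (1 - s^2 z)\<close>.\<close>

lemma norm_one_minus_scaled:
 fixes z :: complex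
 assumes "cmod z <= 1" "0 <= s" "s <= 1"
 shows "1 - s <= cmod (1 - of_real (s^2) * z)" "cmod (1 - z) / 2 <= cmod (1 - of_real (s^2) * z)"
proof -
 have s: "s^2 <= s" "0 <= s^2" using assms by (auto simp: power2_eq_square mult_left_le)
 have a: "cmod (of_real (s^2) * z) <= s^2"
  using mult_left_le[of "cmod z" "s^2"] assms s unfolding norm_mult norm_of_real by simp
 have b: "1 - s\<^sup>2 <= cmod (1 - of_real (s^2) * z)"
  using norm_triangle_ineq2[of 1 "of_real (s^2) * z"] a by simp
 then show "1 - s <= cmod (1 - of_real (s^2) * z)" using s by simp
 have "cmod (1 - z) <= cmod (1 - of_real (s^2) * z) + cmod (of_real (s^2 - 1) * z)"
  using norm_triangle_ineq[of "1 - of_real (s^2) * z" "of_real (s^2 - 1) * z"]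
  by (simp add: algebra_simps)
 also have "cmod (of_real (s^2 - 1) * z) = (1 - s\<^sup>2) * cmod z"
  using s assms unfolding norm_mult norm_of_real by simp
 also have "(1 - s\<^sup>2) * cmod z <= 1 - s\<^sup>2"
  using s assms by (intro mult_left_le) auto
 finally show "cmod (1 - z) / 2 <= cmod (1 - of_real (s^2) * z)" using b by simp
qed

lemma hpl_form_bound:
 assumes "x : {-1, 1}" "t : cball 0 1 - {1, -1}"
 shows "cmod (hpl_form x t) <= 2 / cmod (1 - t\<^sup>2)"
proof -
 have f: "1 - t\<^sup>2 = (1 - of_int x * t) * (1 + of_int x * t)"
  using assms by (auto simp: power2_eq_square algebra_simps)
 have "cmod (1 + of_int x * t) <= 2"
  using assms norm_triangle_ineq[of 1 "of_int x * t"] by (auto simp: norm_mult)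
 moreover have "1 - of_int x * t ~= 0" "1 + of_int x * t ~= 0"
  using assms by (auto simp: add_eq_0_iff minus_equation_iff[of t])
 moreover have "cmod (hpl_form x t) = 1 / cmod (1 - of_int x * t)"
  using assms by (auto simp: hpl_form_def norm_divide)
 ultimately show ?thesis unfolding f norm_mult
  using frac_le[of 1 1 "cmod (1 - of_int x * t) * (cmod (1 + of_int x * t) / 2)" "cmod (1 - of_int x * t)"]
  by (simp add: mult_left_le)
qed

lemma one_minus_square_bounds:
 assumes "t : cball 0 1 - {1, - 1 :: complex}"
 shows "0 < cmod (1 - t\<^sup>2)" "cmod (1 - t\<^sup>2) <= 2"
proof -
 have "1 - t\<^sup>2 = (1 - t) * (1 + t)" by (simp add: power2_eq_square algebra_simps)
 then have "1 - t\<^sup>2 ~= 0" using assms by (auto simp: add_eq_0_iff)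
 then show "0 < cmod (1 - t\<^sup>2)" by simp
 have "cmod (t^2) <= 1" using assms by (simp add: norm_power power_le_one)
 then show "cmod (1 - t\<^sup>2) <= 2" using norm_triangle_ineq4[of 1 "t^2"] by simp
qed

lemma has_vector_derivative_along_ray:
 fixes f :: "complex => complex"
 assumes "(f has_field_derivative D) (at (of_real s * t))"
 shows "((%s. f (of_real s * t)) has_vector_derivative t * D) (at s)"
proof -
 have "((%z. z * t) has_field_derivative t) (at (of_real s))"
  by (auto intro!: derivative_eq_intros)
 from DERIV_chain2[OF assms this] show ?thesis
  unfolding mult.commute[of D t] by (rule has_vector_derivative_real_field)
qed

text \<open>Integration along the ray from 0, with half of \<open>ep\<close> spent in the induction
  hypothesis. The kernel has size \<open>D powr (-1-ep/2)\<close> with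
  \<open>D = cmod (1 - (s t)^2)\<close>; the part \<open>D powr (-ep)\<close> is bounded through
  \<open>t\<close>, and the part \<open>D powr (ep/2-1)\<close> is integrated in \<open>s\<close>.
  The factor \<open>cmod t\<close> for nonempty words cancels the pole of the letter 0.\<close>

lemma hpl_growth:
 assumes "hpl_word w" "0 < ep" "ep <= 1"
 shows "EX C>=0. ALL t:cball 0 1 - {1, -1}.
  cmod (hpl w t) <= C * (if w = [] then 1 else cmod t) * cmod (1 - t\<^sup>2) powr (-ep)"
 using assms
proof (induction w arbitrary: ep)
 case Nil
 have "1 <= 2 powr ep * cmod (1 - t\<^sup>2) powr (-ep)" if "t : cball 0 1 - {1, - 1}" for t
 proof -
  have "2 powr (-ep) <= cmod (1 - t\<^sup>2) powr (-ep)"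
   using one_minus_square_bounds[OF that] Nil by (intro powr_mono2') auto
  then have "2 powr ep * 2 powr (-ep) <= 2 powr ep * cmod (1 - t\<^sup>2) powr (-ep)"
   by (intro mult_left_mono) auto
  then show ?thesis by (simp flip: powr_add)
 qed
 then show ?case by (intro exI[of _ "2 powr ep"]) auto
next
 case (Cons x w)
 have w: "hpl_word w" and x: "x : {-1,0,1}" "x = 0 ==> w ~= []"
  using Cons.prems by (auto simp: hpl_word_Cons)
 obtain C where C: "C >= 0" "!!t. t : cball 0 1 - {1, -1} ==>
   cmod (hpl w t) <= C * (if w = [] then 1 else cmod t) * cmod (1 - t\<^sup>2) powr (-(ep/2))"
  using Cons.IH[OF w, of "ep / 2"] Cons.prems by auto
 have ker: "cmod (hpl w t * hpl_form x t) <= 2 * C * cmod (1 - t\<^sup>2) powr (-1-ep/2)"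
  if t: "t : cball 0 1 - {1, -1}" "t ~= 0" for t
 proof -
  note b = one_minus_square_bounds[OF t(1)]
  have p: "cmod (1 - t\<^sup>2) powr (-1-ep/2) = cmod (1 - t\<^sup>2) powr (-(ep/2)) / cmod (1 - t\<^sup>2)"
   using b by (simp add: powr_diff powr_minus field_simps flip: powr_add)
  show ?thesis
  proof (cases "x = 0")
   case True
   have "cmod (hpl w t * hpl_form x t) <= (C * cmod t * cmod (1 - t\<^sup>2) powr (-(ep/2))) / cmod t"
    using divide_right_mono[OF C(2)[OF t(1)], of "cmod t"] True x t by (simp add: hpl_form_def norm_divide)
   also have "... = C * cmod (1 - t\<^sup>2) powr (-(ep/2)) * 1" using t by simp
   also have "... <= C * cmod (1 - t\<^sup>2) powr (-(ep/2)) * (2 / cmod (1 - t\<^sup>2))"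
    using b C by (intro mult_left_mono) (auto simp: field_simps)
   finally show ?thesis unfolding p by (simp add: field_simps)
  next
   case False
   have "(if w = [] then 1 else cmod t) <= 1" using t by auto
   then have "C * (if w = [] then 1 else cmod t) * cmod (1 - t\<^sup>2) powr (-(ep/2)) <= C * 1 * cmod (1 - t\<^sup>2) powr (-(ep/2))"
    using C by (intro mult_right_mono mult_left_mono) auto
   then have "cmod (hpl w t) <= C * cmod (1 - t\<^sup>2) powr (-(ep/2))" using C(2)[OF t(1)] by linarith
   then have "cmod (hpl w t) * cmod (hpl_form x t) <= (C * cmod (1 - t\<^sup>2) powr (-(ep/2))) * (2 / cmod (1 - t\<^sup>2))"
    using False x t C by (intro mult_mono hpl_form_bound) auto
   then show ?thesis unfolding p norm_mult by (simp add: field_simps)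
  qed
 qed
 \<comment> \<open>The factor \<open>2 / ep\<close> is the integral of
   \<open>(1 - s) powr (ep/2 - 1)\<close> over the unit interval, and \<open>2 powr ep\<close> comes
   from \<open>D >= cmod (1 - t^2) / 2\<close>.\<close>
 define C' where "C' = 2 * C * 2 powr ep * (2 / ep)"
 have "cmod (hpl (x # w) t) <= C' * cmod t * cmod (1 - t\<^sup>2) powr (-ep)"
  if t: "t : cball 0 1 - {1, -1}" for t
 proof (cases "t = 0")
  case True
  then show ?thesis using hpl_at_0[OF Cons.prems(1)] by simp
 next
  case False
  note b = one_minus_square_bounds[OF t]
  define M where "M = 2 * C * cmod t * 2 powr ep * cmod (1 - t\<^sup>2) powr (-ep)"
  have td: "t : hpl_dom" using t cball_subset_hpl_dom by auto
  have "cmod (hpl (x # w) (of_real 1 * t) - hpl (x # w) (of_real 0 * t)) <=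
   - (M * (2/ep) * (1 - 1) powr (ep/2)) - - (M * (2/ep) * (1 - 0) powr (ep/2))"
  proof (rule differentiable_bound_general[where a = 0 and b = 1 and f = "%s. hpl (x # w) (of_real s * t)"
     and \<phi> = "%s. - (M * (2/ep) * (1 - s) powr (ep/2))"
     and f' = "%s. t * (hpl w (of_real s * t) * hpl_form x (of_real s * t))"
     and \<phi>' = "%s. M * (1 - s) powr (ep/2 - 1)"])
   have "continuous_on hpl_dom (hpl (x # w))"
    by (intro holomorphic_on_imp_continuous_on hpl_holomorphic Cons.prems)
   then show "continuous_on {0..1} (%s. hpl (x # w) (of_real s * t))"
    by (rule continuous_on_compose2) (auto intro!: continuous_intros hpl_dom_scale td)
   show "continuous_on {0..1} (%s. - (M * (2/ep) * (1 - s) powr (ep/2)))"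
    using Cons.prems by (intro continuous_intros continuous_on_powr') auto
   fix s :: real assume s: "0 < s" "s < 1"
   have std: "of_real s * t : hpl_dom" "of_real s * t ~= 0"
    using s td False by (auto intro!: hpl_dom_scale)
   show "((%s. hpl (x # w) (of_real s * t)) has_vector_derivative
     t * (hpl w (of_real s * t) * hpl_form x (of_real s * t))) (at s)"
    using hpl_has_derivative[OF Cons.prems(1) std] by (rule has_vector_derivative_along_ray)
   show "((%s. - (M * (2/ep) * (1 - s) powr (ep/2))) has_vector_derivative M * (1 - s) powr (ep/2 - 1)) (at s)"
    unfolding has_real_derivative_iff_has_vector_derivative[symmetric]
    using s Cons.prems by (auto intro!: derivative_eq_intros simp: field_simps powr_diff)
   have n: "cmod (t^2) <= 1" using t by (simp add: norm_power power_le_one)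
   define D where "D = cmod (1 - (of_real s * t)\<^sup>2)"
   have D: "1 - s <= D" "cmod (1 - t\<^sup>2) / 2 <= D"
    using norm_one_minus_scaled[OF n, of s] s by (auto simp: D_def power_mult_distrib)
   have Dpos: "0 < D" using D(1) s by linarith
   have "D powr (-1-ep/2) = D powr (-ep) * D powr (ep/2-1)"
    unfolding powr_add[symmetric] by (rule arg_cong[where f = "(powr) D"]) (simp add: field_simps)
   also have "... <= (cmod (1 - t\<^sup>2) / 2) powr (-ep) * (1 - s) powr (ep/2-1)"
    using D s b Cons.prems by (intro mult_mono powr_mono2') auto
   also have "(cmod (1 - t\<^sup>2) / 2) powr (-ep) = 2 powr ep * cmod (1 - t\<^sup>2) powr (-ep)"
    by (simp add: powr_divide powr_minus field_simps)
   finally have D2: "D powr (-1-ep/2) <= 2 powr ep * cmod (1 - t\<^sup>2) powr (-ep) * (1 - s) powr (ep/2-1)" .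
   have "s * cmod t <= s * 1" using s t by (intro mult_left_mono) auto
   then have "s * cmod t < 1" using s by linarith
   then have st: "of_real s * t : cball 0 1 - {1, -1}"
   proof -
    have "cmod (of_real s * t) < 1" using \<open>s * cmod t < 1\<close> s by (simp add: norm_mult)
    then show ?thesis by (auto simp: less_imp_le)
   qed
   have "cmod (t * (hpl w (of_real s * t) * hpl_form x (of_real s * t))) <= cmod t * (2 * C * D powr (-1-ep/2))"
    unfolding norm_mult[of t] using ker[OF st std(2)] by (intro mult_left_mono) (auto simp: D_def)
   also have "... <= cmod t * (2 * C * (2 powr ep * cmod (1 - t\<^sup>2) powr (-ep) * (1 - s) powr (ep/2-1)))"
    using D2 C by (intro mult_left_mono) auto
   finally show "cmod (t * (hpl w (of_real s * t) * hpl_form x (of_real s * t))) <= M * (1 - s) powr (ep/2 - 1)"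
    by (simp add: M_def mult_ac)
  qed auto
  then show ?thesis using hpl_at_0[OF Cons.prems(1)] Cons.prems
   by (simp add: M_def C'_def mult_ac)
 qed
 moreover have "C' >= 0" using C Cons.prems by (simp add: C'_def)
 ultimately show ?case by (intro exI[of _ C']) auto
qed

text \<open>A punctured neighbourhood of 1 in the closed disc: it covers both ways in which 1 is
  approached later, along the radius and along the unit circle.\<close>

definition near1 :: "complex => bool" where
 "near1 t \<longleftrightarrow> cmod t <= 1 & 0 < cmod (1 - t) & cmod (1 - t) < 1"

lemma near1_D:
 assumes "near1 t"
 shows "t : cball 0 1 - {1, -1}" "t : hpl_dom" "t ~= 0" "Re t > 0" "cmod (1 - t) <= cmod (1 - t\<^sup>2)"
proof -
 have r: "Re t > 0"
  using abs_Re_le_cmod[of "1 - t"] assms by (auto simp: near1_def)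
 show a: "t : cball 0 1 - {1, -1}" using assms r by (auto simp: near1_def)
 then show "t : hpl_dom" using cball_subset_hpl_dom by auto
 show "Re t > 0" "t ~= 0" using r by auto
 have "1 <= cmod (1 + t)" using abs_Re_le_cmod[of "1 + t"] r by simp
 then have "cmod (1 - t) * 1 <= cmod (1 - t) * cmod (1 + t)" by (intro mult_left_mono) auto
 also have "... = cmod (1 - t\<^sup>2)" by (simp add: power2_eq_square algebra_simps flip: norm_mult)
 finally show "cmod (1 - t) <= cmod (1 - t\<^sup>2)" by simp
qed

lemma near1_of_real: "0 < r ==> r < 1 ==> near1 (of_real r)"
proof -
 assume r: "0 < r" "r < 1"
 have "cmod (1 - of_real r) = 1 - r"
  using r norm_of_real[of "1 - r", where 'a = complex] by simp
 then show ?thesis using r by (simp add: near1_def)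
qed

lemma hpl_growth_near1:
 assumes "hpl_word w" "0 < ep" "ep <= 1"
 shows "EX C>=0. ALL t. near1 t --> cmod (hpl w t) <= C * cmod (1 - t) powr (-ep)"
proof -
 obtain C where C: "C >= 0" "!!t. t : cball 0 1 - {1, -1} ==>
   cmod (hpl w t) <= C * (if w = [] then 1 else cmod t) * cmod (1 - t\<^sup>2) powr (-ep)"
  using hpl_growth[OF assms] by auto
 have "cmod (hpl w t) <= C * cmod (1 - t) powr (-ep)" if t: "near1 t" for t
 proof -
  have "(if w = [] then 1 else cmod t) <= 1" using near1_D[OF t] by auto
  then have "C * (if w = [] then 1 else cmod t) * cmod (1 - t\<^sup>2) powr (-ep) <= C * 1 * cmod (1 - t) powr (-ep)"
   using C near1_D[OF t] t assms by (intro mult_mono powr_mono2') (auto simp: near1_def)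
  then show ?thesis using C(2)[of t] near1_D[OF t] by auto
 qed
 with C show ?thesis by auto
qed

text \<open>A first letter other than 1 contributes no pole at 1, so only the logarithmic growth of
  the remaining word is left.\<close>

lemma hpl_kernel_tame_bound:
 assumes "hpl_word (x # w)" "x ~= 1"
 shows "EX C>=0. ALL t. near1 t --> cmod (hpl w t * hpl_form x t) <= C * cmod (1 - t) powr (-1/2)"
proof -
 have w: "hpl_word w" and x: "x : {-1,0,1}" "x = 0 ==> w ~= []"
  using assms by (auto simp: hpl_word_Cons)
 obtain C where C: "C >= 0" "!!t. t : cball 0 1 - {1, -1} ==>
   cmod (hpl w t) <= C * (if w = [] then 1 else cmod t) * cmod (1 - t\<^sup>2) powr (-(1/2))"
  using hpl_growth[OF w, of "1/2"] by auto
 have "cmod (hpl w t * hpl_form x t) <= C * cmod (1 - t) powr (-1/2)" if t: "near1 t" for t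
 proof -
  have p: "cmod (1 - t\<^sup>2) powr (-(1/2)) <= cmod (1 - t) powr (-1/2)"
   using powr_mono2'[of "-1/2" "cmod (1 - t)" "cmod (1 - t\<^sup>2)"] near1_D[OF t] t by (auto simp: near1_def)
  have a: "cmod (hpl w t * hpl_form x t) <= C * cmod (1 - t\<^sup>2) powr (-(1/2))"
  proof (cases "x = 0")
   case True
   have "cmod (hpl w t * hpl_form x t) <= (C * cmod t * cmod (1 - t\<^sup>2) powr (-(1/2))) / cmod t"
    using divide_right_mono[OF C(2), of t "cmod t"] True x near1_D[OF t] by (simp add: hpl_form_def norm_divide)
   then show ?thesis using near1_D[OF t] by simp
  next
   case False
   then have xm: "x = -1" using x assms by auto
   have "1 <= cmod (1 + t)" using abs_Re_le_cmod[of "1 + t"] near1_D[OF t] by simp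
   then have f: "cmod (hpl_form x t) <= 1" by (simp add: xm hpl_form_def norm_divide divide_simps)
   have "(if w = [] then 1 else cmod t) <= 1" using near1_D[OF t] by auto
   then have "C * (if w = [] then 1 else cmod t) * cmod (1 - t\<^sup>2) powr (-(1/2)) <= C * 1 * cmod (1 - t\<^sup>2) powr (-(1/2))"
    using C by (intro mult_right_mono mult_left_mono) auto
   then have "cmod (hpl w t) <= C * cmod (1 - t\<^sup>2) powr (-(1/2))" using C(2)[of t] near1_D[OF t] by auto
   then have "cmod (hpl w t) * cmod (hpl_form x t) <= (C * cmod (1 - t\<^sup>2) powr (-(1/2))) * 1"
    using f C by (intro mult_mono) auto
   then show ?thesis by (simp add: norm_mult)
  qed
  also have "... <= C * cmod (1 - t) powr (-1/2)" using p C by (intro mult_left_mono) auto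
  finally show ?thesis .
 qed
 with C show ?thesis by auto
qed

text \<open>The derivative is of order \<open>cmod (1 - t) powr (-1/2)\<close>, so values along the
  radius form a Cauchy family with rate 1/2. A general \<open>t\<close> is joined to the real point
  at the same distance \<open>d\<close> from 1 by a segment that stays at distance at least
  \<open>d / 2\<close> from 1, because \<open>Re (1 - t) >= 0\<close>.\<close>

lemma hpl_limit_1:
 assumes "hpl_word w" "tame w"
 obtains V C where "C >= 0" "!!t. near1 t ==> cmod (hpl w t - V) <= C * cmod (1 - t) powr (1/2)"
proof (cases w)
 case Nil
 then show ?thesis using that[of 0 1] by simp
next
 case (Cons x v)
 have xv: "hpl_word (x # v)" "x ~= 1" using assms Cons by (auto simp: tame_def)
 obtain C where C: "C >= 0" "!!t. near1 t ==> cmod (hpl v t * hpl_form x t) <= C * cmod (1 - t) powr (-1/2)"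
  using hpl_kernel_tame_bound[OF xv] by auto
 define f where "f r = hpl w (of_real r)" for r :: real
 have rad: "cmod (f r' - f r) <= 2 * C * (1 - r) powr (1/2)" if r: "0 < r" "r < r'" "r' < 1" for r r'
 proof -
  have "cmod (f r' - f r) <= - (2 * C * (1 - r') powr (1/2)) - - (2 * C * (1 - r) powr (1/2))"
  proof (rule differentiable_bound_general[where f' = "%s. hpl v (of_real s) * hpl_form x (of_real s)"
     and \<phi>' = "%s. C * (1 - s) powr (-1/2)" and \<phi> = "%s. - (2 * C * (1 - s) powr (1/2))"])
   have "continuous_on hpl_dom (hpl w)"
    by (intro holomorphic_on_imp_continuous_on hpl_holomorphic assms)
   then show "continuous_on {r..r'} f" unfolding f_def
    by (rule continuous_on_compose2) (use r near1_D(2)[OF near1_of_real] in "auto intro!: continuous_intros")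
   show "continuous_on {r..r'} (%s. - (2 * C * (1 - s) powr (1/2)))"
    using r by (intro continuous_intros) auto
   fix s assume s: "r < s" "s < r'"
   note ns = near1_of_real[of s]
   show "(f has_vector_derivative hpl v (of_real s) * hpl_form x (of_real s)) (at s)"
    unfolding f_def using hpl_has_derivative[OF xv(1), of "of_real s"] near1_D[OF ns] s r Cons
    by (intro has_vector_derivative_real_field) auto
   show "((%s. - (2 * C * (1 - s) powr (1/2))) has_vector_derivative C * (1 - s) powr (-1/2)) (at s)"
    unfolding has_real_derivative_iff_has_vector_derivative[symmetric]
    using s r by (auto intro!: derivative_eq_intros simp: field_simps powr_diff powr_minus)
   have "cmod (1 - of_real s) = 1 - s"
    using s r norm_of_real[of "1 - s", where 'a = complex] by simp
   then show "cmod (hpl v (of_real s) * hpl_form x (of_real s)) <= C * (1 - s) powr (-1/2)"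
    using C(2)[OF ns] s r by simp
  qed (use r in auto)
  also have "... <= 2 * C * (1 - r) powr (1/2)" using C by simp
  finally show ?thesis .
 qed
 define \<rho> where "\<rho> n = 1 - 1 / (real n + 2)" for n
 have \<rho>: "0 < \<rho> n" "\<rho> n < 1" "n < m ==> \<rho> n < \<rho> m" for n m
  by (auto simp: \<rho>_def field_simps)
 have lim0: "(%n. 2 * C * (1 - \<rho> n) powr (1/2)) \<longlonglongrightarrow> 0"
  unfolding \<rho>_def by real_asymp
 have "Cauchy (%n. f (\<rho> n))"
 proof (rule CauchyI)
  fix e :: real assume "0 < e"
  then obtain N where N: "!!n. n >= N ==> norm (2 * C * (1 - \<rho> n) powr (1/2)) < e"
   using lim0 by (auto simp: LIMSEQ_iff)
  have "norm (f (\<rho> m) - f (\<rho> n)) < e" if "m >= N" "n >= N" for m n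
  proof (cases m n rule: linorder_cases)
   case less
   then show ?thesis using rad[OF \<rho>(1) \<rho>(3)[OF less] \<rho>(2)] N[OF that(1)] C
    by (simp add: norm_minus_commute abs_mult)
  next
   case greater
   then show ?thesis using rad[OF \<rho>(1) \<rho>(3)[OF greater] \<rho>(2)] N[OF that(2)] C
    by (simp add: abs_mult)
  qed (use \<open>0 < e\<close> in auto)
  then show "EX M. ALL m>=M. ALL n>=M. norm (f (\<rho> m) - f (\<rho> n)) < e" by blast
 qed
 then obtain V where V: "(%n. f (\<rho> n)) \<longlonglongrightarrow> V"
  using Cauchy_convergent convergent_def by blast
 have radV: "cmod (f r - V) <= 2 * C * (1 - r) powr (1/2)" if r: "0 < r" "r < 1" for r
 proof -
  have "\<rho> \<longlonglongrightarrow> 1" unfolding \<rho>_def by real_asymp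
  then have "eventually (%n. \<rho> n > r) sequentially" using r by (auto simp: order_tendsto_iff)
  then have "eventually (%n. cmod (f (\<rho> n) - f r) <= 2 * C * (1 - r) powr (1/2)) sequentially"
   by eventually_elim (use rad r \<rho> in auto)
  moreover have "(%n. cmod (f (\<rho> n) - f r)) \<longlonglongrightarrow> cmod (V - f r)"
   by (intro tendsto_intros V)
  ultimately show ?thesis
   using tendsto_upperbound[of "%n. cmod (f (\<rho> n) - f r)"] by (simp add: norm_minus_commute)
 qed
 have "cmod (hpl w t - V) <= (4 * C + 2 * C) * cmod (1 - t) powr (1/2)" if t: "near1 t" for t
 proof -
  define d where "d = cmod (1 - t)"
  have d: "0 < d" "d < 1" using t by (auto simp: d_def near1_def)
  have Ret: "Re (1 - t) >= 0" using complex_Re_le_cmod[of t] t by (auto simp: near1_def)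
  have seg: "near1 p & d / 2 <= cmod (1 - p)" if "p : closed_segment t (of_real (1 - d))" for p
  proof -
   from that obtain u where u: "0 <= u" "u <= 1" "p = (1 - u) *\<^sub>R t + u *\<^sub>R of_real (1 - d)"
    by (auto simp: closed_segment_def)
   have p1: "1 - p = of_real (1 - u) * (1 - t) + of_real (u * d)"
    using u by (simp add: scaleR_conv_of_real algebra_simps)
   have "t : cball 0 1" "of_real (1 - d) : cball (0::complex) 1"
    using t d norm_of_real[of "1 - d", where 'a = complex] by (auto simp: near1_def)
   then have "p : cball 0 1" using that closed_segment_subset[OF _ _ convex_cball] by blast
   moreover have "cmod (1 - p) <= (1 - u) * d + u * d"
    unfolding p1 d_def using norm_triangle_ineq[of "of_real (1 - u) * (1 - t)" "of_real (u * cmod (1 - t))"] u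
    by (simp only: norm_mult norm_of_real) simp
   then have "cmod (1 - p) <= d" by (simp add: algebra_simps)
   moreover have "(d / 2)^2 <= (cmod (1 - p))^2"
   proof -
    have "(cmod (1 - p))^2 = ((1-u) * Re (1 - t) + u * d)^2 + ((1-u) * Im (1 - t))^2"
     unfolding p1 cmod_power2 by simp
    also have "... = (1-u)^2 * (cmod (1-t))^2 + (u * d)^2 + 2 * ((1-u) * Re (1 - t)) * (u * d)"
     unfolding cmod_power2 by (simp add: power2_eq_square algebra_simps)
    also have "... >= (1-u)^2 * d^2 + (u * d)^2"
     using u d Ret by (simp add: d_def)
    finally have "((1-u)^2 + u^2) * d^2 <= (cmod (1 - p))^2" by (simp add: algebra_simps)
    moreover have "1/4 <= (1-u)^2 + u^2"
    proof -
     have "(1-u)^2 + u^2 = 2 * (u - 1/2)^2 + 1/2" by (simp add: power2_eq_square algebra_simps)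
     then show ?thesis using zero_le_power2[of "u - 1/2"] by linarith
    qed
    then have "1/4 * d^2 <= ((1-u)^2 + u^2) * d^2" by (intro mult_right_mono) auto
    ultimately show ?thesis by (simp add: power2_eq_square)
   qed
   then have "d / 2 <= cmod (1 - p)" by (rule power2_le_imp_le) simp
   ultimately show ?thesis using d by (auto simp: near1_def)
  qed
  have "cmod (hpl w t - hpl w (of_real (1 - d))) <= C * (d / 2) powr (-1/2) * cmod (t - of_real (1 - d))"
  proof (rule field_differentiable_bound[of "closed_segment t (of_real (1 - d))" _ "%z. hpl v z * hpl_form x z"])
   fix z assume z: "z : closed_segment t (of_real (1 - d))"
   note nz = seg[OF z]
   show "(hpl w has_field_derivative hpl v z * hpl_form x z) (at z within closed_segment t (of_real (1 - d)))"
    using hpl_has_derivative[OF xv(1)] near1_D nz Cons by (blast intro: has_field_derivative_at_within)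
   have "cmod (hpl v z * hpl_form x z) <= C * cmod (1 - z) powr (-1/2)" using nz by (intro C) auto
   also have "... <= C * (d/2) powr (-1/2)"
    using nz C d by (intro mult_left_mono powr_mono2') auto
   finally show "cmod (hpl v z * hpl_form x z) <= C * (d/2) powr (-1/2)" .
  qed auto
  also have "cmod (t - of_real (1 - d)) <= 2 * d"
  proof -
   have eq: "t - of_real (1 - d) = of_real d - (1 - t)" by simp
   have "cmod (t - of_real (1 - d)) <= cmod (of_real d) + cmod (1 - t)"
    unfolding eq by (rule norm_triangle_ineq4)
   then show ?thesis using d by (simp add: d_def[symmetric])
  qed
  also have "C * (d / 2) powr (-1/2) * (2 * d) <= 4 * C * d powr (1/2)"
  proof -
   have "2 powr (1/2) <= (2::real)" by (simp add: powr_half_sqrt real_sqrt_le_iff sqrt2_less_2 less_imp_le)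
   then have "2 * C * d powr (1/2) * 2 powr (1/2) <= 2 * C * d powr (1/2) * 2"
    using C by (intro mult_left_mono) auto
   moreover have "(d / 2) powr (-1/2) * d = 2 powr (1/2) * d powr (1/2)"
    using d by (simp add: powr_divide powr_minus field_simps) (simp flip: powr_add)
   ultimately show ?thesis by (simp add: mult_ac)
  qed
  finally have "cmod (hpl w t - hpl w (of_real (1 - d))) <= 4 * C * d powr (1/2)"
   using C by (auto simp: mult_left_mono)
  moreover have "cmod (hpl w (of_real (1 - d)) - V) <= 2 * C * d powr (1/2)"
   using radV[of "1 - d"] d by (simp add: f_def)
  ultimately show ?thesis
   using norm_triangle_ineq[of "hpl w t - hpl w (of_real (1 - d))" "hpl w (of_real (1 - d)) - V"]
   by (simp add: d_def algebra_simps)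
 qed
 then show ?thesis using that[of "4 * C + 2 * C" V] C by auto
qed

subsection \<open>Symmetries and Taylor coefficients\<close>

lemma cnj_image_hpl_dom: "cnj ` hpl_dom = hpl_dom"
proof -
 have "cnj t : hpl_dom \<longleftrightarrow> t : hpl_dom" for t by (simp add: hpl_dom_def)
 then show ?thesis by (metis (no_types, lifting) complex_cnj_cnj image_iff subsetI subset_antisym)
qed

text \<open>The forms have real coefficients, so conjugation commutes with iterated integration.
  Together with the symmetry under negation this gives the reflection that exchanges the ends of the
  arc.\<close>

lemma hpl_cnj: "hpl_word w ==> t : hpl_dom ==> cnj (hpl w (cnj t)) = hpl w t"
proof (induction w arbitrary: t)
 case (Cons x w)
 have w: "hpl_word w" using Cons.prems by (simp add: hpl_word_Cons)
 have "(cnj \<circ> hpl (x # w) \<circ> cnj) t = hpl (x # w) t"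
 proof (rule eq_on_hpl_dom[OF _ _ _ _ _ Cons.prems(2)])
  show "(cnj \<circ> hpl (x # w) \<circ> cnj) holomorphic_on hpl_dom"
   using hpl_holomorphic[OF Cons.prems(1)] cnj_image_hpl_dom open_hpl_dom
   by (intro holomorphic_on_compose_cnj_cnj) auto
  show "hpl (x # w) holomorphic_on hpl_dom" by (rule hpl_holomorphic[OF Cons.prems(1)])
  show "(cnj \<circ> hpl (x # w) \<circ> cnj) 0 = hpl (x # w) 0" using hpl_at_0[OF Cons.prems(1)] by simp
  fix t assume t: "t : hpl_dom" "t ~= 0"
  show "(hpl (x # w) has_field_derivative hpl w t * hpl_form x t) (at t)"
   by (rule hpl_has_derivative[OF Cons.prems(1) t])
  have ct: "cnj t : hpl_dom" "cnj t ~= 0" using t cnj_image_hpl_dom by auto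
  have "cnj (hpl w (cnj t) * hpl_form x (cnj t)) = hpl w t * hpl_form x t"
   using Cons.IH[OF w t(1)] by (simp add: hpl_form_def)
  then show "(cnj \<circ> hpl (x # w) \<circ> cnj has_field_derivative hpl w t * hpl_form x t) (at t)"
   using has_field_derivative_cnj_cnj[OF hpl_has_derivative[OF Cons.prems(1) ct]] by simp
 qed
 then show ?case by simp
qed simp

lemma hpl_real:
 assumes "hpl_word w" "\<bar>x\<bar> < 1"
 shows "hpl w (of_real x) : \<real>"
 using hpl_cnj[OF assms(1), of "of_real x"] assms(2) by (simp add: Reals_cnj_iff hpl_dom_def)

lemma hpl_uminus: "hpl_word w ==> t : hpl_dom ==> hpl w (- t) = hpl (map uminus w) t"
proof (induction w arbitrary: t)
 case (Cons x w)
 have w: "hpl_word w" using Cons.prems by (simp add: hpl_word_Cons)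
 have mw: "hpl_word (map uminus (x # w))"
  using Cons.prems(1) by (auto simp: hpl_word_def last_map)
 have um: "- t : hpl_dom" if "t : hpl_dom" for t using that by (simp add: hpl_dom_def)
 have "hpl (x # w) (- t) = hpl (map uminus (x # w)) t"
 proof (rule eq_on_hpl_dom[OF _ _ _ _ _ Cons.prems(2)])
  have "hpl (x # w) \<circ> uminus holomorphic_on hpl_dom"
   using um by (intro holomorphic_on_compose_gen[OF _ hpl_holomorphic[OF Cons.prems(1)]] holomorphic_intros) auto
  then show "(%t. hpl (x # w) (- t)) holomorphic_on hpl_dom" by (simp add: o_def)
  show "hpl (map uminus (x # w)) holomorphic_on hpl_dom" by (rule hpl_holomorphic[OF mw])
  show "hpl (x # w) (- 0) = hpl (map uminus (x # w)) 0"
   using hpl_at_0[OF Cons.prems(1)] hpl_at_0[OF mw] by simp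
  fix t assume t: "t : hpl_dom" "t ~= 0"
  show "(hpl (map uminus (x # w)) has_field_derivative hpl (map uminus w) t * hpl_form (- x) t) (at t)"
   using hpl_has_derivative[of "- x" "map uminus w" t] mw t by simp
  have "hpl w (- t) * hpl_form x (- t) * (- 1) = hpl (map uminus w) t * hpl_form (- x) t"
   using Cons.IH[OF w t(1)] by (simp add: hpl_form_def)
  moreover have "(uminus has_field_derivative - 1) (at t)" by (auto intro!: derivative_eq_intros)
  ultimately show "((%t. hpl (x # w) (- t)) has_field_derivative hpl (map uminus w) t * hpl_form (- x) t) (at t)"
   using DERIV_chain2[of "hpl (x # w)" _ uminus t "- 1" UNIV] hpl_has_derivative[OF Cons.prems(1) um[OF t(1)]] t
   by fastforce
 qed
 then show ?case by simp
qed simp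

section \<open>Taylor coefficients as nested sums, and values at 1 as alternating multiple zeta
  values\<close>

primrec hpl_coeff :: "int list => nat => complex" where
 "hpl_coeff [] l = (if l = 0 then 1 else 0)"
| "hpl_coeff (x # w) l =
  (if x = 0 then hpl_coeff w l else (SUM m<l. of_int x ^ (l - m) * hpl_coeff w m)) / of_nat l"

lemma hpl_form_fps:
 assumes "x : {-1, 1}"
 shows "hpl_form x has_fps_expansion Abs_fps (%n. of_int x ^ Suc n)"
proof (rule has_fps_expansionI)
 have "eventually (%u::complex. u : ball 0 1) (nhds 0)"
  by (intro eventually_nhds_in_open) auto
 then show "\<forall>\<^sub>F u in nhds 0. (%n. fps_nth (Abs_fps (%n. of_int x ^ Suc n)) n * u ^ n) sums hpl_form x u"
 proof eventually_elim
  case (elim u)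
  have "norm (of_int x * u) < 1" using elim assms by (auto simp: norm_mult)
  from sums_mult[OF geometric_sums[OF this], of "of_int x"] show ?case
   using assms by (auto simp: hpl_form_def power_mult_distrib mult_ac)
 qed
qed

lemma hpl_fps: "hpl_word w ==> hpl w has_fps_expansion Abs_fps (hpl_coeff w)"
proof (induction w)
 case Nil
 have "Abs_fps (hpl_coeff []) = 1" by (auto simp: fps_eq_iff)
 then show ?case by (simp only: hpl.simps(1) has_fps_expansion_1)
next
 case (Cons x w)
 have w: "hpl_word w" and x: "x : {-1,0,1}" "x = 0 ==> w ~= []"
  using Cons.prems by (auto simp: hpl_word_Cons)
 define F where "F = fps_expansion (hpl (x # w)) 0"
 have hF: "hpl (x # w) has_fps_expansion F"
  unfolding F_def by (rule has_fps_expansion_fps_expansion[OF open_hpl_dom zero_in_hpl_dom hpl_holomorphic[OF Cons.prems]])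
 have F0: "fps_nth F 0 = 0"
  using has_fps_expansion_imp_0_eq_fps_nth_0[OF hF] hpl_at_0[OF Cons.prems] by simp
 have ev: "eventually (%u. u : hpl_dom) (nhds 0)"
  by (intro eventually_nhds_in_open open_hpl_dom) auto
 then have "eventually (%u. deriv (hpl (x # w)) u = hpl_kernel x w u) (nhds 0)"
  by eventually_elim (intro DERIV_imp_deriv hpl_has_derivative_kernel Cons.prems)
 then have kF: "hpl_kernel x w has_fps_expansion fps_deriv F"
  using has_fps_expansion_deriv[OF hF] has_fps_expansion_cong by blast
 have "fps_nth F l = hpl_coeff (x # w) l" for l
 proof (cases l)
  case 0
  then show ?thesis using F0 by simp
 next
  case (Suc n)
  have "of_nat l * fps_nth F l =
   (if x = 0 then hpl_coeff w l else (SUM m<l. of_int x ^ (l - m) * hpl_coeff w m))"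
  proof (cases "x = 0")
   case False
   have "hpl_kernel x w = (%u. hpl w u * hpl_form x u)"
    using False by (auto simp: hpl_kernel_def)
   moreover have "(%u. hpl w u * hpl_form x u) has_fps_expansion
    Abs_fps (hpl_coeff w) * Abs_fps (%n. of_int x ^ Suc n)"
    using False x by (intro has_fps_expansion_mult Cons.IH w hpl_form_fps) auto
   ultimately have "fps_deriv F = Abs_fps (hpl_coeff w) * Abs_fps (%n. of_int x ^ Suc n)"
    using kF fps_expansion_unique_complex by metis
   then have "fps_nth (fps_deriv F) n = (SUM i=0..n. hpl_coeff w i * of_int x ^ Suc (n - i))"
    by (simp add: fps_mult_nth)
   moreover have "(SUM i=0..n. hpl_coeff w i * of_int x ^ Suc (n - i)) = (SUM m<l. of_int x ^ (l - m) * hpl_coeff w m)"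
    unfolding Suc by (intro sum.cong) (auto simp: Suc_diff_le mult_ac)
   ultimately show ?thesis using False Suc by simp
  next
   case True
   have e1: "eventually (%u. u * hpl_kernel x w u = hpl w u) (nhds 0)"
    using ev hpl_at_0[OF w] x True by (auto elim!: eventually_mono simp: hpl_kernel_def hpl_form_def)
   have e2: "(%u. u * hpl_kernel x w u) has_fps_expansion fps_X * fps_deriv F"
    by (intro has_fps_expansion_mult has_fps_expansion_fps_X kF)
   have "hpl w has_fps_expansion fps_X * fps_deriv F"
    by (rule iffD1[OF has_fps_expansion_cong[OF e1 refl] e2])
   then have "Abs_fps (hpl_coeff w) = fps_X * fps_deriv F"
    using Cons.IH[OF w] fps_expansion_unique_complex by blast
   then have "fps_nth (Abs_fps (hpl_coeff w)) l = fps_nth (fps_X * fps_deriv F) l" by simp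
   then show ?thesis using True Suc by simp
  qed
  then show ?thesis using Suc by (simp add: field_simps del: of_nat_Suc)
 qed
 then have "F = Abs_fps (hpl_coeff (x # w))" by (simp add: fps_eq_iff del: hpl_coeff.simps)
 then show ?case using hF by (simp only:)
qed

lemma holomorphic_on_hpl_dom_sums:
 assumes "f holomorphic_on hpl_dom" "f has_fps_expansion F" "cmod t < 1"
 shows "(%l. fps_nth F l * t ^ l) sums f t"
proof (rule has_fps_expansion_imp_sums_complex[where r = 1, OF assms(2)])
 have "eball 0 1 <= hpl_dom" using ball_subset_hpl_dom by (auto simp: eball_def one_ereal_def)
 then show "f holomorphic_on eball 0 1" using assms(1) holomorphic_on_subset by blast
qed (use assms in "auto simp: one_ereal_def")

lemma hpl_sums: "hpl_word w ==> cmod t < 1 ==> (%l. hpl_coeff w l * t ^ l) sums hpl w t"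
 using holomorphic_on_hpl_dom_sums[OF hpl_holomorphic hpl_fps] by simp

lemma multi_polylog_partial_Nil: "multi_polylog_partial [] z L = 1"
proof -
 have "{l :: nat list. length l = length ([] :: nat list) & sorted_wrt (>) l & set l <= {1..L}} = {[]}" by auto
 then show ?thesis unfolding multi_polylog_partial_def by simp
qed

lemma multi_polylog_partial_Cons:
 "multi_polylog_partial (c # a) (y # z) L =
  (SUM l=1..L. y ^ l / of_nat l ^ c * multi_polylog_partial a z (l - 1))"
proof -
 define S where "S n L = {l :: nat list. length l = n & sorted_wrt (>) l & set l <= {1..L}}" for n L
 define P where "P a z l = (PROD j<length a. (z ! j :: complex) ^ (l ! j) / of_nat (l ! j) ^ (a ! j))" for a z l
 have part: "multi_polylog_partial a z L = sum (P a z) (S (length a) L)" for a z L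
  by (simp add: multi_polylog_partial_def S_def P_def)
 have fin: "finite (S n L)" for n L
  by (rule finite_subset[OF _ finite_lists_length_eq[of "{1..L}" n]]) (auto simp: S_def)
 have bij: "bij_betw (%(l0, l). l0 # l) (SIGMA l0:{1..L}. S (length a) (l0 - 1)) (S (Suc (length a)) L)"
 proof (rule bij_betwI')
  fix p q :: "nat \<times> nat list"
  show "((case p of (l0, l) => l0 # l) = (case q of (l0, l) => l0 # l)) = (p = q)"
   by (auto split: prod.splits)
 next
  fix p assume "p : (SIGMA l0:{1..L}. S (length a) (l0 - 1))"
  then show "(case p of (l0, l) => l0 # l) : S (Suc (length a)) L"
   by (fastforce simp: S_def)
 next
  fix l assume l: "l : S (Suc (length a)) L"
  then obtain l0 l' where l': "l = l0 # l'" by (cases l) (auto simp: S_def)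
  then have "(l0, l') : (SIGMA l0:{1..L}. S (length a) (l0 - 1))"
   using l by (fastforce simp: S_def)
  then show "EX p:(SIGMA l0:{1..L}. S (length a) (l0 - 1)). l = (case p of (l0, l) => l0 # l)"
   using l' by (intro bexI[of _ "(l0, l')"]) auto
 qed
 have "multi_polylog_partial (c # a) (y # z) L = sum (P (c # a) (y # z)) (S (Suc (length a)) L)"
  by (simp add: part)
 also have "... = (SUM p:(SIGMA l0:{1..L}. S (length a) (l0 - 1)). P (c # a) (y # z) (case p of (l0, l) => l0 # l))"
  by (rule sum.reindex_bij_betw[OF bij, symmetric])
 also have "... = (\<Sum>(l0, l)\<in>(SIGMA l0:{1..L}. S (length a) (l0 - 1)). y ^ l0 / of_nat l0 ^ c * P a z l)"
  by (intro sum.cong) (auto simp: P_def prod.lessThan_Suc_shift simp del: prod.lessThan_Suc)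
 also have "... = (SUM l0=1..L. SUM l:S (length a) (l0 - 1). y ^ l0 / of_nat l0 ^ c * P a z l)"
  by (rule sum.Sigma[symmetric]) (auto intro: fin)
 finally show ?thesis by (simp add: part sum_distrib_left)
qed

lemma hpl_coeff_0: "w ~= [] ==> hpl_coeff w 0 = 0"
 by (cases w) auto

text \<open>A letter 0 raises the leading exponent by one; a nonzero letter \<open>x\<close> opens a
  new exponent 1. Since \<open>x^(l-m) = x^l * x^m\<close> for \<open>x = 1\<close> and
  \<open>x = -1\<close>, the new leading argument is \<open>x\<close> and the previous one is
  multiplied by \<open>x\<close>, so all arguments remain square roots of 1. A head
  \<open>(1, 1)\<close> can only come from a first letter 1.\<close>

lemma hpl_coeff_polylog:
 assumes "hpl_word w" "w ~= []"
 shows "EX a z. a ~= [] & length z = length a & (ALL c:set a. c > 0) & (ALL y:set z. y\<^sup>2 = 1) &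
  sum_list a = length w & (hd w ~= 1 --> (hd a, hd z) ~= (1, 1)) &
  (ALL l>0. hpl_coeff w l = hd z ^ l / of_nat l ^ hd a * multi_polylog_partial (tl a) (tl z) (l - 1))"
 using assms
proof (induction w)
 case (Cons x w)
 have w: "hpl_word w" and x: "x : {-1,0,1}" "x = 0 ==> w ~= []"
  using Cons.prems by (auto simp: hpl_word_Cons)
 show ?case
 proof (cases "w = []")
  case True
  have "(SUM m<l. of_int x ^ (l - m) * (if m = 0 then 1 else 0)) = (of_int x ^ l :: complex)" if "l > 0" for l
   using that by (subst sum.remove[of _ 0]) auto
  then show ?thesis
   using True x by (intro exI[of _ "[1]"] exI[of _ "[of_int x]"]) (auto simp: multi_polylog_partial_Nil)
 next
  case False
  then obtain a z where az: "a ~= []" "length z = length a" "ALL c:set a. c > 0" "ALL y:set z. y\<^sup>2 = 1"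
   "sum_list a = length w" and co: "!!l. l > 0 ==>
    hpl_coeff w l = hd z ^ l / of_nat l ^ hd a * multi_polylog_partial (tl a) (tl z) (l - 1)"
   using Cons.IH[OF w] by blast
  obtain c a' y z' where az': "a = c # a'" "z = y # z'"
   using az by (metis length_0_conv neq_Nil_conv)
  show ?thesis
  proof (cases "x = 0")
   case True
   show ?thesis
    by (rule exI[of _ "Suc c # a'"], rule exI[of _ z]) (use True az az' co in auto)
  next
   case False
   then have xx: "(of_int x :: complex) * of_int x = 1" and x1: "x = 1 | x = -1" using x by auto
   have pw: "(of_int x :: complex) ^ (l - m) = of_int x ^ l * of_int x ^ m" if "m <= l" for l m
   proof -
    have "(of_int x :: complex) ^ l * of_int x ^ m = of_int x ^ (l - m) * (of_int x * of_int x) ^ m"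
     using that by (simp add: power_mult_distrib flip: power_add)
    then show ?thesis using xx by simp
   qed
   have *: "(SUM m<l. of_int x ^ (l - m) * hpl_coeff w m) =
     of_int x ^ l * multi_polylog_partial a (of_int x * y # z') (l - 1)" if "l > 0" for l
   proof -
    have "(SUM m<l. of_int x ^ (l - m) * hpl_coeff w m) = (SUM m=1..l-1. of_int x ^ (l - m) * hpl_coeff w m)"
     using hpl_coeff_0[OF \<open>w ~= []\<close>] that
     by (intro sum.mono_neutral_right) (auto simp: not_less_eq_eq)
    also have "... = (SUM m=1..l-1. of_int x ^ l * ((of_int x * y) ^ m / of_nat m ^ c * multi_polylog_partial a' z' (m - 1)))"
     using that by (intro sum.cong) (auto simp: pw co az' power_mult_distrib)
    finally show ?thesis by (simp add: az' multi_polylog_partial_Cons sum_distrib_left)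
   qed
   have y2: "(of_int x * y)^2 = 1" using az az' x1 by (auto simp: power_mult_distrib)
   show ?thesis
    by (rule exI[of _ "1 # a"], rule exI[of _ "of_int x # (of_int x * y) # z'"])
     (use False az az' * x1 y2 in auto)
  qed
 qed
qed simp

lemma sum_inverse_le_ln: "l >= 1 ==> (SUM m=1..l. 1 / real m) <= 1 + ln (real l)"
proof (induction l rule: nat_induct_at_least)
 case (Suc l)
 have "ln (1 - 1 / real (Suc l)) <= - (1 / real (Suc l))"
  using ln_add_one_self_le_self2[of "- (1 / real (Suc l))"] Suc by (simp add: field_simps)
 moreover have "1 - 1 / real (Suc l) = real l / real (Suc l)" by (simp add: field_simps)
 ultimately have "ln (real l) + 1 / real (Suc l) <= ln (real (Suc l))"
  using Suc by (simp add: ln_div del: of_nat_Suc)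
 then show ?case using Suc by (simp del: of_nat_Suc)
qed simp

text \<open>Each nested harmonic summation costs one factor \<open>1 + ln l\<close>. The bound for
  the shorter word is a hypothesis so that the estimate serves both the induction that proves this
  bound and the partial sums in \<open>hpl_coeff_summable\<close>.\<close>

lemma hpl_coeff_sum_bound:
 assumes IH: "!!l. l >= 1 ==> w ~= [] ==> cmod (hpl_coeff w l) <= (1 + ln (real l)) ^ length w / real l"
  and x: "x : {-1, 1}" and l: "l >= 1"
 shows "cmod (SUM m<l. of_int x ^ (l - m) * hpl_coeff w m) <= (1 + ln (real l)) ^ Suc (length w)"
proof (cases "w = []")
 case True
 have "(SUM m<l. of_int x ^ (l - m) * (if m = 0 then 1 else 0)) = (of_int x ^ l :: complex)"
  using l by (subst sum.remove[of _ 0]) auto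
 then show ?thesis using True x l by (auto simp: norm_power)
next
 case False
 have "cmod (SUM m<l. of_int x ^ (l - m) * hpl_coeff w m) <= (SUM m<l. cmod (hpl_coeff w m))"
  by (rule sum_norm_le) (use x in "auto simp: norm_mult norm_power")
 also have "... <= (SUM m:insert 0 {1..l}. cmod (hpl_coeff w m))"
  by (rule sum_mono2) auto
 also have "... = (SUM m=1..l. cmod (hpl_coeff w m))"
  using hpl_coeff_0[OF False] by simp
 also have "... <= (SUM m=1..l. (1 + ln (real l)) ^ length w * (1 / real m))"
 proof (rule sum_mono)
  fix m assume m: "m : {1..l}"
  have "cmod (hpl_coeff w m) <= (1 + ln (real m)) ^ length w / real m" using IH m False by auto
  also have "... <= (1 + ln (real l)) ^ length w / real m"
   using m by (intro divide_right_mono power_mono) auto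
  finally show "cmod (hpl_coeff w m) <= (1 + ln (real l)) ^ length w * (1 / real m)" by simp
 qed
 also have "... = (1 + ln (real l)) ^ length w * (SUM m=1..l. 1 / real m)" by (simp add: sum_distrib_left)
 also have "... <= (1 + ln (real l)) ^ length w * (1 + ln (real l))"
  using sum_inverse_le_ln[OF l] l by (intro mult_left_mono) auto
 finally show ?thesis by (simp add: mult_ac)
qed

lemma hpl_coeff_bound:
 "hpl_word w ==> w ~= [] ==> l >= 1 ==> cmod (hpl_coeff w l) <= (1 + ln (real l)) ^ length w / real l"
proof (induction w arbitrary: l)
 case (Cons x w)
 have w: "hpl_word w" and x: "x : {-1,0,1}" "x = 0 ==> w ~= []"
  using Cons.prems by (auto simp: hpl_word_Cons)
 have IH: "!!l. l >= 1 ==> w ~= [] ==> cmod (hpl_coeff w l) <= (1 + ln (real l)) ^ length w / real l"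
  using Cons.IH[OF w] by auto
 have ln0: "ln (real l) >= 0" using Cons.prems by simp
 have l1: "(1 + ln (real l)) ^ length w <= (1 + ln (real l)) ^ length (x # w)"
  using ln0 by (intro power_increasing) auto
 show ?case
 proof (cases "x = 0")
  case True
  have "cmod (hpl_coeff w l) <= (1 + ln (real l)) ^ length w / real l" using IH True x Cons.prems by auto
  also have "... <= (1 + ln (real l)) ^ length w / 1"
   using Cons.prems ln0 by (intro divide_left_mono) auto
  also have "... <= (1 + ln (real l)) ^ length (x # w)" using l1 by simp
  finally show ?thesis using True Cons.prems by (simp add: norm_divide divide_right_mono)
 next
  case False
  then show ?thesis
   using hpl_coeff_sum_bound[OF IH, where x = x and l = l] x Cons.prems
   by (auto simp: norm_divide divide_right_mono)
 qed
qed simp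

lemma summable_ln_power_over_square: "summable (%l. (1 + ln (real l)) ^ k / (real l)^2)"
proof (rule summable_comparison_test_bigo)
 show "summable (%l. norm (real l powr (-3/2)))" by (simp add: summable_real_powr_iff)
 show "(%l. (1 + ln (real l)) ^ k / (real l)^2) : O(%l. real l powr (-3/2))" by real_asymp
qed

text \<open>Summation by parts: a partial sum is half of \<open>b 0\<close> minus a boundary term
  that tends to 0 minus an absolutely convergent sum of differences.\<close>

lemma summable_alternating_bounded_variation:
 fixes b :: "nat => complex"
 assumes "b \<longlonglongrightarrow> 0" "summable (%l. cmod (b (Suc l) - b l))"
 shows "summable (%l. (-1) ^ l * b l)"
proof -
 have eq: "(SUM l<N. (-1) ^ l * b l) = (b 0 - (-1) ^ N * b N - (SUM l<N. (-1) ^ l * (b (Suc l) - b l))) / 2" for N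
  by (induction N) (auto simp: field_simps)
 have "summable (%l. (-1) ^ l * (b (Suc l) - b l))"
  by (rule summable_norm_cancel) (use assms in "simp add: norm_mult norm_power")
 then have 1: "(%N. SUM l<N. (-1) ^ l * (b (Suc l) - b l)) \<longlonglongrightarrow> (\<Sum>l. (-1) ^ l * (b (Suc l) - b l))"
  using summable_LIMSEQ by blast
 have "(%N. cmod ((-1) ^ N * b N)) \<longlonglongrightarrow> 0"
  using tendsto_norm_zero[OF assms(1)] by (simp add: norm_mult norm_power)
 then have 2: "(%N. (-1) ^ N * b N) \<longlonglongrightarrow> 0" by (rule tendsto_norm_zero_cancel)
 have "(%N. SUM l<N. (-1) ^ l * b l) \<longlonglongrightarrow> (b 0 - 0 - (\<Sum>l. (-1) ^ l * (b (Suc l) - b l))) / 2"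
  unfolding eq by (intro tendsto_intros 1 2) simp
 then show ?thesis by (auto simp: summable_def sums_def)
qed

text \<open>With first letter 0 an extra factor \<open>1 / l\<close> gives absolute convergence.
  With first letter -1 the sign \<open>(-1)^l\<close> factors out, and what remains tends to 0 and
  has differences of size a power of the logarithm over \<open>l^2\<close>.\<close>

lemma hpl_coeff_summable:
 assumes "hpl_word w" "w ~= []" "hd w ~= 1"
 shows "summable (hpl_coeff w)"
proof -
 obtain x v where xv: "w = x # v" using assms by (meson neq_Nil_conv)
 have v: "hpl_word v" and x: "x = 0 & v ~= [] | x = -1"
  using assms xv by (auto simp: hpl_word_Cons)
 show ?thesis
 proof (cases "x = 0")
  case True
  show ?thesis
  proof (rule summable_comparison_test'[OF summable_ln_power_over_square[of "length v"], of 1])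
   fix l :: nat assume "1 <= l"
   then show "norm (hpl_coeff w l) <= (1 + ln (real l)) ^ length v / (real l)^2"
    using divide_right_mono[OF hpl_coeff_bound[OF v], of l "real l"] x True xv
    by (simp add: norm_divide power2_eq_square)
  qed
 next
  case False
  then have xm: "x = -1" using x by auto
  define sg where "sg l = (SUM m<l. (-1) ^ m * hpl_coeff v m)" for l
  define b where "b l = sg l / of_nat l" for l
  have pw: "(-1) ^ (l - m) = (-1) ^ l * ((-1) ^ m :: complex)" if "m <= l" for l m :: nat
  proof -
   have "(-1) ^ l * ((-1) ^ m :: complex) = (-1) ^ (l - m) * ((-1) * (-1)) ^ m"
    using that unfolding power_mult_distrib mult.assoc[symmetric] power_add[symmetric] by simp
   then show ?thesis by simp
  qed
  have sg: "(SUM m<l. (-1) ^ (l - m) * hpl_coeff v m) = (-1) ^ l * sg l" for l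
   unfolding sg_def sum_distrib_left by (intro sum.cong) (auto simp: pw)
  have eq: "hpl_coeff w l = (-1) ^ l * b l" for l
   using sg[of l] by (simp add: xv xm b_def)
  have sg_bound: "cmod (sg l) <= (1 + ln (real l)) ^ Suc (length v)" if "l >= 1" for l
   using hpl_coeff_sum_bound[of v "-1" l] hpl_coeff_bound[OF v] that sg[of l]
   by (auto simp: norm_mult norm_power)
  have "b \<longlonglongrightarrow> 0"
  proof (rule Lim_null_comparison)
   show "eventually (%l. norm (b l) <= (1 + ln (real l)) ^ Suc (length v) / real l) sequentially"
    using eventually_ge_at_top[of 1]
    by eventually_elim (use sg_bound in "auto simp: b_def norm_divide intro!: divide_right_mono")
   show "(%l. (1 + ln (real l)) ^ Suc (length v) / real l) \<longlonglongrightarrow> 0" by real_asymp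
  qed
  moreover have "summable (%l. cmod (b (Suc l) - b l))"
  proof (rule summable_comparison_test'[OF summable_mult[OF summable_ln_power_over_square[of "Suc (length v)"], of 2], of 1])
   fix l :: nat assume l: "1 <= l"
   define Q where "Q = (1 + ln (real l)) ^ Suc (length v)"
   have lg: "ln (real l) >= 0" using l by simp
   have cv: "cmod (hpl_coeff v l) <= Q / real l"
   proof (cases "v = []")
    case True
    then show ?thesis using l lg by (auto simp: Q_def)
   next
    case False
    have "(1 + ln (real l)) ^ length v <= Q" unfolding Q_def using lg by (intro power_increasing) auto
    then show ?thesis using hpl_coeff_bound[OF v False l] l by (meson divide_right_mono of_nat_0_le_iff order_trans)
   qed
   have "b (Suc l) - b l = (-1) ^ l * hpl_coeff v l / of_nat (Suc l) - sg l / (of_nat l * of_nat (Suc l))"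
    using l by (simp add: b_def sg_def divide_simps del: of_nat_Suc) (simp add: algebra_simps)
   also have "cmod ... <= cmod (hpl_coeff v l) / real (Suc l) + cmod (sg l) / (real l * real (Suc l))"
    by (rule order_trans[OF norm_triangle_ineq4]) (simp add: norm_divide norm_mult norm_power del: of_nat_Suc)
   also have "... <= Q / real l / real l + Q / (real l * real l)"
    using cv sg_bound[OF l] l lg
    by (intro add_mono frac_le) (auto simp: Q_def)
   finally show "norm (cmod (b (Suc l) - b l)) <= 2 * ((1 + ln (real l)) ^ Suc (length v) / (real l)^2)"
    by (simp add: Q_def power2_eq_square)
  qed
  ultimately show ?thesis
   using summable_alternating_bounded_variation[of b] eq by (simp add: eq[abs_def])
 qed
qed

text \<open>Multiplying by the geometric series replaces the coefficients by the partial sums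
  \<open>S k\<close>. Hence \<open>(A - s) / (1 - r)\<close> is the power series of
  \<open>S k - s\<close>: its tail is at most \<open>e / (2 (1 - r))\<close> and its head at most
  the constant \<open>M\<close>.\<close>

lemma abel_limit:
 fixes c :: "nat => complex"
 assumes "c sums s"
 shows "((%r::real. \<Sum>n. c n * of_real r ^ n) ---> s) (at_left 1)"
proof (rule tendstoI)
 fix e :: real assume e: "e > 0"
 define S where "S n = (SUM i<=n. c i)" for n
 have "S \<longlonglongrightarrow> s" unfolding S_def using assms by (simp add: sums_def_le)
 then obtain N where N: "!!n. n >= N ==> cmod (S n - s) < e / 2"
  using e by (metis LIMSEQ_iff half_gt_zero)
 define M where "M = (SUM n<N. cmod (S n - s))"
 have "((%r::real. (1 - r) * M) ---> (1 - 1) * M) (at_left 1)" by (intro tendsto_intros)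
 then have "eventually (%r. (1 - r) * M < e / 2) (at_left (1::real))"
  using e by (intro order_tendstoD(2)) auto
 moreover have "eventually (%r. 0 < r & r < 1) (at_left (1::real))"
  by (auto simp: eventually_at_left[of 0] intro!: exI[of _ 0])
 ultimately show "eventually (%r. dist (\<Sum>n. c n * of_real r ^ n) s < e) (at_left (1::real))"
 proof eventually_elim
  case (elim r)
  have r: "0 < r" "r < 1" using elim by auto
  define A where "A = (\<Sum>n. c n * of_real r ^ n)"
  have "summable (%n. c n * 1 ^ n)" using assms sums_summable by auto
  then have s1: "summable (%n. norm (c n * of_real r ^ n))" using r by (intro powser_insidea[of c 1]) auto
  have s2: "summable (%n. norm ((of_real r :: complex) ^ n))"
   using r by (simp add: norm_power summable_geometric)
  have g: "(\<Sum>n. (of_real r :: complex) ^ n) = 1 / (1 - of_real r)" using r by (simp add: suminf_geometric)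
  have "(%k. S k * of_real r ^ k) = (%k. SUM i<=k. (c i * of_real r ^ i) * of_real r ^ (k - i))"
   unfolding S_def sum_distrib_right by (intro ext sum.cong) (auto simp flip: power_add)
  then have 1: "(%k. S k * of_real r ^ k) sums (A * (1 / (1 - of_real r)))"
   using Cauchy_product_sums[OF s1 s2] g A_def by simp
  have 2: "(%k. s * of_real r ^ k) sums (s * (1 / (1 - of_real r)))"
   using r by (intro sums_mult geometric_sums) auto
  have 3: "(%k. (S k - s) * of_real r ^ k) sums ((A - s) / (1 - of_real r))"
   using sums_diff[OF 1 2] by (simp add: algebra_simps diff_divide_distrib)
  have "(%k. if k : {..<N} then cmod (S k - s) else 0) sums M"
   unfolding M_def by (rule sums_If_finite_set) simp
  moreover have "(%k. e / 2 * r ^ k) sums (e / 2 * (1 / (1 - r)))"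
   using r by (intro sums_mult geometric_sums) auto
  ultimately have 4: "(%k. (if k : {..<N} then cmod (S k - s) else 0) + e / 2 * r ^ k) sums (M + e / 2 * (1 / (1 - r)))"
   by (rule sums_add)
  have "cmod (\<Sum>k. (S k - s) * of_real r ^ k) <= (\<Sum>k. (if k : {..<N} then cmod (S k - s) else 0) + e / 2 * r ^ k)"
  proof (rule norm_suminf_le)
   fix k
   show "norm ((S k - s) * of_real r ^ k) <= (if k : {..<N} then cmod (S k - s) else 0) + e / 2 * r ^ k"
   proof (cases "k < N")
    case True
    have "r ^ k <= 1" using r by (simp add: power_le_one)
    then have "cmod (S k - s) * r ^ k <= cmod (S k - s)" by (simp add: mult_left_le)
    moreover have "0 <= e / 2 * r ^ k" using r e by simp
    ultimately show ?thesis using True r by (simp add: norm_mult norm_power)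
   next
    case False
    then have "cmod (S k - s) * r ^ k <= e / 2 * r ^ k"
     using N[of k] r by (intro mult_right_mono) auto
    then show ?thesis using False r by (simp add: norm_mult norm_power)
   qed
  qed (use 4 sums_summable in blast)
  then have "cmod ((A - s) / (1 - of_real r)) <= M + e / 2 * (1 / (1 - r))"
   using 3 4 by (simp add: sums_iff)
  moreover have "cmod (1 - of_real r) = 1 - r" using r norm_of_real[of "1 - r", where 'a = complex] by simp
  ultimately have "cmod (A - s) <= (M + e / 2 * (1 / (1 - r))) * (1 - r)"
   using r by (simp add: norm_divide pos_divide_le_eq)
  also have "... = (1 - r) * M + e / 2" using r by (simp add: field_simps)
  finally have "cmod (A - s) <= (1 - r) * M + e / 2" .
  then show ?case using elim by (simp add: dist_norm A_def)
 qed
qed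

subsection \<open>Regularised values\<close>

text \<open>Only the combination has to converge, not its single words. This makes closure under
  products immediate from the shuffle product, and leaves to the regularisation the proof that such
  limits are multiple zeta values.\<close>

definition hpl_values :: "nat => complex set" where
 "hpl_values n = {v. EX f. hpls n f & ((%x. f (of_real x)) ---> v) (at_left 1)}"

lemma eventually_unit_interval: "eventually (%r. 0 < r & r < 1) (at_left (1::real))"
 by (auto simp: eventually_at_left[of 0] intro!: exI[of _ 0])

lemma hpl_valuesI: "hpls n f ==> ((%x. f (of_real x)) ---> v) (at_left 1) ==> v : hpl_values n"
 by (auto simp: hpl_values_def)

lemma hpl_values_add:
 assumes "u : hpl_values n" "v : hpl_values n" shows "u + v : hpl_values n"
proof -
 obtain f g where f: "hpls n f" "((%x. f (of_real x)) ---> u) (at_left 1)"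
  and g: "hpls n g" "((%x. g (of_real x)) ---> v) (at_left 1)"
  using assms by (auto simp: hpl_values_def)
 show ?thesis by (rule hpl_valuesI[OF hpl_span.add[OF f(1) g(1)] tendsto_add[OF f(2) g(2)]])
qed

lemma hpl_values_mult:
 assumes "u : hpl_values m" "v : hpl_values n" shows "u * v : hpl_values (m + n)"
proof -
 obtain f g where f: "hpls m f" "((%x. f (of_real x)) ---> u) (at_left 1)"
  and g: "hpls n g" "((%x. g (of_real x)) ---> v) (at_left 1)"
  using assms by (auto simp: hpl_values_def)
 show ?thesis by (rule hpl_valuesI[OF hpls_mult[OF f(1) g(1)] tendsto_mult[OF f(2) g(2)]])
qed

lemma hpl_values_scale:
 assumes "v : hpl_values n" shows "of_rat q * v : hpl_values n"
proof -
 obtain f where f: "hpls n f" "((%x. f (of_real x)) ---> v) (at_left 1)"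
  using assms by (auto simp: hpl_values_def)
 show ?thesis by (rule hpl_valuesI[OF hpl_span_scale[OF f(1)] tendsto_mult[OF tendsto_const f(2)]])
qed

lemma hpl_values_0: "0 : hpl_values n"
 by (rule hpl_valuesI[OF hpl_span.zero tendsto_const])

lemma hpl_values_of_rat: "of_rat q : hpl_values 0"
proof -
 have "hpls 0 (%_. of_rat q)" using hpl_span.word[of "[]" "%_. True" q] by simp
 then show ?thesis by (rule hpl_valuesI[OF _ tendsto_const])
qed

lemma hpl_span_real: "hpl_span P n f ==> \<bar>x\<bar> < 1 ==> f (of_real x) : \<real>"
proof (induction rule: hpl_span.induct)
 case (word w q)
 have "complex_of_rat q : \<real>" by (cases q) (simp add: of_rat_rat)
 then show ?case using hpl_real[of w x] word by (intro Reals_mult) auto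
next
 case (cong n f g)
 have "of_real x : hpl_dom" using cong by (simp add: hpl_dom_def)
 then show ?case using cong by metis
qed auto

lemma hpl_values_real: assumes "v : hpl_values n" shows "v : \<real>"
proof -
 obtain f where f: "hpls n f" "((%x. f (of_real x)) ---> v) (at_left 1)"
  using assms by (auto simp: hpl_values_def)
 have "eventually (%x. f (of_real x) : \<real>) (at_left (1::real))"
  using eventually_unit_interval by eventually_elim (auto intro!: hpl_span_real[OF f(1)])
 then show ?thesis using f(2)
  by (intro Lim_in_closed_set[OF closed_complex_Reals]) auto
qed

lemma cyclotomic_mzv_space_add:
 "u : cyclotomic_mzv_space n N ==> v : cyclotomic_mzv_space n N ==> u + v : cyclotomic_mzv_space n N"
 by (auto simp: cyclotomic_mzv_space_def intro: rat_complex.span_add split: if_splits)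

lemma cyclotomic_mzv_space_scale:
 "v : cyclotomic_mzv_space n N ==> of_rat q * v : cyclotomic_mzv_space n N"
 by (auto simp: cyclotomic_mzv_space_def intro: rat_complex.span_scale split: if_splits)

lemma cyclotomic_mzv_space_0: "0 : cyclotomic_mzv_space n N"
 by (auto simp: cyclotomic_mzv_space_def intro: rat_complex.span_zero split: if_splits)

lemma tendsto_1_rate:
 assumes "!!t. P t ==> cmod (f t - V) <= C * cmod (1 - t) powr a" "a > 0"
  and "eventually (%x. P (T x)) F" "(T ---> 1) F"
 shows "((%x. f (T x)) ---> V) F"
proof -
 have "((%x. cmod (1 - T x)) ---> cmod (1 - 1)) F" by (intro tendsto_intros assms)
 then have "((%x. C * cmod (1 - T x) powr a) ---> C * 0) F"
  using assms(2) by (intro tendsto_mult tendsto_const tendsto_zero_powrI[where b = a]) auto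
 moreover have "eventually (%x. norm (f (T x) - V) <= C * cmod (1 - T x) powr a) F"
  using assms(3) by eventually_elim (rule assms)
 ultimately have "((%x. f (T x) - V) ---> 0) F"
  using Lim_null_comparison[of "%x. f (T x) - V"] by simp
 then show ?thesis by (simp add: LIM_zero_iff)
qed

lemma tendsto_of_real_1: "((%x. of_real x) ---> (1::complex)) (at_left 1)"
 using tendsto_of_real[OF tendsto_ident_at[of 1 "{..<1}"], where 'a = complex] by simp

lemma eventually_near1_real: "eventually (%x. near1 (of_real x)) (at_left 1)"
 using eventually_unit_interval by eventually_elim (auto intro: near1_of_real)

lemma hpl_tame_sum:
 assumes "hpl_word w" "w ~= []" "hd w ~= 1" "hpl_coeff w sums s"
 shows "((%x. hpl w (of_real x)) ---> s) (at_left 1)"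
proof (rule Lim_transform_eventually[OF abel_limit[OF assms(4)]])
 show "eventually (%r. (\<Sum>n. hpl_coeff w n * of_real r ^ n) = hpl w (of_real r)) (at_left 1)"
  using eventually_unit_interval
  by eventually_elim (use hpl_sums[OF assms(1)] in "auto simp: sums_iff")
qed

text \<open>By Abel's theorem the limit is the sum of the Taylor coefficients, and the partial sums
  of those coefficients are truncations of one multiple polylogarithm.\<close>

lemma hpl_limit_value:
 assumes "hpl_word w" "tame w" "((%x. hpl w (of_real x)) ---> V) (at_left 1)"
 shows "V : cyclotomic_mzv_space (length w) 2"
proof (cases "w = []")
 case True
 then have "V = 1" using assms(3) by (simp add: tendsto_const_iff)
 then show ?thesis using True by (simp add: cyclotomic_mzv_space_def)
next
 case False
 then have hd: "hd w ~= 1" using assms by (auto simp: tame_def)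
 obtain s where s: "hpl_coeff w sums s"
  using hpl_coeff_summable[OF assms(1) False hd] by (auto simp: summable_def)
 have V: "V = s"
  by (rule tendsto_unique[OF _ assms(3) hpl_tame_sum[OF assms(1) False hd s]]) simp
 obtain a z where az: "a ~= []" "length z = length a" "ALL c:set a. c > 0" "ALL y:set z. y\<^sup>2 = 1"
   "sum_list a = length w" "(hd a, hd z) ~= (1, 1)" and co: "!!l. l > 0 ==>
    hpl_coeff w l = hd z ^ l / of_nat l ^ hd a * multi_polylog_partial (tl a) (tl z) (l - 1)"
  using hpl_coeff_polylog[OF assms(1) False] hd by blast
 have hdtl: "a = hd a # tl a" "z = hd z # tl z" using az(1,2) by (cases a; cases z; simp)+
 have "multi_polylog_partial a z L = (SUM l<=L. hpl_coeff w l)" for L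
 proof -
  have "multi_polylog_partial a z L = (SUM l=1..L. hpl_coeff w l)"
   by (subst hdtl(1), subst hdtl(2), subst multi_polylog_partial_Cons) (auto intro!: sum.cong simp: co)
  also have "... = (SUM l<=L. hpl_coeff w l)"
   using hpl_coeff_0[OF False] by (intro sum.mono_neutral_left) (auto simp: not_less_eq_eq)
  finally show ?thesis .
 qed
 then have "multi_polylog_partial a z = (%L. SUM l<=L. hpl_coeff w l)" by auto
 then have "multi_polylog_partial a z \<longlonglongrightarrow> s" using s by (simp add: sums_def_le)
 then have "multi_polylog a z = V" unfolding multi_polylog_def V by (rule limI)
 then show ?thesis using False az
  unfolding cyclotomic_mzv_space_def by (auto intro!: rat_complex.span_base)
qed

lemma hpl_tame_limit:
 assumes "hpl_word w" "tame w"
 obtains V C where "V : cyclotomic_mzv_space (length w) 2" "V : hpl_values (length w)"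
  "!!t. near1 t ==> cmod (hpl w t - V) <= C * cmod (1 - t) powr (1/2)"
proof -
 obtain V C where VC: "!!t. near1 t ==> cmod (hpl w t - V) <= C * cmod (1 - t) powr (1/2)"
  using hpl_limit_1[OF assms] by blast
 have lim: "((%x. hpl w (of_real x)) ---> V) (at_left 1)"
  by (rule tendsto_1_rate[OF VC _ eventually_near1_real tendsto_of_real_1]) auto
 moreover have "hpls (length w) (hpl w)" using assms by (intro hpl_span_hpl) auto
 ultimately have "V : hpl_values (length w)" by (auto simp: hpl_values_def)
 with VC hpl_limit_value[OF assms lim] show ?thesis using that by blast
qed

text \<open>The word \<open>[0, 1]\<close> is the dilogarithm, whose limit at 1 is zeta(2).\<close>

lemma pi_squared_in_hpl_values: "of_real (pi^2) : hpl_values 2"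
proof -
 have w: "hpl_word [0, 1]" by (simp add: hpl_word_def)
 have c: "hpl_coeff [0, 1] l = of_real (1 / (real l)^2)" for l
 proof (cases l)
  case (Suc n)
  have "(SUM m<l. of_int 1 ^ (l - m) * (if m = 0 then 1 else 0)) = (1 :: complex)"
   using Suc by (subst sum.remove[of _ 0]) auto
  then show ?thesis by (simp add: power2_eq_square)
 qed simp
 have "(%n. 1 / (real (n + 1))^2) sums (pi^2 / 6)" using inverse_squares_sums by simp
 then have "(%n. 1 / (real n)^2) sums (pi^2 / 6)"
  using sums_Suc_iff[of "%n. 1 / (real n)^2" "pi^2 / 6"] by simp
 then have "(%l. of_real (1 / (real l)^2) :: complex) sums of_real (pi^2 / 6)" by (rule sums_of_real)
 then have "hpl_coeff [0, 1] sums of_real (pi^2 / 6)" unfolding c[abs_def, symmetric] .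
 then have "((%x. hpl [0, 1] (of_real x)) ---> of_real (pi^2 / 6)) (at_left 1)"
  by (intro hpl_tame_sum w) auto
 moreover have "hpls 2 (hpl [0, 1])" using hpl_span_hpl[OF w, of "%_. True"] by (simp add: numeral_2_eq_2)
 ultimately have "of_real (pi^2 / 6) : hpl_values 2" by (auto simp: hpl_values_def)
 from hpl_values_scale[OF this, of 6] show ?thesis by simp
qed

text \<open>The radius 1/2 is what the estimate of \<open>Ln t\<close> in
  \<open>Ln_close1_bound\<close> requires.\<close>

definition close1 :: "complex => bool" where
 "close1 t \<longleftrightarrow> near1 t & cmod (1 - t) < 1/2"

lemma close1_near1: "close1 t ==> near1 t"
 by (simp add: close1_def)

text \<open>An expansion \<open>f = SUM i<=n. l ^ i * g i\<close> near \<open>1\<close>, where \<open>l = - log (1 - t)\<close> and each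
 \<open>g i\<close> has a limit of weight \<open>n - i\<close>; the rate beats every power of \<open>l\<close>.\<close>

definition log_expansion :: "(nat => complex set) => nat => (complex => complex) => bool" where
 "log_expansion K n f \<longleftrightarrow> (EX g kp C. (ALL i<=n. kp i : K (n - i)) &
  (ALL i<=n. ALL t. close1 t --> cmod (g i t - kp i) <= C * cmod (1 - t) powr (1/4)) &
  (ALL t. close1 t --> f t = (SUM i<=n. hpl [1] t ^ i * g i t)))"

lemma log_expansion_zero: "(!!m. 0 : K m) ==> log_expansion K n (%_. 0)"
 unfolding log_expansion_def by (intro exI[of _ "%_ _. 0"] exI[of _ "%_. 0"] exI[of _ 0]) auto

lemma log_expansion_add:
 assumes K: "!!m u v. u : K m ==> v : K m ==> u + v : K m"
  and "log_expansion K n f" "log_expansion K n h"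
 shows "log_expansion K n (%t. f t + h t)"
proof -
 obtain g1 k1 C1 where 1: "ALL i<=n. k1 i : K (n - i)"
  "ALL i<=n. ALL t. close1 t --> cmod (g1 i t - k1 i) <= C1 * cmod (1 - t) powr (1/4)"
  "ALL t. close1 t --> f t = (SUM i<=n. hpl [1] t ^ i * g1 i t)"
  using assms(2) unfolding log_expansion_def by blast
 obtain g2 k2 C2 where 2: "ALL i<=n. k2 i : K (n - i)"
  "ALL i<=n. ALL t. close1 t --> cmod (g2 i t - k2 i) <= C2 * cmod (1 - t) powr (1/4)"
  "ALL t. close1 t --> h t = (SUM i<=n. hpl [1] t ^ i * g2 i t)"
  using assms(3) unfolding log_expansion_def by blast
 have "cmod (g1 i t + g2 i t - (k1 i + k2 i)) <= (C1 + C2) * cmod (1 - t) powr (1/4)" if "i <= n" "close1 t" for i t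
 proof -
  have "g1 i t + g2 i t - (k1 i + k2 i) = (g1 i t - k1 i) + (g2 i t - k2 i)" by simp
  then have "cmod (g1 i t + g2 i t - (k1 i + k2 i)) <= cmod (g1 i t - k1 i) + cmod (g2 i t - k2 i)"
   using norm_triangle_ineq by metis
  moreover have "cmod (g1 i t - k1 i) <= C1 * cmod (1 - t) powr (1/4)"
   "cmod (g2 i t - k2 i) <= C2 * cmod (1 - t) powr (1/4)" using 1(2) 2(2) that by blast+
  ultimately show ?thesis unfolding distrib_right by linarith
 qed
 moreover have "f t + h t = (SUM i<=n. hpl [1] t ^ i * (g1 i t + g2 i t))" if "close1 t" for t
  using 1(3) 2(3) that by (simp add: distrib_left sum.distrib)
 moreover have "ALL i<=n. k1 i + k2 i : K (n - i)" using 1(1) 2(1) K by blast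
 ultimately show ?thesis unfolding log_expansion_def
  by (intro exI[of _ "%i t. g1 i t + g2 i t"] exI[of _ "%i. k1 i + k2 i"] exI[of _ "C1 + C2"]) blast
qed

lemma log_expansion_cong:
 assumes "log_expansion K n f" "!!t. close1 t ==> f t = h t"
 shows "log_expansion K n h"
proof -
 obtain g kp C where 1: "ALL i<=n. kp i : K (n - i)"
  "ALL i<=n. ALL t. close1 t --> cmod (g i t - kp i) <= C * cmod (1 - t) powr (1/4)"
  "ALL t. close1 t --> f t = (SUM i<=n. hpl [1] t ^ i * g i t)"
  using assms(1) unfolding log_expansion_def by blast
 have "ALL t. close1 t --> h t = (SUM i<=n. hpl [1] t ^ i * g i t)" using 1(3) assms(2) by simp
 with 1(1,2) show ?thesis unfolding log_expansion_def by blast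
qed

lemma hpl_dom_one_minus: "t : hpl_dom ==> 1 - t \<notin> \<real>\<^sub>\<le>\<^sub>0"
 by (auto simp: hpl_dom_def complex_nonpos_Reals_iff)

lemma hpl_1_eq: assumes "t : hpl_dom" shows "hpl [1] t = - Ln (1 - t)"
proof (rule eq_on_hpl_dom[OF _ _ _ _ _ assms])
 have w: "hpl_word [1]" by (simp add: hpl_word_def)
 then show "hpl [1] holomorphic_on hpl_dom" by (rule hpl_holomorphic)
 show "(%t. - Ln (1 - t)) holomorphic_on hpl_dom"
  using hpl_dom_one_minus by (intro holomorphic_intros) auto
 show "hpl [1] 0 = - Ln (1 - 0)" using hpl_at_0[OF w] by simp
 fix t assume t: "t : hpl_dom" "t ~= 0"
 show "(hpl [1] has_field_derivative hpl_form 1 t) (at t)" using hpl_has_derivative[OF w t] by simp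
 show "((%t. - Ln (1 - t)) has_field_derivative hpl_form 1 t) (at t)"
  using hpl_dom_one_minus[OF t(1)] by (auto intro!: derivative_eq_intros simp: hpl_form_def field_simps)
qed

lemma hpl_1_at_infinity:
 assumes "eventually (%x. near1 (T x)) F" "(T ---> 1) F"
 shows "filterlim (%x. hpl [1] (T x)) at_infinity F"
proof (rule filterlim_norm_at_top_imp_at_infinity)
 have "((%x. cmod (1 - T x)) ---> cmod (1 - 1)) F" by (intro tendsto_intros assms)
 moreover have "eventually (%x. cmod (1 - T x) > 0) F"
  using assms(1) by eventually_elim (simp add: near1_def)
 ultimately have "filterlim (%x. cmod (1 - T x)) (at_right 0) F"
  by (auto simp: filterlim_at)
 then have "filterlim (%x. - ln (cmod (1 - T x))) at_top F"
  by (intro filterlim_compose[OF filterlim_uminus_at_top_at_bot] filterlim_compose[OF ln_at_0])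
 moreover have "eventually (%x. - ln (cmod (1 - T x)) <= cmod (hpl [1] (T x))) F"
  using assms(1)
 proof eventually_elim
  case (elim x)
  then have "1 - T x ~= 0" by (auto simp: near1_def)
  then have "Re (Ln (1 - T x)) = ln (cmod (1 - T x))" by simp
  then show ?case using abs_Re_le_cmod[of "Ln (1 - T x)"] hpl_1_eq[OF near1_D(2)[OF elim]] by simp
 qed
 ultimately show "filterlim (%x. norm (hpl [1] (T x))) at_top F"
  by (rule filterlim_at_top_mono)
qed

text \<open>Dividing by the top power of the unbounded function shows that the leading coefficient
  vanishes; induction on the degree then leaves the constant term.\<close>

lemma tendsto_polynomial_at_infinity:
 fixes kp :: "nat => complex"
 assumes "filterlim l at_infinity F" "F ~= bot" "((%x. SUM i<=n. l x ^ i * kp i) ---> v) F"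
 shows "v = kp 0"
 using assms(3)
proof (induction n)
 case 0
 then show ?case using tendsto_const_iff[OF assms(2), of "kp 0" v] by simp
next
 case (Suc n)
 have inv: "((%x. inverse (l x)) ---> 0) F" by (rule filterlim_compose[OF tendsto_inverse_0 assms(1)])
 have nz: "eventually (%x. l x ~= 0) F"
  using assms(1) by (rule filterlim_at_infinity_imp_eventually_ne)
 have A: "((%x. (SUM i<=Suc n. l x ^ i * kp i) * inverse (l x) ^ Suc n) ---> v * 0 ^ Suc n) F"
  by (intro tendsto_intros Suc.prems inv)
 have B: "((%x. SUM i<=Suc n. inverse (l x) ^ (Suc n - i) * kp i) ---> (SUM i<=Suc n. 0 ^ (Suc n - i) * kp i)) F"
  by (intro tendsto_intros inv)
 have E: "eventually (%x. (SUM i<=Suc n. l x ^ i * kp i) * inverse (l x) ^ Suc n =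
   (SUM i<=Suc n. inverse (l x) ^ (Suc n - i) * kp i)) F"
  using nz
 proof eventually_elim
  case (elim x)
  show ?case unfolding sum_distrib_right
  proof (intro sum.cong refl)
   fix i assume "i : {..Suc n}"
   then have "inverse (l x) ^ Suc n = inverse (l x) ^ (Suc n - i) * inverse (l x) ^ i"
    by (simp flip: power_add)
   moreover have "l x ^ i * inverse (l x) ^ i = 1" using elim by (simp flip: power_mult_distrib)
   ultimately show "l x ^ i * kp i * inverse (l x) ^ Suc n = inverse (l x) ^ (Suc n - i) * kp i"
    by (metis mult.assoc mult.commute mult.right_neutral)
  qed
 qed
 have "(SUM i<=Suc n. 0 ^ (Suc n - i) * kp i) = v * 0 ^ Suc n"
  by (rule tendsto_unique[OF assms(2) B Lim_transform_eventually[OF A E]])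
 moreover have "(SUM i<=Suc n. 0 ^ (Suc n - i) * kp i) = kp (Suc n)"
  by (subst sum.remove[of _ "Suc n"]) (auto intro!: sum.neutral)
 ultimately have "kp (Suc n) = 0" by simp
 then show ?case using Suc by simp
qed

text \<open>The errors \<open>l^i (g i - kp i)\<close> tend to 0 because \<open>l\<close> grows more
  slowly than any negative power of \<open>cmod (1 - t)\<close>. So a polynomial in \<open>l\<close>
  with the coefficients \<open>kp i\<close> converges while \<open>l\<close> is unbounded, and its
  limit is \<open>kp 0\<close>. No value is assigned to a divergent word: existence of the limit is
  a hypothesis.\<close>

lemma log_expansion_limit:
 assumes "log_expansion K n f" "F ~= bot" "eventually (%x. near1 (T x)) F" "(T ---> 1) F"
  and "((%x. f (T x)) ---> v) F"
 shows "v : K n"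
proof -
 obtain g kp C where k: "!!i. i <= n ==> kp i : K (n - i)"
  and g: "!!i t. i <= n ==> close1 t ==> cmod (g i t - kp i) <= C * cmod (1 - t) powr (1/4)"
  and f: "!!t. close1 t ==> f t = (SUM i<=n. hpl [1] t ^ i * g i t)"
  using assms(1) unfolding log_expansion_def by blast
 have w1: "hpl_word [1]" by (simp add: hpl_word_def)
 have "((%x. cmod (1 - T x)) ---> cmod (1 - 1)) F" by (intro tendsto_intros assms)
 then have "eventually (%x. cmod (1 - T x) < 1/2) F" by (rule order_tendstoD) simp
 with assms(3) have ev: "eventually (%x. close1 (T x)) F"
  by eventually_elim (simp add: close1_def)
 have z: "((%x. hpl [1] (T x) ^ i * (g i (T x) - kp i)) ---> 0) F" if i: "i <= n" for i
 proof -
  \<comment> \<open>The exponent is chosen so that the \<open>i\<close>-th power of \<open>l\<close>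
    costs at most \<open>cmod (1 - t) powr (-1/8)\<close>, half of the available rate 1/4.\<close>
  obtain D where D: "D >= 0" "!!t. near1 t ==> cmod (hpl [1] t) <= D * cmod (1 - t) powr (- (1 / (8 * (real i + 1))))"
   using hpl_growth_near1[OF w1, of "1 / (8 * (real i + 1))"] by auto
  have "cmod (hpl [1] t ^ i * (g i t - kp i) - 0) <= (D ^ i * \<bar>C\<bar>) * cmod (1 - t) powr (1/8)" if t: "close1 t" for t
  proof -
   define d where "d = cmod (1 - t)"
   have d: "0 < d" "d < 1" using t by (auto simp: d_def close1_def near1_def)
   have "cmod (hpl [1] t) ^ i <= (D * d powr (- (1 / (8 * (real i + 1))))) ^ i"
    using D close1_near1[OF t] by (intro power_mono) (auto simp: d_def)
   also have "... = D ^ i * d powr (- (real i / (8 * (real i + 1))))"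
    using d by (simp add: power_mult_distrib powr_power)
   also have "... <= D ^ i * d powr (- (1/8))"
    using D d by (intro mult_left_mono powr_mono') (auto simp: field_simps)
   finally have 1: "cmod (hpl [1] t) ^ i <= D ^ i * d powr (- (1/8))" .
   have "C * d powr (1/4) <= \<bar>C\<bar> * d powr (1/4)" by (intro mult_right_mono) auto
   then have 2: "cmod (g i t - kp i) <= \<bar>C\<bar> * d powr (1/4)" using g[OF i t] by (simp add: d_def)
   have "cmod (hpl [1] t) ^ i * cmod (g i t - kp i) <= (D ^ i * d powr (- (1/8))) * (\<bar>C\<bar> * d powr (1/4))"
    using 1 2 D by (intro mult_mono) auto
   also have "... = D ^ i * \<bar>C\<bar> * (d powr (- (1/8)) * d powr (1/4))" by simp
   also have "d powr (- (1/8)) * d powr (1/4) = d powr (1/8)" by (simp flip: powr_add)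
   finally show ?thesis by (simp add: norm_mult norm_power d_def)
  qed
  then show ?thesis by (rule tendsto_1_rate[OF _ _ ev assms(4)]) auto
 qed
 have "((%x. f (T x) - (SUM i<=n. hpl [1] (T x) ^ i * (g i (T x) - kp i))) ---> v - (SUM i<=n. 0)) F"
  by (intro tendsto_intros z assms(5)) auto
 moreover have "eventually (%x. f (T x) - (SUM i<=n. hpl [1] (T x) ^ i * (g i (T x) - kp i)) =
   (SUM i<=n. hpl [1] (T x) ^ i * kp i)) F"
  using ev by eventually_elim (simp add: f right_diff_distrib sum_subtractf)
 ultimately have "((%x. SUM i<=n. hpl [1] (T x) ^ i * kp i) ---> v) F"
  using Lim_transform_eventually by fastforce
 then have "v = kp 0"
  by (rule tendsto_polynomial_at_infinity[OF hpl_1_at_infinity[OF assms(3,4)] assms(2)])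
 then show ?thesis using k[of 0] by simp
qed

text \<open>The coefficients are placed in both spaces at once: the cyclotomic space is the goal for
  real limits, while \<open>hpl_values\<close> is closed under products and is needed once constants
  are multiplied in.\<close>

lemma hpl_reg_log_expansion:
 "hpl_reg n f ==> log_expansion (%m. hpl_values m \<inter> cyclotomic_mzv_space m 2) n f"
proof (induction rule: hpl_reg.induct)
 case (gen w j q)
 obtain V C where V: "V : cyclotomic_mzv_space (length w) 2" "V : hpl_values (length w)"
  and C: "!!t. near1 t ==> cmod (hpl w t - V) <= C * cmod (1 - t) powr (1/2)"
  using hpl_tame_limit[OF gen] by blast
 define g where "g i t = (if i = j then of_rat q * hpl w t else 0)" for i t
 define kp where "kp i = (if i = j then of_rat q * V else 0)" for i
 have "kp i : hpl_values (j + length w - i) \<inter> cyclotomic_mzv_space (j + length w - i) 2" for i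
  using V by (auto simp: kp_def hpl_values_0 cyclotomic_mzv_space_0 intro: hpl_values_scale cyclotomic_mzv_space_scale)
 moreover have "cmod (g i t - kp i) <= (cmod (of_rat q) * \<bar>C\<bar>) * cmod (1 - t) powr (1/4)" if t: "close1 t" for i t
 proof (cases "i = j")
  case True
  have "cmod (hpl w t - V) <= C * cmod (1 - t) powr (1/2)" by (rule C[OF close1_near1[OF t]])
  also have "... <= \<bar>C\<bar> * cmod (1 - t) powr (1/4)"
   using t by (intro mult_mono powr_mono') (auto simp: close1_def near1_def)
  finally have "cmod (of_rat q) * cmod (hpl w t - V) <= cmod (of_rat q) * (\<bar>C\<bar> * cmod (1 - t) powr (1/4))"
   by (intro mult_left_mono) auto
  then show ?thesis using True by (simp add: g_def kp_def norm_mult mult.assoc flip: right_diff_distrib)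
 qed (auto simp: g_def kp_def)
 moreover have "of_rat q * hpl [1] t ^ j * hpl w t = (SUM i<=j + length w. hpl [1] t ^ i * g i t)" for t
  by (subst sum.remove[of _ j]) (auto simp: g_def intro!: sum.neutral)
 ultimately show ?case unfolding log_expansion_def
  by (intro exI[of _ g] exI[of _ kp] exI[of _ "cmod (of_rat q) * \<bar>C\<bar>"]) auto
next
 case (zero n)
 then show ?case by (intro log_expansion_zero) (auto simp: hpl_values_0 cyclotomic_mzv_space_0)
next
 case (add n f g)
 then show ?case by (intro log_expansion_add) (auto intro: hpl_values_add cyclotomic_mzv_space_add)
next
 case (cong n f g)
 show ?case by (rule log_expansion_cong[OF cong.IH]) (use cong near1_D(2) close1_near1 in auto)
qed

lemma hpls_reg: "hpls n f ==> hpl_reg n f"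
proof (induction rule: hpl_span.induct)
 case (word w q)
 have s: "hpl_reg n (%t. of_rat q * f t)" if "hpl_reg n f" for n f
  using that
 proof (induction rule: hpl_reg.induct)
  case (gen w j q')
  show ?case by (rule hpl_reg.cong[OF hpl_reg.gen[OF gen, of j "q * q'"]]) (simp add: of_rat_mult)
 next
  case (zero n)
  show ?case by (rule hpl_reg.cong[OF hpl_reg.zero]) simp
 next
  case (add n f g)
  show ?case by (rule hpl_reg.cong[OF hpl_reg.add[OF add.IH]]) (simp add: ring_distribs)
 next
  case (cong n f g)
  show ?case by (rule hpl_reg.cong[OF cong.IH]) (simp add: cong)
 qed
 show ?case by (rule s[OF hpl_reg_hpl[OF word(1)]])
next
 case (zero n)
 show ?case by (rule hpl_reg.zero)
next
 case (add n f g)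
 show ?case by (rule hpl_reg.add[OF add.IH])
next
 case (cong n f g)
 show ?case by (rule hpl_reg.cong[OF cong.IH cong(2)])
qed

lemma hpl_values_subset: "hpl_values n <= cyclotomic_mzv_space n 2"
proof
 fix v assume "v : hpl_values n"
 then obtain f where f: "hpls n f" "((%x. f (of_real x)) ---> v) (at_left 1)"
  by (auto simp: hpl_values_def)
 show "v : cyclotomic_mzv_space n 2"
  using log_expansion_limit[OF hpl_reg_log_expansion[OF hpls_reg[OF f(1)]] _ eventually_near1_real tendsto_of_real_1 f(2)]
  by simp
qed

section \<open>Constants that involve powers of i pi\<close>

inductive hpl_const :: "nat => complex => bool" where
 gen: "v : hpl_values n ==> hpl_const (a + n) ((\<i> * of_real pi) ^ a * v)"
| add: "hpl_const n u ==> hpl_const n v ==> hpl_const n (u + v)"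

lemma hpl_const_value: "v : hpl_values n ==> hpl_const n v"
 using hpl_const.gen[of v n 0] by simp

lemma hpl_const_0: "hpl_const n 0"
 by (rule hpl_const_value[OF hpl_values_0])

lemma hpl_const_of_rat: "hpl_const 0 (of_rat q)"
 by (rule hpl_const_value[OF hpl_values_of_rat])

lemma hpl_const_1: "hpl_const 0 1"
 using hpl_const_of_rat[of 1] by simp

lemma hpl_const_i_pi: "hpl_const 1 (\<i> * of_real pi)"
 using hpl_const.gen[OF hpl_values_of_rat[of 1], of 1] by simp

lemma hpl_const_mult: "hpl_const m u ==> hpl_const n v ==> hpl_const (m + n) (u * v)"
proof (induction rule: hpl_const.induct)
 case (gen u m a)
 show ?case using gen(2)
 proof (induction rule: hpl_const.induct)
  case (gen v n b)
  have "hpl_const ((a + b) + (m + n)) ((\<i> * of_real pi) ^ (a + b) * (u * v))"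
   by (rule hpl_const.gen[OF hpl_values_mult[OF \<open>u : hpl_values m\<close> gen]])
  then show ?case by (simp add: power_add mult_ac add_ac)
 next
  case (add n v v')
  then show ?case unfolding distrib_left by (rule_tac hpl_const.add)
 qed
next
 case (add m u u')
 then show ?case unfolding distrib_right by (blast intro: hpl_const.add)
qed

lemma hpl_const_scale: "hpl_const n v ==> hpl_const n (of_rat q * v)"
 using hpl_const_mult[OF hpl_const_of_rat, of n v q] by simp

lemma hpl_const_minus: "hpl_const n v ==> hpl_const n (- v)"
 using hpl_const_scale[of n v "-1"] by simp

lemma hpl_const_cnj: "hpl_const n v ==> hpl_const n (cnj v)"
proof (induction rule: hpl_const.induct)
 case (gen v n a)
 have "cnj v = v" using hpl_values_real[OF gen] by (simp add: Reals_cnj_iff)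
 then have "cnj ((\<i> * of_real pi) ^ a * v) = of_rat ((-1) ^ a) * ((\<i> * of_real pi) ^ a * v)"
  by (simp add: of_rat_power power_mult_distrib[symmetric] flip: mult.assoc)
 then show ?case using hpl_const_scale[OF hpl_const.gen[OF gen, of a], of "(-1) ^ a"] by simp
qed (auto intro: hpl_const.add)

lemma hpl_values_pi_power: "v : hpl_values n ==> of_real pi ^ (2 * j) * v : hpl_values (2 * j + n)"
proof (induction j)
 case (Suc j)
 have "of_real (pi^2) * (of_real pi ^ (2 * j) * v) : hpl_values (2 + (2 * j + n))"
  by (rule hpl_values_mult[OF pi_squared_in_hpl_values Suc.IH[OF Suc.prems]])
 then show ?case by (simp add: power2_eq_square mult_ac)
qed simp

text \<open>This is how \<open>i pi\<close> disappears: values are real, so an odd power of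
  \<open>i pi\<close> has no real part, and an even power is up to sign a power of
  \<open>pi^2\<close>, itself a value of the right weight.\<close>

lemma hpl_const_Re: "hpl_const n v ==> of_real (Re v) : hpl_values n"
proof (induction rule: hpl_const.induct)
 case (gen v n a)
 obtain x where x: "v = of_real x" using hpl_values_real[OF gen] by (auto elim: Reals_cases)
 show ?case
 proof (cases "even a")
  case True
  then obtain j where j: "a = 2 * j" by auto
  have "(\<i> * of_real pi) ^ a * v = of_rat ((-1) ^ j) * (of_real pi ^ (2 * j) * v)"
   by (simp add: j power_mult_distrib power_mult of_rat_power power_minus[of "(of_real pi)^2"])
  moreover have "of_rat ((-1) ^ j) * (of_real pi ^ (2 * j) * v) : hpl_values (a + n)"
   unfolding j by (intro hpl_values_scale hpl_values_pi_power gen)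
  ultimately show ?thesis using hpl_values_real by (metis of_real_Re)
 next
  case False
  then obtain j where j: "a = Suc (2 * j)" by (auto elim: oddE)
  have "(\<i> * of_real pi) ^ a * v = \<i> * of_real ((-1) ^ j * pi ^ a * x)"
   by (simp add: j x power_mult_distrib power_mult power_minus[of "(of_real pi)^2"])
  then show ?thesis by (simp add: hpl_values_0)
 qed
next
 case (add n u v)
 then show ?case using hpl_values_add by simp
qed

section \<open>Polylogarithms multiplied by powers of Ln\<close>

definition cut_dom :: "complex set" where
 "cut_dom = hpl_dom - \<real>\<^sub>\<le>\<^sub>0"

text \<open>The domain avoids the cut of \<open>Ln\<close> and contains both the open upper arc and
  the open unit interval. Admitting powers of \<open>Ln\<close> makes the class closed under
  integration against every letter, including \<open>1/t\<close> applied to a constant.\<close>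

inductive hpl_log :: "nat => (complex => complex) => bool" where
 gen: "hpl_const b kp ==> hpl_word w ==> hpl_log (b + j + length w) (%t. kp * Ln t ^ j * hpl w t)"
| zero: "hpl_log n (%_. 0)"
| add: "hpl_log n f ==> hpl_log n g ==> hpl_log n (%t. f t + g t)"
| cong: "hpl_log n f ==> (!!t. t : cut_dom ==> f t = g t) ==> hpl_log n g"

lemma hpl_log_const_mult:
 assumes "hpl_const m c" shows "hpl_log n f ==> hpl_log (m + n) (%t. c * f t)"
proof (induction rule: hpl_log.induct)
 case (gen b kp w j)
 have "hpl_log ((m + b) + j + length w) (%t. (c * kp) * Ln t ^ j * hpl w t)"
  by (rule hpl_log.gen[OF hpl_const_mult[OF assms gen(1)] gen(2)])
 then have "hpl_log (m + (b + j + length w)) (%t. (c * kp) * Ln t ^ j * hpl w t)" by (simp only: add.assoc)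
 then show ?case by (rule hpl_log.cong) simp
next
 case (zero n)
 show ?case by (rule hpl_log.cong[OF hpl_log.zero]) simp
next
 case (add n f g)
 show ?case by (rule hpl_log.cong[OF hpl_log.add[OF add.IH]]) (simp add: ring_distribs)
next
 case (cong n f g)
 show ?case by (rule hpl_log.cong[OF cong.IH]) (simp add: cong)
qed

lemma hpl_log_scale: "hpl_log n f ==> hpl_log n (%t. of_rat q * f t)"
 using hpl_log_const_mult[OF hpl_const_of_rat, of n f q] by simp

lemma hpl_log_minus: assumes "hpl_log n f" shows "hpl_log n (%t. - f t)"
 by (rule hpl_log.cong[OF hpl_log_scale[OF assms, of "-1"]]) simp

lemma hpl_log_diff:
 assumes "hpl_log n f" "hpl_log n g" shows "hpl_log n (%t. f t - g t)"
 by (rule hpl_log.cong[OF hpl_log.add[OF assms(1) hpl_log_minus[OF assms(2)]]]) simp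

lemma hpl_log_sum: "(!!i. i : I ==> hpl_log n (f i)) ==> hpl_log n (%t. SUM i:I. f i t)"
 by (induction I rule: infinite_finite_induct) (auto intro: hpl_log.zero hpl_log.add)

lemma hpl_log_Ln: "hpl_log 1 Ln"
 using hpl_log.gen[OF hpl_const_1, of "[]" 1] by simp

lemma hpl_log_const: assumes "hpl_const n c" shows "hpl_log n (%_. c)"
 by (rule hpl_log.cong[OF hpl_log.gen[OF assms, of "[]" 0, simplified]]) simp

lemma hpl_log_hpls: "hpls n f ==> hpl_log n f"
proof (induction rule: hpl_span.induct)
 case (word w q)
 show ?case by (rule hpl_log.cong[OF hpl_log.gen[OF hpl_const_of_rat[of q] word(1), of 0, simplified]]) simp
next
 case (zero n)
 show ?case by (rule hpl_log.zero)
next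
 case (add n f g)
 show ?case by (rule hpl_log.add[OF add.IH])
next
 case (cong n f g)
 show ?case by (rule hpl_log.cong[OF cong.IH]) (use cong in "auto simp: cut_dom_def")
qed

lemma hpl_log_Ln_power_mult:
 "hpl_log n f ==> hpl_log (j + n) (%t. Ln t ^ j * f t)"
proof (induction rule: hpl_log.induct)
 case (gen b kp w i)
 have "hpl_log (b + (j + i) + length w) (%t. kp * Ln t ^ (j + i) * hpl w t)"
  by (rule hpl_log.gen[OF gen])
 then have "hpl_log (j + (b + i + length w)) (%t. kp * Ln t ^ (j + i) * hpl w t)" by (simp only: ac_simps)
 then show ?case by (rule hpl_log.cong) (simp add: power_add)
next
 case (zero n)
 show ?case by (rule hpl_log.cong[OF hpl_log.zero]) simp
next
 case (add n f g)
 show ?case by (rule hpl_log.cong[OF hpl_log.add[OF add.IH]]) (simp add: ring_distribs)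
next
 case (cong n f g)
 show ?case by (rule hpl_log.cong[OF cong.IH]) (simp add: cong)
qed

lemma hpl_log_mult:
 assumes "hpl_log n g" shows "hpl_log m f ==> hpl_log (m + n) (%t. f t * g t)"
proof (induction rule: hpl_log.induct)
 case (gen b kp u j)
 have "hpl_log (length u + n) (%t. hpl u t * g t)" using assms
 proof (induction rule: hpl_log.induct)
  case (gen b' kp' v i)
  have "hpl_log (i + (length u + length v)) (%t. Ln t ^ i * (hpl u t * hpl v t))"
   by (intro hpl_log_Ln_power_mult hpl_log_hpls hpls_mult_words) fact+
  from hpl_log_const_mult[OF gen(1) this]
  have "hpl_log (length u + (b' + i + length v)) (%t. kp' * (Ln t ^ i * (hpl u t * hpl v t)))"
   by (simp only: ac_simps)
  then show ?case by (rule hpl_log.cong) simp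
 next
  case (zero n)
  show ?case by (rule hpl_log.cong[OF hpl_log.zero]) simp
 next
  case (add n f g)
  show ?case by (rule hpl_log.cong[OF hpl_log.add[OF add.IH]]) (simp add: ring_distribs)
 next
  case (cong n f g)
  show ?case by (rule hpl_log.cong[OF cong.IH]) (simp add: cong)
 qed
 from hpl_log_const_mult[OF gen(1) hpl_log_Ln_power_mult[OF this, of j]]
 have "hpl_log (b + j + length u + n) (%t. kp * (Ln t ^ j * (hpl u t * g t)))" by (simp only: ac_simps)
 then show ?case by (rule hpl_log.cong) simp
next
 case (zero n)
 show ?case by (rule hpl_log.cong[OF hpl_log.zero]) simp
next
 case (add n f g)
 show ?case by (rule hpl_log.cong[OF hpl_log.add[OF add.IH]]) (simp add: ring_distribs)
next
 case (cong n f g)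
 show ?case by (rule hpl_log.cong[OF cong.IH]) (simp add: cong)
qed

lemma hpl_log_power: "hpl_log 1 f ==> hpl_log j (%t. f t ^ j)"
proof (induction j)
 case 0
 show ?case by (rule hpl_log.cong[OF hpl_log_const[OF hpl_const_1]]) simp
next
 case (Suc j)
 show ?case
  by (rule hpl_log.cong[OF hpl_log_mult[OF Suc.IH[OF Suc.prems] Suc.prems, simplified]]) simp
qed

lemma cut_dom_D: "t : cut_dom ==> t : hpl_dom & t ~= 0 & t \<notin> \<real>\<^sub>\<le>\<^sub>0"
 by (auto simp: cut_dom_def)

text \<open>Integration by parts lowers the power of \<open>Ln\<close>: the primitive is
  \<open>Ln^(i+1) L\<close> minus \<open>i + 1\<close> times the primitive of
  \<open>Ln^i L / t\<close>, with \<open>L\<close> the function of \<open>x # w\<close>. The letter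
  0 with the empty word is separate because \<open>[0]\<close> is not an admissible word; there the
  primitive is a power of \<open>Ln\<close>.\<close>

lemma hpl_log_primitive_word:
 assumes "hpl_word w" "x : {-1, 0, 1}"
 shows "EX g. hpl_log (Suc (j + length w)) g &
  (ALL t:cut_dom. (g has_field_derivative Ln t ^ j * hpl w t * hpl_form x t) (at t))"
 using assms
proof (induction j arbitrary: w x)
 case (0 w x)
 show ?case
 proof (cases "x = 0 & w = []")
  case True
  have "(Ln has_field_derivative 1 / t) (at t)" if "t : cut_dom" for t
   using cut_dom_D[OF that] has_field_derivative_Ln[of t] by (simp add: inverse_eq_divide)
  then show ?thesis using True hpl_log_Ln by (intro exI[of _ Ln]) (auto simp: hpl_form_def)
 next
  case False
  then have u: "hpl_word (x # w)" using 0 by (auto simp: hpl_word_Cons)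
  have "hpl_log (length (x # w)) (hpl (x # w))" by (intro hpl_log_hpls hpl_span_hpl u) auto
  then show ?thesis using hpl_has_derivative[OF u] cut_dom_D by (intro exI[of _ "hpl (x # w)"]) auto
 qed
next
 case (Suc i w x)
 have dL: "((%t. Ln t ^ Suc k) has_field_derivative of_nat (Suc k) * (Ln t ^ k * (1 / t))) (at t)"
  if "t : cut_dom" for t k
  using DERIV_power[OF has_field_derivative_Ln[of t], of "Suc k"] cut_dom_D[OF that]
  by (simp add: inverse_eq_divide mult_ac del: of_nat_Suc power_Suc)
 show ?case
 proof (cases "x = 0 & w = []")
  case True
  have "hpl_log (Suc (Suc i) + 0) (%t. Ln t ^ Suc (Suc i) * 1)"
   by (intro hpl_log_Ln_power_mult hpl_log_const hpl_const_1)
  from hpl_log_scale[OF this, of "1 / of_nat (Suc (Suc i))"]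
  have "hpl_log (Suc (Suc i + length w)) (%t. of_rat (1 / of_nat (Suc (Suc i))) * (Ln t ^ Suc (Suc i) * 1))"
   using True by (simp only: list.size add.right_neutral)
  moreover have "((%t. of_rat (1 / of_nat (Suc (Suc i))) * (Ln t ^ Suc (Suc i) * 1)) has_field_derivative
    Ln t ^ Suc i * hpl w t * hpl_form x t) (at t)" if t: "t : cut_dom" for t
  proof -
   have "((%t. of_rat (1 / of_nat (Suc (Suc i))) * Ln t ^ Suc (Suc i)) has_field_derivative
    of_rat (1 / of_nat (Suc (Suc i))) * (of_nat (Suc (Suc i)) * (Ln t ^ Suc i * (1 / t)))) (at t)"
    by (rule DERIV_cmult[OF dL[OF t]])
   moreover have "of_rat (1 / of_nat (Suc (Suc i))) * (of_nat (Suc (Suc i)) * (Ln t ^ Suc i * (1 / t)))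
    = Ln t ^ Suc i * hpl w t * hpl_form x t"
    using True by (simp add: hpl_form_def of_rat_divide del: of_nat_Suc)
   ultimately show ?thesis by (simp del: of_nat_Suc power_Suc)
  qed
  ultimately show ?thesis by blast
 next
  case False
  then have u: "hpl_word (x # w)" and u0: "hpl_word (0 # x # w)" using Suc.prems by (auto simp: hpl_word_Cons)
  obtain G where G: "hpl_log (Suc (i + length (x # w))) G"
   "ALL t:cut_dom. (G has_field_derivative Ln t ^ i * hpl (x # w) t * hpl_form 0 t) (at t)"
   using Suc.IH[OF u, of 0] by auto
  have "hpl_log (Suc i + length (x # w)) (%t. Ln t ^ Suc i * hpl (x # w) t)"
   by (intro hpl_log_Ln_power_mult hpl_log_hpls hpl_span_hpl u) auto
  moreover have "hpl_log (Suc i + length (x # w)) (%t. of_rat (of_nat (Suc i)) * G t)"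
   using hpl_log_scale[OF G(1), of "of_nat (Suc i)"] by (simp only: add_Suc)
  ultimately have "hpl_log (Suc i + length (x # w)) (%t. Ln t ^ Suc i * hpl (x # w) t - of_rat (of_nat (Suc i)) * G t)"
   by (rule hpl_log_diff)
  then have l: "hpl_log (Suc (Suc i + length w)) (%t. Ln t ^ Suc i * hpl (x # w) t - of_rat (of_nat (Suc i)) * G t)"
   by (simp only: list.size add_Suc add_Suc_right add_0_right)
  have "((%t. Ln t ^ Suc i * hpl (x # w) t - of_rat (of_nat (Suc i)) * G t) has_field_derivative
   Ln t ^ Suc i * hpl w t * hpl_form x t) (at t)" if t: "t : cut_dom" for t
  proof -
   have td: "t : hpl_dom" "t ~= 0" using cut_dom_D[OF t] by auto
   have "((%t. Ln t ^ Suc i * hpl (x # w) t - of_rat (of_nat (Suc i)) * G t) has_field_derivative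
    (Ln t ^ Suc i * (hpl w t * hpl_form x t) + of_nat (Suc i) * (Ln t ^ i * (1 / t)) * hpl (x # w) t)
    - of_rat (of_nat (Suc i)) * (Ln t ^ i * hpl (x # w) t * hpl_form 0 t)) (at t)"
    by (intro DERIV_diff DERIV_mult' dL[OF t] hpl_has_derivative[OF u td] DERIV_cmult) (use G(2) t in blast)
   then show ?thesis by (rule DERIV_cong) (simp add: hpl_form_def of_rat_add mult_ac)
  qed
  with l show ?thesis by blast
 qed
qed

lemma hpl_log_primitive:
 assumes "hpl_log n f" "x : {-1, 0, 1}"
 obtains g where "hpl_log (Suc n) g"
  "!!t. t : cut_dom ==> (g has_field_derivative f t * hpl_form x t) (at t)"
proof -
 have "EX g. hpl_log (Suc n) g & (ALL t:cut_dom. (g has_field_derivative f t * hpl_form x t) (at t))"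
  using assms(1)
 proof (induction rule: hpl_log.induct)
  case (gen b kp w j)
  obtain g where g: "hpl_log (Suc (j + length w)) g"
   "!!t. t : cut_dom ==> (g has_field_derivative Ln t ^ j * hpl w t * hpl_form x t) (at t)"
   using hpl_log_primitive_word[OF gen(2) assms(2), of j] by blast
  have "hpl_log (Suc (b + j + length w)) (%t. kp * g t)"
   using hpl_log_const_mult[OF gen(1) g(1)] by (simp add: add_ac)
  moreover have "((%t. kp * g t) has_field_derivative kp * Ln t ^ j * hpl w t * hpl_form x t) (at t)"
   if "t : cut_dom" for t
   using DERIV_cmult[OF g(2)[OF that], of kp] by (simp add: mult.assoc)
  ultimately show ?case by blast
 next
  case (zero n)
  show ?case by (intro exI[of _ "%_. 0"]) (auto intro: hpl_log.zero)
 next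
  case (add n f g)
  then obtain F G where *: "hpl_log (Suc n) F" "hpl_log (Suc n) G"
   "!!t. t : cut_dom ==> (F has_field_derivative f t * hpl_form x t) (at t)"
   "!!t. t : cut_dom ==> (G has_field_derivative g t * hpl_form x t) (at t)" by blast
  have "((%t. F t + G t) has_field_derivative (f t + g t) * hpl_form x t) (at t)" if "t : cut_dom" for t
   unfolding distrib_right by (intro DERIV_add * that)
  then show ?case using hpl_log.add[OF *(1,2)] by blast
 next
  case (cong n f g)
  then show ?case by auto
 qed
 then show ?thesis using that by blast
qed

lemma Ln_close1_bound: assumes "close1 t" shows "cmod (Ln t) <= 2 * cmod (1 - t)"
 using norm_Ln_le[of "t - 1"] assms by (simp add: close1_def norm_minus_commute)

text \<open>\<open>Ln t\<close> vanishes at 1 to first order, so a positive power of it makes every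
  limiting coefficient 0; the constants survive only for \<open>j = 0\<close>.\<close>

lemma log_expansion_Ln_mult:
 assumes f: "log_expansion (%m. hpl_values m \<inter> cyclotomic_mzv_space m 2) n f" and c: "hpl_const b c"
 shows "log_expansion (%m. {v. hpl_const m v}) (b + j + n) (%t. c * Ln t ^ j * f t)"
proof -
 obtain g kp C where k: "!!i. i <= n ==> kp i : hpl_values (n - i)"
  and g: "!!i t. i <= n ==> close1 t ==> cmod (g i t - kp i) <= C * cmod (1 - t) powr (1/4)"
  and fe: "!!t. close1 t ==> f t = (SUM i<=n. hpl [1] t ^ i * g i t)"
  using f unfolding log_expansion_def by blast
 define g' where "g' i t = (if i <= n then c * Ln t ^ j * g i t else 0)" for i t
 define kp' where "kp' i = (if i <= n & j = 0 then c * kp i else 0)" for i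
 define B where "B = (SUM i<=n. cmod (kp i)) + \<bar>C\<bar>"
 have "hpl_const (b + j + n - i) (kp' i)" for i
 proof (cases "i <= n & j = 0")
  case True
  have "hpl_const (b + (n - i)) (c * kp i)"
   using True by (intro hpl_const_mult c hpl_const_value k) auto
  then show ?thesis using True by (simp add: kp'_def)
 next
  case False
  then show ?thesis unfolding kp'_def by (simp only: if_False hpl_const_0)
 qed
 moreover have "cmod (g' i t - kp' i) <= (cmod c * 2 ^ j * B) * cmod (1 - t) powr (1/4)" if t: "close1 t" for i t
 proof -
  define d where "d = cmod (1 - t)"
  have d: "0 < d" "d < 1/2" using t by (auto simp: d_def close1_def near1_def)
  have B: "B >= 0" "\<bar>C\<bar> <= B" "!!i. i <= n ==> cmod (kp i) + \<bar>C\<bar> <= B"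
   by (auto simp: B_def sum_nonneg intro!: member_le_sum)
  show ?thesis
  proof (cases "i <= n")
   case False
   then show ?thesis using B by (simp add: g'_def kp'_def)
  next
   case True
   have gi: "cmod (g i t - kp i) <= \<bar>C\<bar> * d powr (1/4)"
    using g[OF True t] mult_right_mono[OF abs_ge_self[of C], of "d powr (1/4)"] by (simp add: d_def)
   show ?thesis
   proof (cases "j = 0")
    case True
    have "cmod c * cmod (g i t - kp i) <= cmod c * (B * d powr (1/4))"
     using gi B mult_right_mono[of "\<bar>C\<bar>" B "d powr (1/4)"] by (intro mult_left_mono) auto
    then show ?thesis using True \<open>i <= n\<close>
     by (simp add: g'_def kp'_def d_def norm_mult mult.assoc flip: right_diff_distrib)
   next
    case False
    then obtain j' where j': "j = Suc j'" by (cases j) auto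
    have "cmod (g i t) <= cmod (kp i) + cmod (g i t - kp i)"
     using norm_triangle_ineq[of "kp i" "g i t - kp i"] by simp
    also have "... <= cmod (kp i) + \<bar>C\<bar> * 1"
     using gi d powr_le1[of "1/4" d] mult_left_mono[of "d powr (1/4)" 1 "\<bar>C\<bar>"] by (auto intro: order_trans)
    finally have gB: "cmod (g i t) <= B" using B(3)[OF True] by simp
    have "cmod (Ln t) ^ j <= (2 * d) ^ j"
     using Ln_close1_bound[OF t] by (intro power_mono) (auto simp: d_def)
    also have "... = 2 ^ j * (d * d ^ j')" by (simp add: j' power_mult_distrib)
    also have "... <= 2 ^ j * (d * 1)"
     using d by (intro mult_left_mono power_le_one) auto
    also have "... <= 2 ^ j * d powr (1/4)"
     using d powr_mono'[of "1/4" 1 d] by (intro mult_left_mono) auto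
    finally have "cmod (Ln t) ^ j <= 2 ^ j * d powr (1/4)" .
    then have "cmod c * (cmod (Ln t) ^ j * cmod (g i t)) <= cmod c * ((2 ^ j * d powr (1/4)) * B)"
     using gB d by (intro mult_left_mono mult_mono) auto
    then show ?thesis using True False by (simp add: g'_def kp'_def norm_mult norm_power d_def mult_ac)
   qed
  qed
 qed
 moreover have "c * Ln t ^ j * f t = (SUM i<=b + j + n. hpl [1] t ^ i * g' i t)" if "close1 t" for t
 proof -
  have "(SUM i<=b + j + n. hpl [1] t ^ i * g' i t) = (SUM i<=n. hpl [1] t ^ i * g' i t)"
   by (rule sum.mono_neutral_right) (auto simp: g'_def)
  also have "... = c * Ln t ^ j * (SUM i<=n. hpl [1] t ^ i * g i t)"
   unfolding sum_distrib_left by (intro sum.cong) (auto simp: g'_def mult_ac)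
  finally show ?thesis using fe[OF that] by simp
 qed
 ultimately show ?thesis unfolding log_expansion_def
  by (intro exI[of _ g'] exI[of _ kp'] exI[of _ "cmod c * 2 ^ j * B"]) auto
qed

lemma close1_cut_dom: assumes "close1 t" shows "t : cut_dom"
 using near1_D(2,4)[OF close1_near1[OF assms]] by (auto simp: cut_dom_def complex_nonpos_Reals_iff)

lemma hpl_log_log_expansion: "hpl_log n f ==> log_expansion (%m. {v. hpl_const m v}) n f"
proof (induction rule: hpl_log.induct)
 case (gen b kp w j)
 show ?case by (rule log_expansion_Ln_mult[OF hpl_reg_log_expansion[OF hpl_reg_hpl[OF gen(2)]] gen(1)])
next
 case (zero n)
 show ?case by (rule log_expansion_zero) (simp add: hpl_const_0)
next
 case (add n f g)
 show ?case by (rule log_expansion_add[OF _ add.IH]) (auto intro: hpl_const.add)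
next
 case (cong n f g)
 show ?case by (rule log_expansion_cong[OF cong.IH]) (use cong close1_cut_dom in auto)
qed

lemma hpl_log_limit_1:
 assumes "hpl_log n f" "((%x. f (of_real x)) ---> v) (at_left 1)"
 shows "hpl_const n v"
 using log_expansion_limit[OF hpl_log_log_expansion[OF assms(1)] _ eventually_near1_real tendsto_of_real_1 assms(2)]
 by simp

section \<open>Limits at both ends of the arc and at the origin\<close>

lemma eventually_arc: "eventually (%ph. 0 < ph & ph < pi) (at_right (0::real))"
 by (rule eventually_at_rightI[of 0 pi]) auto

lemma cis_in_cut_dom: "0 < ph ==> ph < pi ==> cis ph : cut_dom"
 using sin_gt_zero[of ph] by (auto simp: cut_dom_def hpl_dom_def complex_nonpos_Reals_iff)

lemma Ln_cis: "0 < ph ==> ph < pi ==> Ln (cis ph) = \<i> * of_real ph"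
 by (simp add: cis_conv_exp)

lemma hpl_log_arc_limit_0:
 assumes "hpl_log n f" "((%ph. f (cis ph)) ---> v) (at_right 0)"
 shows "hpl_const n v"
proof -
 have l: "(cis ---> cis 0) (at_right 0)"
  by (intro tendsto_cis tendsto_ident_at)
 then have "((%ph. cmod (1 - cis ph)) ---> cmod (1 - cis 0)) (at_right 0)" by (intro tendsto_intros)
 then have "eventually (%ph. cmod (1 - cis ph) < 1) (at_right 0)" by (rule order_tendstoD) simp
 with eventually_arc have "eventually (%ph. near1 (cis ph)) (at_right 0)"
 proof eventually_elim
  case (elim ph)
  have "1 \<notin> cut_dom" by (simp add: cut_dom_def hpl_dom_def)
  then have "cis ph ~= 1" using cis_in_cut_dom[of ph] elim by auto
  then show ?case using elim by (simp add: near1_def)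
 qed
 from log_expansion_limit[OF hpl_log_log_expansion[OF assms(1)] _ this _ assms(2)] l show ?thesis
  by simp
qed

text \<open>Since the conjugate of \<open>cis (pi - ph)\<close> is \<open>- cis ph\<close>,
  conjugation followed by negation carries the end -1 of the arc to the end 1. It negates the
  letters of a word and replaces the logarithm by \<open>Ln t - i pi\<close>, which stays in the
  class.\<close>

lemma hpl_log_reflection:
 "hpl_log n f ==> EX h. hpl_log n h & (ALL ph. 0 < ph --> ph < pi --> h (cis ph) = cnj (f (cis (pi - ph))))"
proof (induction rule: hpl_log.induct)
 case (gen b kp w j)
 have mw: "hpl_word (map uminus w)" using gen(2) by (auto simp: hpl_word_def last_map)
 have "hpl_log 1 (%t. Ln t - \<i> * of_real pi)"
  by (intro hpl_log_diff hpl_log_Ln hpl_log_const hpl_const_i_pi)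
 then have "hpl_log j (%t. (Ln t - \<i> * of_real pi) ^ j)" by (rule hpl_log_power)
 moreover have "hpl_log (length w) (hpl (map uminus w))"
  using hpl_log_hpls[OF hpl_span_hpl[OF mw, of "%_. True"]] by simp
 ultimately have "hpl_log (j + length w) (%t. (Ln t - \<i> * of_real pi) ^ j * hpl (map uminus w) t)"
  by (rule hpl_log_mult[rotated])
 from hpl_log_const_mult[OF hpl_const_cnj[OF gen(1)] this]
 have h: "hpl_log (b + j + length w) (%t. cnj kp * ((Ln t - \<i> * of_real pi) ^ j * hpl (map uminus w) t))"
  by (simp only: add.assoc)
 have "cnj kp * ((Ln (cis ph) - \<i> * of_real pi) ^ j * hpl (map uminus w) (cis ph)) =
   cnj (kp * Ln (cis (pi - ph)) ^ j * hpl w (cis (pi - ph)))" if p: "0 < ph" "ph < pi" for ph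
 proof -
  have d: "cis ph : hpl_dom" "cis (- ph) : hpl_dom"
   using sin_gt_zero[OF p] by (auto simp: hpl_dom_def)
  have e: "cis (pi - ph) = - cis (- ph)" by (auto simp: complex_eq_iff)
  have "hpl w (cis (pi - ph)) = hpl (map uminus w) (cis (- ph))"
   unfolding e by (rule hpl_uminus[OF gen(2) d(2)])
  then have 1: "cnj (hpl w (cis (pi - ph))) = hpl (map uminus w) (cis ph)"
   using hpl_cnj[OF mw d(1)] by (simp add: cis_cnj)
  have "Ln (cis (pi - ph)) = \<i> * of_real (pi - ph)" using Ln_cis[of "pi - ph"] p by simp
  then have 2: "cnj (Ln (cis (pi - ph))) = Ln (cis ph) - \<i> * of_real pi"
   unfolding Ln_cis[OF p] by (simp add: right_diff_distrib)
  show ?thesis by (simp add: 1 2)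
 qed
 with h show ?case by blast
next
 case (zero n)
 show ?case by (intro exI[of _ "%_. 0"]) (auto intro: hpl_log.zero)
next
 case (add n f g)
 then obtain F G where *: "hpl_log n F" "hpl_log n G"
  "ALL ph. 0 < ph --> ph < pi --> F (cis ph) = cnj (f (cis (pi - ph)))"
  "ALL ph. 0 < ph --> ph < pi --> G (cis ph) = cnj (g (cis (pi - ph)))" by blast
 show ?case using *(3,4) by (intro exI[of _ "%t. F t + G t"] conjI hpl_log.add[OF *(1,2)]) auto
next
 case (cong n f g)
 then obtain h where h: "hpl_log n h" "ALL ph. 0 < ph --> ph < pi --> h (cis ph) = cnj (f (cis (pi - ph)))" by blast
 have "ALL ph. 0 < ph --> ph < pi --> h (cis ph) = cnj (g (cis (pi - ph)))"
  using h(2) cong(2) cis_in_cut_dom by simp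
 with h(1) show ?case by blast
qed

lemma hpl_log_arc_limit_pi:
 assumes "hpl_log n f" "((%ph. f (cis ph)) ---> v) (at_left pi)"
 shows "hpl_const n v"
proof -
 obtain h where h: "hpl_log n h" "ALL ph. 0 < ph --> ph < pi --> h (cis ph) = cnj (f (cis (pi - ph)))"
  using hpl_log_reflection[OF assms(1)] by blast
 have "filterlim (%ph. pi - ph) (at_left pi) (at_right (0::real))"
 proof -
  have "((%ph. pi - ph) ---> pi - 0) (at_right (0::real))" by (intro tendsto_intros)
  moreover have "eventually (%ph. pi - ph < pi) (at_right (0::real))"
   using eventually_arc by eventually_elim simp
  ultimately show ?thesis by (auto simp: filterlim_at elim: eventually_mono)
 qed
 from filterlim_compose[OF assms(2) this]
 have "((%ph. cnj (f (cis (pi - ph)))) ---> cnj v) (at_right 0)" by (intro tendsto_cnj)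
 then have "((%ph. h (cis ph)) ---> cnj v) (at_right 0)"
  by (rule Lim_transform_eventually) (use eventually_arc h(2) in "auto elim!: eventually_mono")
 from hpl_const_cnj[OF hpl_log_arc_limit_0[OF h(1) this]] show ?thesis by simp
qed

text \<open>A nonempty word is of order \<open>x\<close> at the origin and so cancels every power of
  \<open>ln x\<close>. Only the empty word contributes, which leaves a polynomial in
  \<open>ln x\<close>.\<close>

lemma hpl_log_expansion_0:
 "hpl_log n f ==> EX kp. (ALL i<=n. hpl_const (n - i) (kp i)) &
  ((%x. f (of_real x) - (SUM i<=n. of_real (ln x) ^ i * kp i)) ---> 0) (at_right 0)"
proof (induction rule: hpl_log.induct)
 case (gen b kp w j)
 show ?case
 proof (cases "w = []")
  case True
  define k where "k i = (if i = j then kp else 0)" for i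
  have "hpl_const (b + j + length w - i) (k i)" for i
   using gen(1) True hpl_const_0 by (auto simp: k_def)
  moreover have e: "eventually (%x. 0 = kp * Ln (of_real x) ^ j * hpl w (of_real x) -
    (SUM i<=b + j + length w. of_real (ln x) ^ i * k i)) (at_right (0::real))"
   using eventually_at_right_less[of 0]
  proof eventually_elim
   case (elim x)
   have "(SUM i<=b + j + length w. of_real (ln x) ^ i * k i) = of_real (ln x) ^ j * kp"
    by (subst sum.remove[of _ j]) (auto simp: k_def intro!: sum.neutral)
   then show ?case using elim True by (simp add: Ln_of_real)
  qed
  ultimately show ?thesis
   using Lim_transform_eventually[OF tendsto_const e] by (intro exI[of _ k]) auto
 next
  case False
  obtain C where C: "C >= 0" "!!t. t : cball 0 1 - {1, -1} ==>
   cmod (hpl w t) <= C * (if w = [] then 1 else cmod t) * cmod (1 - t\<^sup>2) powr (-1)"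
   using hpl_growth[OF gen(2), of 1] by auto
  have lim: "((%x::real. (cmod kp * C * 2) * (x * \<bar>ln x\<bar> ^ j)) ---> (cmod kp * C * 2) * 0) (at_right 0)"
  proof (intro tendsto_mult tendsto_const)
   show "((%x::real. x * \<bar>ln x\<bar> ^ j) ---> 0) (at_right 0)" by real_asymp
  qed
  have "eventually (%x. x < 1/2) (at_right (0::real))"
   by (rule eventually_at_rightI[of 0 "1/2"]) auto
  with eventually_at_right_less[of 0]
  have "eventually (%x. norm (kp * Ln (of_real x) ^ j * hpl w (of_real x)) <= (cmod kp * C * 2) * (x * \<bar>ln x\<bar> ^ j)) (at_right (0::real))"
  proof eventually_elim
   case (elim x)
   have t: "complex_of_real x : cball 0 1 - {1, -1}"
    using elim by auto (metis Re_complex_of_real one_complex.simps(1) uminus_complex.simps(1) less_irrefl not_less_iff_gr_or_eq zero_less_one neg_less_0_iff_less less_trans)+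
   have x2: "x^2 <= 1/4" using elim power_mono[of x "1/2" 2] by (simp add: power2_eq_square)
   have n: "cmod (1 - (of_real x)\<^sup>2) = 1 - x\<^sup>2"
    using x2 norm_of_real[of "1 - x\<^sup>2", where 'a = complex] by simp
   have "cmod (hpl w (of_real x)) <= C * x * (1 / (1 - x\<^sup>2))"
    using C(2)[OF t] False elim n x2 by (simp add: powr_minus_divide)
   also have "... <= C * x * 2"
    using C elim x2 by (intro mult_left_mono) (auto simp: field_simps)
   finally have "cmod kp * \<bar>ln x\<bar> ^ j * cmod (hpl w (of_real x)) <= cmod kp * \<bar>ln x\<bar> ^ j * (C * x * 2)"
    by (intro mult_left_mono) auto
   then show ?case using elim by (simp add: norm_mult norm_power Ln_of_real mult_ac)
  qed
  from Lim_null_comparison[OF this] lim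
  have "((%x. kp * Ln (of_real x) ^ j * hpl w (of_real x)) ---> 0) (at_right 0)" by simp
  then show ?thesis by (intro exI[of _ "%_. 0"]) (auto simp: hpl_const_0)
 qed
next
 case (zero n)
 show ?case by (intro exI[of _ "%_. 0"]) (auto simp: hpl_const_0)
next
 case (add n f g)
 then obtain k1 k2 where k: "ALL i<=n. hpl_const (n - i) (k1 i)" "ALL i<=n. hpl_const (n - i) (k2 i)"
  and l: "((%x. f (of_real x) - (SUM i<=n. of_real (ln x) ^ i * k1 i)) ---> 0) (at_right 0)"
   "((%x. g (of_real x) - (SUM i<=n. of_real (ln x) ^ i * k2 i)) ---> 0) (at_right 0)" by blast
 have "((%x. f (of_real x) + g (of_real x) - (SUM i<=n. of_real (ln x) ^ i * (k1 i + k2 i))) ---> 0) (at_right 0)"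
  using tendsto_add[OF l] by (simp add: algebra_simps sum.distrib)
 moreover have "ALL i<=n. hpl_const (n - i) (k1 i + k2 i)" using k by (auto intro: hpl_const.add)
 ultimately show ?case by (intro exI[of _ "%i. k1 i + k2 i"]) blast
next
 case (cong n f g)
 then obtain k where k: "ALL i<=n. hpl_const (n - i) (k i)"
  "((%x. f (of_real x) - (SUM i<=n. of_real (ln x) ^ i * k i)) ---> 0) (at_right 0)" by blast
 have "eventually (%x. x < 1) (at_right (0::real))"
  by (rule eventually_at_rightI[of 0 1]) auto
 with eventually_at_right_less[of 0] have "eventually (%x. complex_of_real x : cut_dom) (at_right (0::real))"
  by eventually_elim (auto simp: cut_dom_def hpl_dom_def)
 then have "eventually (%x. f (of_real x) - (SUM i<=n. of_real (ln x) ^ i * k i)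
   = g (of_real x) - (SUM i<=n. of_real (ln x) ^ i * k i)) (at_right (0::real))"
  by eventually_elim (simp add: cong)
 from Lim_transform_eventually[OF k(2) this] k(1) show ?case by blast
qed

lemma hpl_log_limit_0:
 assumes "hpl_log n f" "((%x. f (of_real x)) ---> v) (at_right 0)"
 shows "hpl_const n v"
proof -
 obtain kp where k: "ALL i<=n. hpl_const (n - i) (kp i)"
  "((%x. f (of_real x) - (SUM i<=n. of_real (ln x) ^ i * kp i)) ---> 0) (at_right 0)"
  using hpl_log_expansion_0[OF assms(1)] by blast
 have "((%x. SUM i<=n. of_real (ln x) ^ i * kp i) ---> v) (at_right 0)"
  using tendsto_diff[OF assms(2) k(2)] by simp
 moreover have "filterlim (%x::real. complex_of_real (ln x)) at_infinity (at_right 0)"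
 proof (rule filterlim_norm_at_top_imp_at_infinity)
  show "filterlim (%x. norm (complex_of_real (ln x))) at_top (at_right 0)"
   unfolding norm_of_real by real_asymp
 qed
 ultimately have "v = kp 0" by (intro tendsto_polynomial_at_infinity) auto
 then show ?thesis using k(1) by auto
qed

lemma has_vector_derivative_along_arc:
 assumes "(f has_field_derivative D) (at (cis ph))"
 shows "((%ph. f (cis ph)) has_vector_derivative (\<i> * cis ph) * D) (at ph)"
proof -
 have "((%z. exp (\<i> * z)) has_field_derivative \<i> * exp (\<i> * of_real ph)) (at (of_real ph))"
  by (auto intro!: derivative_eq_intros)
 moreover have "(f has_field_derivative D) (at (exp (\<i> * of_real ph)))" using assms by (simp add: cis_conv_exp)
 ultimately have "((%z. f (exp (\<i> * z))) has_field_derivative D * (\<i> * exp (\<i> * of_real ph))) (at (of_real ph))"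
  by (rule DERIV_chain2[rotated])
 from has_vector_derivative_real_field[OF this] show ?thesis
  by (simp add: cis_conv_exp mult.commute)
qed

section \<open>The integrals along the arc\<close>

subsection \<open>Powers of logarithms\<close>

text \<open>The coefficient of \<open>p^n\<close> in \<open>x^p\<close>. Working with these
  coefficients turns averages of logarithm powers into generating series in \<open>p\<close>, and
  \<open>lpow_mult\<close> into the rule \<open>(x y)^p = x^p y^p\<close>.\<close>

definition lpow :: "nat => real => real" where
 "lpow n x = ln x ^ n / fact n"

lemma lpow_0 [simp]: "lpow 0 x = 1"
 by (simp add: lpow_def)

lemma lpow_eq_fps: "lpow n x = fps_nth (fps_exp (ln x)) n"
 by (simp add: lpow_def)

lemma lpow_mult: "x > 0 ==> y > 0 ==> lpow n (x * y) = (SUM i<=n. lpow i x * lpow (n - i) y)"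
 by (simp add: lpow_eq_fps ln_mult fps_exp_add_mult fps_mult_nth atMost_atLeast0 del: fps_exp_nth)

lemma power_le_fact_exp: "0 <= (y::real) ==> y ^ n / fact n <= exp y"
proof -
 assume y: "0 <= y"
 have s: "(%n. y ^ n / fact n) sums exp y" using exp_converges[of y] by (simp add: field_simps)
 have "(SUM i:{n}. y ^ i / fact i) <= (\<Sum>i. y ^ i / fact i)"
  by (rule sum_le_suminf) (use s y in "auto simp: sums_iff")
 then show ?thesis using s by (simp add: sums_iff)
qed

text \<open>One term of the exponential series at \<open>dl * abs (ln x)\<close> is at most its sum;
  the two powers cover the two signs of \<open>ln x\<close>.\<close>

lemma abs_lpow_le:
 assumes "x > 0" "dl > 0"
 shows "\<bar>lpow n x\<bar> <= (x powr dl + x powr (-dl)) / dl ^ n"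
proof -
 have "(dl * \<bar>ln x\<bar>) ^ n / fact n <= exp (dl * \<bar>ln x\<bar>)" using assms by (intro power_le_fact_exp) auto
 also have "... <= x powr dl + x powr (-dl)"
  using assms by (auto simp: powr_def abs_if mult.commute)
 finally show ?thesis using assms
  by (simp add: lpow_def abs_mult power_abs field_simps power_mult_distrib)
qed

lemma lpow_measurable [measurable]: "f : borel_measurable M ==> (%x. lpow n (f x)) : borel_measurable M"
 unfolding lpow_def by (intro borel_measurable_divide borel_measurable_power borel_measurable_ln borel_measurable_const)

lemma continuous_on_lpow: "continuous_on S f ==> (!!x. x : S ==> f x > 0) ==> continuous_on S (%x. lpow n (f x))"
 unfolding lpow_def by (intro continuous_intros) (auto simp: less_imp_neq[symmetric])

text \<open>The indefinite integral is continuous up to the endpoints and differs from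
  \<open>F\<close> by a constant inside. Existence of the two limits is therefore a conclusion drawn
  from integrability alone.\<close>

lemma improper_FTC:
 fixes f F :: "real => 'a::banach"
 assumes "a < b" "f integrable_on {a..b}" "!!x. a < x ==> x < b ==> (F has_vector_derivative f x) (at x)"
 obtains L R where "(F ---> L) (at_right a)" "(F ---> R) (at_left b)" "integral {a..b} f = R - L"
proof -
 define J where "J x = integral {a..x} f" for x
 define m where "m = (a + b) / 2"
 have m: "a < m" "m < b" using assms(1) by (auto simp: m_def)
 have J: "continuous_on {a..b} J" unfolding J_def by (rule indefinite_integral_continuous_1[OF assms(2)])
 have sub: "F y - F x = J y - J x" if "a < x" "x <= y" "y < b" for x y
 proof -
  have "(f has_integral (F y - F x)) {x..y}"
   by (rule fundamental_theorem_of_calculus) (use that assms(3) in "auto intro: has_vector_derivative_at_within")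
  moreover have "integral {a..x} f + integral {x..y} f = integral {a..y} f"
   using that by (intro Henstock_Kurzweil_Integration.integral_combine integrable_on_subinterval[OF assms(2)]) auto
  ultimately show ?thesis by (simp add: J_def integral_unique algebra_simps)
 qed
 have Feq: "F x = F m - J m + J x" if "a < x" "x < b" for x
  using sub[of x m] sub[of m x] that m by (cases "x <= m") (auto simp: algebra_simps)
 have "(J ---> J a) (at_right a)"
 proof -
  have "(J ---> J a) (at a within {a..b})" using J assms(1) by (auto simp: continuous_on_def)
  then show ?thesis using assms(1) by (simp add: at_within_Icc_at_right)
 qed
 then have "((%x. F m - J m + J x) ---> F m - J m + J a) (at_right a)" by (intro tendsto_intros)
 moreover have "eventually (%x. F m - J m + J x = F x) (at_right a)"
  by (rule eventually_at_rightI[of a b]) (use Feq assms(1) in auto)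
 ultimately have 1: "(F ---> F m - J m + J a) (at_right a)" by (rule Lim_transform_eventually)
 have "(J ---> J b) (at_left b)"
 proof -
  have "(J ---> J b) (at b within {a..b})" using J assms(1) by (auto simp: continuous_on_def)
  then show ?thesis using assms(1) by (simp add: at_within_Icc_at_left)
 qed
 then have "((%x. F m - J m + J x) ---> F m - J m + J b) (at_left b)" by (intro tendsto_intros)
 moreover have "eventually (%x. F m - J m + J x = F x) (at_left b)"
  by (rule eventually_at_leftI[of a b]) (use Feq assms(1) in auto)
 ultimately have 2: "(F ---> F m - J m + J b) (at_left b)" by (rule Lim_transform_eventually)
 have "integral {a..b} f = (F m - J m + J b) - (F m - J m + J a)" by (simp add: J_def)
 with 1 2 show ?thesis using that by blast
qed

lemma integrable_lpow_one_minus_square: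
 fixes g :: "real => real"
 assumes "continuous_on {0..<1} g" "!!x. 0 <= x ==> x < 1 ==> \<bar>g x\<bar> <= B"
 shows "(%x. lpow j (1 - x\<^sup>2) * g x) absolutely_integrable_on {0..<1}"
proof -
 have i: "(%x::real. (1 - x) powr (-1/2)) integrable_on {0..<1}"
 proof -
  have "((%x::real. (1 - x) powr (-1/2)) has_integral (- (2 * (1 - 1) powr (1/2)) - - (2 * (1 - 0) powr (1/2)))) {0..1}"
  proof (rule fundamental_theorem_of_calculus_interior)
   show "continuous_on {0..1::real} (%x. - (2 * (1 - x) powr (1/2)))"
    by (intro continuous_intros continuous_on_powr') auto
   fix x :: real assume "x : {0<..<1}"
   then show "((%x. - (2 * (1 - x) powr (1/2))) has_vector_derivative (1 - x) powr (-1/2)) (at x)"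
    unfolding has_real_derivative_iff_has_vector_derivative[symmetric]
    by (auto intro!: derivative_eq_intros simp: field_simps powr_diff powr_minus)
  qed simp
  then have "(%x::real. (1 - x) powr (-1/2)) integrable_on {0..1}" by blast
  then show ?thesis
   by (rule integrable_spike_set) (auto intro: negligible_subset[of "{1}"])
 qed
 have c: "continuous_on {0..<1} (%x. lpow j (1 - x\<^sup>2) * g x)"
 proof (intro continuous_on_mult continuous_on_lpow assms)
  show "1 - x\<^sup>2 > 0" if "x : {0..<1}" for x :: real
   using that abs_square_less_1[of x] by auto
 qed (auto intro!: continuous_intros)
 show ?thesis
 proof (rule measurable_bounded_by_integrable_imp_absolutely_integrable[where g = "%x. (2 * 2 ^ j * B) * (1 - x) powr (-1/2)"])
  show "(%x. lpow j (1 - x\<^sup>2) * g x) : borel_measurable (lebesgue_on {0..<1})"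
   by (intro continuous_imp_measurable_on_sets_lebesgue c) auto
  show "(%x. (2 * 2 ^ j * B) * (1 - x) powr (-1/2)) integrable_on {0..<1}"
   using integrable_on_mult_right[OF i] by simp
  fix x :: real assume x: "x : {0..<1}"
  have x2: "0 < 1 - x" "1 - x <= 1 - x\<^sup>2" "1 - x\<^sup>2 <= 1" using x by (auto simp: power2_eq_square mult_left_le)
  have "\<bar>lpow j (1 - x\<^sup>2)\<bar> <= ((1 - x\<^sup>2) powr (1/2) + (1 - x\<^sup>2) powr (-(1/2))) / (1/2) ^ j"
   using x2 by (intro abs_lpow_le) auto
  also have "... <= ((1 - x) powr (-1/2) + (1 - x) powr (-1/2)) / (1/2) ^ j"
  proof (intro divide_right_mono add_mono)
   have "(1 - x\<^sup>2) powr (1/2) <= 1" using x2 by (intro powr_le1) auto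
   also have "1 <= (1 - x) powr (-1/2)" using x2 x powr_mono2'[of "-1/2" "1 - x" 1] by auto
   finally show "(1 - x\<^sup>2) powr (1/2) <= (1 - x) powr (-1/2)" .
   show "(1 - x\<^sup>2) powr (-(1/2)) <= (1 - x) powr (-1/2)"
    using x2 powr_mono2'[of "-1/2" "1 - x" "1 - x\<^sup>2"] by auto
  qed auto
  finally have l: "\<bar>lpow j (1 - x\<^sup>2)\<bar> <= 2 * 2 ^ j * (1 - x) powr (-1/2)" by (simp add: power_divide mult_ac)
  have "\<bar>g x\<bar> <= B" using assms(2) x by auto
  then have "\<bar>lpow j (1 - x\<^sup>2)\<bar> * \<bar>g x\<bar> <= (2 * 2 ^ j * (1 - x) powr (-1/2)) * B"
   using l by (intro mult_mono) auto
  then show "norm (lpow j (1 - x\<^sup>2) * g x) <= (2 * 2 ^ j * B) * (1 - x) powr (-1/2)"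
   by (simp add: abs_mult mult_ac)
 qed auto
qed

subsection \<open>The moments of the logarithm\<close>

text \<open>The coefficient of \<open>p^j\<close> in the Beta integral of
  \<open>(1 - x^2)^p x^(2m)\<close> over the unit interval.\<close>

definition mu :: "nat => nat => real" where
 "mu j m = integral {0..<1} (%x. lpow j (1 - x\<^sup>2) * x ^ (2 * m))"

lemma mu_integrable: "(%x. lpow j (1 - x\<^sup>2) * x ^ (2 * m)) absolutely_integrable_on {0..<1}"
 by (rule integrable_lpow_one_minus_square[where B = 1]) (auto intro!: continuous_intros simp: power_le_one)

lemma mu_bound: "EX B>=0. ALL m. \<bar>mu j m\<bar> <= B"
proof -
 have "\<bar>mu j m\<bar> <= integral {0..<1} (%x. \<bar>lpow j (1 - x\<^sup>2) * 1\<bar>)" for m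
 proof -
  have "norm (mu j m) <= integral {0..<1} (%x. \<bar>lpow j (1 - x\<^sup>2) * 1\<bar>)"
   unfolding mu_def
  proof (rule integral_norm_bound_integral)
   show "(%x. lpow j (1 - x\<^sup>2) * x ^ (2 * m)) integrable_on {0..<1}"
    by (rule set_lebesgue_integral_eq_integral(1)[OF mu_integrable])
   have "(%x. lpow j (1 - x\<^sup>2) * 1) absolutely_integrable_on {0..<1}"
    by (rule integrable_lpow_one_minus_square[where B = 1]) auto
   from absolutely_integrable_norm[OF this]
   show "(%x. \<bar>lpow j (1 - x\<^sup>2) * 1\<bar>) integrable_on {0..<1}"
    using set_lebesgue_integral_eq_integral(1) by (simp add: o_def)
   fix x :: real assume "x : {0..<1}"
   then show "norm (lpow j (1 - x\<^sup>2) * x ^ (2 * m)) <= \<bar>lpow j (1 - x\<^sup>2) * 1\<bar>"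
    by (auto simp: abs_mult intro!: mult_left_le power_le_one)
  qed
  then show ?thesis by simp
 qed
 then show ?thesis by (intro exI[of _ "\<bar>integral {0..<1} (%x. \<bar>lpow j (1 - x\<^sup>2) * 1\<bar>)\<bar>"]) (auto intro: order_trans[OF _ abs_ge_self])
qed

lemma DERIV_lpow:
 assumes "(f has_real_derivative D) (at x)" "f x > 0"
 shows "((%x. lpow n (f x)) has_real_derivative (if n = 0 then 0 else lpow (n - 1) (f x)) * (D / f x)) (at x)"
proof (cases n)
 case (Suc m)
 have "((%x. ln (f x)) has_real_derivative D / f x) (at x)"
  using assms by (auto intro!: derivative_eq_intros simp: divide_inverse)
 from DERIV_cdivide[OF DERIV_power[OF this, of "Suc m"], of "fact (Suc m)"] show ?thesis
  unfolding lpow_def Suc by (rule DERIV_cong) (simp add: field_simps del: of_nat_Suc)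
qed (simp add: lpow_def)

text \<open>Order \<open>j\<close> in \<open>p\<close> of
  \<open>(2m + 3 + 2p) M (m + 1) = (2m + 1) M m\<close>, where \<open>M m\<close> is the full Beta
  integral. It comes from integrating the derivative of \<open>(1 - x^2)^(p+1) x^(2m+1)\<close>,
  whose boundary values vanish.\<close>

lemma mu_recurrence:
 "(2 * real m + 3) * mu j (Suc m) + 2 * (if j = 0 then 0 else mu (j - 1) (Suc m)) = (2 * real m + 1) * mu j m"
proof -
 define F where "F x = (1 - x\<^sup>2) * lpow j (1 - x\<^sup>2) * x ^ (2 * m + 1)" for x :: real
 define f where "f x = (2 * real m + 1) * (lpow j (1 - x\<^sup>2) * x ^ (2 * m))
  - ((2 * real m + 3) * (lpow j (1 - x\<^sup>2) * x ^ (2 * Suc m))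
    + 2 * (if j = 0 then 0 else lpow (j - 1) (1 - x\<^sup>2) * x ^ (2 * Suc m)))" for x :: real
 have hi: "((%x. lpow j (1 - x\<^sup>2) * x ^ (2 * m)) has_integral mu j m) {0..<1}" for j m
  unfolding mu_def by (rule integrable_integral[OF set_lebesgue_integral_eq_integral(1)[OF mu_integrable]])
 have "((%x. if j = 0 then 0 else lpow (j - 1) (1 - x\<^sup>2) * x ^ (2 * Suc m)) has_integral
  (if j = 0 then 0 else mu (j - 1) (Suc m))) {0..<1}"
  using hi[of "j - 1" "Suc m"] by (cases "j = 0") (simp_all del: mult_Suc_right power_Suc)
 then have fh: "(f has_integral ((2 * real m + 1) * mu j m
  - ((2 * real m + 3) * mu j (Suc m) + 2 * (if j = 0 then 0 else mu (j - 1) (Suc m))))) {0..<1}"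
  unfolding f_def by (intro has_integral_diff has_integral_add has_integral_mult_right hi)
 then have fi: "f integrable_on {0..<1}" by blast
 have fI: "integral {0..<1} f = (2 * real m + 1) * mu j m
  - ((2 * real m + 3) * mu j (Suc m) + 2 * (if j = 0 then 0 else mu (j - 1) (Suc m)))"
  using fh by (rule integral_unique)
 have f1: "f integrable_on {0..1}"
  by (rule integrable_spike_set[OF fi]) (auto intro: negligible_subset[of "{1}"])
 have f1I: "integral {0..1} f = integral {0..<1} f"
  by (rule integral_spike_set) (auto intro: negligible_subset[of "{1}"])
 have pos: "1 - x\<^sup>2 > 0" if "0 < x" "x < 1" for x :: real using that abs_square_less_1[of x] by auto
 have der: "(F has_vector_derivative f x) (at x)" if x: "0 < x" "x < 1" for x
 proof -
  have d: "((%x. 1 - x\<^sup>2) has_real_derivative - (2 * x)) (at x)" by (auto intro!: derivative_eq_intros)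
  have "(F has_real_derivative
   ((1 - x\<^sup>2) * ((if j = 0 then 0 else lpow (j - 1) (1 - x\<^sup>2)) * (- (2 * x) / (1 - x\<^sup>2))) + - (2 * x) * lpow j (1 - x\<^sup>2)) * x ^ (2 * m + 1)
   + (real (2 * m + 1) * x ^ (2 * m)) * ((1 - x\<^sup>2) * lpow j (1 - x\<^sup>2))) (at x)"
   unfolding F_def using DERIV_mult[OF DERIV_mult'[OF d DERIV_lpow[OF d pos[OF x], of j]] DERIV_pow[of "2 * m + 1" x UNIV]]
   by simp
  moreover have "((1 - x\<^sup>2) * ((if j = 0 then 0 else lpow (j - 1) (1 - x\<^sup>2)) * (- (2 * x) / (1 - x\<^sup>2))) + - (2 * x) * lpow j (1 - x\<^sup>2)) * x ^ (2 * m + 1)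
   + (real (2 * m + 1) * x ^ (2 * m)) * ((1 - x\<^sup>2) * lpow j (1 - x\<^sup>2)) = f x"
   using pos[OF x] by (cases "j = 0") (simp_all add: f_def field_simps power2_eq_square)
  ultimately show ?thesis by (simp add: has_real_derivative_iff_has_vector_derivative)
 qed
 obtain L R where LR: "(F ---> L) (at_right 0)" "(F ---> R) (at_left 1)" "integral {0..1} f = R - L"
  using improper_FTC[OF zero_less_one f1 der] by blast
 have "(F ---> 0) (at_right 0)"
 proof -
  have "continuous_on {-1<..<1} F"
   unfolding F_def by (intro continuous_intros continuous_on_lpow) (auto simp: abs_square_less_1)
  then have "isCont F 0" by (rule continuous_on_interior) (simp add: interior_open)
  then have "(F ---> F 0) (at_right 0)" by (simp add: isCont_def filterlim_at_split)
  then show ?thesis by (simp add: F_def)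
 qed
 moreover have "(F ---> 0) (at_left 1)"
 proof -
  have "((%x. (1 - x\<^sup>2) * ((ln (1 - x\<^sup>2)) ^ j / fact j) * x ^ (2 * m + 1)) ---> 0) (at_left (1::real))"
  proof -
   have "((%y::real. y * (ln y ^ j / fact j)) ---> 0) (at_right 0)" by real_asymp
   moreover have "filterlim (%x::real. 1 - x\<^sup>2) (at_right 0) (at_left 1)" by real_asymp
   ultimately have "((%x::real. (1 - x\<^sup>2) * (ln (1 - x\<^sup>2) ^ j / fact j)) ---> 0) (at_left 1)"
    by (rule filterlim_compose)
   moreover have "((%x::real. x ^ (2 * m + 1)) ---> 1 ^ (2 * m + 1)) (at_left 1)" by (intro tendsto_intros)
   ultimately have "((%x. (1 - x\<^sup>2) * ((ln (1 - x\<^sup>2)) ^ j / fact j) * x ^ (2 * m + 1)) ---> 0 * 1 ^ (2 * m + 1)) (at_left (1::real))"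
    by (rule tendsto_mult)
   then show ?thesis by simp
  qed
  then show ?thesis by (simp add: F_def[abs_def] lpow_def)
 qed
 ultimately have "L = 0" "R = 0" using LR tendsto_unique[of "at_right (0::real)" F] tendsto_unique[of "at_left (1::real)" F] by auto
 then show ?thesis using LR(3) f1I fI by simp
qed

subsection \<open>A linear differential system\<close>

definition bco :: "nat => real" where
 "bco m = (-1) ^ m * ((-1/2) gchoose m)"

lemma bco_Suc: "bco (Suc m) * (real m + 1) = bco m * (real m + 1/2)"
proof -
 have e: "((-1/2) gchoose Suc m) * (real m + 1) = - (((-1/2) gchoose m) * (real m + 1/2))"
  using gbinomial_mult_1[of "-1/2 :: real" m] by (simp add: algebra_simps)
 have "bco (Suc m) * (real m + 1) = - ((-1) ^ m) * (((-1/2) gchoose Suc m) * (real m + 1))"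
  by (simp add: bco_def)
 also have "... = bco m * (real m + 1/2)" unfolding e by (simp add: bco_def)
 finally show ?thesis .
qed

lemma bco_bounds: "0 <= bco m & bco m <= 1"
proof (induction m)
 case (Suc m)
 have "bco (Suc m) = bco m * ((real m + 1/2) / (real m + 1))"
  using bco_Suc[of m] by (simp add: field_simps)
 moreover have r: "0 <= (real m + 1/2) / (real m + 1)" "(real m + 1/2) / (real m + 1) <= 1" by auto
 ultimately show ?case
  using Suc mult_le_one[of "bco m" "(real m + 1/2) / (real m + 1)"] mult_nonneg_nonneg[OF _ r(1), of "bco m"]
  by (simp only:)
qed (simp add: bco_def)

lemma bco_sums: "\<bar>x\<bar> < 1 ==> (%m. bco m * x ^ m) sums (1 - x) powr (-1/2)"
 using gen_binomial_real[of "-x" "-1/2"] by (simp add: bco_def power_minus[of x] mult_ac)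

text \<open>Taylor coefficients in \<open>k\<close> of order \<open>j\<close> in \<open>p\<close> of
  the integral of \<open>(1 - x^2)^p * 2k / sqrt (1 - k^2 x^2)\<close>, as
  \<open>Nser_integral\<close> confirms.\<close>

definition nco :: "nat => nat => real" where
 "nco j l = (if odd l then 2 * bco (l div 2) * mu j (l div 2) else 0)"

text \<open>With \<open>theta = k d/dk\<close> the companion series is
  \<open>P = (theta + 2p) N\<close>. It splits the second-order hypergeometric equation into a
  first-order system.\<close>

definition pco :: "nat => nat => real" where
 "pco j l = real l * nco j l + 2 * (if j = 0 then 0 else nco (j - 1) l)"

definition Nser :: "nat => real => real" where
 "Nser j k = (\<Sum>l. nco j l * k ^ l)"

definition Pser :: "nat => real => real" where
 "Pser j k = (\<Sum>l. pco j l * k ^ l)"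

text \<open>The hypergeometric equation \<open>(theta - 1) P = k^2 theta^2 N\<close>, read at the
  coefficient of \<open>k^(l+2)\<close>; it combines the recurrences of \<open>mu\<close> and
  \<open>bco\<close>.\<close>

lemma pco_recurrence: "(real l + 1) * pco j (Suc (Suc l)) = (real l)^2 * nco j l"
proof (cases "odd l")
 case True
 then obtain m where m: "l = 2 * m + 1" by (elim oddE)
 have "pco j (Suc (Suc l)) = 2 * bco (Suc m) * ((2 * real m + 3) * mu j (Suc m) + 2 * (if j = 0 then 0 else mu (j - 1) (Suc m)))"
  by (simp add: pco_def nco_def m algebra_simps)
 also have "... = 2 * bco (Suc m) * ((2 * real m + 1) * mu j m)" unfolding mu_recurrence ..
 finally have "(real l + 1) * pco j (Suc (Suc l)) = 4 * (bco (Suc m) * (real m + 1)) * ((2 * real m + 1) * mu j m)"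
  by (simp add: m algebra_simps)
 also have "... = (2 * real m + 1) ^ 2 * (2 * bco m * mu j m)" unfolding bco_Suc by (simp add: power2_eq_square algebra_simps)
 finally show ?thesis by (simp add: m nco_def algebra_simps)
qed (simp add: pco_def nco_def)

lemma summable_euler:
 fixes c :: "nat => real"
 assumes "!!x. \<bar>x\<bar> < 1 ==> summable (%l. c l * x ^ l)" "\<bar>k\<bar> < 1"
 shows "summable (%l. real l * c l * k ^ l)"
  and "k ~= 0 ==> ((%k. \<Sum>l. c l * k ^ l) has_real_derivative (\<Sum>l. real l * c l * k ^ l) / k) (at k)"
proof -
 have s: "summable (%n. diffs c n * k ^ n)"
  by (rule termdiff_converges[of k 1]) (use assms in auto)
 then have "(%n. k * (diffs c n * k ^ n)) sums (k * (\<Sum>n. diffs c n * k ^ n))"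
  by (intro sums_mult summable_sums)
 then have "(%n. real (Suc n) * c (Suc n) * k ^ Suc n) sums (k * (\<Sum>n. diffs c n * k ^ n))"
  by (simp add: diffs_def mult_ac)
 then have e: "(%l. real l * c l * k ^ l) sums (k * (\<Sum>n. diffs c n * k ^ n))"
  using sums_Suc_iff[of "%l. real l * c l * k ^ l"] by simp
 then show "summable (%l. real l * c l * k ^ l)" by (rule sums_summable)
 assume k: "k ~= 0"
 have "((%k. \<Sum>l. c l * k ^ l) has_real_derivative (\<Sum>n. diffs c n * k ^ n)) (at k)"
  by (rule termdiffs_strong'[of 1]) (use assms in auto)
 then show "((%k. \<Sum>l. c l * k ^ l) has_real_derivative (\<Sum>l. real l * c l * k ^ l) / k) (at k)"
  using e k by (simp add: sums_iff)
qed

lemma nco_summable: "\<bar>x\<bar> < 1 ==> summable (%l. nco j l * x ^ l)"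
proof -
 assume x: "\<bar>x\<bar> < 1"
 obtain B where B: "B >= 0" "!!m. \<bar>mu j m\<bar> <= B" using mu_bound[of j] by auto
 show ?thesis
 proof (rule summable_comparison_test'[of "%l. 2 * B * \<bar>x\<bar> ^ l" 0])
  show "summable (%l. 2 * B * \<bar>x\<bar> ^ l)" using x by (intro summable_mult summable_geometric) auto
  fix l :: nat
  have "2 * bco (l div 2) * \<bar>mu j (l div 2)\<bar> <= 2 * 1 * B"
   using B bco_bounds[of "l div 2"] by (intro mult_mono) auto
  then have "\<bar>nco j l\<bar> <= 2 * B"
   using B bco_bounds[of "l div 2"] by (auto simp: nco_def abs_mult)
  then show "norm (nco j l * x ^ l) <= 2 * B * \<bar>x\<bar> ^ l"
   by (auto simp: abs_mult power_abs intro: mult_right_mono)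
 qed
qed

lemma pco_summable: "\<bar>x\<bar> < 1 ==> summable (%l. pco j l * x ^ l)"
 and Pser_eq: "\<bar>x\<bar> < 1 ==> Pser j x = (\<Sum>l. real l * nco j l * x ^ l) + 2 * (if j = 0 then 0 else Nser (j - 1) x)"
proof -
 assume x: "\<bar>x\<bar> < 1"
 have 1: "(%l. real l * nco j l * x ^ l) sums (\<Sum>l. real l * nco j l * x ^ l)"
  by (intro summable_sums summable_euler(1) nco_summable x)
 have 2: "(%l. 2 * (if j = 0 then 0 else nco (j - 1) l * x ^ l)) sums (2 * (if j = 0 then 0 else Nser (j - 1) x))"
  unfolding Nser_def by (intro sums_mult) (auto intro!: summable_sums nco_summable x)
 have "(%l. pco j l * x ^ l) sums ((\<Sum>l. real l * nco j l * x ^ l) + 2 * (if j = 0 then 0 else Nser (j - 1) x))"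
  using sums_add[OF 1 2] by (cases "j = 0") (simp_all add: pco_def algebra_simps)
 then show "summable (%l. pco j l * x ^ l)"
  "Pser j x = (\<Sum>l. real l * nco j l * x ^ l) + 2 * (if j = 0 then 0 else Nser (j - 1) x)"
  by (auto simp: sums_iff Pser_def)
qed

lemma DERIV_Nser:
 assumes "0 < k" "k < 1"
 shows "(Nser j has_real_derivative (Pser j k - 2 * (if j = 0 then 0 else Nser (j - 1) k)) / k) (at k)"
 using summable_euler(2)[of "nco j" k, OF nco_summable] Pser_eq[of k j] assms
 by (simp add: Nser_def[abs_def])

text \<open>Put \<open>Q = theta^2 N\<close>. Then \<open>theta P = Q + 2p theta N\<close> and
  \<open>theta N = P - 2p N\<close>, and the recurrence gives \<open>theta P - P = k^2 Q\<close>.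
  Eliminating \<open>Q\<close> yields
  \<open>(1 - k^2) theta P = P - 2p k^2 P + 4p^2 k^2 N\<close>.\<close>

lemma DERIV_Pser:
 assumes "0 < k" "k < 1"
 shows "(Pser j has_real_derivative (Pser j k - 2 * k^2 * (if j = 0 then 0 else Pser (j - 1) k)
  + 4 * k^2 * (if j < 2 then 0 else Nser (j - 2) k)) / (k * (1 - k\<^sup>2))) (at k)"
proof -
 have k: "\<bar>k\<bar> < 1" using assms by auto
 define D where "D = (\<Sum>l. real l * pco j l * k ^ l)"
 define Q where "Q = (\<Sum>l. real l * (real l * nco j l) * k ^ l)"
 define Pm where "Pm = (if j = 0 then 0 else Pser (j - 1) k)"
 define Nm where "Nm = (if j < 2 then 0 else Nser (j - 2) k)"
 have s1: "summable (%l. real l * nco i l * x ^ l)" if "\<bar>x\<bar> < 1" for i x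
  by (intro summable_euler(1) nco_summable that)
 have D: "(%l. real l * pco j l * k ^ l) sums D"
  unfolding D_def by (intro summable_sums summable_euler(1) pco_summable k)
 have Q: "(%l. real l * (real l * nco j l) * k ^ l) sums Q"
  unfolding Q_def by (intro summable_sums summable_euler(1)[of "%l. real l * nco j l"] s1 k)
 have P: "(%l. pco j l * k ^ l) sums Pser j k"
  unfolding Pser_def by (intro summable_sums pco_summable k)
 define f where "f l = real l * pco j l * k ^ l - pco j l * k ^ l" for l
 have f01: "f 0 = 0" "f (Suc 0) = 0" by (simp_all add: f_def pco_def nco_def)
 have "f sums (D - Pser j k)" unfolding f_def by (rule sums_diff[OF D P])
 then have "(%l. f (Suc l)) sums (D - Pser j k)" by (simp add: sums_Suc_iff f01)
 then have "(%l. f (Suc (Suc l))) sums (D - Pser j k)"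
  by (simp add: sums_Suc_iff[of "%l. f (Suc l)"] f01)
 then have "(%l. real (Suc (Suc l)) * pco j (Suc (Suc l)) * k ^ Suc (Suc l) - pco j (Suc (Suc l)) * k ^ Suc (Suc l)) sums (D - Pser j k)"
  by (simp only: f_def)
 moreover have "(%l. real (Suc (Suc l)) * pco j (Suc (Suc l)) * k ^ Suc (Suc l) - pco j (Suc (Suc l)) * k ^ Suc (Suc l))
   = (%l. k\<^sup>2 * (real l * (real l * nco j l) * k ^ l))"
 proof
  fix l
  have "real (Suc (Suc l)) * pco j (Suc (Suc l)) * k ^ Suc (Suc l) - pco j (Suc (Suc l)) * k ^ Suc (Suc l)
   = ((real l + 1) * pco j (Suc (Suc l))) * (k^2 * k ^ l)"
   by (simp add: algebra_simps power2_eq_square)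
  also have "... = k^2 * (real l * (real l * nco j l) * k ^ l)"
   unfolding pco_recurrence by (simp add: power2_eq_square mult_ac)
  finally show "real (Suc (Suc l)) * pco j (Suc (Suc l)) * k ^ Suc (Suc l) - pco j (Suc (Suc l)) * k ^ Suc (Suc l)
   = k^2 * (real l * (real l * nco j l) * k ^ l)" .
 qed
 ultimately have DQ: "D - Pser j k = k^2 * Q"
  using sums_mult[OF Q, of "k^2"] sums_unique2 by metis
 have "D = Q + 2 * (Pm - 2 * Nm)"
 proof (cases "j = 0")
  case True
  then show ?thesis by (simp add: D_def Q_def Pm_def Nm_def pco_def)
 next
  case False
  have "(%l. real l * (real l * nco j l) * k ^ l + 2 * (real l * nco (j - 1) l * k ^ l)) sums
    (Q + 2 * (\<Sum>l. real l * nco (j - 1) l * k ^ l))"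
   by (intro sums_add sums_mult Q summable_sums s1 k)
  moreover have "(\<Sum>l. real l * nco (j - 1) l * k ^ l) = Pm - 2 * Nm"
   using Pser_eq[OF k, of "j - 1"] False by (auto simp: Pm_def Nm_def numeral_2_eq_2)
  moreover have "(%l. real l * (real l * nco j l) * k ^ l + 2 * (real l * nco (j - 1) l * k ^ l)) = (%l. real l * pco j l * k ^ l)"
   using False by (simp add: pco_def algebra_simps)
  ultimately have "(%l. real l * pco j l * k ^ l) sums (Q + 2 * (Pm - 2 * Nm))"
   by (simp only:)
  then show ?thesis using D sums_unique2 by blast
 qed
 then have "D - Pser j k = k^2 * (D - 2 * Pm + 4 * Nm)" using DQ by simp
 then have "(1 - k\<^sup>2) * D = Pser j k - 2 * k^2 * Pm + 4 * k^2 * Nm" by (simp add: algebra_simps)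
 moreover have "1 - k\<^sup>2 ~= 0" using abs_square_less_1[of k] k by simp
 ultimately have "D = (Pser j k - 2 * k^2 * Pm + 4 * k^2 * Nm) / (1 - k\<^sup>2)"
  by (metis nonzero_mult_div_cancel_left)
 then have "D / k = (Pser j k - 2 * k^2 * Pm + 4 * k^2 * Nm) / (k * (1 - k\<^sup>2))"
  by (simp add: mult.commute)
 moreover have "(Pser j has_real_derivative D / k) (at k)"
  using summable_euler(2)[of "pco j" k, OF pco_summable k] assms by (simp add: Pser_def[abs_def] D_def)
 ultimately show ?thesis by (simp add: Pm_def Nm_def)
qed

text \<open>The formal variable is the exponent \<open>p\<close>, while the derivative is taken
  coefficientwise in a real variable such as the modulus or the angle.\<close>

definition fps_DERIV :: "(real => real fps) => real fps => real => bool" where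
 "fps_DERIV F F' x \<longleftrightarrow> (ALL n. ((%x. fps_nth (F x) n) has_real_derivative fps_nth F' n) (at x))"

lemma fps_DERIV_mult:
 assumes "fps_DERIV F F' x" "fps_DERIV G G' x"
 shows "fps_DERIV (%x. F x * G x) (F' * G x + F x * G') x"
 unfolding fps_DERIV_def
proof
 fix n
 have "((%x. SUM i=0..n. fps_nth (F x) i * fps_nth (G x) (n - i)) has_real_derivative
   (SUM i=0..n. fps_nth (F x) i * fps_nth G' (n - i) + fps_nth F' i * fps_nth (G x) (n - i))) (at x)"
  using assms unfolding fps_DERIV_def by (intro DERIV_sum DERIV_mult') auto
 then show "((%x. fps_nth (F x * G x) n) has_real_derivative fps_nth (F' * G x + F x * G') n) (at x)"
  by (simp add: fps_mult_nth sum.distrib add.commute)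
qed

lemma fps_DERIV_exp:
 assumes "(u has_real_derivative u') (at x)"
 shows "fps_DERIV (%x. fps_exp (u x)) (fps_const u' * fps_X * fps_exp (u x)) x"
 unfolding fps_DERIV_def
proof
 fix n
 show "((%x. fps_nth (fps_exp (u x)) n) has_real_derivative fps_nth (fps_const u' * fps_X * fps_exp (u x)) n) (at x)"
 proof (cases n)
  case (Suc m)
  have "((%x. u x ^ n / fact n) has_real_derivative of_nat n * (u' * u x ^ (n - 1)) / fact n) (at x)"
   using DERIV_cdivide[OF DERIV_power[OF assms, of n], of "fact n"] by simp
  moreover have "of_nat n * (u' * u x ^ (n - 1)) / fact n = fps_nth (fps_const u' * fps_X * fps_exp (u x)) n"
   by (simp add: Suc mult.assoc fps_mult_left_const_nth field_simps del: of_nat_Suc)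
  ultimately show ?thesis by simp
 qed (simp add: mult.assoc)
qed

lemma fps_DERIV_const:
 "(g has_real_derivative g') (at x) ==> fps_DERIV (%x. fps_const (g x)) (fps_const g') x"
 unfolding fps_DERIV_def by auto

lemma fps_DERIV_chain:
 assumes "fps_DERIV F F' (g x)" "(g has_real_derivative g') (at x)"
 shows "fps_DERIV (%x. F (g x)) (fps_const g' * F') x"
 unfolding fps_DERIV_def
proof
 fix n
 have "((%x. fps_nth (F x) n) has_real_derivative fps_nth F' n) (at (g x))"
  using assms(1) by (simp add: fps_DERIV_def)
 from DERIV_chain2[OF this assms(2)]
 show "((%x. fps_nth (F (g x)) n) has_real_derivative fps_nth (fps_const g' * F') n) (at x)"
  by (simp add: fps_mult_left_const_nth mult.commute)
qed

definition Nfps :: "real => real fps" where "Nfps k = Abs_fps (%j. Nser j k)"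

definition Pfps :: "real => real fps" where "Pfps k = Abs_fps (%j. Pser j k)"

lemma fps_X2_nth: "fps_nth (fps_X^2 * F) n = (if n < 2 then 0 else fps_nth F (n - 2))"
 by (simp add: fps_X_power_mult_nth)

lemma fps_DERIV_Nfps:
 assumes "0 < k" "k < 1"
 shows "fps_DERIV Nfps (fps_const (1 / k) * (Pfps k - 2 * (fps_X * Nfps k))) k"
 unfolding fps_DERIV_def
proof
 fix n
 show "((%x. fps_nth (Nfps x) n) has_real_derivative fps_nth (fps_const (1 / k) * (Pfps k - 2 * (fps_X * Nfps k))) n) (at k)"
  using DERIV_Nser[OF assms, of n]
  by (cases "n = 0") (simp_all add: Nfps_def Pfps_def fps_mult_left_const_nth numeral_fps_const)
qed

lemma fps_DERIV_Pfps:
 assumes "0 < k" "k < 1"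
 shows "fps_DERIV Pfps (fps_const (1 / (k * (1 - k\<^sup>2))) * (Pfps k - fps_const (2 * k^2) * (fps_X * Pfps k)
  + fps_const (4 * k^2) * (fps_X^2 * Nfps k))) k"
 unfolding fps_DERIV_def
proof
 fix n
 show "((%x. fps_nth (Pfps x) n) has_real_derivative fps_nth (fps_const (1 / (k * (1 - k\<^sup>2))) *
  (Pfps k - fps_const (2 * k^2) * (fps_X * Pfps k) + fps_const (4 * k^2) * (fps_X^2 * Nfps k))) n) (at k)"
  using DERIV_Pser[OF assms, of n]
  by (simp only: fps_mult_left_const_nth fps_add_nth fps_sub_nth fps_X_mult_nth fps_X2_nth Pfps_def Nfps_def fps_nth_Abs_fps)
   (auto split: if_splits)
qed

section \<open>The generating series on the arc and their triangular system\<close>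

definition arc_fps :: "real => real fps" where
 "arc_fps ph = fps_exp (ln (4 * (sin (ph/2))^2)) * Nfps (sin (ph/2))"

text \<open>The prefactors are chosen to cancel the diagonal terms of the system for
  \<open>N\<close> and \<open>P\<close>, so that each of the two derivatives is a multiple of the
  other function.\<close>

definition dual_fps :: "real => real fps" where
 "dual_fps ph = fps_const (cos (ph/2) / (2 * sin (ph/2))) * (fps_exp (- ln (4 * (cos (ph/2))^2)) * Pfps (sin (ph/2)))"

lemma half_angle_bounds:
 assumes "0 < ph" "ph < pi"
 shows "0 < sin (ph/2)" "sin (ph/2) < 1" "0 < cos (ph/2)" "(cos (ph/2))^2 = 1 - (sin (ph/2))\<^sup>2"
proof -
 show s: "0 < sin (ph/2)" "0 < cos (ph/2)" using assms by (auto intro!: sin_gt_zero cos_gt_zero)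
 show c: "(cos (ph/2))^2 = 1 - (sin (ph/2))\<^sup>2" by (simp add: cos_squared_eq)
 have "0 < (cos (ph/2))^2" using s by simp
 then have "(sin (ph/2))^2 < 1" using c by simp
 then show "sin (ph/2) < 1" using s by (simp add: abs_square_less_1)
qed

lemma ln_4_sin_squared:
 assumes "0 < ph" "ph < pi"
 shows "ln (4 * (sin ph)^2) = ln (4 * (sin (ph/2))^2) + ln (4 * (cos (ph/2))^2)"
proof -
 have "4 * (sin ph)^2 = (4 * (sin (ph/2))^2) * (4 * (cos (ph/2))^2)"
  using sin_double[of "ph/2"] by (simp add: power_mult_distrib)
 moreover have "ln ((4 * (sin (ph/2))^2) * (4 * (cos (ph/2))^2)) = ln (4 * (sin (ph/2))^2) + ln (4 * (cos (ph/2))^2)"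
  by (rule ln_mult_pos) (use half_angle_bounds(1,3)[OF assms] in auto)
 ultimately show ?thesis by (simp only:)
qed

text \<open>Formally \<open>arc' = (4 sin^2 ph)^p dual\<close> and
  \<open>dual' = p^2 (4 sin^2 ph)^(-p) arc\<close>. The factor \<open>p^2\<close> makes the system
  triangular: order \<open>n\<close> of the dual series depends only on orders up to
  \<open>n - 2\<close> of the arc series, so every coefficient is obtained by one more
  integration.\<close>

lemma arc_fps_system:
 assumes "0 < ph" "ph < pi"
 shows "fps_DERIV arc_fps (fps_exp (ln (4 * (sin ph)^2)) * dual_fps ph) ph"
  and "fps_DERIV dual_fps (fps_X^2 * (fps_exp (- ln (4 * (sin ph)^2)) * arc_fps ph)) ph"
proof -
 define s c where "s = sin (ph/2)" and "c = cos (ph/2)"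
 have sc: "0 < s" "s < 1" "0 < c" "c^2 = 1 - s\<^sup>2" using half_angle_bounds[OF assms] by (auto simp: s_def c_def)
 define e1 e2 :: "real fps" where "e1 = fps_exp (ln (4 * s^2))" and "e2 = fps_exp (- ln (4 * c^2))"
 define X :: "real fps" where "X = fps_X"
 define N P where "N = Nfps s" and "P = Pfps s"
 have ds: "((%x. sin (x/2)) has_real_derivative c/2) (at ph)"
  by (auto intro!: derivative_eq_intros simp: c_def)
 have dc: "((%x. cos (x/2)) has_real_derivative - s/2) (at ph)"
  by (auto intro!: derivative_eq_intros simp: s_def)
 have "((%x. ln (4 * (sin (x/2))^2)) has_real_derivative c / s) (at ph)"
  using sc by (auto intro!: derivative_eq_intros simp: s_def c_def field_simps power2_eq_square)
 from fps_DERIV_exp[OF this] have E1: "fps_DERIV (%x. fps_exp (ln (4 * (sin (x/2))^2))) (fps_const (c/s) * X * e1) ph"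
  by (simp add: e1_def X_def s_def)
 have "((%x. - ln (4 * (cos (x/2))^2)) has_real_derivative s / c) (at ph)"
  using sc by (auto intro!: derivative_eq_intros simp: s_def c_def field_simps power2_eq_square)
 from fps_DERIV_exp[OF this] have E2: "fps_DERIV (%x. fps_exp (- ln (4 * (cos (x/2))^2))) (fps_const (s/c) * X * e2) ph"
  by (simp add: e2_def X_def c_def)
 have NN: "fps_DERIV (%x. Nfps (sin (x/2))) (fps_const (c/2) * (fps_const (1 / s) * (P - 2 * (X * N)))) ph"
  using fps_DERIV_chain[OF fps_DERIV_Nfps ds] sc by (simp add: s_def P_def N_def X_def)
 have PP: "fps_DERIV (%x. Pfps (sin (x/2))) (fps_const (c/2) * (fps_const (1 / (s * (1 - s\<^sup>2))) *
   (P - fps_const (2 * s^2) * (X * P) + fps_const (4 * s^2) * (X^2 * N)))) ph"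
  using fps_DERIV_chain[OF fps_DERIV_Pfps ds] sc by (simp add: s_def P_def N_def X_def)
 have sp: "sin ph = 2 * s * c" using sin_double[of "ph/2"] by (simp add: s_def c_def)
 define f1 f2 :: "real fps" where "f1 = fps_exp (- ln (4 * s^2))" and "f2 = fps_exp (ln (4 * c^2))"
 have 1: "fps_exp (ln (4 * (sin ph)^2)) = e1 * f2"
  using ln_4_sin_squared[OF assms] by (simp add: e1_def f2_def s_def c_def fps_exp_add_mult)
 have 2: "f2 * e2 = 1" unfolding f2_def e2_def fps_exp_add_mult[symmetric] by simp
 have "e1 * f2 * (fps_const (c / (2 * s)) * (e2 * P)) = fps_const (c / (2 * s)) * (e1 * ((f2 * e2) * P))"
  by (simp only: mult_ac)
 then have L: "fps_exp (ln (4 * (sin ph)^2)) * dual_fps ph = fps_const (c / (2 * s)) * (e1 * P)"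
  unfolding 1 2 dual_fps_def by (simp add: c_def s_def e2_def P_def)
 have "- ln (4 * (sin ph)^2) = - ln (4 * s^2) + - ln (4 * c^2)"
  using ln_4_sin_squared[OF assms] by (simp add: s_def c_def)
 then have 3: "fps_exp (- ln (4 * (sin ph)^2)) = f1 * e2"
  unfolding f1_def e2_def fps_exp_add_mult[symmetric] by simp
 have 4: "f1 * e1 = 1" unfolding f1_def e1_def fps_exp_add_mult[symmetric] by simp
 have "X^2 * (f1 * e2 * (e1 * N)) = X^2 * ((f1 * e1) * (e2 * N))"
  by (simp only: mult_ac)
 then have R: "fps_X^2 * (fps_exp (- ln (4 * (sin ph)^2)) * arc_fps ph) = X^2 * (e2 * N)"
  unfolding 3 4 arc_fps_def by (simp add: s_def e1_def N_def X_def)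
 have "fps_DERIV arc_fps (fps_const (c/s) * X * e1 * N + e1 * (fps_const (c/2) * (fps_const (1 / s) * (P - 2 * (X * N))))) ph"
  using fps_DERIV_mult[OF E1 NN] by (simp add: arc_fps_def[abs_def] N_def s_def e1_def)
 moreover have "fps_const (c/s) * X * e1 * N + e1 * (fps_const (c/2) * (fps_const (1 / s) * (P - 2 * (X * N))))
  = fps_const (c / (2 * s)) * (e1 * P)"
 proof -
  define a where "a = fps_const (c / (2 * s))"
  have 1: "fps_const (c/s) = 2 * a" by (simp add: a_def numeral_fps_const)
  have 2: "fps_const (c/2) * fps_const (1 / s) = a" by (simp add: a_def)
  have "fps_const (c/s) * X * e1 * N + e1 * (fps_const (c/2) * (fps_const (1 / s) * (P - 2 * (X * N))))
   = 2 * a * X * e1 * N + e1 * ((fps_const (c/2) * fps_const (1 / s)) * (P - 2 * (X * N)))"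
   unfolding 1 by (simp add: mult.assoc)
  also have "... = a * (e1 * P)" unfolding 2 by (simp add: algebra_simps)
  finally show ?thesis by (simp add: a_def)
 qed
 ultimately show "fps_DERIV arc_fps (fps_exp (ln (4 * (sin ph)^2)) * dual_fps ph) ph" unfolding L by simp
 have "((%x. cos (x/2) / (2 * sin (x/2))) has_real_derivative (- s/2 * (2 * s) - c * (2 * (c/2))) / ((2 * s) * (2 * s))) (at ph)"
  using DERIV_divide[OF dc DERIV_cmult[OF ds, of 2]] sc by (simp add: s_def c_def)
 moreover have "(- s/2 * (2 * s) - c * (2 * (c/2))) / ((2 * s) * (2 * s)) = - (1 / (4 * s^2))"
 proof -
  have "- s/2 * (2 * s) - c * (2 * (c/2)) = -1" using sc(4) by (simp add: power2_eq_square)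
  then show ?thesis by (simp add: power2_eq_square)
 qed
 ultimately have "fps_DERIV (%x. fps_const (cos (x/2) / (2 * sin (x/2)))) (fps_const (- (1 / (4 * s^2)))) ph"
  using fps_DERIV_const by metis
 from fps_DERIV_mult[OF this fps_DERIV_mult[OF E2 PP]]
 have "fps_DERIV dual_fps (fps_const (- (1 / (4 * s^2))) * (e2 * P) + fps_const (c / (2 * s)) *
  (fps_const (s/c) * X * e2 * P + e2 * (fps_const (c/2) * (fps_const (1 / (s * (1 - s\<^sup>2))) *
   (P - fps_const (2 * s^2) * (X * P) + fps_const (4 * s^2) * (X^2 * N)))))) ph"
  by (simp add: dual_fps_def[abs_def] e2_def P_def s_def[symmetric] c_def[symmetric])
 moreover have "fps_const (- (1 / (4 * s^2))) * (e2 * P) + fps_const (c / (2 * s)) *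
  (fps_const (s/c) * X * e2 * P + e2 * (fps_const (c/2) * (fps_const (1 / (s * (1 - s\<^sup>2))) *
   (P - fps_const (2 * s^2) * (X * P) + fps_const (4 * s^2) * (X^2 * N))))) = X^2 * (e2 * N)"
 proof -
  define a h where "a = fps_const (1 / (4 * s^2))" and "h = fps_const (1/2 :: real)"
  have 1: "fps_const (- (1 / (4 * s^2))) = - a" by (simp add: a_def)
  have 2: "fps_const (c / (2 * s)) * fps_const (s/c) = h" using sc by (simp add: h_def)
  have "c / (2 * s) * (c/2) * (1 / (s * (1 - s\<^sup>2))) = c^2 / (4 * s^2 * (1 - s\<^sup>2))"
   by (simp add: power2_eq_square)
  also have "... = 1 / (4 * s^2)" unfolding sc(4)[symmetric] using sc(3) by simp
  finally have 3: "fps_const (c / (2 * s)) * (fps_const (c/2) * fps_const (1 / (s * (1 - s\<^sup>2)))) = a"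
   by (simp add: a_def mult.assoc)
  have 4: "a * fps_const (2 * s^2) = h" "a * fps_const (4 * s^2) = 1" using sc by (auto simp: a_def h_def)
  have "fps_const (- (1 / (4 * s^2))) * (e2 * P) + fps_const (c / (2 * s)) *
  (fps_const (s/c) * X * e2 * P + e2 * (fps_const (c/2) * (fps_const (1 / (s * (1 - s\<^sup>2))) *
   (P - fps_const (2 * s^2) * (X * P) + fps_const (4 * s^2) * (X^2 * N)))))
   = - (a * (e2 * P)) + (fps_const (c / (2 * s)) * fps_const (s/c)) * (X * (e2 * P)) +
    (fps_const (c / (2 * s)) * (fps_const (c/2) * fps_const (1 / (s * (1 - s\<^sup>2))))) * (e2 *
     (P - fps_const (2 * s^2) * (X * P) + fps_const (4 * s^2) * (X^2 * N)))"
  proof -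
   have "- a * (e2 * P) + k1 * (k2 * X * e2 * P + e2 * (k3 * (k4 * T))) =
    - (a * (e2 * P)) + (k1 * k2) * (X * (e2 * P)) + (k1 * (k3 * k4)) * (e2 * T)" for k1 k2 k3 k4 T
    by (simp add: algebra_simps)
   then show ?thesis unfolding 1 .
  qed
  also have "... = - (a * (e2 * P)) + h * (X * (e2 * P)) + a * (e2 * P) - (a * fps_const (2 * s^2)) * (e2 * (X * P))
    + (a * fps_const (4 * s^2)) * (e2 * (X^2 * N))"
  proof -
   have "- (a * (e2 * P)) + h * (X * (e2 * P)) + a * (e2 * (P - k1 * (X * P) + k2 * (X^2 * N))) =
    - (a * (e2 * P)) + h * (X * (e2 * P)) + a * (e2 * P) - (a * k1) * (e2 * (X * P)) + (a * k2) * (e2 * (X^2 * N))" for k1 k2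
    by (simp add: algebra_simps)
   then show ?thesis unfolding 2 3 .
  qed
  also have "... = X^2 * (e2 * N)" unfolding 4 by (simp add: mult_ac)
  finally show ?thesis .
 qed
 ultimately show "fps_DERIV dual_fps (fps_X^2 * (fps_exp (- ln (4 * (sin ph)^2)) * arc_fps ph)) ph" unfolding R by simp
qed

lemma power_series_over_k_limit:
 fixes c :: "nat => real"
 assumes "!!x. \<bar>x\<bar> < 1 ==> summable (%l. c l * x ^ l)" "c 0 = 0"
 shows "((%k. (\<Sum>l. c l * k ^ l) / k) ---> c 1) (at_right 0)"
proof -
 have "((%k. \<Sum>l. c l * k ^ l) has_real_derivative (\<Sum>n. diffs c n * 0 ^ n)) (at 0)"
  by (rule termdiffs_strong'[of 1]) (use assms in auto)
 then have "((%k. ((\<Sum>l. c l * k ^ l) - (\<Sum>l. c l * 0 ^ l)) / (k - 0)) ---> (\<Sum>n. diffs c n * 0 ^ n)) (at 0)"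
  by (simp add: has_field_derivative_iff)
 then have "((%k. (\<Sum>l. c l * k ^ l) / k) ---> diffs c 0) (at 0)"
  using assms(2) by (simp add: powser_zero)
 then show ?thesis by (simp add: filterlim_at_split diffs_def)
qed

lemma filterlim_sin_half: "filterlim (%ph::real. sin (ph/2)) (at_right 0) (at_right 0)"
 by real_asymp

lemma arc_fps_limit: "((%ph. fps_nth (arc_fps ph) n) ---> 0) (at_right 0)"
proof -
 have N: "((%k. Nser j k / k) ---> nco j 1) (at_right 0)" for j
  unfolding Nser_def by (rule power_series_over_k_limit[OF nco_summable]) (auto simp: nco_def)
 have l: "((%k::real. k * (ln (4 * k^2) ^ i / fact i)) ---> 0) (at_right 0)" for i by real_asymp
 have "((%k. (k * (ln (4 * k^2) ^ i / fact i)) * (Nser j k / k)) ---> 0 * nco j 1) (at_right 0)" for i j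
  by (intro tendsto_mult l N)
 moreover have "eventually (%k. (k * (ln (4 * k^2) ^ i / fact i)) * (Nser j k / k) = ln (4 * k^2) ^ i / fact i * Nser j k) (at_right 0)" for i j
  using eventually_at_right_less[of 0] by eventually_elim simp
 ultimately have "((%k. ln (4 * k^2) ^ i / fact i * Nser j k) ---> 0) (at_right 0)" for i j
  using Lim_transform_eventually by fastforce
 then have "((%k. SUM i=0..n. ln (4 * k^2) ^ i / fact i * Nser (n - i) k) ---> (SUM i=0..n. 0)) (at_right 0)"
  by (intro tendsto_sum)
 from filterlim_compose[OF this filterlim_sin_half] show ?thesis
  by (simp add: arc_fps_def fps_mult_nth Nfps_def)
qed

text \<open>Coefficients of \<open>4^(-p) (1 + 2p)\<close> times the integral of
  \<open>(1 - x^2)^p\<close> over the unit interval, that is of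
  \<open>Gamma (1+p)^2 / Gamma (1+2p)\<close>. They are the initial values of the dual series at
  angle 0.\<close>

definition dual_init :: "nat => real" where
 "dual_init n = (SUM i=0..n. lpow i (1/4) * (mu (n - i) 0 + 2 * (if n - i = 0 then 0 else mu (n - i - 1) 0)))"

lemma dual_fps_limit: "((%ph. fps_nth (dual_fps ph) n) ---> dual_init n) (at_right 0)"
proof -
 have P: "((%k. Pser j k / k) ---> pco j 1) (at_right 0)" for j
  unfolding Pser_def by (rule power_series_over_k_limit[OF pco_summable]) (auto simp: nco_def pco_def)
 have "((%ph. cos (ph/2) / 2 * (SUM i=0..n. (- ln (4 * (cos (ph/2))^2)) ^ i / fact i * (Pser (n - i) (sin (ph/2)) / sin (ph/2))))
  ---> cos (0/2) / 2 * (SUM i=0..n. (- ln (4 * (cos (0/2))^2)) ^ i / fact i * pco (n - i) 1)) (at_right 0)"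
  by (intro tendsto_intros filterlim_compose[OF P filterlim_sin_half]) auto
 moreover have "cos (ph/2) / 2 * (SUM i=0..n. (- ln (4 * (cos (ph/2))^2)) ^ i / fact i * (Pser (n - i) (sin (ph/2)) / sin (ph/2)))
   = fps_nth (dual_fps ph) n" for ph
  unfolding dual_fps_def fps_mult_left_const_nth by (simp add: fps_mult_nth Pfps_def sum_distrib_left) (simp add: mult_ac)
 moreover have "cos (0/2) / 2 * (SUM i=0..n. (- ln (4 * (cos (0/2))^2)) ^ i / fact i * pco (n - i) 1) = dual_init n"
 proof -
  have "- ln 4 = ln (1/4 :: real)" by (simp add: ln_div)
  then show ?thesis
   unfolding dual_init_def sum_distrib_left
   by (intro sum.cong) (auto simp: lpow_def pco_def nco_def bco_def field_simps)
 qed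
 ultimately show ?thesis by simp
qed

lemma of_rat_fact: "complex_of_rat (fact j) = fact j"
 by (metis of_nat_fact of_rat_of_nat_eq)

lemma has_integral_up_to_finite:
 fixes f :: "real => 'a::banach"
 assumes "(f has_integral y) S" "finite A" "S - T <= A" "T - S <= A"
 shows "(f has_integral y) T"
proof -
 have "negligible {x : S - T. f x ~= 0}" "negligible {x : T - S. f x ~= 0}"
  by (rule negligible_subset[OF negligible_finite[OF assms(2)]]; use assms(3,4) in auto)+
 then show ?thesis using assms(1) has_integral_spike_set_eq by blast
qed

text \<open>The inverse square root is expanded in its binomial series. Its partial sums are
  positive and at most the full sum at \<open>x = 1\<close>, which gives the dominating constant
  \<open>B\<close>.\<close>

lemma Nser_integral:
 assumes k: "0 < k" "k < 1"
 shows "((%x. lpow j (1 - x\<^sup>2) * (2 * k / sqrt (1 - k\<^sup>2 * x^2))) has_integral Nser j k) {0..<1}"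
proof -
 define f where "f M x = (SUM m<M. (2 * bco m * k ^ (2 * m + 1)) * (lpow j (1 - x\<^sup>2) * x ^ (2 * m)))" for M x
 define B where "B = 2 * k * (1 - k\<^sup>2) powr (-1/2)"
 have k2: "\<bar>k\<^sup>2\<bar> < 1" using k by (simp add: abs_square_less_1)
 have hi: "((%x. lpow j (1 - x\<^sup>2) * x ^ (2 * m)) has_integral mu j m) {0..<1}" for m
  unfolding mu_def by (rule integrable_integral[OF set_lebesgue_integral_eq_integral(1)[OF mu_integrable]])
 have fM: "(f M has_integral (SUM m<M. (2 * bco m * k ^ (2 * m + 1)) * mu j m)) {0..<1}" for M
  unfolding f_def by (intro has_integral_sum has_integral_mult_right hi) auto
 have fx: "f M x = lpow j (1 - x\<^sup>2) * (2 * k * (SUM m<M. bco m * (k^2 * x^2) ^ m))" for M x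
  unfolding f_def sum_distrib_left
  unfolding power_add power_mult[of _ 2] power_one_right power_mult_distrib
  by (intro sum.cong refl) (simp only: mult_ac)
 have h: "(%x. B * \<bar>lpow j (1 - x\<^sup>2) * 1\<bar>) integrable_on {0..<1}"
 proof -
  have "(%x. lpow j (1 - x\<^sup>2) * 1) absolutely_integrable_on {0..<1}"
   by (rule integrable_lpow_one_minus_square[where B = 1]) auto
  from absolutely_integrable_norm[OF this]
  have "(%x. \<bar>lpow j (1 - x\<^sup>2) * 1\<bar>) integrable_on {0..<1}"
   using set_lebesgue_integral_eq_integral(1) by (simp add: o_def)
  then show ?thesis by (rule integrable_on_mult_right)
 qed
 have xk: "\<bar>k\<^sup>2 * x\<^sup>2\<bar> < 1" "k^2 * x^2 <= k^2" if "x : {0..<1}" for x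
 proof -
  have "x^2 <= 1" using that by (simp add: abs_square_le_1)
  then show "k^2 * x^2 <= k^2" by (simp add: mult_left_le)
  then show "\<bar>k\<^sup>2 * x\<^sup>2\<bar> < 1" using k2 by simp
 qed
 have bound: "norm (f M x) <= B * \<bar>lpow j (1 - x\<^sup>2) * 1\<bar>" if x: "x : {0..<1}" for M x
 proof -
  have "(SUM m<M. bco m * (k^2 * x^2) ^ m) <= (SUM m<M. bco m * (k^2) ^ m)"
   using bco_bounds xk[OF x] by (intro sum_mono mult_left_mono power_mono) auto
  also have "... <= (\<Sum>m. bco m * (k^2) ^ m)"
   using bco_sums[OF k2] bco_bounds by (intro sum_le_suminf) (auto simp: sums_iff)
  also have "... = (1 - k\<^sup>2) powr (-1/2)" using bco_sums[OF k2] by (simp add: sums_iff)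
  finally have "2 * k * (SUM m<M. bco m * (k^2 * x^2) ^ m) <= B"
   using k by (auto simp: B_def intro: mult_left_mono)
  moreover have "0 <= 2 * k * (SUM m<M. bco m * (k^2 * x^2) ^ m)"
   using k bco_bounds by (intro mult_nonneg_nonneg sum_nonneg) auto
  ultimately have "\<bar>lpow j (1 - x\<^sup>2)\<bar> * \<bar>2 * k * (SUM m<M. bco m * (k^2 * x^2) ^ m)\<bar> <= \<bar>lpow j (1 - x\<^sup>2)\<bar> * B"
   by (intro mult_left_mono) auto
  then show ?thesis unfolding fx by (simp add: abs_mult mult_ac)
 qed
 have conv: "(%M. f M x) \<longlonglongrightarrow> lpow j (1 - x\<^sup>2) * (2 * k / sqrt (1 - k\<^sup>2 * x^2))" if x: "x : {0..<1}" for x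
 proof -
  have "(%M. SUM m<M. bco m * (k^2 * x^2) ^ m) \<longlonglongrightarrow> (1 - k\<^sup>2 * x^2) powr (-1/2)"
   using bco_sums[OF xk(1)[OF x]] by (simp add: sums_def)
  moreover have "(1 - k\<^sup>2 * x^2) powr (-1/2) = 1 / sqrt (1 - k\<^sup>2 * x^2)"
   using xk[OF x] k2 by (simp add: powr_minus_divide powr_half_sqrt)
  ultimately have "(%M. lpow j (1 - x\<^sup>2) * (2 * k * (SUM m<M. bco m * (k^2 * x^2) ^ m))) \<longlonglongrightarrow>
    lpow j (1 - x\<^sup>2) * (2 * k * (1 / sqrt (1 - k\<^sup>2 * x^2)))"
   by (intro tendsto_intros) simp
  then show ?thesis unfolding fx by simp
 qed
 note dc = dominated_convergence[of f "{0..<1}", OF has_integral_integrable[OF fM] h bound conv]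
 have "(SUM m<M. (2 * bco m * k ^ (2 * m + 1)) * mu j m) = (SUM l<2 * M. nco j l * k ^ l)" for M
  by (induction M) (auto simp: nco_def)
 then have "integral {0..<1} (f M) = (SUM l<2 * M. nco j l * k ^ l)" for M
  using integral_unique[OF fM, of M] by (simp only:)
 moreover have "(%M. SUM l<2 * M. nco j l * k ^ l) \<longlonglongrightarrow> Nser j k"
 proof -
  have "(%M. SUM l<M. nco j l * k ^ l) \<longlonglongrightarrow> Nser j k"
   unfolding Nser_def using k by (intro summable_LIMSEQ nco_summable) auto
  then show ?thesis
   using LIMSEQ_subseq_LIMSEQ[of _ "Nser j k" "%M. 2 * M"] by (auto simp: o_def strict_mono_def)
 qed
 ultimately have "(%M. integral {0..<1} (f M)) \<longlonglongrightarrow> Nser j k"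
  by (simp only:)
 then have "integral {0..<1} (%x. lpow j (1 - x\<^sup>2) * (2 * k / sqrt (1 - k\<^sup>2 * x^2))) = Nser j k"
  using dc(2) LIMSEQ_unique by blast
 then show ?thesis using integrable_integral[OF dc(1)] by simp
qed

text \<open>The substitution \<open>sin (th/2) = sin (ph/2) * sg\<close>.\<close>

lemma arc_integral:
 assumes p: "0 < ph" "ph < pi"
 shows "(%th. lpow n (2 * cos th - 2 * cos ph)) absolutely_integrable_on {0<..<ph}"
  and "integral {0<..<ph} (%th. lpow n (2 * cos th - 2 * cos ph)) = fps_nth (arc_fps ph) n"
proof -
 define k where "k = sin (ph/2)"
 have k: "0 < k" "k < 1" using half_angle_bounds[OF p] by (auto simp: k_def)
 have ak: "arcsin k = ph/2" unfolding k_def using p by (intro arcsin_sin) auto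
 define g where "g x = 2 * arcsin (k * x)" for x
 define g' where "g' x = 2 * k / sqrt (1 - k\<^sup>2 * x^2)" for x
 have kx: "0 < k * x" "k * x < k" "k * x < 1" if "x : {0<..<1}" for x
 proof -
  show "0 < k * x" using that k by simp
  show "k * x < k" using that k mult_strict_left_mono[of x 1 k] by simp
  then show "k * x < 1" using k by linarith
 qed
 have kx2: "0 < 1 - k\<^sup>2 * x^2" if "x : {0..<1}" for x
 proof -
  have "x^2 <= 1" using that by (simp add: abs_square_le_1)
  then have "k^2 * x^2 <= k^2" by (simp add: mult_left_le)
  moreover have "k^2 < 1" using k by (simp add: abs_square_less_1)
  ultimately show ?thesis by linarith
 qed
 have der: "(g has_field_derivative g' x) (at x within {0<..<1})" if x: "x : {0<..<1}" for x
 proof -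
  have "(arcsin has_real_derivative inverse (sqrt (1 - (k * x)\<^sup>2))) (at (k * x))"
   using kx[OF x] by (intro DERIV_arcsin) auto
  moreover have "((%x. k * x) has_real_derivative k) (at x)" by (auto intro!: derivative_eq_intros)
  ultimately have "((%x. arcsin (k * x)) has_real_derivative inverse (sqrt (1 - (k * x)\<^sup>2)) * k) (at x)"
   by (rule DERIV_chain2)
  from DERIV_cmult[OF this, of 2] have "(g has_real_derivative g' x) (at x)"
   unfolding g_def g'_def by (rule DERIV_cong) (simp add: power_mult_distrib field_simps)
  then show ?thesis by (rule has_field_derivative_at_within)
 qed
 have sg: "sin (g x / 2) = k * x" if "x : {0<..<1}" for x
  using kx[OF that] by (simp add: g_def)
 have inj: "inj_on g {0<..<1}"
  by (rule inj_onI) (use sg k in "metis mult_cancel_left less_irrefl")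
 have img: "g ` {0<..<1} = {0<..<ph}"
 proof (intro set_eqI iffI)
  fix th assume "th : g ` {0<..<1}"
  then obtain x where x: "x : {0<..<1}" "th = g x" by auto
  have "arcsin (k * x) < arcsin k" using kx[OF x(1)] k by (intro arcsin_less_arcsin) auto
  moreover have "arcsin 0 < arcsin (k * x)" using kx[OF x(1)] by (intro arcsin_less_arcsin) auto
  ultimately show "th : {0<..<ph}" using x ak by (simp add: g_def)
 next
  fix th assume t: "th : {0<..<ph}"
  have "sin (th/2) < k" unfolding k_def using t p by (intro sin_monotone_2pi) auto
  moreover have "0 < sin (th/2)" using t p by (intro sin_gt_zero) auto
  ultimately have "sin (th/2) / k : {0<..<1}" using k by auto
  moreover have "g (sin (th/2) / k) = th" using k t p by (simp add: g_def arcsin_sin)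
  ultimately show "th : g ` {0<..<1}" by (metis image_eqI)
 qed
 define B where "B = 2 * k / sqrt (1 - k\<^sup>2)"
 have abs: "(%x. lpow j (1 - x\<^sup>2) * g' x) absolutely_integrable_on {0..<1}" for j
 proof (rule integrable_lpow_one_minus_square[where B = B])
  show "continuous_on {0..<1} g'" unfolding g'_def
   using kx2 by (intro continuous_intros) (auto simp: less_imp_neq[symmetric])
  fix x :: real assume x: "0 <= x" "x < 1"
  have "x^2 <= 1" using x by (simp add: abs_square_le_1)
  then have "k^2 * x^2 <= k^2" by (simp add: mult_left_le)
  moreover have "k^2 < 1" using k by (simp add: abs_square_less_1)
  ultimately show "\<bar>g' x\<bar> <= B" unfolding g'_def B_def using k kx2[of x] x
   by (auto simp: intro!: divide_left_mono mult_pos_pos)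
 qed
 have eq: "\<bar>g' x\<bar> * lpow n (2 * cos (g x) - 2 * cos ph) = (SUM i:{0..n}. lpow i (4 * k^2) * (lpow (n - i) (1 - x\<^sup>2) * g' x))"
  if x: "x : {0<..<1}" for x
 proof -
  have "cos (g x) = 1 - 2 * (k * x)^2" using cos_double_sin[of "g x / 2"] sg[OF x] by simp
  moreover have "cos ph = 1 - 2 * k^2" using cos_double_sin[of "ph/2"] by (simp add: k_def)
  ultimately have e: "2 * cos (g x) - 2 * cos ph = (4 * k^2) * (1 - x\<^sup>2)" by (simp add: power_mult_distrib algebra_simps)
  have "x^2 < 1" using x by (simp add: abs_square_less_1)
  then have "lpow n (2 * cos (g x) - 2 * cos ph) = (SUM i<=n. lpow i (4 * k^2) * lpow (n - i) (1 - x\<^sup>2))"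
   unfolding e using k by (intro lpow_mult) auto
  moreover have "g' x >= 0" using k kx2[of x] x by (simp add: g'_def)
  ultimately show ?thesis by (simp add: sum_distrib_left mult_ac atMost_atLeast0)
 qed
 have 1: "(%x. SUM i:{0..n}. lpow i (4 * k^2) * (lpow (n - i) (1 - x\<^sup>2) * g' x)) absolutely_integrable_on {0..<1}"
  by (intro absolutely_integrable_sum set_integrable_mult_right abs) auto
 have 2: "((%x. SUM i:{0..n}. lpow i (4 * k^2) * (lpow (n - i) (1 - x\<^sup>2) * g' x)) has_integral fps_nth (arc_fps ph) n) {0..<1}"
 proof -
  have "((%x. SUM i:{0..n}. lpow i (4 * k^2) * (lpow (n - i) (1 - x\<^sup>2) * g' x)) has_integral
    (SUM i:{0..n}. lpow i (4 * k^2) * Nser (n - i) k)) {0..<1}"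
   unfolding g'_def by (intro has_integral_sum has_integral_mult_right Nser_integral k) auto
  moreover have "(SUM i:{0..n}. lpow i (4 * k^2) * Nser (n - i) k) = fps_nth (arc_fps ph) n"
   by (simp add: arc_fps_def fps_mult_nth Nfps_def k_def lpow_def)
  ultimately show ?thesis by simp
 qed
 have "(%x. SUM i:{0..n}. lpow i (4 * k^2) * (lpow (n - i) (1 - x\<^sup>2) * g' x)) absolutely_integrable_on {0<..<1}"
  by (rule set_integrable_subset[OF 1]) auto
 then have 3: "(%x. \<bar>g' x\<bar> * lpow n (2 * cos (g x) - 2 * cos ph)) absolutely_integrable_on {0<..<1}"
  by (rule absolutely_integrable_spike[of _ _ "{}"]) (use eq in auto)
 have "((%x. SUM i:{0..n}. lpow i (4 * k^2) * (lpow (n - i) (1 - x\<^sup>2) * g' x)) has_integral fps_nth (arc_fps ph) n) {0<..<1}"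
  by (rule has_integral_up_to_finite[OF 2, of "{0}"]) auto
 then have 4: "integral {0<..<1} (%x. \<bar>g' x\<bar> * lpow n (2 * cos (g x) - 2 * cos ph)) = fps_nth (arc_fps ph) n"
  by (subst integral_cong[OF eq]) (auto simp: integral_unique)
 from has_absolute_integral_change_of_variables_1'[of "{0<..<1}" g g' "%th. lpow n (2 * cos th - 2 * cos ph)", OF _ der inj] 3 4
 show "(%th. lpow n (2 * cos th - 2 * cos ph)) absolutely_integrable_on {0<..<ph}"
  "integral {0<..<ph} (%th. lpow n (2 * cos th - 2 * cos ph)) = fps_nth (arc_fps ph) n"
  unfolding img by auto
qed

text \<open>The integrand mixes two weights. With \<open>x = (1 + sg) / 2\<close> and
  \<open>u = x (1 - x)\<close>, integration by parts writes \<open>(1 + 2p) u^p dsg\<close> as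
  \<open>d (sg u^p)\<close> plus \<open>p u^p\<close> times \<open>dx/x + dx/(1 - x)\<close>. The
  remaining form uses only the letters 0 and 1, and the boundary term is a pure power of the
  logarithm at each end.\<close>

lemma dual_init_const: "hpl_const n (of_real (dual_init n))"
proof (cases n)
 case 0
 have "((%x::real. 1 :: real) has_integral 1) {0..<1}"
  by (rule has_integral_up_to_finite[of _ _ "{0..1}" "{1}"]) (use has_integral_const_real[of "1 :: real" 0 1] in auto)
 then have "mu 0 0 = 1" by (simp add: mu_def integral_unique)
 then show ?thesis using 0 hpl_const_1 by (simp add: dual_init_def)
next
 case (Suc m)
 define u where "u sg = (1 - sg\<^sup>2) / 4" for sg :: real
 define f where "f sg = lpow n (u sg) + 2 * lpow m (u sg)" for sg
 have "((%x. SUM i:{0..n}. lpow i (1/4) * (lpow (n - i) (1 - x\<^sup>2) * x ^ (2 * 0) +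
   2 * (if n - i = 0 then 0 else lpow (n - i - 1) (1 - x\<^sup>2) * x ^ (2 * 0)))) has_integral dual_init n) {0..<1}"
  unfolding dual_init_def
 proof (intro has_integral_sum has_integral_mult_right has_integral_add)
  have hi: "((%x. lpow j (1 - x\<^sup>2) * x ^ (2 * 0)) has_integral mu j 0) {0..<1}" for j
   unfolding mu_def by (rule integrable_integral[OF set_lebesgue_integral_eq_integral(1)[OF mu_integrable]])
  fix i
  show "((%x. lpow (n - i) (1 - x\<^sup>2) * x ^ (2 * 0)) has_integral mu (n - i) 0) {0..<1}" by (rule hi)
  show "((%x. if n - i = 0 then 0 else lpow (n - i - 1) (1 - x\<^sup>2) * x ^ (2 * 0)) has_integral
    (if n - i = 0 then 0 else mu (n - i - 1) 0)) {0..<1}"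
   using hi[of "n - i - 1"] by (cases "n - i = 0") auto
 qed auto
 moreover have "(SUM i:{0..n}. lpow i (1/4) * (lpow (n - i) (1 - x\<^sup>2) * x ^ (2 * 0) +
   2 * (if n - i = 0 then 0 else lpow (n - i - 1) (1 - x\<^sup>2) * x ^ (2 * 0)))) = f x" if "x : {0..<1}" for x
 proof -
  have x: "x^2 < 1" using that by (simp add: abs_square_less_1)
  have e: "u x = 1/4 * (1 - x\<^sup>2)" by (simp add: u_def)
  have 1: "lpow n (u x) = (SUM i:{0..n}. lpow i (1/4) * lpow (n - i) (1 - x\<^sup>2))"
   unfolding e atMost_atLeast0[symmetric] using x by (intro lpow_mult) auto
  have 2: "lpow m (u x) = (SUM i:{0..m}. lpow i (1/4) * lpow (m - i) (1 - x\<^sup>2))"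
   unfolding e atMost_atLeast0[symmetric] using x by (intro lpow_mult) auto
  have "(SUM i:{0..n}. lpow i (1/4) * (2 * (if n - i = 0 then 0 else lpow (n - i - 1) (1 - x\<^sup>2))))
   = 2 * (SUM i:{0..m}. lpow i (1/4) * lpow (m - i) (1 - x\<^sup>2))"
   unfolding Suc sum.atLeast0_atMost_Suc sum_distrib_left
   by (simp, intro sum.cong) (auto simp: Suc_diff_le)
  then show ?thesis unfolding f_def 1 2 by (simp add: distrib_left sum.distrib cong: if_cong)
 qed
 ultimately have f1: "(f has_integral dual_init n) {0..<1}"
  using has_integral_cong by (metis (no_types, lifting))
 have f2: "(f has_integral dual_init n) {0..1}"
  by (rule has_integral_up_to_finite[OF f1, of "{1}"]) auto
 \<comment> \<open>\<open>f\<close> is even; the integral is doubled to \<open>[-1, 1]\<close> so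
   that \<open>(1 + sg) / 2\<close> runs over the whole unit interval.\<close>
 have "((%x. f (- x)) has_integral dual_init n) {-1..-0}" using f2 by (simp only: has_integral_reflect_real)
 moreover have "(%x. f (- x)) = f" by (simp add: f_def u_def fun_eq_iff)
 ultimately have "(f has_integral dual_init n) {-1..0}" by simp
 then have "(f has_integral (dual_init n + dual_init n)) {-1..1}"
  using f2 by (rule has_integral_combine[rotated 2]) auto
 then have ff: "((%x. of_real (f x) :: complex) has_integral of_real (2 * dual_init n)) {-1..1}"
  using has_integral_of_real[of f "2 * dual_init n"] by simp
 define U where "U t = Ln t - hpl [1] t" for t
 have w1: "hpl_word [1]" by (simp add: hpl_word_def)
 have U: "hpl_log 1 U" unfolding U_def[abs_def]
  using hpl_log_hpls[OF hpl_span_hpl[OF w1, of "%_. True"]] by (intro hpl_log_diff hpl_log_Ln) simp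
 have Ux: "U (of_real x) = of_real (ln (x * (1 - x)))" if "0 < x" "x < 1" for x :: real
 proof -
  have "of_real x : hpl_dom" using that by (simp add: hpl_dom_def)
  then have "hpl [1] (of_real x) = - Ln (of_real (1 - x))" by (simp add: hpl_1_eq)
  also have "... = - of_real (ln (1 - x))" using that by (subst Ln_of_real) auto
  finally show ?thesis using that by (simp add: U_def Ln_of_real ln_mult)
 qed
 have Um: "hpl_log j (%t. of_rat (1 / fact j) * U t ^ j)" for j
  by (intro hpl_log_scale hpl_log_power U)
 have Uj: "of_rat (1 / fact j) * U (of_real x) ^ j = of_real (lpow j (x * (1 - x)))" if "0 < x" "x < 1" for x :: real and j
  using Ux[OF that] by (simp add: lpow_def of_rat_divide of_rat_fact)
 obtain Ph0 where p0: "hpl_log (Suc m) Ph0"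
  "!!t. t : cut_dom ==> (Ph0 has_field_derivative (of_rat (1 / fact m) * U t ^ m) * hpl_form 0 t) (at t)"
  by (rule hpl_log_primitive[OF Um, of 0 m]) auto
 obtain Ph1 where p1: "hpl_log (Suc m) Ph1"
  "!!t. t : cut_dom ==> (Ph1 has_field_derivative (of_rat (1 / fact m) * U t ^ m) * hpl_form 1 t) (at t)"
  by (rule hpl_log_primitive[OF Um, of 1 m]) auto
 define F where "F sg = Ph0 (of_real ((1 + sg) / 2)) + Ph1 (of_real ((1 + sg) / 2)) + of_real (sg * lpow n (u sg))" for sg :: real
 have der: "(F has_vector_derivative of_real (f sg)) (at sg)" if s: "-1 < sg" "sg < 1" for sg
 proof -
  define x where "x = (1 + sg) / 2"
  have x: "0 < x" "x < 1" using s by (auto simp: x_def)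
  have cd: "of_real x : cut_dom" using x by (simp add: cut_dom_def hpl_dom_def)
  have xs: "x * (1 - x) = u sg" by (simp add: x_def u_def power2_eq_square field_simps)
  have us: "u sg > 0" using x xs by (metis diff_gt_0_iff_gt mult_pos_pos)
  have aff: "((%z. (1 + z) / 2) has_field_derivative (1/2 :: complex)) (at (of_real sg))"
   by (auto intro!: derivative_eq_intros)
  have xc: "(1 + of_real sg) / 2 = (of_real x :: complex)" by (simp add: x_def)
  have "((%z. Ph0 ((1 + z) / 2) + Ph1 ((1 + z) / 2)) has_field_derivative
    of_real (lpow m (u sg)) * hpl_form 0 (of_real x) * (1/2) + of_real (lpow m (u sg)) * hpl_form 1 (of_real x) * (1/2)) (at (of_real sg))"
  proof -
   have "(Ph0 has_field_derivative of_real (lpow m (u sg)) * hpl_form 0 (of_real x)) (at ((1 + of_real sg) / 2))"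
    "(Ph1 has_field_derivative of_real (lpow m (u sg)) * hpl_form 1 (of_real x)) (at ((1 + of_real sg) / 2))"
    using p0(2)[OF cd] p1(2)[OF cd] unfolding Uj[OF x] xs xc by auto
   then show ?thesis by (intro DERIV_add DERIV_chain2[OF _ aff])
  qed
  from has_vector_derivative_real_field[OF this]
  have 1: "((%sg. Ph0 (of_real ((1 + sg) / 2)) + Ph1 (of_real ((1 + sg) / 2))) has_vector_derivative
    of_real (lpow m (u sg)) * hpl_form 0 (of_real x) * (1/2) + of_real (lpow m (u sg)) * hpl_form 1 (of_real x) * (1/2)) (at sg)"
   by simp
  have du: "(u has_real_derivative - sg / 2) (at sg)" unfolding u_def by (auto intro!: derivative_eq_intros)
  have "((%sg. sg * lpow n (u sg)) has_real_derivative sg * (lpow m (u sg) * (- sg / 2 / u sg)) + 1 * lpow n (u sg)) (at sg)"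
   using DERIV_mult'[OF DERIV_ident DERIV_lpow[OF du us, of n]] Suc by simp
  then have 2: "((%sg. of_real (sg * lpow n (u sg)) :: complex) has_vector_derivative
   of_real (sg * (lpow m (u sg) * (- sg / 2 / u sg)) + 1 * lpow n (u sg))) (at sg)"
   by (intro has_vector_derivative_of_real) (simp add: has_real_derivative_iff_has_vector_derivative)
  have "hpl_form 0 (of_real x) + hpl_form 1 (of_real x) = (of_real (1 / x + 1 / (1 - x)) :: complex)"
   by (simp add: hpl_form_def)
  also have "1 / x + 1 / (1 - x) = 1 / u sg" using x unfolding xs[symmetric] by (simp add: field_simps)
  finally have hf: "hpl_form 0 (of_real x) + hpl_form 1 (of_real x) = of_real (1 / u sg)" .
  have "of_real (lpow m (u sg)) * hpl_form 0 (of_real x) * (1/2) + of_real (lpow m (u sg)) * hpl_form 1 (of_real x) * (1/2)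
   + of_real (sg * (lpow m (u sg) * (- sg / 2 / u sg)) + 1 * lpow n (u sg))
   = of_real (lpow m (u sg)) * (1/2) * (hpl_form 0 (of_real x) + hpl_form 1 (of_real x))
   + of_real (sg * (lpow m (u sg) * (- sg / 2 / u sg)) + 1 * lpow n (u sg))"
   by (simp add: algebra_simps)
  also have "... = of_real (lpow m (u sg) * (1/2) * (1 / u sg) + (sg * (lpow m (u sg) * (- sg / 2 / u sg)) + 1 * lpow n (u sg)))"
   unfolding hf by simp
  also have "lpow m (u sg) * (1/2) * (1 / u sg) + (sg * (lpow m (u sg) * (- sg / 2 / u sg)) + 1 * lpow n (u sg))
   = lpow m (u sg) * ((1 - sg\<^sup>2) / (2 * u sg)) + lpow n (u sg)"
   using us by (simp add: field_simps power2_eq_square)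
  also have "1 - sg\<^sup>2 = 4 * u sg" by (simp add: u_def)
  also have "lpow m (u sg) * (4 * u sg / (2 * u sg)) + lpow n (u sg) = f sg" using us by (simp add: f_def)
  finally show ?thesis using has_vector_derivative_add[OF 1 2] unfolding F_def by simp
 qed
 obtain L R where LR: "(F ---> L) (at_right (-1))" "(F ---> R) (at_left 1)"
  "integral {-1..1} (%x. of_real (f x) :: complex) = R - L"
  using improper_FTC[of "-1" 1 "%x. of_real (f x)" F, OF _ has_integral_integrable[OF ff] der] by auto
 have Gn: "hpl_log n (%t. of_rat (1 / fact n) * U t ^ n)" by (rule Um)
 have Fx: "F (2 * x - 1) = Ph0 (of_real x) + Ph1 (of_real x) + of_real ((2 * x - 1) * lpow n (x * (1 - x)))" for x
 proof -
  have "u (2 * x - 1) = x * (1 - x)" by (simp add: u_def power2_eq_square field_simps)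
  then show ?thesis by (simp add: F_def)
 qed
 have zl: "((%z::real. z * (ln z ^ n / fact n)) ---> 0) (at_right 0)" by real_asymp
 \<comment> \<open>Near \<open>x = 1\<close> the factor \<open>sg = 2 x - 1\<close> of the boundary
   term may be replaced by 1: the error is \<open>2 (1 - x)\<close> times a power of the logarithm.
   At the other end it is replaced by -1 with error factor \<open>2 x\<close>.\<close>
 have z1: "((%x::real. 2 * (1 - x) * (ln (x * (1 - x)) ^ n / fact n)) ---> 0) (at_left 1)"
 proof -
  have "((%x::real. (x * (1 - x)) * (ln (x * (1 - x)) ^ n / fact n)) ---> 0) (at_left 1)"
   by (rule filterlim_compose[OF zl]) real_asymp
  moreover have "((%x::real. 2 / x) ---> 2) (at_left 1)" by real_asymp
  ultimately have "((%x::real. (2 / x) * ((x * (1 - x)) * (ln (x * (1 - x)) ^ n / fact n))) ---> 2 * 0) (at_left 1)"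
   by (intro tendsto_mult)
  then show ?thesis unfolding mult_zero_right
   by (rule Lim_transform_eventually) (use eventually_unit_interval in eventually_elim, simp)
 qed
 have z0: "((%x::real. 2 * x * (ln (x * (1 - x)) ^ n / fact n)) ---> 0) (at_right 0)"
 proof -
  have "((%x::real. (x * (1 - x)) * (ln (x * (1 - x)) ^ n / fact n)) ---> 0) (at_right 0)"
   by (rule filterlim_compose[OF zl]) real_asymp
  moreover have "((%x::real. 2 / (1 - x)) ---> 2) (at_right 0)" by real_asymp
  ultimately have "((%x::real. (2 / (1 - x)) * ((x * (1 - x)) * (ln (x * (1 - x)) ^ n / fact n))) ---> 2 * 0) (at_right 0)"
   by (intro tendsto_mult)
  moreover have "eventually (%x. x < 1) (at_right (0::real))" by (rule eventually_at_rightI[of 0 1]) auto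
  then have "eventually (%x::real. (2 / (1 - x)) * ((x * (1 - x)) * (ln (x * (1 - x)) ^ n / fact n))
   = 2 * x * (ln (x * (1 - x)) ^ n / fact n)) (at_right 0)"
   by eventually_elim (simp add: field_simps)
  ultimately show ?thesis unfolding mult_zero_right by (rule Lim_transform_eventually)
 qed
 have "hpl_const n R"
 proof (rule hpl_log_limit_1)
  show "hpl_log n (%t. Ph0 t + Ph1 t + of_rat (1 / fact n) * U t ^ n)"
   using p0(1) p1(1) Gn unfolding Suc by (intro hpl_log.add)
  have "((%x. F (2 * x - 1)) ---> R) (at_left 1)"
   by (rule filterlim_compose[OF LR(2)]) real_asymp
  moreover have "((%x::real. of_real (2 * (1 - x) * (ln (x * (1 - x)) ^ n / fact n)) :: complex) ---> of_real 0) (at_left 1)"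
   by (rule tendsto_of_real[OF z1])
  ultimately have "((%x. F (2 * x - 1) + of_real (2 * (1 - x) * (ln (x * (1 - x)) ^ n / fact n))) ---> R + of_real 0) (at_left 1)"
   by (rule tendsto_add)
  moreover have "eventually (%x. F (2 * x - 1) + of_real (2 * (1 - x) * (ln (x * (1 - x)) ^ n / fact n))
   = Ph0 (of_real x) + Ph1 (of_real x) + of_rat (1 / fact n) * U (of_real x) ^ n) (at_left 1)"
   using eventually_unit_interval
  proof eventually_elim
   case (elim x)
   have "of_rat (1 / fact n) * U (of_real x) ^ n = of_real (lpow n (x * (1 - x)))" using elim by (intro Uj) auto
   then show ?case unfolding Fx lpow_def[symmetric] by (simp add: algebra_simps)
  qed
  ultimately show "((%x. Ph0 (of_real x) + Ph1 (of_real x) + of_rat (1 / fact n) * U (of_real x) ^ n) ---> R) (at_left 1)"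
   using Lim_transform_eventually by fastforce
 qed
 moreover have "hpl_const n L"
 proof (rule hpl_log_limit_0)
  show "hpl_log n (%t. Ph0 t + Ph1 t - of_rat (1 / fact n) * U t ^ n)"
   using p0(1) p1(1) Gn unfolding Suc by (intro hpl_log.add hpl_log_diff)
  have "((%x. F (2 * x - 1)) ---> L) (at_right 0)"
   by (rule filterlim_compose[OF LR(1)]) real_asymp
  moreover have "((%x::real. of_real (2 * x * (ln (x * (1 - x)) ^ n / fact n)) :: complex) ---> of_real 0) (at_right 0)"
   by (rule tendsto_of_real[OF z0])
  ultimately have "((%x. F (2 * x - 1) - of_real (2 * x * (ln (x * (1 - x)) ^ n / fact n))) ---> L - of_real 0) (at_right 0)"
   by (rule tendsto_diff)
  moreover have "eventually (%x. F (2 * x - 1) - of_real (2 * x * (ln (x * (1 - x)) ^ n / fact n))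
   = Ph0 (of_real x) + Ph1 (of_real x) - of_rat (1 / fact n) * U (of_real x) ^ n) (at_right 0)"
  proof -
   have "eventually (%x. 0 < x & x < 1) (at_right (0::real))" by (rule eventually_at_rightI[of 0 1]) auto
   then show ?thesis
   proof eventually_elim
    case (elim x)
    have "of_rat (1 / fact n) * U (of_real x) ^ n = of_real (lpow n (x * (1 - x)))" using elim by (intro Uj) auto
    then show ?case unfolding Fx lpow_def[symmetric] by (simp add: algebra_simps)
   qed
  qed
  ultimately show "((%x. Ph0 (of_real x) + Ph1 (of_real x) - of_rat (1 / fact n) * U (of_real x) ^ n) ---> L) (at_right 0)"
   using Lim_transform_eventually by fastforce
 qed
 moreover have "R - L = of_real (2 * dual_init n)" using LR(3) ff by (simp add: integral_unique)
 ultimately have "hpl_const n (of_real (2 * dual_init n))"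
  using hpl_const.add[OF _ hpl_const_minus, of n R L] by simp
 from hpl_const_scale[OF this, of "1/2"] show ?thesis by (simp add: of_rat_divide)
qed

section \<open>Logarithms on the arc as polylogarithms in t = cis ph\<close>

lemma Ln_cis_general: "- pi < th ==> th <= pi ==> Ln (cis th) = \<i> * of_real th"
 by (simp add: cis_conv_exp)

lemma Ln_of_real_cis: "r > 0 ==> - pi < th ==> th <= pi ==> Ln (of_real r * cis th) = of_real (ln r) + \<i> * of_real th"
 by (simp add: Ln_times_of_real Ln_cis_general Ln_of_real)

lemma one_minus_cis: "1 - cis ph = of_real (2 * sin (ph/2)) * cis ((ph - pi) / 2)"
proof -
 have e: "(ph - pi) / 2 = ph/2 - pi/2" by (simp add: field_simps)
 have "cos ph = 1 - 2 * (sin (ph/2))^2" "sin ph = 2 * sin (ph/2) * cos (ph/2)"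
  using cos_double_sin[of "ph/2"] sin_double[of "ph/2"] by simp_all
 then show ?thesis unfolding e
  by (auto simp: complex_eq_iff cos_diff sin_diff power2_eq_square)
qed

lemma one_plus_cis: "1 + cis ph = of_real (2 * cos (ph/2)) * cis (ph/2)"
proof -
 have "cos ph = 2 * (cos (ph/2))^2 - 1" "sin ph = 2 * sin (ph/2) * cos (ph/2)"
  using cos_double_cos[of "ph/2"] sin_double[of "ph/2"] by simp_all
 then show ?thesis by (auto simp: complex_eq_iff power2_eq_square)
qed

text \<open>On the unit circle \<open>4 sin^2 (ph/2) = - (1 - t)^2 / t\<close>, and the sign under
  the logarithm produces \<open>i pi\<close>. The cosine counterpart is
  \<open>(1 + t)^2 / t\<close>.\<close>

definition arc_log_sin :: "complex => complex" where
 "arc_log_sin t = of_rat (-2) * hpl [1] t - Ln t + \<i> * of_real pi"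

definition arc_log_cos :: "complex => complex" where
 "arc_log_cos t = of_rat (-2) * hpl [-1] t - Ln t"

lemma hpl_log_word1: "x : {-1, 1} ==> hpl_log 1 (hpl [x])"
 using hpl_log_hpls[OF hpl_span_hpl[of "[x]" "%_. True"]] by (auto simp: hpl_word_def)

lemma arc_log_sin: "hpl_log 1 arc_log_sin"
 "0 < ph ==> ph < pi ==> arc_log_sin (cis ph) = of_real (ln (4 * (sin (ph/2))^2))"
proof -
 show "hpl_log 1 arc_log_sin" unfolding arc_log_sin_def[abs_def]
  by (intro hpl_log.add hpl_log_diff hpl_log_scale hpl_log_word1 hpl_log_Ln hpl_log_const hpl_const_i_pi) auto
 assume p: "0 < ph" "ph < pi"
 have s: "0 < sin (ph/2)" by (rule half_angle_bounds[OF p])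
 have "cis ph : hpl_dom" using cis_in_cut_dom[OF p] by (simp add: cut_dom_def)
 then have "hpl [1] (cis ph) = - (of_real (ln (2 * sin (ph/2))) + \<i> * of_real ((ph - pi) / 2))"
  using s p by (simp only: hpl_1_eq one_minus_cis) (subst Ln_of_real_cis, auto)
 moreover have "ln (4 * (sin (ph/2))^2) = 2 * ln (2 * sin (ph/2))"
  using s ln_realpow[of "2 * sin (ph/2)" 2] by (simp add: power_mult_distrib)
 ultimately show "arc_log_sin (cis ph) = of_real (ln (4 * (sin (ph/2))^2))"
  using Ln_cis_general[of ph] p by (simp add: arc_log_sin_def of_rat_minus field_simps)
qed

lemma arc_log_cos: "hpl_log 1 arc_log_cos"
 "0 < ph ==> ph < pi ==> arc_log_cos (cis ph) = of_real (ln (4 * (cos (ph/2))^2))"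
proof -
 show "hpl_log 1 arc_log_cos" unfolding arc_log_cos_def[abs_def]
  by (intro hpl_log_diff hpl_log_scale hpl_log_word1 hpl_log_Ln) auto
 assume p: "0 < ph" "ph < pi"
 have s: "0 < cos (ph/2)" by (rule half_angle_bounds[OF p])
 have d: "cis ph : hpl_dom" "- cis ph : hpl_dom"
  using sin_gt_zero[OF p] by (auto simp: hpl_dom_def)
 have "hpl [-1] (cis ph) = hpl [1] (- cis ph)"
  using hpl_uminus[of "[1]" "cis ph"] d by (simp add: hpl_word_def)
 also have "... = - Ln (1 + cis ph)" using hpl_1_eq[OF d(2)] by simp
 also have "... = - (of_real (ln (2 * cos (ph/2))) + \<i> * of_real (ph/2))"
  unfolding one_plus_cis using s p by (subst Ln_of_real_cis) auto
 finally have h: "hpl [-1] (cis ph) = - (of_real (ln (2 * cos (ph/2))) + \<i> * of_real (ph/2))" .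
 have l: "ln (4 * (cos (ph/2))^2) = 2 * ln (2 * cos (ph/2))"
  using s ln_realpow[of "2 * cos (ph/2)" 2] by (simp add: power_mult_distrib)
 show "arc_log_cos (cis ph) = of_real (ln (4 * (cos (ph/2))^2))"
  unfolding arc_log_cos_def h l Ln_cis[OF p] by (simp add: algebra_simps of_rat_minus)
qed

text \<open>A function known only on the arc differs from a class member with the same derivative by
  a constant. Comparing limits at angle 0 shows that this constant has weight \<open>n\<close>, so
  it can be added to \<open>g\<close>.\<close>

lemma hpl_log_on_arc:
 fixes v :: "real => complex"
 assumes "hpl_log n g" "hpl_const n l" "(v ---> l) (at_right 0)"
  and v: "!!ph. 0 < ph ==> ph < pi ==> (v has_vector_derivative d ph) (at ph)"
  and g: "!!ph. 0 < ph ==> ph < pi ==> ((%ph. g (cis ph)) has_vector_derivative d ph) (at ph)"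
 shows "EX G. hpl_log n G & (ALL ph. 0 < ph --> ph < pi --> G (cis ph) = v ph)"
proof -
 obtain c where c: "!!ph. ph : {0<..<pi} ==> v ph - g (cis ph) = c"
 proof (rule has_vector_derivative_zero_constant[of "{0<..<pi}" "%ph. v ph - g (cis ph)"])
  fix ph assume "ph : {0<..<pi}"
  then have "((%ph. v ph - g (cis ph)) has_vector_derivative d ph - d ph) (at ph)"
   by (intro has_vector_derivative_diff v g) auto
  then show "((%ph. v ph - g (cis ph)) has_vector_derivative 0) (at ph within {0<..<pi})"
   by (auto intro: has_vector_derivative_at_within)
 qed auto
 have "((%ph. v ph - c) ---> l - c) (at_right 0)" by (intro tendsto_intros assms)
 moreover have "eventually (%ph. v ph - c = g (cis ph)) (at_right 0)"
  using eventually_arc by eventually_elim (use c in "force simp: algebra_simps")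
 ultimately have "((%ph. g (cis ph)) ---> l - c) (at_right 0)" by (rule Lim_transform_eventually)
 then have "hpl_const n (l - c)" by (rule hpl_log_arc_limit_0[OF assms(1)])
 then have "hpl_const n (l + - (l - c))" by (intro hpl_const.add assms hpl_const_minus)
 then have "hpl_log n (%t. g t + c)" by (intro hpl_log.add assms hpl_log_const) simp
 then show ?thesis using c by (intro exI[of _ "%t. g t + c"]) (force simp: algebra_simps)
qed

lemma hpl_log_arc_primitive:
 assumes "hpl_log n f"
 obtains g where "hpl_log (Suc n) g"
  "!!ph. 0 < ph ==> ph < pi ==> ((%ph. g (cis ph)) has_vector_derivative \<i> * f (cis ph)) (at ph)"
proof -
 obtain g where g: "hpl_log (Suc n) g"
  "!!t. t : cut_dom ==> (g has_field_derivative f t * hpl_form 0 t) (at t)"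
  by (rule hpl_log_primitive[OF assms, of 0]) auto
 have "((%ph. g (cis ph)) has_vector_derivative \<i> * f (cis ph)) (at ph)" if "0 < ph" "ph < pi" for ph
  using has_vector_derivative_along_arc[OF g(2)[OF cis_in_cut_dom[OF that]]] by (simp add: hpl_form_def)
 with g(1) show ?thesis using that by blast
qed

lemma vector_derivative_of_real:
 "(f has_real_derivative D) (at x) ==> ((%x. complex_of_real (f x)) has_vector_derivative of_real D) (at x)"
 by (intro has_vector_derivative_of_real) (simp add: has_real_derivative_iff_has_vector_derivative)

text \<open>Strong induction along the triangular system: order \<open>n\<close> of the dual series
  is integrated from orders at most \<open>n - 2\<close> of the arc series, then order
  \<open>n\<close> of the arc series from orders at most \<open>n\<close> of the dual series. The
  factor \<open>i\<close> is forced by \<open>dph = dt / (i t)\<close>.\<close>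

lemma arc_functions:
 "(EX A. hpl_log (Suc n) A & (ALL ph. 0 < ph --> ph < pi --> A (cis ph) = \<i> * of_real (fps_nth (arc_fps ph) n))) &
 (EX W. hpl_log n W & (ALL ph. 0 < ph --> ph < pi --> W (cis ph) = of_real (fps_nth (dual_fps ph) n)))"
proof (induction n rule: less_induct)
 case (less n)
 define R where "R t = arc_log_sin t + arc_log_cos t" for t
 have R: "hpl_log 1 R" unfolding R_def[abs_def] by (intro hpl_log.add arc_log_sin arc_log_cos)
 have Rc: "R (cis ph) = of_real (ln (4 * (sin ph)^2))" if "0 < ph" "ph < pi" for ph
  using arc_log_sin(2)[OF that] arc_log_cos(2)[OF that] ln_4_sin_squared[OF that] by (simp add: R_def)
 have "ALL m. EX A. m < n --> hpl_log (Suc m) A & (ALL ph. 0 < ph --> ph < pi --> A (cis ph) = \<i> * of_real (fps_nth (arc_fps ph) m))"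
  using less by blast
 then obtain A where A: "!!m. m < n ==> hpl_log (Suc m) (A m)"
  "!!m ph. m < n ==> 0 < ph ==> ph < pi ==> A m (cis ph) = \<i> * of_real (fps_nth (arc_fps ph) m)" by metis
 have "ALL m. EX W. m < n --> hpl_log m W & (ALL ph. 0 < ph --> ph < pi --> W (cis ph) = of_real (fps_nth (dual_fps ph) m))"
  using less by blast
 then obtain W0 where W0: "!!m. m < n ==> hpl_log m (W0 m)"
  "!!m ph. m < n ==> 0 < ph ==> ph < pi ==> W0 m (cis ph) = of_real (fps_nth (dual_fps ph) m)" by metis
 have lw: "((%ph. complex_of_real (fps_nth (dual_fps ph) n)) ---> of_real (dual_init n)) (at_right 0)"
  by (intro tendsto_of_real dual_fps_limit)
 have dw: "((%ph. complex_of_real (fps_nth (dual_fps ph) n)) has_vector_derivative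
   of_real (fps_nth (fps_X^2 * (fps_exp (- ln (4 * (sin ph)^2)) * arc_fps ph)) n)) (at ph)" if "0 < ph" "ph < pi" for ph
  using arc_fps_system(2)[OF that] unfolding fps_DERIV_def by (intro vector_derivative_of_real) blast
 have W: "EX W. hpl_log n W & (ALL ph. 0 < ph --> ph < pi --> W (cis ph) = of_real (fps_nth (dual_fps ph) n))"
 proof (cases "n < 2")
  case True
  show ?thesis
  proof (rule hpl_log_on_arc[OF hpl_log.zero dual_init_const lw dw])
   fix ph assume "0 < ph" "ph < pi"
   show "((%ph. 0) has_vector_derivative of_real (fps_nth (fps_X^2 * (fps_exp (- ln (4 * (sin ph)^2)) * arc_fps ph)) n)) (at ph)"
    using True by (simp add: fps_X2_nth)
  qed
 next
  case False
  define f where "f t = - (SUM i=0..n-2. (of_rat (1 / fact i) * (- R t) ^ i) * A (n - 2 - i) t)" for t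
  have "hpl_log (n - 1) f" unfolding f_def[abs_def]
  proof (intro hpl_log_minus hpl_log_sum)
   fix i assume i: "i : {0..n-2}"
   have "hpl_log i (%t. of_rat (1 / fact i) * (- R t) ^ i)"
    by (intro hpl_log_scale hpl_log_power hpl_log_minus R)
   from hpl_log_mult[OF A(1)[of "n - 2 - i"] this]
   have "hpl_log (i + Suc (n - 2 - i)) (%t. (of_rat (1 / fact i) * (- R t) ^ i) * A (n - 2 - i) t)"
    using i False by simp
   then show "hpl_log (n - 1) (%t. (of_rat (1 / fact i) * (- R t) ^ i) * A (n - 2 - i) t)"
    using i False by (simp add: Suc_diff_Suc numeral_2_eq_2)
  qed
  then obtain g where g: "hpl_log (Suc (n - 1)) g"
   "!!ph. 0 < ph ==> ph < pi ==> ((%ph. g (cis ph)) has_vector_derivative \<i> * f (cis ph)) (at ph)"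
   by (rule hpl_log_arc_primitive) blast
  have gn: "hpl_log n g" using g(1) False by simp
  show ?thesis
  proof (rule hpl_log_on_arc[OF gn dual_init_const lw dw])
   fix ph assume p: "0 < ph" "ph < pi"
   have "\<i> * f (cis ph) = - (SUM i=0..n-2. \<i> * ((of_rat (1 / fact i) * (- of_real (ln (4 * (sin ph)^2))) ^ i) * (\<i> * of_real (fps_nth (arc_fps ph) (n - 2 - i)))))"
    unfolding f_def Rc[OF p] sum_distrib_left mult_minus_right
    using A(2)[OF _ p] False by (intro arg_cong[where f = uminus] sum.cong) auto
   also have "... = (SUM i=0..n-2. of_real ((- ln (4 * (sin ph)^2)) ^ i / fact i * fps_nth (arc_fps ph) (n - 2 - i)))"
    unfolding sum_negf[symmetric] by (intro sum.cong) (auto simp: of_rat_divide of_rat_fact algebra_simps)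
   also have "... = of_real (fps_nth (fps_X^2 * (fps_exp (- ln (4 * (sin ph)^2)) * arc_fps ph)) n)"
    unfolding fps_X2_nth using False by (simp add: fps_mult_nth)
   finally show "((%ph. g (cis ph)) has_vector_derivative of_real (fps_nth (fps_X^2 * (fps_exp (- ln (4 * (sin ph)^2)) * arc_fps ph)) n)) (at ph)"
    using g(2)[OF p] by simp
  qed
 qed
 then obtain Wn where Wn: "hpl_log n Wn" "!!ph. 0 < ph ==> ph < pi ==> Wn (cis ph) = of_real (fps_nth (dual_fps ph) n)"
  by blast
 define WW where "WW m = (if m = n then Wn else W0 m)" for m
 have WW: "hpl_log m (WW m)" "!!ph. 0 < ph ==> ph < pi ==> WW m (cis ph) = of_real (fps_nth (dual_fps ph) m)" if "m <= n" for m
  using that W0[of m] Wn by (auto simp: WW_def le_less)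
 define f where "f t = (SUM i=0..n. (of_rat (1 / fact i) * R t ^ i) * WW (n - i) t)" for t
 have "hpl_log n f" unfolding f_def[abs_def]
 proof (intro hpl_log_sum)
  fix i assume i: "i : {0..n}"
  have "hpl_log i (%t. of_rat (1 / fact i) * R t ^ i)" by (intro hpl_log_scale hpl_log_power R)
  from hpl_log_mult[OF WW(1)[of "n - i"] this]
  have "hpl_log (i + (n - i)) (%t. (of_rat (1 / fact i) * R t ^ i) * WW (n - i) t)" by simp
  then show "hpl_log n (%t. (of_rat (1 / fact i) * R t ^ i) * WW (n - i) t)" using i by simp
 qed
 then obtain g where g: "hpl_log (Suc n) g"
   "!!ph. 0 < ph ==> ph < pi ==> ((%ph. g (cis ph)) has_vector_derivative \<i> * f (cis ph)) (at ph)"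
  by (rule hpl_log_arc_primitive) blast
 have la: "((%ph. \<i> * complex_of_real (fps_nth (arc_fps ph) n)) ---> \<i> * of_real 0) (at_right 0)"
  by (intro tendsto_intros arc_fps_limit)
 have "EX A. hpl_log (Suc n) A & (ALL ph. 0 < ph --> ph < pi --> A (cis ph) = \<i> * of_real (fps_nth (arc_fps ph) n))"
 proof (rule hpl_log_on_arc[OF g(1) _ la _ g(2)])
  show "hpl_const (Suc n) (\<i> * of_real 0)" using hpl_const_0 by simp
  fix ph assume p: "0 < ph" "ph < pi"
  have "f (cis ph) = (SUM i=0..n. of_real (ln (4 * (sin ph)^2) ^ i / fact i * fps_nth (dual_fps ph) (n - i)))"
   unfolding f_def Rc[OF p] using WW(2)[OF _ p] by (intro sum.cong) (auto simp: of_rat_divide of_rat_fact)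
  also have "... = of_real (fps_nth (fps_exp (ln (4 * (sin ph)^2)) * dual_fps ph) n)"
   by (simp add: fps_mult_nth)
  finally have f: "f (cis ph) = of_real (fps_nth (fps_exp (ln (4 * (sin ph)^2)) * dual_fps ph) n)" .
  have "((%ph. complex_of_real (fps_nth (arc_fps ph) n)) has_vector_derivative
   of_real (fps_nth (fps_exp (ln (4 * (sin ph)^2)) * dual_fps ph) n)) (at ph)"
   using arc_fps_system(1)[OF p] unfolding fps_DERIV_def by (intro vector_derivative_of_real) blast
  then show "((%ph. \<i> * complex_of_real (fps_nth (arc_fps ph) n)) has_vector_derivative \<i> * f (cis ph)) (at ph)"
   unfolding f by (rule has_vector_derivative_mult_right)
 qed auto
 with W show ?case by blast
qed

definition ratio_fps :: "real => real fps" where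
 "ratio_fps ph = fps_exp (- ln (4 * (sin (ph/2))^2)) * arc_fps ph - fps_const pi"

text \<open>The two factors have weights \<open>n + 1\<close> and \<open>m + 1\<close>, and the
  outer integration adds one. With \<open>t = cis ph\<close>, the letters 0 and 1 combine to
  \<open>(1 + t) / (1 - t) = i cot (ph/2)\<close>. The integral is real, so passing to the real part
  removes \<open>i pi\<close>.\<close>

lemma arc_integral_value:
 assumes int: "(%ph. fps_nth (arc_fps ph) n * fps_nth (ratio_fps ph) m * cot (ph/2)) integrable_on {0..pi}"
 shows "of_real (integral {0..pi} (%ph. fps_nth (arc_fps ph) n * fps_nth (ratio_fps ph) m * cot (ph/2))) : hpl_values (n + m + 3)"
proof -
 let ?f = "%ph. fps_nth (arc_fps ph) n * fps_nth (ratio_fps ph) m * cot (ph/2)"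
 have "ALL m. EX A. hpl_log (Suc m) A & (ALL ph. 0 < ph --> ph < pi --> A (cis ph) = \<i> * of_real (fps_nth (arc_fps ph) m))"
  using arc_functions by blast
 then obtain A where A: "!!m. hpl_log (Suc m) (A m)"
  "!!m ph. 0 < ph ==> ph < pi ==> A m (cis ph) = \<i> * of_real (fps_nth (arc_fps ph) m)" by metis
 define B where "B t = (SUM i=0..m. (of_rat (1 / fact i) * (- arc_log_sin t) ^ i) * A (m - i) t)
  - (if m = 0 then \<i> * of_real pi else 0)" for t
 have B: "hpl_log (Suc m) B" unfolding B_def[abs_def]
 proof (intro hpl_log_diff hpl_log_sum hpl_log_const)
  show "hpl_const (Suc m) (if m = 0 then \<i> * of_real pi else 0)"
   using hpl_const_i_pi hpl_const_0 by auto
  fix i assume i: "i : {0..m}"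
  have "hpl_log i (%t. of_rat (1 / fact i) * (- arc_log_sin t) ^ i)"
   by (intro hpl_log_scale hpl_log_power hpl_log_minus arc_log_sin)
  from hpl_log_mult[OF A(1)[of "m - i"] this]
  show "hpl_log (Suc m) (%t. (of_rat (1 / fact i) * (- arc_log_sin t) ^ i) * A (m - i) t)" using i by simp
 qed
 have Bc: "B (cis ph) = \<i> * of_real (fps_nth (ratio_fps ph) m)" if p: "0 < ph" "ph < pi" for ph
 proof -
  have "(SUM i=0..m. (of_rat (1 / fact i) * (- arc_log_sin (cis ph)) ^ i) * A (m - i) (cis ph))
   = (SUM i=0..m. \<i> * of_real ((- ln (4 * (sin (ph/2))^2)) ^ i / fact i * fps_nth (arc_fps ph) (m - i)))"
   using A(2)[OF p] arc_log_sin(2)[OF p] by (intro sum.cong) (auto simp: of_rat_divide of_rat_fact)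
  also have "... = \<i> * of_real (fps_nth (fps_exp (- ln (4 * (sin (ph/2))^2)) * arc_fps ph) m)"
   by (simp add: fps_mult_nth sum_distrib_left)
  finally show ?thesis by (auto simp: B_def ratio_fps_def algebra_simps)
 qed
 have AB: "hpl_log (n + m + 2) (%t. A n t * B t)"
  using hpl_log_mult[OF B A(1)[of n]] by (simp add: numeral_2_eq_2)
 obtain p0 where p0: "hpl_log (Suc (n + m + 2)) p0"
  "!!t. t : cut_dom ==> (p0 has_field_derivative (A n t * B t) * hpl_form 0 t) (at t)"
  by (rule hpl_log_primitive[OF AB, of 0]) auto
 obtain p1 where p1: "hpl_log (Suc (n + m + 2)) p1"
  "!!t. t : cut_dom ==> (p1 has_field_derivative (A n t * B t) * hpl_form 1 t) (at t)"
  by (rule hpl_log_primitive[OF AB, of 1]) auto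
 define Ph where "Ph t = p0 t + of_rat 2 * p1 t" for t
 have P: "hpl_log (n + m + 3) Ph" unfolding Ph_def[abs_def]
  using hpl_log.add[OF p0(1) hpl_log_scale[OF p1(1), of 2]] by (simp add: numeral_3_eq_3 numeral_2_eq_2)
 have der: "((%ph. Ph (cis ph)) has_vector_derivative of_real (?f ph)) (at ph)" if p: "0 < ph" "ph < pi" for ph
 proof -
  have cd: "cis ph : cut_dom" by (rule cis_in_cut_dom[OF p])
  have "(Ph has_field_derivative (A n (cis ph) * B (cis ph)) * hpl_form 0 (cis ph) + of_rat 2 * ((A n (cis ph) * B (cis ph)) * hpl_form 1 (cis ph))) (at (cis ph))"
   unfolding Ph_def[abs_def] by (intro DERIV_add DERIV_cmult p0 p1 cd)
  note d = has_vector_derivative_along_arc[OF this]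
  have s: "0 < sin (ph/2)" by (rule half_angle_bounds[OF p])
  have "1 - cis ph ~= 0" unfolding one_minus_cis using s by simp
  then have "cis ph * (hpl_form 0 (cis ph) + 2 * hpl_form 1 (cis ph)) = (1 + cis ph) / (1 - cis ph)"
   by (simp add: hpl_form_def field_simps)
  also have "... = \<i> * of_real (cot (ph/2))"
  proof -
   have "ph/2 - (ph - pi) / 2 = pi/2" by (simp add: field_simps)
   then have "cis (ph/2) / cis ((ph - pi) / 2) = \<i>" unfolding cis_divide by (simp only: cis_pi_half)
   then show ?thesis unfolding one_plus_cis one_minus_cis using s by (simp add: cot_def field_simps)
  qed
  finally have e: "cis ph * (hpl_form 0 (cis ph) + 2 * hpl_form 1 (cis ph)) = \<i> * of_real (cot (ph/2))" .
  have "\<i> * cis ph * ((A n (cis ph) * B (cis ph)) * hpl_form 0 (cis ph) + of_rat 2 * ((A n (cis ph) * B (cis ph)) * hpl_form 1 (cis ph)))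
   = \<i> * (A n (cis ph) * B (cis ph)) * (cis ph * (hpl_form 0 (cis ph) + 2 * hpl_form 1 (cis ph)))"
   by (simp add: algebra_simps)
  also have "... = of_real (?f ph)" unfolding e A(2)[OF p] Bc[OF p] by (simp add: algebra_simps)
  finally show ?thesis using d by simp
 qed
 have fi: "((%ph. complex_of_real (?f ph)) has_integral of_real (integral {0..pi} ?f)) {0..pi}"
  by (rule has_integral_of_real[OF integrable_integral[OF int]])
 obtain l r where lr: "((%ph. Ph (cis ph)) ---> l) (at_right 0)" "((%ph. Ph (cis ph)) ---> r) (at_left pi)"
  "integral {0..pi} (%ph. complex_of_real (?f ph)) = r - l"
  using improper_FTC[OF pi_gt_zero has_integral_integrable[OF fi] der] by blast
 have "hpl_const (n + m + 3) (r + - l)"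
  by (intro hpl_const.add hpl_const_minus hpl_log_arc_limit_0[OF P lr(1)] hpl_log_arc_limit_pi[OF P lr(2)])
 then have "hpl_const (n + m + 3) (of_real (integral {0..pi} ?f))" using lr(3) integral_unique[OF fi] by simp
 from hpl_const_Re[OF this] show ?thesis by simp
qed

section \<open>The integrals along the segment\<close>

lemma integral_cis:
 "((%x. cis (of_int k * x)) has_integral (if k = 0 then of_real (2 * pi) else 0)) {0..2 * pi}"
proof (cases "k = 0")
 case True
 then show ?thesis using has_integral_const_real[of "1::complex" 0 "2 * pi"] by (simp add: scaleR_conv_of_real)
next
 case False
 have "((%x. cis (of_int k * x)) has_integral
  (cis (of_int k * (2 * pi)) / (\<i> * of_int k) - cis (of_int k * 0) / (\<i> * of_int k))) {0..2 * pi}"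
 proof (rule fundamental_theorem_of_calculus)
  fix x :: real
  have "((%z. exp (\<i> * of_int k * z) / (\<i> * of_int k)) has_field_derivative exp (\<i> * of_int k * of_real x)) (at (of_real x))"
   using False by (auto intro!: derivative_eq_intros)
  from has_vector_derivative_real_field[OF this]
  have "((%x. cis (of_int k * x) / (\<i> * of_int k)) has_vector_derivative cis (of_int k * x)) (at x)"
   by (simp add: cis_conv_exp mult.assoc)
  then show "((%x. cis (of_int k * x) / (\<i> * of_int k)) has_vector_derivative cis (of_int k * x)) (at x within {0..2 * pi})"
   by (rule has_vector_derivative_at_within)
 qed simp
 moreover have "cis (of_int k * (2 * pi)) = 1"
  by (metis cis_multiple_2pi Ints_of_int mult.commute mult.assoc)
 ultimately show ?thesis using False by simp
qed

lemma integral_sums_of_bounded: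
 fixes c :: "nat => complex" and h :: "nat => real => complex"
 assumes "summable (%l. cmod (c l))" "!!l. continuous_on {a..b} (h l)"
  and M: "!!l x. x : {a..b} ==> cmod (h l x) <= M"
  and f: "!!x. x : {a..b} ==> (%l. c l * h l x) sums f x"
 shows "f integrable_on {a..b}" "(%l. c l * integral {a..b} (h l)) sums integral {a..b} f"
proof -
 have hi: "h l integrable_on {a..b}" for l by (rule integrable_continuous_interval[OF assms(2)])
 have 1: "(%x. SUM l<N. c l * h l x) integrable_on {a..b}" for N
  by (intro integrable_sum integrable_on_mult_right hi) auto
 have 2: "(%x. (\<Sum>l. cmod (c l)) * \<bar>M\<bar>) integrable_on {a..b}" by (rule integrable_const_ivl)
 have 3: "cmod (SUM l<N. c l * h l x) <= (\<Sum>l. cmod (c l)) * \<bar>M\<bar>" if "x : {a..b}" for N x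
 proof -
  have "cmod (SUM l<N. c l * h l x) <= (SUM l<N. cmod (c l) * \<bar>M\<bar>)"
   using M[OF that] by (intro sum_norm_le) (auto simp: norm_mult intro!: mult_left_mono intro: order_trans[OF _ abs_ge_self])
  also have "... = (SUM l<N. cmod (c l)) * \<bar>M\<bar>" by (simp add: sum_distrib_right)
  also have "... <= (\<Sum>l. cmod (c l)) * \<bar>M\<bar>"
   using assms(1) by (intro mult_right_mono sum_le_suminf) auto
  finally show ?thesis .
 qed
 have 4: "(%N. SUM l<N. c l * h l x) \<longlonglongrightarrow> f x" if "x : {a..b}" for x
  using f[OF that] by (simp add: sums_def)
 note dc = dominated_convergence[of "%N x. SUM l<N. c l * h l x" "{a..b}", OF 1 2 3 4]
 show "f integrable_on {a..b}" by (rule dc(1))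
 have "integral {a..b} (%x. SUM l<N. c l * h l x) = (SUM l<N. c l * integral {a..b} (h l))" for N
  by (subst integral_sum) (auto intro!: integrable_on_mult_right hi)
 with dc(2) show "(%l. c l * integral {a..b} (h l)) sums integral {a..b} f" by (simp add: sums_def)
qed

text \<open>Orthogonality of the characters on the circle of radius \<open>r\<close>. The second
  series is taken at the opposite angle, so that the diagonal products carry no conjugation.\<close>

lemma parseval:
 fixes a b :: "nat => complex"
 assumes f: "!!z. cmod z < 1 ==> (%l. a l * z ^ l) sums f z"
  and g: "!!z. cmod z < 1 ==> (%l. b l * z ^ l) sums g z"
  and r: "0 <= r" "r < 1"
 shows "(%x. f (of_real r * cis x) * g (of_real r * cis (- x))) integrable_on {0..2 * pi}"
  and "(%l. a l * b l * of_real r ^ (2 * l)) sums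
   (integral {0..2 * pi} (%x. f (of_real r * cis x) * g (of_real r * cis (- x))) / of_real (2 * pi))"
proof -
 define \<rho> where "\<rho> = (r + 1) / 2"
 have rho: "r < \<rho>" "\<rho> < 1" "0 < \<rho>" using r by (auto simp: \<rho>_def)
 have sa: "summable (%l. cmod (a l * of_real r ^ l))"
  by (rule powser_insidea[of a "of_real \<rho>"]) (use f[of "of_real \<rho>"] rho r in "auto simp: sums_iff")
 have sb: "summable (%l. cmod (b l * of_real r ^ l))"
  by (rule powser_insidea[of b "of_real \<rho>"]) (use g[of "of_real \<rho>"] rho r in "auto simp: sums_iff")
 have cisp: "cis x ^ l = cis (of_int (int l) * x)" for x l by (simp add: Complex.DeMoivre)
 have fs: "(%l. (a l * of_real r ^ l) * cis (of_int (int l) * x)) sums f (of_real r * cis x)" for x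
  using f[of "of_real r * cis x"] r by (simp add: norm_mult power_mult_distrib cisp mult_ac)
 have gs: "(%l. (b l * of_real r ^ l) * cis (of_int (- int l) * x)) sums g (of_real r * cis (- x))" for x
 proof -
  have "cis (- x) ^ l = cis (of_int (- int l) * x)" for l by (simp add: Complex.DeMoivre)
  then show ?thesis using g[of "of_real r * cis (- x)"] r by (simp add: norm_mult power_mult_distrib mult_ac)
 qed
 define G where "G x = g (of_real r * cis (- x))" for x
 have Gb: "cmod (G x) <= (\<Sum>l. cmod (b l * of_real r ^ l))" for x
 proof -
  have "G x = (\<Sum>l. (b l * of_real r ^ l) * cis (of_int (- int l) * x))" using gs[of x] by (simp add: G_def sums_iff)
  also have "cmod ... <= (\<Sum>l. cmod (b l * of_real r ^ l))"
   by (rule norm_suminf_le) (use sb in "auto simp: norm_mult")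
  finally show ?thesis .
 qed
 have Gc: "continuous_on {0..2 * pi} G"
 proof -
  have "uniform_limit {0..2 * pi} (%N x. SUM l<N. (b l * of_real r ^ l) * cis (of_int (- int l) * x))
   (%x. \<Sum>l. (b l * of_real r ^ l) * cis (of_int (- int l) * x)) sequentially"
   by (rule Weierstrass_m_test[OF _ sb]) (simp add: norm_mult)
  then have "continuous_on {0..2 * pi} (%x. \<Sum>l. (b l * of_real r ^ l) * cis (of_int (- int l) * x))"
   by (rule uniform_limit_theorem[rotated]) (auto intro!: always_eventually continuous_intros)
  moreover have "(%x. \<Sum>l. (b l * of_real r ^ l) * cis (of_int (- int l) * x)) = G"
   using gs by (auto simp: G_def sums_iff fun_eq_iff)
  ultimately show ?thesis by (simp only:)
 qed
 have inner: "integral {0..2 * pi} (%x. cis (of_int (int l) * x) * G x) = of_real (2 * pi) * (b l * of_real r ^ l)" for l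
 proof -
  have cc: "continuous_on {0..2 * pi} (%x. cis (of_int (int l - int m) * x))" for m
   by (intro continuous_intros)
  have "(%m. (b m * of_real r ^ m) * cis (of_int (int l - int m) * x)) sums (cis (of_int (int l) * x) * G x)" for x
   using sums_mult[OF gs[of x], of "cis (of_int (int l) * x)"]
   by (simp add: G_def cis_mult mult_ac algebra_simps)
  from integral_sums_of_bounded(2)[where a = 0 and b = "2 * pi" and M = 1 and h = "%m x. cis (of_int (int l - int m) * x)"
    and f = "%x. cis (of_int (int l) * x) * G x", OF sb cc _ this]
  have "(%m. (b m * of_real r ^ m) * integral {0..2 * pi} (%x. cis (of_int (int l - int m) * x))) sums
    integral {0..2 * pi} (%x. cis (of_int (int l) * x) * G x)"
   by simp
  moreover have "(b m * of_real r ^ m) * integral {0..2 * pi} (%x. cis (of_int (int l - int m) * x))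
   = (if m = l then of_real (2 * pi) * (b l * of_real r ^ l) else 0)" for m
   using integral_unique[OF integral_cis[of "int l - int m"]] by auto
  ultimately have "(%m. if m = l then of_real (2 * pi) * (b l * of_real r ^ l) else 0) sums
    integral {0..2 * pi} (%x. cis (of_int (int l) * x) * G x)" by simp
  then show ?thesis using sums_unique2[OF sums_single[of l "%_. of_real (2 * pi) * (b l * of_real r ^ l)"]] by simp
 qed
 have fg: "(%l. (a l * of_real r ^ l) * (cis (of_int (int l) * x) * G x)) sums (f (of_real r * cis x) * g (of_real r * cis (- x)))" for x
  using sums_mult2[OF fs[of x], of "G x"] by (simp add: G_def mult.assoc)
 have bnd: "cmod (cis (of_int (int l) * x) * G x) <= (\<Sum>l. cmod (b l * of_real r ^ l))" for l x
  using Gb[of x] by (simp add: norm_mult)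
 have cont: "continuous_on {0..2 * pi} (%x. cis (of_int (int l) * x) * G x)" for l
  by (intro continuous_intros Gc)
 show "(%x. f (of_real r * cis x) * g (of_real r * cis (- x))) integrable_on {0..2 * pi}"
  by (rule integral_sums_of_bounded(1)[OF sa cont bnd fg])
 have "(%l. (a l * of_real r ^ l) * (of_real (2 * pi) * (b l * of_real r ^ l))) sums
   integral {0..2 * pi} (%x. f (of_real r * cis x) * g (of_real r * cis (- x)))"
  using integral_sums_of_bounded(2)[OF sa cont bnd fg] inner by simp
 note s = sums_divide[OF this, of "of_real (2 * pi)"]
 have e: "x * y * (c * (z * y)) / c = x * z * (y * y)" if "c ~= 0" for x y z c :: complex
  using that by simp
 have "(a l * of_real r ^ l) * (of_real (2 * pi) * (b l * of_real r ^ l)) / of_real (2 * pi) = a l * b l * of_real r ^ (2 * l)" for l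
  using e[of "of_real (2 * pi)" "a l" "of_real r ^ l" "b l"] by (simp only: mult_2[of l] power_add) simp
 with s show "(%l. a l * b l * of_real r ^ (2 * l)) sums
   (integral {0..2 * pi} (%x. f (of_real r * cis x) * g (of_real r * cis (- x))) / of_real (2 * pi))"
  by (simp only:)
qed

lemma integral_cos_symmetric:
 fixes h :: "real => real"
 assumes "continuous_on {-1..1} h"
 shows "((%x. h (cos x)) has_integral (2 * integral {0..pi} (%x. h (cos x)))) {0..2 * pi}"
proof -
 have c: "continuous_on A (%x. h (cos x))" for A :: "real set"
  by (rule continuous_on_compose2[OF assms]) (auto intro!: continuous_intros)
 have 1: "((%x. h (cos x)) has_integral integral {0..pi} (%x. h (cos x))) {0..pi}"
  by (intro integrable_integral integrable_continuous_interval c)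
 have "((%x. h (cos (- x))) has_integral integral {0..pi} (%x. h (cos x))) {- pi..- 0}"
  using 1 by (simp only: has_integral_reflect_real[where f = "%x. h (cos x)"])
 then have "((%x. h (cos x)) has_integral integral {0..pi} (%x. h (cos x))) (cbox (- pi) 0)" by simp
 from has_integral_affinity[OF this, of 1 "- (2 * pi)"]
 have "((%x. h (cos (x - 2 * pi))) has_integral integral {0..pi} (%x. h (cos x))) ((%x. x + 2 * pi) ` cbox (- pi) 0)"
  by simp
 moreover have "(%x. x + 2 * pi) ` cbox (- pi) 0 = {pi..2 * pi}"
  using image_add_atLeastAtMost[of "2 * pi" "- pi" 0] by (simp add: add.commute)
 ultimately have 2: "((%x. h (cos x)) has_integral integral {0..pi} (%x. h (cos x))) {pi..2 * pi}"
  by (simp add: cos_diff)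
 show ?thesis using has_integral_combine[OF _ _ 1 2] by simp
qed

section \<open>Squared binomial coefficients and averages over circles of radius r < 1\<close>

definition lncoef :: "nat => nat => complex" where
 "lncoef i l = fps_nth (fps_expansion (%t. of_rat (1 / fact i) * (- hpl [-1] t) ^ i) 0) l"

lemma hpl_m1_eq: "t : hpl_dom ==> hpl [-1] t = - Ln (1 + t)"
 using hpl_uminus[of "[1]" t] hpl_1_eq[of "- t"] by (simp add: hpl_word_def hpl_dom_def)

lemma lnpow_hpls: "hpls i (%t. of_rat (1 / fact i) * (- hpl [-1] t) ^ i)"
 using hpl_span_hpl[of "[-1]" "%_. True"]
 by (intro hpl_span_scale hpls_power hpl_span_minus) (simp add: hpl_word_def)

lemma lncoef_fps: "(%t. of_rat (1 / fact i) * (- hpl [-1] t) ^ i) has_fps_expansion Abs_fps (lncoef i)"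
proof -
 have "(%t. of_rat (1 / fact i) * (- hpl [-1] t) ^ i) has_fps_expansion
   fps_expansion (%t. of_rat (1 / fact i) * (- hpl [-1] t) ^ i) 0"
  by (rule has_fps_expansion_fps_expansion[OF open_hpl_dom zero_in_hpl_dom hpl_span_holomorphic[OF lnpow_hpls]])
 then show ?thesis by (simp add: lncoef_def[abs_def] fps_nth_inverse)
qed

lemma lncoef_sums:
 "cmod t < 1 ==> (%l. lncoef i l * t ^ l) sums (of_rat (1 / fact i) * (- hpl [-1] t) ^ i)"
 using holomorphic_on_hpl_dom_sums[OF hpl_span_holomorphic[OF lnpow_hpls] lncoef_fps] by simp

lemma lncoef_0: "lncoef i 0 = (if i = 0 then 1 else 0)"
 using has_fps_expansion_imp_0_eq_fps_nth_0[OF lncoef_fps[of i]] hpl_at_0[of "[-1]"]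
 by (auto simp: hpl_word_def power_0_left)

lemma lncoef_zero: "lncoef 0 l = (if l = 0 then 1 else 0)"
proof -
 have "Abs_fps (lncoef 0) = 1"
  by (rule fps_expansion_unique_complex[OF lncoef_fps]) simp
 then have "lncoef 0 l = fps_nth 1 l" by (metis fps_nth_Abs_fps)
 then show ?thesis by simp
qed

text \<open>\<open>lncoef i l\<close> is the coefficient of \<open>p^i\<close> in the binomial
  coefficient of \<open>p\<close> over \<open>l\<close>. The relation is
  \<open>(l + 1) binom(p, l+1) = (p - l) binom(p, l)\<close>, obtained from
  \<open>(1 + t) f_i' = f_(i-1)\<close> for \<open>f_i = log (1 + t)^i / i!\<close>.\<close>

lemma lncoef_Suc: "of_nat (Suc l) * lncoef i (Suc l) = (if i = 0 then 0 else lncoef (i - 1) l) - of_nat l * lncoef i l"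
proof (cases i)
 case 0
 then show ?thesis by (simp add: lncoef_zero)
next
 case (Suc j)
 let ?f = "%i t. of_rat (1 / fact i) * (- hpl [-1] t) ^ i"
 have w: "hpl_word [-1]" by (simp add: hpl_word_def)
 have d: "(?f (Suc j) has_field_derivative ?f j t / (1 + t)) (at t)" if t: "t : hpl_dom" for t
 proof -
  have t1: "1 + t ~= 0" using hpl_dom_ne_sing[OF t, of "-1"] by simp
  have "(hpl [-1] has_field_derivative - 1 / (1 + t)) (at t)"
   using hpl_has_derivative_kernel[OF w t] by (simp add: hpl_kernel_def hpl_form_def)
  from DERIV_cmult[OF DERIV_power[OF DERIV_minus[OF this], of "Suc j"], of "of_rat (1 / fact (Suc j))"]
  show ?thesis
  proof (rule DERIV_cong)
   have "of_rat (1 / fact (Suc j)) * of_nat (Suc j) = (of_rat (1 / fact j) :: complex)"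
    by (simp add: of_rat_divide of_rat_mult of_rat_fact del: of_nat_Suc)
   then have "(of_rat (1 / fact (Suc j)) * of_nat (Suc j)) * (- (- 1 / (1 + t)) * (- hpl [- 1] t) ^ j) = ?f j t / (1 + t)"
    by (simp only:) simp
   then show "of_rat (1 / fact (Suc j)) * (of_nat (Suc j) * (- (- 1 / (1 + t)) * (- hpl [- 1] t) ^ (Suc j - Suc 0))) = ?f j t / (1 + t)"
    by (simp only: mult.assoc diff_Suc_Suc diff_zero)
  qed
 qed
 have ev: "eventually (%u. u : hpl_dom) (nhds 0)"
  by (intro eventually_nhds_in_open open_hpl_dom) auto
 have e1: "eventually (%t. (1 + t) * deriv (?f (Suc j)) t = ?f j t) (nhds 0)"
  using ev
 proof eventually_elim
  case (elim t)
  have "1 + t ~= 0" using hpl_dom_ne_sing[OF elim, of "-1"] by simp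
  then show ?case using DERIV_imp_deriv[OF d[OF elim]] by simp
 qed
 have "(%t. (1 + t) * deriv (?f (Suc j)) t) has_fps_expansion (1 + fps_X) * fps_deriv (Abs_fps (lncoef (Suc j)))"
  by (intro fps_expansion_intros lncoef_fps)
 then have "?f j has_fps_expansion (1 + fps_X) * fps_deriv (Abs_fps (lncoef (Suc j)))"
  using iffD1[OF has_fps_expansion_cong[OF e1 refl]] by blast
 then have "Abs_fps (lncoef j) = (1 + fps_X) * fps_deriv (Abs_fps (lncoef (Suc j)))"
  by (rule fps_expansion_unique_complex[OF lncoef_fps])
 then have "lncoef j l = fps_nth ((1 + fps_X) * fps_deriv (Abs_fps (lncoef (Suc j)))) l" by (metis fps_nth_Abs_fps)
 then show ?thesis using Suc by (cases l) (simp_all add: distrib_right)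
qed

text \<open>The square of \<open>binom(p, l)\<close> as a power series in \<open>p\<close>.\<close>

definition Bfps :: "nat => complex fps" where
 "Bfps l = Abs_fps (%i. lncoef i l) * Abs_fps (%i. lncoef i l)"

lemma Bfps_Suc:
 "of_nat (Suc l) ^ 2 * fps_nth (Bfps (Suc l)) n = of_nat l ^ 2 * fps_nth (Bfps l) n
  - 2 * of_nat l * (if n = 0 then 0 else fps_nth (Bfps l) (n - 1)) + (if n < 2 then 0 else fps_nth (Bfps l) (n - 2))"
proof -
 define G where "G l = Abs_fps (%i. lncoef i l)" for l
 define c where "c = fps_const (of_nat (Suc l) :: complex)"
 define d where "d = fps_const (of_nat l :: complex)"
 have "c * G (Suc l) = fps_X * G l - d * G l"
  by (rule fps_ext) (simp add: c_def d_def G_def lncoef_Suc fps_mult_left_const_nth del: of_nat_Suc)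
 then have "(c * G (Suc l)) * (c * G (Suc l)) = (fps_X * G l - d * G l) * (fps_X * G l - d * G l)" by simp
 then have "(c * c) * Bfps (Suc l) = (d * d) * Bfps l - (2 * d) * (fps_X * Bfps l) + fps_X ^ 2 * Bfps l"
  unfolding Bfps_def G_def[symmetric] by (simp add: algebra_simps power2_eq_square)
 then have "fps_nth ((c * c) * Bfps (Suc l)) n = fps_nth ((d * d) * Bfps l - (2 * d) * (fps_X * Bfps l) + fps_X ^ 2 * Bfps l) n"
  by simp
 moreover have "c * c = fps_const (of_nat (Suc l) ^ 2)" "d * d = fps_const (of_nat l ^ 2)" "2 * d = fps_const (2 * of_nat l)"
  by (simp_all add: c_def d_def power2_eq_square numeral_fps_const del: of_nat_Suc)
 ultimately show ?thesis
  by (simp only: fps_add_nth fps_sub_nth fps_mult_left_const_nth fps_X_mult_nth fps_X_power_mult_nth)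
qed

text \<open>The coefficient of \<open>p^n r^k\<close> in the mean of the \<open>2p\<close>-th power
  of \<open>cmod (1 + r cis x)\<close>, which by Parseval is the sum of
  \<open>binom(p, l)^2 r^(2l)\<close>.\<close>

definition Hco :: "nat => nat => complex" where
 "Hco n k = (if even k then fps_nth (Bfps (k div 2)) n else 0)"

text \<open>Coefficients of \<open>(p^2 - p theta) H\<close> with \<open>theta = r d/dr\<close>: the
  lower-order source in the differential equation for \<open>H\<close>.\<close>

definition Eco :: "nat => nat => complex" where
 "Eco n k = (if n < 2 then 0 else Hco (n - 2) k) - (if n = 0 then 0 else of_nat k * Hco (n - 1) k)"

lemma Hco_step: "of_nat (k + 2) ^ 2 * Hco n (k + 2) = of_nat k ^ 2 * Hco n k + 4 * Eco n k"
proof (cases "even k")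
 case True
 then obtain l where l: "k = 2 * l" by auto
 have "of_nat (k + 2) ^ 2 * Hco n (k + 2) = 4 * (of_nat (Suc l) ^ 2 * fps_nth (Bfps (Suc l)) n)"
  by (simp add: l Hco_def power2_eq_square algebra_simps)
 also have "... = of_nat k ^ 2 * Hco n k + 4 * Eco n k"
  unfolding Bfps_Suc by (simp add: l Hco_def Eco_def power2_eq_square algebra_simps)
 finally show ?thesis .
qed (auto simp: Hco_def Eco_def)

text \<open>In terms of series, \<open>theta^2 H = 4 r^2 / (1 - r^2) * (p^2 - p theta) H\<close>.
  Since \<open>4 r / (1 - r^2) = 2 / (1 - r) - 2 / (1 + r)\<close>, the first integration is twice
  the sum over the letters 1 and -1, which the factor \<open>2 (1 + (-1)^(k-m))\<close>
  expresses.\<close>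

lemma Hco_sum: "of_nat k ^ 2 * Hco n k = (SUM m<k. 2 * (1 + (-1) ^ (k - m)) * Eco n m)"
proof (induction k rule: less_induct)
 case (less k)
 consider "k = 0" | "k = 1" | j where "k = j + 2" by (metis One_nat_def add_2_eq_Suc' nat.exhaust)
 then show ?case
 proof cases
  case 3
  have "(SUM m<k. 2 * (1 + (-1) ^ (k - m)) * Eco n m) = (SUM m<j. 2 * (1 + (-1) ^ (k - m)) * Eco n m) + 4 * Eco n j"
   using 3 by (simp add: numeral_2_eq_2)
  also have "(SUM m<j. 2 * (1 + (-1) ^ (k - m)) * Eco n m) = (SUM m<j. 2 * (1 + (-1) ^ (j - m)) * Eco n m)"
   using 3 by (intro sum.cong) (auto simp: Suc_diff_le numeral_2_eq_2)
  also have "... = of_nat j ^ 2 * Hco n j" using less[of j] 3 by simp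
  finally show ?thesis using Hco_step[of j n] 3 by simp
 qed (auto simp: Hco_def)
qed

lemma Hco_0: "Hco 0 k = (if k = 0 then 1 else 0)"
 by (auto simp: Hco_def Bfps_def lncoef_zero)

lemma Hco_1: "Hco 1 k = 0"
 by (auto simp: Hco_def Bfps_def lncoef_zero lncoef_0 fps_mult_nth)

lemma Hco_at_0: "n > 0 ==> Hco n 0 = 0"
proof -
 assume n: "n > 0"
 have "Abs_fps (%i. lncoef i 0) = 1" by (auto simp: fps_eq_iff lncoef_0)
 then show ?thesis using n by (simp add: Hco_def Bfps_def)
qed

text \<open>The effect on Taylor coefficients of integrating \<open>F\<close> times
  \<open>hpl_form x\<close> from 0, the same recursion as in \<open>hpl_coeff\<close>.\<close>

definition fps_prim :: "int => complex fps => complex fps" where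
 "fps_prim x F = Abs_fps (%l. (if x = 0 then fps_nth F l else (SUM m<l. of_int x ^ (l - m) * fps_nth F m)) / of_nat l)"

lemma hpls_fps_primitive:
 assumes "hpls n f" "x : {-1, 0, 1}" "x = 0 ==> n > 0" "f has_fps_expansion F"
 obtains g where "hpls (Suc n) g"
  "g has_fps_expansion fps_prim x F"
proof -
 have "EX F g. f has_fps_expansion F & hpls (Suc n) g & g has_fps_expansion fps_prim x F"
  using assms(1,3)
 proof (induction rule: hpl_span.induct)
  case (word w q)
  have xw: "hpl_word (x # w)" using word assms(2) by (auto simp: hpl_word_Cons)
  have "(%t. of_rat q * hpl w t) has_fps_expansion fps_const (of_rat q) * Abs_fps (hpl_coeff w)"
   by (intro fps_expansion_intros hpl_fps word)
  moreover have "hpls (Suc (length w)) (%t. of_rat q * hpl (x # w) t)"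
   using hpl_span.word[OF xw, of "%_. True" q] by simp
  moreover have "(%t. of_rat q * hpl (x # w) t) has_fps_expansion fps_const (of_rat q) * Abs_fps (hpl_coeff (x # w))"
   by (intro fps_expansion_intros hpl_fps xw)
  moreover have "fps_const (of_rat q) * Abs_fps (hpl_coeff (x # w)) = fps_prim x (fps_const (of_rat q) * Abs_fps (hpl_coeff w))"
   by (rule fps_ext) (simp add: fps_prim_def fps_mult_left_const_nth sum_distrib_left mult_ac)
  ultimately show ?case by (simp del: hpl_coeff.simps) blast
 next
  case (zero n)
  have "fps_prim x 0 = 0" by (rule fps_ext) (simp add: fps_prim_def)
  then show ?case by (intro exI[of _ 0] exI[of _ "%_. 0"]) (auto intro: hpl_span.zero)
 next
  case (add n f g)
  then obtain F1 g1 F2 g2 where *: "f has_fps_expansion F1" "hpls (Suc n) g1" "g1 has_fps_expansion fps_prim x F1"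
   "g has_fps_expansion F2" "hpls (Suc n) g2" "g2 has_fps_expansion fps_prim x F2" by blast
  have "fps_prim x F1 + fps_prim x F2 = fps_prim x (F1 + F2)"
   by (rule fps_ext) (simp add: fps_prim_def sum.distrib distrib_left add_divide_distrib)
  then have "(%t. g1 t + g2 t) has_fps_expansion fps_prim x (F1 + F2)" using has_fps_expansion_add[OF *(3,6)] by simp
  then show ?case using has_fps_expansion_add[OF *(1,4)] hpl_span.add[OF *(2,5)] by blast
 next
  case (cong n f g)
  then obtain F g' where *: "f has_fps_expansion F" "hpls (Suc n) g'" "g' has_fps_expansion fps_prim x F" by blast
  have "eventually (%t. f t = g t) (nhds 0)"
   using eventually_nhds_in_open[OF open_hpl_dom zero_in_hpl_dom] by eventually_elim (rule cong)
  then have "g has_fps_expansion F" using iffD1[OF has_fps_expansion_cong[OF _ refl] *(1)] by blast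
  with * show ?case by blast
 qed
 then obtain F' g where *: "f has_fps_expansion F'" "hpls (Suc n) g" "g has_fps_expansion fps_prim x F'" by blast
 have "F' = F" by (rule fps_expansion_unique_complex[OF *(1) assms(4)])
 with * that show ?thesis by simp
qed

text \<open>Both \<open>H\<close> and \<open>theta H\<close> are carried through the induction. At
  order \<open>n\<close> the source has weight \<open>n - 2\<close>; the letters 1 and -1 give
  \<open>theta H\<close> of weight \<open>n - 1\<close>, and the letter 0 then gives
  \<open>H\<close> of weight \<open>n\<close>. Orders 0 and 1 start the recursion, where the
  truncated \<open>n - 1\<close> is harmless because \<open>theta H\<close> vanishes.\<close>

lemma Hco_hpls:
 "(EX h. hpls n h & h has_fps_expansion Abs_fps (Hco n)) &
 (EX g. hpls (n - 1) g & g has_fps_expansion Abs_fps (%k. of_nat k * Hco n k))"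
proof (induction n rule: less_induct)
 case (less n)
 have z: "(%_. 0) has_fps_expansion Abs_fps (%k. 0)"
  using has_fps_expansion_0 by (metis fps_zero_def)
 consider "n = 0" | "n = 1" | "n >= 2" by linarith
 then show ?case
 proof cases
  case 1
  have "Abs_fps (Hco 0) = 1" by (auto simp: fps_eq_iff Hco_0)
  moreover have "hpls 0 (%_. 1)" using hpl_span_hpl[of "[]" "%_. True"] by simp
  moreover have "(%k. of_nat k * Hco 0 k) = (%k. 0)" by (auto simp: Hco_0)
  ultimately show ?thesis using 1 z hpl_span.zero
   by (intro conjI exI[of _ "%_. 1"] exI[of _ "%_. 0"]) (auto simp: hpl_span.zero)
 next
  case 2
  have H: "Hco 1 = (%k. 0)" by (rule ext) (rule Hco_1)
  show ?thesis unfolding 2 H mult_zero_right using z hpl_span.zero by blast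
 next
  case 3
  obtain h where h: "hpls (n - 2) h" "h has_fps_expansion Abs_fps (Hco (n - 2))" using less[of "n - 2"] 3 by auto
  obtain g where g: "hpls (n - 1 - 1) g" "g has_fps_expansion Abs_fps (%k. of_nat k * Hco (n - 1) k)"
   using less[of "n - 1"] 3 by auto
  have n2: "n - 1 - 1 = n - 2" by simp
  have e: "hpls (n - 2) (%t. h t - g t)" using hpl_span_diff[OF h(1)] g(1) unfolding n2 by blast
  have "(%t. h t - g t) has_fps_expansion Abs_fps (Hco (n - 2)) - Abs_fps (%k. of_nat k * Hco (n - 1) k)"
   by (rule has_fps_expansion_diff[OF h(2) g(2)])
  moreover have "Abs_fps (Hco (n - 2)) - Abs_fps (%k. of_nat k * Hco (n - 1) k) = Abs_fps (Eco n)"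
   using 3 by (auto simp: fps_eq_iff Eco_def)
  ultimately have eE: "(%t. h t - g t) has_fps_expansion Abs_fps (Eco n)" by simp
  obtain g1 where g1: "hpls (Suc (n - 2)) g1" "g1 has_fps_expansion
   fps_prim 1 (Abs_fps (Eco n))"
   by (rule hpls_fps_primitive[OF e _ _ eE, of 1]) auto
  obtain g2 where g2: "hpls (Suc (n - 2)) g2" "g2 has_fps_expansion
   fps_prim (-1) (Abs_fps (Eco n))"
   by (rule hpls_fps_primitive[OF e _ _ eE, of "-1"]) auto
  have n1: "Suc (n - 2) = n - 1" using 3 by simp
  have k: "hpls (n - 1) (%t. of_rat 2 * (g1 t + g2 t))"
   using g1(1) g2(1) unfolding n1 by (intro hpl_span_scale hpl_span.add)
  have "(%t. of_rat 2 * (g1 t + g2 t)) has_fps_expansion fps_const (of_rat 2) *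
   (fps_prim 1 (Abs_fps (Eco n))
   + fps_prim (-1) (Abs_fps (Eco n)))"
   by (intro fps_expansion_intros g1 g2)
  moreover have "fps_const (of_rat 2) *
   (fps_prim 1 (Abs_fps (Eco n))
   + fps_prim (-1) (Abs_fps (Eco n)))
   = Abs_fps (%k. of_nat k * Hco n k)"
  proof (rule fps_ext)
   fix l
   have "(SUM m<l. 2 * (1 + (-1) ^ (l - m)) * Eco n m) = 2 * ((SUM m<l. Eco n m) + (SUM m<l. (-1) ^ (l - m) * Eco n m))"
    by (simp add: sum.distrib sum_distrib_left algebra_simps)
   then have "2 * ((SUM m<l. Eco n m) + (SUM m<l. (-1) ^ (l - m) * Eco n m)) = of_nat l ^ 2 * Hco n l"
    using Hco_sum[of l n] by simp
   then have "2 * ((SUM m<l. Eco n m) / of_nat l + (SUM m<l. (-1) ^ (l - m) * Eco n m) / of_nat l) = of_nat l * Hco n l"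
    by (cases "l = 0") (auto simp: field_simps power2_eq_square)
   then show "fps_nth (fps_const (of_rat 2) *
   (fps_prim 1 (Abs_fps (Eco n))
   + fps_prim (-1) (Abs_fps (Eco n)))) l
   = fps_nth (Abs_fps (%k. of_nat k * Hco n k)) l" by (simp add: fps_prim_def fps_mult_left_const_nth)
  qed
  ultimately have kE: "(%t. of_rat 2 * (g1 t + g2 t)) has_fps_expansion Abs_fps (%k. of_nat k * Hco n k)" by simp
  obtain H where H: "hpls (Suc (n - 1)) H" "H has_fps_expansion fps_prim 0 (Abs_fps (%k. of_nat k * Hco n k))"
   by (rule hpls_fps_primitive[OF k _ _ kE, of 0]) (use 3 in auto)
  have "fps_prim 0 (Abs_fps (%k. of_nat k * Hco n k)) = Abs_fps (Hco n)"
   using Hco_at_0[of n] 3 by (intro fps_ext) (auto simp: fps_prim_def field_simps)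
  then have "H has_fps_expansion Abs_fps (Hco n)" using H(2) by simp
  moreover have "hpls n H" using H(1) 3 by simp
  ultimately show ?thesis using k kE by blast
 qed
qed

definition seg_mean :: "nat => real => real" where
 "seg_mean n r = integral {0..pi} (%x. lpow n (1 + 2 * r * cos x + r^2)) / pi"

lemma seg_quadratic_pos: "0 <= r ==> r < 1 ==> -1 <= c ==> 0 < 1 + 2 * r * c + (r::real)^2"
proof -
 assume a: "0 <= r" "r < 1" "-1 <= c"
 have "r * (-1) <= r * c" by (rule mult_left_mono) (use a in auto)
 moreover have "0 < (1 - r)^2" using a by simp
 ultimately show ?thesis by (simp add: power2_eq_square algebra_simps)
qed

text \<open>\<open>1 + 2 r cos x + r^2\<close> factors as \<open>(1 + z)\<close> times its conjugate
  with \<open>z = r cis x\<close>, so its logarithm splits and Parseval applies to each product of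
  powers.\<close>

lemma seg_mean_sums:
 assumes r: "0 <= r" "r < 1"
 shows "(%k. Hco n k * of_real r ^ k) sums of_real (seg_mean n r)"
proof -
 let ?f = "%i t. of_rat (1 / fact i) * (- hpl [-1] t) ^ i"
 note P = parseval[OF lncoef_sums lncoef_sums r]
 have "(%l. SUM i:{0..n}. lncoef i l * lncoef (n - i) l * of_real r ^ (2 * l)) sums
  (SUM i:{0..n}. integral {0..2 * pi} (%x. ?f i (of_real r * cis x) * ?f (n - i) (of_real r * cis (- x))) / of_real (2 * pi))"
  by (intro sums_sum P(2))
 also have "(SUM i:{0..n}. integral {0..2 * pi} (%x. ?f i (of_real r * cis x) * ?f (n - i) (of_real r * cis (- x))) / of_real (2 * pi))
  = integral {0..2 * pi} (%x. SUM i:{0..n}. ?f i (of_real r * cis x) * ?f (n - i) (of_real r * cis (- x))) / of_real (2 * pi)"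
  unfolding sum_divide_distrib[symmetric] by (subst integral_sum) (auto intro: P(1))
 also have "(%x. SUM i:{0..n}. ?f i (of_real r * cis x) * ?f (n - i) (of_real r * cis (- x)))
  = (%x. of_real (lpow n (1 + 2 * r * cos x + r^2)))"
 proof
  fix x
  define z where "z = of_real r * cis x"
  have zd: "z : hpl_dom" "cnj z : hpl_dom"
   using ball_subset_hpl_dom r by (auto simp: z_def norm_mult)
  have z1: "1 + z \<notin> \<real>\<^sub>\<le>\<^sub>0" using hpl_dom_one_minus[of "- z"] zd by (simp add: hpl_dom_def)
  then have nz: "1 + z ~= 0" by auto
  have cz: "of_real r * cis (- x) = cnj z" by (simp add: z_def cis_cnj)
  have "Ln (cnj (1 + z)) = cnj (Ln (1 + z))" using z1 by (intro cnj_Ln[symmetric]) auto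
  then have "- hpl [-1] z + - hpl [-1] (cnj z) = of_real (2 * Re (Ln (1 + z)))"
   using zd by (simp add: hpl_m1_eq complex_add_cnj)
  also have "2 * Re (Ln (1 + z)) = ln ((cmod (1 + z))^2)" using nz by (simp add: ln_realpow)
  also have "(cmod (1 + z))^2 = 1 + 2 * r * cos x + r^2"
   unfolding cmod_power2 using sin_cos_squared_add[of x] by (simp add: z_def power2_eq_square algebra_simps)
    (metis distrib_left mult.right_neutral power2_eq_square sin_cos_squared_add3)
  finally have s: "- hpl [-1] z + - hpl [-1] (cnj z) = of_real (ln (1 + 2 * r * cos x + r^2))" .
  have "(SUM i:{0..n}. ?f i z * ?f (n - i) (cnj z)) = fps_nth (fps_exp (- hpl [-1] z) * fps_exp (- hpl [-1] (cnj z))) n"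
   by (simp add: fps_mult_nth of_rat_divide of_rat_fact)
  also have "... = of_real (lpow n (1 + 2 * r * cos x + r^2))"
   unfolding fps_exp_add_mult[symmetric] s by (simp add: lpow_def)
  finally show "(SUM i:{0..n}. ?f i (of_real r * cis x) * ?f (n - i) (of_real r * cis (- x))) = of_real (lpow n (1 + 2 * r * cos x + r^2))"
   unfolding cz z_def[symmetric] .
 qed
 also have "integral {0..2 * pi} (%x. complex_of_real (lpow n (1 + 2 * r * cos x + r^2))) / of_real (2 * pi) = of_real (seg_mean n r)"
 proof -
  have "continuous_on {-1..1} (%c. lpow n (1 + 2 * r * c + r^2))"
   using r by (intro continuous_on_lpow continuous_intros seg_quadratic_pos) auto
  from has_integral_of_real[OF integral_cos_symmetric[OF this]]
  have "((%x. complex_of_real (lpow n (1 + 2 * r * cos x + r^2))) has_integral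
   of_real (2 * integral {0..pi} (%x. lpow n (1 + 2 * r * cos x + r^2)))) {0..2 * pi}" .
  then have "integral {0..2 * pi} (%x. complex_of_real (lpow n (1 + 2 * r * cos x + r^2))) = of_real (2 * (pi * seg_mean n r))"
   by (simp add: integral_unique seg_mean_def)
  then show ?thesis by simp
 qed
 finally have "(%l. SUM i:{0..n}. lncoef i l * lncoef (n - i) l * of_real r ^ (2 * l)) sums of_real (seg_mean n r)" .
 moreover have "(SUM i:{0..n}. lncoef i l * lncoef (n - i) l * of_real r ^ (2 * l)) = Hco n (2 * l) * of_real r ^ (2 * l)" for l
  by (simp add: Hco_def Bfps_def fps_mult_nth sum_distrib_right)
 ultimately have "(%l. Hco n (2 * l) * of_real r ^ (2 * l)) sums of_real (seg_mean n r)" by simp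
 then show ?thesis
  by (subst (asm) sums_mono_reindex[where g = "%l. 2 * l"]) (auto simp: strict_mono_def Hco_def elim!: evenE)
qed

lemma seg_mean_hpls: "EX h. hpls n h & (ALL r. 0 <= r --> r < 1 --> h (of_real r) = of_real (seg_mean n r))"
proof -
 obtain h where h: "hpls n h" "h has_fps_expansion Abs_fps (Hco n)" using Hco_hpls by blast
 have "h (of_real r) = of_real (seg_mean n r)" if "0 <= r" "r < 1" for r
  using holomorphic_on_hpl_dom_sums[OF hpl_span_holomorphic[OF h(1)] h(2), of "of_real r"] seg_mean_sums[OF that, of n] that
  by (auto intro: sums_unique2)
 with h(1) show ?thesis by blast
qed

text \<open>For \<open>c = (1 + r)^2 / r\<close> one has
  \<open>c - e = (1 + 2 r cos x + r^2) / r\<close>, so this is the generating series of the mean of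
  \<open>(c - e)^p\<close>. In \<open>seg_ratio_fps\<close> the factor
  \<open>r^(-p) c^(-p) = (1 + r)^(-2p)\<close> appears, and the 1 is the order-0
  subtraction.\<close>

definition seg_fps :: "real => real fps" where
 "seg_fps r = fps_exp (- ln r) * Abs_fps (%n. seg_mean n r)"

definition seg_ratio_fps :: "real => real fps" where
 "seg_ratio_fps r = fps_exp (- (2 * ln (1 + r))) * Abs_fps (%n. seg_mean n r) - 1"

text \<open>The weight \<open>(1 - r) / ((1 + r) r)\<close> is \<open>1/r - 2/(1 + r)\<close>, the
  letters 0 and -1. The averages are already normalised by \<open>pi\<close>, so the weights are
  only \<open>n\<close> and \<open>m\<close>, plus one for the outer integration.\<close>

lemma segment_integral_value:
 assumes int: "(%r. fps_nth (seg_fps r) n * fps_nth (seg_ratio_fps r) m * ((1 - r) / ((1 + r) * r))) integrable_on {0..1}"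
 shows "of_real (integral {0..1} (%r. fps_nth (seg_fps r) n * fps_nth (seg_ratio_fps r) m * ((1 - r) / ((1 + r) * r)))) : hpl_values (n + m + 1)"
proof -
 let ?f = "%r. fps_nth (seg_fps r) n * fps_nth (seg_ratio_fps r) m * ((1 - r) / ((1 + r) * r))"
 obtain h where h: "!!n. hpls n (h n)" "!!n r. 0 <= r ==> r < 1 ==> h n (of_real r) = of_real (seg_mean n r)"
  using seg_mean_hpls by metis
 define A where "A t = (SUM i=0..n. (of_rat (1 / fact i) * (- Ln t) ^ i) * h (n - i) t)" for t
 define B where "B t = (SUM i=0..m. (of_rat (1 / fact i) * (of_rat 2 * hpl [-1] t) ^ i) * h (m - i) t) - (if m = 0 then 1 else 0)" for t
 have A: "hpl_log n A" unfolding A_def[abs_def]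
 proof (intro hpl_log_sum)
  fix i assume i: "i : {0..n}"
  have "hpl_log i (%t. of_rat (1 / fact i) * (- Ln t) ^ i)"
   by (intro hpl_log_scale hpl_log_power hpl_log_minus hpl_log_Ln)
  from hpl_log_mult[OF hpl_log_hpls[OF h(1)[of "n - i"]] this]
  show "hpl_log n (%t. (of_rat (1 / fact i) * (- Ln t) ^ i) * h (n - i) t)" using i by simp
 qed
 have B: "hpl_log m B" unfolding B_def[abs_def]
 proof (intro hpl_log_diff hpl_log_sum hpl_log_const)
  show "hpl_const m (if m = 0 then 1 else 0)" using hpl_const_1 hpl_const_0 by auto
  fix i assume i: "i : {0..m}"
  have "hpl_log i (%t. of_rat (1 / fact i) * (of_rat 2 * hpl [-1] t) ^ i)"
   by (intro hpl_log_scale hpl_log_power hpl_log_word1) auto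
  from hpl_log_mult[OF hpl_log_hpls[OF h(1)[of "m - i"]] this]
  show "hpl_log m (%t. (of_rat (1 / fact i) * (of_rat 2 * hpl [-1] t) ^ i) * h (m - i) t)" using i by simp
 qed
 have cd: "of_real r : cut_dom" if "0 < r" "r < 1" for r :: real
  using that by (simp add: cut_dom_def hpl_dom_def)
 have Ar: "A (of_real r) = of_real (fps_nth (seg_fps r) n)" if "0 < r" "r < 1" for r
  using that h(2) by (simp add: A_def seg_fps_def fps_mult_nth of_rat_divide of_rat_fact Ln_of_real)
 have Br: "B (of_real r) = of_real (fps_nth (seg_ratio_fps r) m)" if r: "0 < r" "r < 1" for r
 proof -
  have "hpl [-1] (of_real r) = - Ln (of_real (1 + r))" using cd[OF r] by (simp add: hpl_m1_eq cut_dom_def)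
  also have "... = - of_real (ln (1 + r))" using r by (subst Ln_of_real) auto
  finally have "hpl [-1] (of_real r) = - of_real (ln (1 + r))" .
  then have "of_rat 2 * hpl [-1] (of_real r) = - (2 * of_real (ln (1 + r)))" by simp
  then show ?thesis unfolding B_def using r h(2)
   by (simp add: seg_ratio_fps_def fps_mult_nth of_rat_divide of_rat_fact)
 qed
 have AB: "hpl_log (n + m) (%t. A t * B t)" by (rule hpl_log_mult[OF B A])
 obtain p0 where p0: "hpl_log (Suc (n + m)) p0"
  "!!t. t : cut_dom ==> (p0 has_field_derivative (A t * B t) * hpl_form 0 t) (at t)"
  by (rule hpl_log_primitive[OF AB, of 0]) auto
 obtain p1 where p1: "hpl_log (Suc (n + m)) p1"
  "!!t. t : cut_dom ==> (p1 has_field_derivative (A t * B t) * hpl_form (-1) t) (at t)"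
  by (rule hpl_log_primitive[OF AB, of "-1"]) auto
 define Ph where "Ph t = p0 t + of_rat 2 * p1 t" for t
 have P: "hpl_log (n + m + 1) Ph" unfolding Ph_def[abs_def]
  using hpl_log.add[OF p0(1) hpl_log_scale[OF p1(1), of 2]] by simp
 have der: "((%r. Ph (of_real r)) has_vector_derivative of_real (?f r)) (at r)" if r: "0 < r" "r < 1" for r
 proof -
  have "(Ph has_field_derivative (A (of_real r) * B (of_real r)) * hpl_form 0 (of_real r) +
   of_rat 2 * ((A (of_real r) * B (of_real r)) * hpl_form (-1) (of_real r))) (at (of_real r))"
   unfolding Ph_def[abs_def] by (intro DERIV_add DERIV_cmult p0 p1 cd r)
  note d = has_vector_derivative_real_field[OF this]
  have f0: "hpl_form 0 (of_real r) = complex_of_real (1 / r)" by (simp add: hpl_form_def)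
  have f1: "2 * hpl_form (-1) (of_real r) = complex_of_real (- (2 / (1 + r)))" by (simp add: hpl_form_def)
  have "1 / r - 2 / (1 + r) = (1 - r) / ((1 + r) * r)" using r by (simp add: field_simps)
  then have "hpl_form 0 (of_real r) + 2 * hpl_form (-1) (of_real r) = (of_real ((1 - r) / ((1 + r) * r)) :: complex)"
   by (simp only: f0 f1 flip: of_real_add) simp
  then have "(A (of_real r) * B (of_real r)) * (hpl_form 0 (of_real r) + 2 * hpl_form (-1) (of_real r)) = of_real (?f r)"
   unfolding Ar[OF r] Br[OF r] by (simp only: of_real_mult)
  then have "(A (of_real r) * B (of_real r)) * hpl_form 0 (of_real r) + of_rat 2 * ((A (of_real r) * B (of_real r)) * hpl_form (-1) (of_real r))
   = of_real (?f r)"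
   by (simp only: distrib_left of_rat_numeral_eq mult_ac)
  then show ?thesis using d by simp
 qed
 have fi: "((%r. complex_of_real (?f r)) has_integral of_real (integral {0..1} ?f)) {0..1}"
  by (rule has_integral_of_real[OF integrable_integral[OF int]])
 obtain l r where lr: "((%r. Ph (of_real r)) ---> l) (at_right 0)" "((%r. Ph (of_real r)) ---> r) (at_left 1)"
  "integral {0..1} (%r. complex_of_real (?f r)) = r - l"
  using improper_FTC[OF zero_less_one has_integral_integrable[OF fi] der] by blast
 have "hpl_const (n + m + 1) (r + - l)"
  by (intro hpl_const.add hpl_const_minus hpl_log_limit_0[OF P lr(1)] hpl_log_limit_1[OF P lr(2)])
 then have "hpl_const (n + m + 1) (of_real (integral {0..1} ?f))" using lr(3) integral_unique[OF fi] by simp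
 from hpl_const_Re[OF this] show ?thesis by simp
qed

section \<open>Power series of the moment integrals\<close>

definition arcM :: "real measure" where "arcM = restrict_space lborel {0<..<pi}"

definition posM :: "real measure" where "posM = restrict_space lborel {0<..}"

definition chord :: "real => real" where "chord th = 2 - 2 * cos th"

lemma space_arcM [simp]: "space arcM = {0<..<pi}" by (simp add: arcM_def space_restrict_space)

lemma space_posM [simp]: "space posM = {0<..}" by (simp add: posM_def space_restrict_space)

lemma sigma_finite_arcM: "sigma_finite_measure arcM"
 unfolding arcM_def by (rule sigma_finite_measure_restrict_space) (auto simp: sigma_finite_lborel)

lemma sigma_finite_posM: "sigma_finite_measure posM"
 unfolding posM_def by (rule sigma_finite_measure_restrict_space) (auto simp: sigma_finite_lborel)

lemma finite_measure_arcM: "finite_measure arcM"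
 by (rule finite_measureI) (simp add: arcM_def emeasure_restrict_space space_restrict_space)

lemma integrable_arcM_const [simp]: "integrable arcM (%_. c :: real)"
 using finite_measure.integrable_const[OF finite_measure_arcM] .

lemma integral_arcM_const [simp]: "(\<integral>th. c \<partial>arcM) = pi * (c::real)"
 by (simp add: arcM_def measure_restrict_space)

lemma measure_arcM [simp]: "measure arcM {0<..<pi} = pi"
 using integral_arcM_const[of 1] by (simp only: Bochner_Integration.lebesgue_integral_const space_arcM) simp

lemma id_arcM: "(%th. th) : borel_measurable arcM"
 unfolding arcM_def by (rule measurable_restrict_space1) simp

lemma borel_arcM: "f : borel \<rightarrow>\<^sub>M N ==> f : arcM \<rightarrow>\<^sub>M N"
 unfolding arcM_def by (rule measurable_restrict_space1) simp

lemma id_posM: "(%c. c) : borel_measurable posM"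
 unfolding posM_def by (rule measurable_restrict_space1) simp

lemma snd_arcM [measurable]: "snd : borel_measurable (N \<Otimes>\<^sub>M arcM)" "fst : borel_measurable (arcM \<Otimes>\<^sub>M N)"
 by (rule measurable_compose[OF measurable_snd id_arcM], rule measurable_compose[OF measurable_fst id_arcM])

lemma snd_posM [measurable]: "snd : borel_measurable (N \<Otimes>\<^sub>M posM)" "fst : borel_measurable (posM \<Otimes>\<^sub>M N)"
 by (rule measurable_compose[OF measurable_snd id_posM], rule measurable_compose[OF measurable_fst id_posM])

lemma chord_measurable [measurable]: "chord : borel_measurable borel"
 unfolding chord_def by measurable

lemma nn_integral_arcM: "f : borel_measurable borel ==> (\<integral>\<^sup>+th. f th \<partial>arcM) = (\<integral>\<^sup>+th. f th * indicator {0<..<pi} th \<partial>lborel)"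
 unfolding arcM_def by (simp add: nn_integral_restrict_space)

lemma nn_integral_posM: "(\<integral>\<^sup>+c. f c \<partial>posM) = (\<integral>\<^sup>+c. f c * indicator {0<..} c \<partial>lborel)"
 unfolding posM_def by (simp add: nn_integral_restrict_space)

lemma chord_bounds: "0 < th ==> th < pi ==> 0 < chord th & chord th < 4"
 using cos_monotone_0_pi[of 0 th] cos_monotone_0_pi[of th pi] by (simp add: chord_def)

lemma sin_ge_third: "0 <= x ==> x <= 2 ==> x / 3 <= sin (x::real)"
proof -
 assume x: "0 <= x" "x <= 2"
 have "\<bar>sin x - x\<bar> <= x ^ 3 / 6"
  using Maclaurin_sin_bound[of x 3] x by (simp add: sin_coeff_def numeral_3_eq_3 fact_numeral)
 moreover have "x ^ 3 <= 4 * x"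
  using mult_right_mono[OF power_mono[of x 2 2] x(1)] x by (simp add: power3_eq_cube power2_eq_square)
 ultimately show ?thesis using abs_ge_minus_self[of "sin x - x"] by linarith
qed

text \<open>\<open>ph\<close> is the angle whose chord is the smaller of \<open>c\<close> and 4.
  Then \<open>c - chord th\<close> is at least \<open>4 sin ((th+ph)/2) sin ((ph-th)/2)\<close>, and
  both sines are at least \<open>(ph - th) / 6\<close>. This quadratic bound is uniform in
  \<open>c\<close>, including \<open>c = 4\<close>, where the difference does vanish to second
  order.\<close>

lemma exists_arc_angle:
 assumes "c > 0"
 obtains ph where "0 < ph" "ph <= pi" "ph <= 3 * sqrt c"
  "!!th. 0 < th ==> th < pi ==> chord th < c ==> th < ph & ((ph - th) / 3)\<^sup>2 <= c - chord th"
proof -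
 have main: "EX ph. 0 < ph & ph <= pi & ph <= 3 * sqrt d &
   (ALL th. 0 < th --> th < pi --> chord th < d --> th < ph & ((ph - th) / 3)\<^sup>2 <= d - chord th)"
  if d: "0 < d" "d <= 4" for d
 proof (intro exI[of _ "arccos (1 - d / 2)"] conjI allI impI)
  let ?ph = "arccos (1 - d / 2)"
  have c: "cos ?ph = 1 - d / 2" using d by (intro cos_arccos) auto
  have b: "0 <= ?ph" "?ph <= pi" using arccos_lbound[of "1 - d / 2"] arccos_ubound[of "1 - d / 2"] d by auto
  moreover have "?ph ~= 0"
  proof
   assume "?ph = 0"
   then have "cos ?ph = 1" by (simp only: cos_zero)
   with c d show False by linarith
  qed
  ultimately show "0 < ?ph" "?ph <= pi" by auto
  have "?ph / 2 / 3 <= sin (?ph / 2)" using b pi_less_4 by (intro sin_ge_third) auto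
  then have "(?ph / 3) <= 2 * sin (?ph / 2)" by simp
  moreover have "(2 * sin (?ph / 2))^2 = d" using c cos_double_sin[of "?ph / 2"] by (simp add: power_mult_distrib)
  ultimately show "?ph <= 3 * sqrt d" using real_le_rsqrt[of "?ph / 3" d] power_mono[of "?ph / 3" "2 * sin (?ph / 2)" 2] b by simp
  fix th assume t: "0 < th" "th < pi" "chord th < d"
  have "cos ?ph < cos th" using t c by (simp add: chord_def)
  then show lt: "th < ?ph" using cos_monotone_0_pi_le[of ?ph th] b t by (meson leD leI less_imp_le)
  let ?v = "(?ph - th) / 2"
  have v: "?v / 3 <= sin ?v" using lt b t pi_less_4 by (intro sin_ge_third) auto
  have "0 <= cos (?ph / 2) * sin (th / 2)" using b t by (intro mult_nonneg_nonneg cos_ge_zero sin_ge_zero) auto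
  then have "sin ?v <= sin ((th + ?ph) / 2)"
   by (simp add: add_divide_distrib diff_divide_distrib sin_add sin_diff algebra_simps)
  then have "(?v / 3) * (?v / 3) <= sin ((th + ?ph) / 2) * sin ?v" using v lt by (intro mult_mono) auto
  moreover have "d - chord th = 2 * (cos th - cos ?ph)" using c by (simp add: chord_def)
  ultimately show "((?ph - th) / 3)^2 <= d - chord th" by (simp add: cos_diff_cos power2_eq_square)
 qed
 show thesis
 proof (cases "c <= 4")
  case True
  then show ?thesis using main[OF assms] that by blast
 next
  case False
  have s: "sqrt 4 <= sqrt c" using False by (intro real_sqrt_le_mono) simp
  from main[of 4] obtain ph where *: "0 < ph" "ph <= pi"
   "!!th. 0 < th ==> th < pi ==> chord th < 4 ==> th < ph & ((ph - th) / 3)\<^sup>2 <= 4 - chord th" by auto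
  show ?thesis
  proof (rule that[OF *(1,2)])
   show "ph <= 3 * sqrt c" using *(2) pi_less_4 s by simp
   fix th assume "0 < th" "th < pi" "chord th < c"
   then show "th < ph & ((ph - th) / 3)\<^sup>2 <= c - chord th" using *(3)[of th] chord_bounds[of th] False by force
  qed
 qed
qed

lemma integral_inverse_sqrt_diff:
 assumes "0 < ph"
 shows "((%th. 1 / sqrt (ph - th)) has_integral 2 * sqrt ph) {0..ph}"
proof -
 have "((%th. 1 / sqrt (ph - th)) has_integral (- 2 * sqrt (ph - ph) - (- 2 * sqrt (ph - 0)))) {0..ph}"
 proof (rule fundamental_theorem_of_calculus_interior)
  show "continuous_on {0..ph} (%th. - 2 * sqrt (ph - th))" by (intro continuous_intros)
  fix th assume "th : {0<..<ph}"
  then have "((%th. - 2 * sqrt (ph - th)) has_real_derivative 1 / sqrt (ph - th)) (at th)"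
   by (auto intro!: derivative_eq_intros simp: field_simps)
  then show "((%th. - 2 * sqrt (ph - th)) has_vector_derivative 1 / sqrt (ph - th)) (at th)"
   by (simp add: has_real_derivative_iff_has_vector_derivative)
 qed (use assms in auto)
 then show ?thesis by simp
qed

text \<open>A common majorant for the negative powers that occur; the exponent 1/4 fixes the radius
  1/4 of the series in \<open>p\<close>.\<close>

definition arc_weight :: "real => real => real" where
 "arc_weight c th = (if chord th < c then (c - chord th) powr (- 1/4) else 0)"

lemma arc_weight_measurable [measurable]: "case_prod arc_weight : borel_measurable (borel \<Otimes>\<^sub>M borel)"
 "arc_weight c : borel_measurable borel"
 unfolding arc_weight_def by measurable

lemma arc_weight_nonneg: "0 <= arc_weight c th"
 by (simp add: arc_weight_def)

text \<open>The weight is at most \<open>sqrt 3 / sqrt (ph - th)\<close>, with integral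
  \<open>2 sqrt (3 ph)\<close>. The bound \<open>ph <= 3 sqrt c\<close> gives decay at
  \<open>c = 0\<close>, and \<open>ph <= pi\<close> with \<open>3 pi < 3.5^2\<close> gives the
  constant 7.\<close>

lemma arc_weight:
 assumes c: "c > 0"
 shows "integrable arcM (arc_weight c)" "(\<integral>th. arc_weight c th \<partial>arcM) <= 6 * c powr (1/4)" "(\<integral>th. arc_weight c th \<partial>arcM) <= 7"
proof -
 obtain ph where p: "0 < ph" "ph <= pi" "ph <= 3 * sqrt c"
  "!!th. 0 < th ==> th < pi ==> chord th < c ==> th < ph & ((ph - th) / 3)\<^sup>2 <= c - chord th"
  using exists_arc_angle[OF c] by metis
 define B where "B = 2 * (sqrt 3 * sqrt ph)"
 have ptw: "arc_weight c th <= sqrt 3 * (1 / sqrt (ph - th))" "th < ph" if "0 < th" "th < pi" "chord th < c" for th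
 proof -
  from p(4)[OF that] have *: "th < ph" "((ph - th) / 3)^2 <= c - chord th" by auto
  then have "(c - chord th) powr (- 1/4) <= (((ph - th) / 3)^2) powr (- 1/4)"
   by (intro powr_mono2') auto
  also have "... = ((ph - th) / 3) powr (- (1/2))"
   using * by (simp add: powr_powr flip: powr_numeral)
  also have "... = sqrt 3 * (1 / sqrt (ph - th))"
   using * by (simp add: powr_minus powr_half_sqrt real_sqrt_divide field_simps)
  finally show "arc_weight c th <= sqrt 3 * (1 / sqrt (ph - th))" using that by (simp add: arc_weight_def)
  show "th < ph" by fact
 qed
 have hi: "((%th. sqrt 3 * (1 / sqrt (ph - th))) has_integral sqrt 3 * (2 * sqrt ph)) {0..ph}"
  by (rule has_integral_mult_right[OF integral_inverse_sqrt_diff[OF p(1)]])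
 have nn: "(\<integral>\<^sup>+th. ennreal (arc_weight c th) \<partial>arcM) <= ennreal B"
 proof -
  have "(\<integral>\<^sup>+th. ennreal (arc_weight c th) \<partial>arcM) = (\<integral>\<^sup>+th. ennreal (arc_weight c th) * indicator {0<..<pi} th \<partial>lborel)"
   by (rule nn_integral_arcM) measurable
  also have "... <= (\<integral>\<^sup>+th. ennreal (sqrt 3 * (1 / sqrt (ph - th))) * indicator {0..ph} th \<partial>lborel)"
  proof (intro nn_integral_mono)
   fix th
   show "ennreal (arc_weight c th) * indicator {0<..<pi} th <= ennreal (sqrt 3 * (1 / sqrt (ph - th))) * indicator {0..ph} th"
    using ptw[of th] by (cases "0 < th & th < pi & chord th < c") (auto intro!: ennreal_leI simp: arc_weight_def indicator_def)
  qed
  also have "... = ennreal (sqrt 3 * (2 * sqrt ph))"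
   by (rule nn_integral_has_integral_lebesgue'[OF _ hi]) auto
  finally show ?thesis by (simp add: B_def mult_ac)
 qed
 show int: "integrable arcM (arc_weight c)"
 proof (rule integrableI_nonneg)
  show "arc_weight c : borel_measurable arcM" by (rule borel_arcM[OF arc_weight_measurable(2)])
  show "AE th in arcM. 0 <= arc_weight c th" by (simp add: arc_weight_nonneg)
  show "(\<integral>\<^sup>+th. ennreal (arc_weight c th) \<partial>arcM) < \<infinity>" using nn by (simp add: le_less_trans ennreal_less_top)
 qed
 have le: "(\<integral>th. arc_weight c th \<partial>arcM) <= B"
 proof -
  have "ennreal (\<integral>th. arc_weight c th \<partial>arcM) <= ennreal B"
   using nn nn_integral_eq_integral[OF int] arc_weight_nonneg by simp
  then show ?thesis using p(1) by (subst (asm) ennreal_le_iff) (auto simp: B_def)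
 qed
 have "sqrt ph <= sqrt (3 * sqrt c)" using p by (intro real_sqrt_le_mono)
 also have "... = sqrt 3 * c powr (1/4)" using c by (simp add: real_sqrt_mult powr_powr flip: powr_half_sqrt)
 finally have "sqrt 3 * sqrt ph <= sqrt 3 * (sqrt 3 * c powr (1/4))" by (intro mult_left_mono) auto
 then have "sqrt 3 * sqrt ph <= 3 * c powr (1/4)" by (simp add: mult.assoc[symmetric])
 then have "B <= 6 * c powr (1/4)" unfolding B_def by linarith
 with le show "(\<integral>th. arc_weight c th \<partial>arcM) <= 6 * c powr (1/4)" by simp
 have "B = 2 * sqrt (3 * ph)" by (simp add: B_def real_sqrt_mult)
 also have "... <= 2 * sqrt (3.5^2)" using p(2) pi_less_4 by (intro mult_left_mono real_sqrt_le_mono) (auto simp: power2_eq_square)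
 finally show "(\<integral>th. arc_weight c th \<partial>arcM) <= 7" using le by simp
qed

text \<open>One exponential moment controls everything: each term of the exponential series of
  \<open>abs f / 4\<close> is at most \<open>W\<close>, so the moments grow at most like
  \<open>4^n\<close> and the series in \<open>p\<close> may be integrated termwise. The guard
  \<open>S\<close> becomes the condition that the chord lies below the level.\<close>

lemma exp_moment_expansion:
 fixes f W :: "'a => real"
 assumes [measurable]: "f : borel_measurable M" "Measurable.pred M S"
  and W: "integrable M W" "!!x. x : space M ==> 0 <= W x"
   "!!x. x : space M ==> S x ==> exp (\<bar>f x\<bar> / 4) <= W x"
 shows "integrable M (%x. if S x then f x ^ n / fact n else 0)"
  and "\<bar>\<integral>x. (if S x then f x ^ n / fact n else 0) \<partial>M\<bar> <= 4 ^ n * (\<integral>x. W x \<partial>M)"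
  and "\<bar>p\<bar> <= 1/4 ==> integrable M (%x. if S x then exp (p * f x) else 0)"
  and "\<bar>p\<bar> < 1/4 ==> (%n. p ^ n * (\<integral>x. (if S x then f x ^ n / fact n else 0) \<partial>M)) sums
   (\<integral>x. (if S x then exp (p * f x) else 0) \<partial>M)"
proof -
 let ?g = "%n x. if S x then f x ^ n / fact n else 0"
 have b: "norm (?g n x) <= 4 ^ n * W x" if "x : space M" for n x
 proof (cases "S x")
  case True
  have "(\<bar>f x\<bar> / 4) ^ n / fact n <= W x"
   using power_le_fact_exp[of "\<bar>f x\<bar> / 4" n] W(3)[OF that True] by simp
  then show ?thesis using True by (simp add: power_abs power_divide field_simps)
 qed (use W(2)[OF that] in auto)
 have Wn: "integrable M (%x. 4 ^ n * W x)" for n using W(1) by simp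
 show int: "integrable M (?g n)" for n
 proof (rule Bochner_Integration.integrable_bound[OF Wn[of n]])
  show "AE x in M. norm (?g n x) <= norm (4 ^ n * W x)"
   unfolding real_norm_def[of "4 ^ n * W _"] by (intro AE_I2 order_trans[OF b abs_ge_self])
 qed measurable
 have nint: "(\<integral>x. norm (?g n x) \<partial>M) <= 4 ^ n * (\<integral>x. W x \<partial>M)" for n
  using integral_mono[OF integrable_norm[OF int[of n]] Wn[of n] b] by simp
 then show "\<bar>\<integral>x. ?g n x \<partial>M\<bar> <= 4 ^ n * (\<integral>x. W x \<partial>M)"
  using integral_norm_bound[of M "?g n"] by (simp only: real_norm_def) (meson order_trans)
 {
  assume p: "\<bar>p\<bar> <= 1/4"
  show "integrable M (%x. if S x then exp (p * f x) else 0)"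
  proof (rule Bochner_Integration.integrable_bound[OF W(1)])
   have "norm (if S x then exp (p * f x) else 0) <= norm (W x)" if x: "x : space M" for x
   proof (cases "S x")
    case True
    have "p * f x <= \<bar>p\<bar> * \<bar>f x\<bar>" by (metis abs_ge_self abs_mult)
    also have "... <= \<bar>f x\<bar> / 4" using mult_right_mono[OF p, of "\<bar>f x\<bar>"] by simp
    finally show ?thesis using W(3)[OF x True] True by (simp add: order_trans[OF _ order_trans[OF W(3)[OF x True] abs_ge_self]])
   qed simp
   then show "AE x in M. norm (if S x then exp (p * f x) else 0) <= norm (W x)" by (intro AE_I2)
  qed measurable
 }
 assume p: "\<bar>p\<bar> < 1/4"
 have e: "(%n. p ^ n * ?g n x) sums (if S x then exp (p * f x) else 0)" for x
  using exp_converges[of "p * f x"] by (simp add: power_mult_distrib field_simps)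
 have "(%n. \<integral>x. p ^ n * ?g n x \<partial>M) sums (\<integral>x. (\<Sum>n. p ^ n * ?g n x) \<partial>M)"
 proof (rule sums_integral)
  show "integrable M (%x. p ^ n * ?g n x)" for n using int by simp
  show "AE x in M. summable (%n. norm (p ^ n * ?g n x))"
  proof (intro AE_I2)
   fix x
   show "summable (%n. norm (p ^ n * ?g n x))"
    using summable_norm_exp[of "p * f x"] by (cases "S x") (simp_all add: power_mult_distrib abs_mult power_abs field_simps)
  qed
  show "summable (%n. \<integral>x. norm (p ^ n * ?g n x) \<partial>M)"
  proof (rule summable_comparison_test')
   show "summable (%n. (4 * \<bar>p\<bar>) ^ n * (\<integral>x. W x \<partial>M))" using p by (intro summable_mult2 summable_geometric) auto
   fix n
   have "(\<integral>x. norm (p ^ n * ?g n x) \<partial>M) = \<bar>p\<bar> ^ n * (\<integral>x. norm (?g n x) \<partial>M)"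
    by (simp only: norm_mult integral_mult_right_zero) (simp add: power_abs)
   also have "... <= \<bar>p\<bar> ^ n * (4 ^ n * (\<integral>x. W x \<partial>M))" by (intro mult_left_mono nint) auto
   finally show "norm (\<integral>x. norm (p ^ n * ?g n x) \<partial>M) <= (4 * \<bar>p\<bar>) ^ n * (\<integral>x. W x \<partial>M)"
    by (simp add: power_mult_distrib mult_ac)
  qed
 qed
 moreover have "(\<Sum>n. p ^ n * ?g n x) = (if S x then exp (p * f x) else 0)" for x using e[of x] by (rule sums_unique[symmetric])
 ultimately show "(%n. p ^ n * (\<integral>x. ?g n x \<partial>M)) sums (\<integral>x. (if S x then exp (p * f x) else 0) \<partial>M)"
  by (simp only: integral_mult_right_zero)
qed

definition arc_moment :: "nat => real => real" where
 "arc_moment n c = (\<integral>th. (if chord th < c then lpow n (c - chord th) else 0) \<partial>arcM)"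

text \<open>As the level tends to infinity \<open>1 - chord th / c\<close> tends to 1, so order 0
  tends to \<open>pi\<close>; subtracting this limit gives decay.\<close>

definition ratio_moment :: "nat => real => real" where
 "ratio_moment m c = (\<integral>th. (if chord th < c then lpow m (1 - chord th / c) else 0) \<partial>arcM) - (if m = 0 then pi else 0)"

definition arc_power :: "real => real => real" where
 "arc_power p c = (\<integral>th. (if chord th < c then exp (p * ln (c - chord th)) else 0) \<partial>arcM)"

definition ratio_power :: "real => real => real" where
 "ratio_power p c = (\<integral>th. (if chord th < c then exp (p * ln (1 - chord th / c)) else 0) \<partial>arcM)"

lemma exp_abs_ln_le: "(x::real) > 0 ==> exp (\<bar>ln x\<bar> / 4) <= x powr (1/4) + x powr (- 1/4)"
 by (cases "ln x >= 0") (auto simp: powr_def)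

lemma arc_moment:
 assumes c: "c > 0"
 shows "integrable arcM (%th. if chord th < c then lpow n (c - chord th) else 0)"
  and "\<bar>arc_moment n c\<bar> <= 4 ^ n * (10 * c powr (1/4))"
  and "\<bar>p\<bar> <= 1/4 ==> integrable arcM (%th. if chord th < c then exp (p * ln (c - chord th)) else 0)"
  and "\<bar>p\<bar> < 1/4 ==> (%n. p ^ n * arc_moment n c) sums arc_power p c"
proof -
 define W where "W th = c powr (1/4) + arc_weight c th" for th
 have W: "integrable arcM W" unfolding W_def using arc_weight(1)[OF c] by simp
 have "(\<integral>th. W th \<partial>arcM) = pi * c powr (1/4) + (\<integral>th. arc_weight c th \<partial>arcM)"
  unfolding W_def using arc_weight(1)[OF c] by simp
 also have "... <= 4 * c powr (1/4) + 6 * c powr (1/4)"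
  using arc_weight(2)[OF c] pi_less_4 by (intro add_mono mult_right_mono) auto
 finally have Wi: "(\<integral>th. W th \<partial>arcM) <= 10 * c powr (1/4)" by simp
 have Wb: "exp (\<bar>ln (c - chord th)\<bar> / 4) <= W th" if "th : space arcM" "chord th < c" for th
  using exp_abs_ln_le[of "c - chord th"] powr_mono2[of "1/4" "c - chord th" c] chord_bounds[of th] that
  by (simp add: W_def arc_weight_def)
 have W0: "0 <= W th" for th by (simp add: W_def arc_weight_def)
 have m: "(%th. ln (c - chord th)) : borel_measurable arcM" "Measurable.pred arcM (%th. chord th < c)"
  by (rule borel_arcM, measurable)+
 note * = exp_moment_expansion[OF m W W0 Wb]
 show "integrable arcM (%th. if chord th < c then lpow n (c - chord th) else 0)"
  unfolding lpow_def by (rule *(1)) assumption+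
 have "\<bar>arc_moment n c\<bar> <= 4 ^ n * (\<integral>th. W th \<partial>arcM)"
  unfolding lpow_def arc_moment_def by (rule *(2)) assumption+
 also have "... <= 4 ^ n * (10 * c powr (1/4))" by (intro mult_left_mono Wi) auto
 finally show "\<bar>arc_moment n c\<bar> <= 4 ^ n * (10 * c powr (1/4))" .
 show "\<bar>p\<bar> <= 1/4 ==> integrable arcM (%th. if chord th < c then exp (p * ln (c - chord th)) else 0)"
  by (rule *(3)) assumption+
 show "\<bar>p\<bar> < 1/4 ==> (%n. p ^ n * arc_moment n c) sums arc_power p c"
  unfolding lpow_def arc_moment_def arc_power_def by (rule *(4)) assumption+
qed

text \<open>Decay like \<open>1 / c\<close> makes the later integral against \<open>dc / c\<close>
  converge at infinity. For \<open>c >= 8\<close> the ratio of chord and level is at most 1/2, hence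
  the logarithm is at most \<open>8 / c\<close> in size, and order 0 vanishes exactly. For
  \<open>c < 8\<close> the bound by the arc weight suffices.\<close>

lemma ratio_moment:
 assumes c: "c > 0"
 shows "integrable arcM (%th. if chord th < c then lpow n (1 - chord th / c) else 0)"
  and "\<bar>ratio_moment n c\<bar> <= 4 ^ n * (200 / (1 + c))"
  and "\<bar>p\<bar> <= 1/4 ==> integrable arcM (%th. if chord th < c then exp (p * ln (1 - chord th / c)) else 0)"
  and "\<bar>p\<bar> < 1/4 ==> (%n. p ^ n * ratio_moment n c) sums (ratio_power p c - pi)"
proof -
 define W where "W th = c powr (1/4) * arc_weight c th" for th
 have W: "integrable arcM W" unfolding W_def using arc_weight(1)[OF c] by simp
 have Wi: "(\<integral>th. W th \<partial>arcM) <= c powr (1/4) * 7"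
  unfolding W_def integral_mult_right_zero by (rule mult_left_mono[OF arc_weight(3)[OF c]]) simp
 have rb: "0 < 1 - chord th / c & 1 - chord th / c < 1" if "th : space arcM" "chord th < c" for th
  using chord_bounds[of th] that c by (simp add: field_simps)
 have Wb: "exp (\<bar>ln (1 - chord th / c)\<bar> / 4) <= W th" if t: "th : space arcM" "chord th < c" for th
 proof -
  have "exp (\<bar>ln x\<bar> / 4) = x powr (- 1/4)" if "0 < x" "x < 1" for x :: real
   using that ln_less_zero[of x] by (simp add: powr_def)
  then have "exp (\<bar>ln (1 - chord th / c)\<bar> / 4) = (1 - chord th / c) powr (- 1/4)" using rb[OF t] by blast
  also have "(1 - chord th / c) powr (- 1/4) = ((c - chord th) / c) powr (- 1/4)" using c by (simp add: diff_divide_distrib)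
  also have "... = (c - chord th) powr (- 1/4) * c powr (1/4)"
   using c t by (simp add: powr_divide powr_minus field_simps)
  finally show ?thesis using t by (simp add: W_def arc_weight_def mult_ac)
 qed
 have W0: "0 <= W th" for th by (simp add: W_def arc_weight_def)
 have m: "(%th. ln (1 - chord th / c)) : borel_measurable arcM" "Measurable.pred arcM (%th. chord th < c)"
  by (rule borel_arcM, measurable)+
 note * = exp_moment_expansion[OF m W W0 Wb]
 show int: "integrable arcM (%th. if chord th < c then lpow n (1 - chord th / c) else 0)" for n
  unfolding lpow_def by (rule *(1)) assumption+
 have 1: "\<bar>\<integral>th. (if chord th < c then lpow n (1 - chord th / c) else 0) \<partial>arcM\<bar> <= 4 ^ n * (\<integral>th. W th \<partial>arcM)"
  unfolding lpow_def by (rule *(2)) assumption+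
 show "\<bar>p\<bar> <= 1/4 ==> integrable arcM (%th. if chord th < c then exp (p * ln (1 - chord th / c)) else 0)"
  by (rule *(3)) assumption+
 have "(%n. p ^ n * (\<integral>th. (if chord th < c then lpow n (1 - chord th / c) else 0) \<partial>arcM)) sums ratio_power p c" if "\<bar>p\<bar> < 1/4"
  unfolding lpow_def ratio_power_def by (rule *(4)) (assumption | rule that)+
 from sums_diff[OF this sums_single[of 0 "%_. pi"]]
 show "\<bar>p\<bar> < 1/4 ==> (%n. p ^ n * ratio_moment n c) sums (ratio_power p c - pi)"
  unfolding ratio_moment_def by (simp add: right_diff_distrib if_distrib[of "%x. p ^ _ * x"] cong: if_cong)
 have one: "1 <= (4::real) ^ n" by simp
 show "\<bar>ratio_moment n c\<bar> <= 4 ^ n * (200 / (1 + c))"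
 proof (cases "c < 8")
  case True
  \<comment> \<open>16 is a convenient fourth power above 8. The weight then contributes at most 7 *
    2 = 14, the subtracted \<open>pi\<close> at most 4, and 18 is below 200 / 9.\<close>
  have "c powr (1/4) <= 16 powr (1/4)" using True c by (intro powr_mono2) auto
  also have "(16::real) powr (1/4) = 2" using powr_powr[of 2 4 "1/4"] by simp
  finally have "(\<integral>th. W th \<partial>arcM) <= 14" using Wi by simp
  then have "4 ^ n * (\<integral>th. W th \<partial>arcM) <= 4 ^ n * 14" by (intro mult_left_mono) auto
  have "\<bar>ratio_moment n c\<bar> <= 4 ^ n * 14 + 4"
  proof -
   have "\<bar>if n = 0 then pi else 0\<bar> <= 4" using pi_less_4 by simp
   with abs_triangle_ineq4[of "\<integral>th. (if chord th < c then lpow n (1 - chord th / c) else 0) \<partial>arcM" "if n = 0 then pi else 0"]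
   show ?thesis using 1 \<open>4 ^ n * (\<integral>th. W th \<partial>arcM) <= 4 ^ n * 14\<close> unfolding ratio_moment_def by linarith
  qed
  also have "... <= 4 ^ n * 18" using one by simp
  also have "... <= 4 ^ n * (200 / (1 + c))" using True c by (intro mult_left_mono) (auto simp: field_simps)
  finally show ?thesis .
 next
  case False
  show ?thesis
  proof (cases n)
   case 0
   have "(\<integral>th. (if chord th < c then lpow 0 (1 - chord th / c) else 0) \<partial>arcM) = (\<integral>th. 1 \<partial>arcM)"
    using False chord_bounds by (intro Bochner_Integration.integral_cong refl) force
   then show ?thesis using 0 False by (simp add: ratio_moment_def)
  next
   case (Suc k)
   have "\<bar>if chord th < c then lpow n (1 - chord th / c) else 0\<bar> <= 8 / c" if t: "th : space arcM" for th
   proof -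
    have lt: "chord th < c" using chord_bounds[of th] t False by auto
    define x where "x = 1 - chord th / c"
    have "chord th / c <= 4 / c" using chord_bounds[of th] t c by (intro divide_right_mono) auto
    moreover have "4 / c <= 1/2" using False by (simp add: field_simps)
    ultimately have x: "1/2 <= x" "x < 1" "1 - x <= 4 / c" using rb[OF t lt] unfolding x_def by linarith+
    have "- ln x = ln (1 / x)" using x by (simp add: ln_div)
    also have "... <= 1 / x - 1" using x by (intro ln_le_minus_one) auto
    also have "... = (1 - x) / x" using x by (simp add: field_simps)
    also have "... <= (4 / c) / (1/2)" using x c by (intro frac_le) auto
    finally have y: "- ln x <= 8 / c" by simp
    have y0: "0 <= - ln x" using x by simp
    have "8 / c <= 1" using False by simp
    with y have y1: "- ln x <= 1" by linarith
    have "\<bar>lpow n x\<bar> = (- ln x) ^ n / fact n" using y0 by (simp add: lpow_def power_abs)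
    also have "... <= (- ln x) ^ n / 1" using y0 by (intro divide_left_mono) (auto simp: fact_ge_1)
    also have "... <= - ln x" using power_decreasing[of 1 n "- ln x"] y0 y1 Suc by simp
    finally show ?thesis using lt y by (simp add: x_def)
   qed
   then have "(\<integral>th. norm (if chord th < c then lpow n (1 - chord th / c) else 0) \<partial>arcM) <= (\<integral>th. 8 / c \<partial>arcM)"
    by (intro integral_mono integrable_norm int integrable_arcM_const) auto
   then have "\<bar>ratio_moment n c\<bar> <= pi * (8 / c)"
    using order_trans[OF integral_norm_bound[of arcM "%th. if chord th < c then lpow n (1 - chord th / c) else 0"]] Suc
    unfolding ratio_moment_def integral_arcM_const by (simp only: real_norm_def nat.distinct if_False diff_zero)
   also have "... <= 4 * (8 / c)" using pi_less_4 c by (intro mult_right_mono) auto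
   also have "... <= 1 * (200 / (1 + c))" using False c by (simp add: field_simps)
   also have "... <= 4 ^ n * (200 / (1 + c))" using one c by (intro mult_right_mono) auto
   finally show ?thesis .
  qed
 qed
qed

lemma arc_measurable [measurable]:
 "arc_moment n : borel_measurable borel" "ratio_moment n : borel_measurable borel"
 "arc_power p : borel_measurable borel" "ratio_power p : borel_measurable borel"
proof -
 note m = sigma_finite_measure.borel_measurable_lebesgue_integral[OF sigma_finite_arcM]
 have [measurable]: "(%x. chord (snd x)) : borel_measurable (borel \<Otimes>\<^sub>M arcM)"
  by (rule measurable_compose[OF snd_arcM(1) chord_measurable])
 show "arc_moment n : borel_measurable borel" unfolding arc_moment_def[abs_def]
  by (rule m) (unfold split_beta', measurable)
 show "ratio_moment n : borel_measurable borel" unfolding ratio_moment_def[abs_def]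
  by (rule borel_measurable_diff, rule m) (unfold split_beta', measurable)
 show "arc_power p : borel_measurable borel" unfolding arc_power_def[abs_def]
  by (rule m) (unfold split_beta', measurable)
 show "ratio_power p : borel_measurable borel" unfolding ratio_power_def[abs_def]
  by (rule m) (unfold split_beta', measurable)
qed

lemma borel_posM: "f : borel \<rightarrow>\<^sub>M N ==> f : posM \<rightarrow>\<^sub>M N"
 unfolding posM_def by (rule measurable_restrict_space1) simp

lemma integrable_pos_weight: "integrable posM (%c. c powr (- 3/4) / (1 + c))"
proof (rule integrableI_nonneg)
 show "(%c. c powr (- 3/4) / (1 + c)) : borel_measurable posM" by (rule borel_posM) measurable
 show "AE c in posM. 0 <= c powr (- 3/4) / (1 + c)" by (rule AE_I2) auto
 have h1: "((%c. c powr (- 3/4)) has_integral 1 powr (- 3/4 + 1) / (- 3/4 + 1)) {0..1::real}"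
  by (rule has_integral_powr_from_0) auto
 have h2: "((%c. c powr (- 7/4)) has_integral - (1 powr (- 7/4 + 1)) / (- 7/4 + 1)) {1::real..}"
  by (rule has_integral_powr_to_inf) auto
 have "(\<integral>\<^sup>+c. ennreal (c powr (- 3/4) / (1 + c)) \<partial>posM) <=
  (\<integral>\<^sup>+c. ennreal (c powr (- 3/4)) * indicator {0..1} c + ennreal (c powr (- 7/4)) * indicator {1..} c \<partial>lborel)"
  unfolding nn_integral_posM
 proof (intro nn_integral_mono)
  fix c :: real
  have "c powr (- 3/4) / (1 + c) <= c powr (- 7/4)" if "1 <= c"
  proof -
   have "c powr (- 3/4) / (1 + c) <= c powr (- 3/4) / c" using that by (intro divide_left_mono) auto
   also have "... = c powr (- 3/4 - 1)" using that by (simp only: powr_diff) simp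
   finally show ?thesis by simp
  qed
  moreover have "c powr (- 3/4) / (1 + c) <= c powr (- 3/4)" if "0 < c"
   using that by (simp add: divide_le_eq mult_le_cancel_left1)
  ultimately have "ennreal (c powr (- 3/4) / (1 + c)) * indicator {0<..} c <=
   (if c <= 1 then ennreal (c powr (- 3/4)) * indicator {0..1} c else ennreal (c powr (- 7/4)) * indicator {1..} c)"
   by (auto simp: indicator_def intro!: ennreal_leI)
  then show "ennreal (c powr (- 3/4) / (1 + c)) * indicator {0<..} c <=
   ennreal (c powr (- 3/4)) * indicator {0..1} c + ennreal (c powr (- 7/4)) * indicator {1..} c"
   by (rule order_trans) (auto intro: add_increasing add_increasing2)
 qed
 also have "... = (\<integral>\<^sup>+c. ennreal (c powr (- 3/4)) * indicator {0..1} c \<partial>lborel) + (\<integral>\<^sup>+c. ennreal (c powr (- 7/4)) * indicator {1..} c \<partial>lborel)"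
  by (rule nn_integral_add) measurable
 also have "... < \<infinity>"
  using nn_integral_has_integral_lebesgue'[OF _ h1] nn_integral_has_integral_lebesgue'[OF _ h2] by simp
 finally show "(\<integral>\<^sup>+c. ennreal (c powr (- 3/4) / (1 + c)) \<partial>posM) < \<infinity>" .
qed

text \<open>The coefficient of \<open>p^n q^m\<close> in the integral over all levels; the kernel
  identity will only determine the sums with \<open>n + m\<close> fixed.\<close>

definition cross_moment :: "nat => nat => real" where
 "cross_moment n m = (\<integral>c. arc_moment n c * ratio_moment m c / c \<partial>posM)"

lemma cross_moment_integrable: "integrable posM (%c. arc_moment n c * ratio_moment m c / c)"
 and cross_moment_bound: "c > 0 ==> \<bar>arc_moment n c * ratio_moment m c / c\<bar> <= 4 ^ (n + m) * (2000 * (c powr (- 3/4) / (1 + c)))"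
proof -
 show b: "\<bar>arc_moment n c * ratio_moment m c / c\<bar> <= 4 ^ (n + m) * (2000 * (c powr (- 3/4) / (1 + c)))" if c: "c > 0" for c
 proof -
  have "\<bar>arc_moment n c * ratio_moment m c / c\<bar> = \<bar>arc_moment n c\<bar> * \<bar>ratio_moment m c\<bar> / c"
   using c by (simp add: abs_mult)
  also have "... <= (4 ^ n * (10 * c powr (1/4))) * (4 ^ m * (200 / (1 + c))) / c"
   using c by (intro divide_right_mono mult_mono arc_moment(2) ratio_moment(2)) auto
  also have "... = 4 ^ (n + m) * (2000 * ((c powr (1/4) / c) / (1 + c)))" by (simp add: power_add mult_ac)
  also have "c powr (1/4) / c = c powr (1/4 - 1)" using c by (simp only: powr_diff) simp
  finally show ?thesis by simp
 qed
 show "integrable posM (%c. arc_moment n c * ratio_moment m c / c)"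
 proof (rule Bochner_Integration.integrable_bound)
  show "integrable posM (%c. 4 ^ (n + m) * (2000 * (c powr (- 3/4) / (1 + c))))"
   by (intro integrable_mult_right integrable_pos_weight)
  show "(%c. arc_moment n c * ratio_moment m c / c) : borel_measurable posM" by (rule borel_posM) measurable
  show "AE c in posM. norm (arc_moment n c * ratio_moment m c / c) <= norm (4 ^ (n + m) * (2000 * (c powr (- 3/4) / (1 + c))))"
   unfolding real_norm_def by (intro AE_I2 order_trans[OF b abs_ge_self]) simp
 qed
qed

lemma summable_Suc_geometric: "\<bar>x\<bar> < 1 ==> summable (%k. real (Suc k) * x ^ k)"
 using geometric_deriv_sums[of x] by (simp add: sums_iff)

text \<open>A Cauchy product for each level, then termwise integration: order \<open>k\<close> has
  \<open>k + 1\<close> terms, each at most \<open>4^k\<close> times the same integrable weight, so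
  the series converges for \<open>abs p < 1/4\<close>.\<close>

lemma cross_moment_sums:
 assumes p: "\<bar>p\<bar> < 1/4"
 shows "integrable posM (%c. arc_power p c * (ratio_power p c - pi) / c)"
  and "(%k. p ^ k * (SUM i<=k. cross_moment i (k - i))) sums (\<integral>c. arc_power p c * (ratio_power p c - pi) / c \<partial>posM)"
proof -
 define I where "I = (\<integral>c. 2000 * (c powr (- 3/4) / (1 + c)) \<partial>posM)"
 let ?h = "%k c. p ^ k * (SUM i<=k. arc_moment i c * ratio_moment (k - i) c / c)"
 have b: "norm (?h k c) <= real (Suc k) * (4 * \<bar>p\<bar>) ^ k * (2000 * (c powr (- 3/4) / (1 + c)))" if c: "c > 0" for k c
 proof -
  have "\<bar>SUM i<=k. arc_moment i c * ratio_moment (k - i) c / c\<bar> <= (SUM i<=k. 4 ^ k * (2000 * (c powr (- 3/4) / (1 + c))))"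
  proof (intro order_trans[OF sum_abs] sum_mono)
   fix i assume "i : {..k}"
   then show "\<bar>arc_moment i c * ratio_moment (k - i) c / c\<bar> <= 4 ^ k * (2000 * (c powr (- 3/4) / (1 + c)))"
    using cross_moment_bound[OF c, of i "k - i"] by simp
  qed
  then have "\<bar>p\<bar> ^ k * \<bar>SUM i<=k. arc_moment i c * ratio_moment (k - i) c / c\<bar> <= \<bar>p\<bar> ^ k * (SUM i<=k. 4 ^ k * (2000 * (c powr (- 3/4) / (1 + c))))"
   by (intro mult_left_mono) auto
  then show ?thesis by (simp add: abs_mult power_abs power_mult_distrib mult_ac)
 qed
 have int: "integrable posM (?h k)" for k
  by (intro integrable_mult_right Bochner_Integration.integrable_sum cross_moment_integrable)
 have geo: "summable (%k. real (Suc k) * (4 * \<bar>p\<bar>) ^ k)" using p by (intro summable_Suc_geometric) auto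
 have pt: "(%k. ?h k c) sums (arc_power p c * (ratio_power p c - pi) / c)" if c: "c > 0" for c
 proof -
  have g: "summable (%n. (4 * \<bar>p\<bar>) ^ n * C)" for C :: real using p by (intro summable_mult2 summable_geometric) auto
  have "(%k. SUM i<=k. (p ^ i * arc_moment i c) * (p ^ (k - i) * ratio_moment (k - i) c)) sums
    ((\<Sum>k. p ^ k * arc_moment k c) * (\<Sum>k. p ^ k * ratio_moment k c))"
  proof (rule Cauchy_product_sums)
   show "summable (%k. norm (p ^ k * arc_moment k c))"
   proof (rule summable_comparison_test'[OF g[of "10 * c powr (1/4)"]])
    show "norm (norm (p ^ n * arc_moment n c)) <= (4 * \<bar>p\<bar>) ^ n * (10 * c powr (1/4))" for n
     using mult_left_mono[OF arc_moment(2)[OF c, of n], of "\<bar>p\<bar> ^ n"] by (simp add: abs_mult power_abs power_mult_distrib mult_ac)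
   qed
   show "summable (%k. norm (p ^ k * ratio_moment k c))"
   proof (rule summable_comparison_test'[OF g[of "200 / (1 + c)"]])
    show "norm (norm (p ^ n * ratio_moment n c)) <= (4 * \<bar>p\<bar>) ^ n * (200 / (1 + c))" for n
     using mult_left_mono[OF ratio_moment(2)[OF c, of n], of "\<bar>p\<bar> ^ n"] by (simp add: abs_mult power_abs power_mult_distrib mult_ac)
   qed
  qed
  moreover have "(\<Sum>k. p ^ k * arc_moment k c) = arc_power p c" "(\<Sum>k. p ^ k * ratio_moment k c) = ratio_power p c - pi"
   using arc_moment(4)[OF c p] ratio_moment(4)[OF c p] by (simp_all add: sums_iff)
  moreover have "(SUM i<=k. (p ^ i * arc_moment i c) * (p ^ (k - i) * ratio_moment (k - i) c)) = p ^ k * (SUM i<=k. arc_moment i c * ratio_moment (k - i) c)" for k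
   unfolding sum_distrib_left
  proof (intro sum.cong refl)
   fix i assume "i : {..k}"
   then have "p ^ k = p ^ i * p ^ (k - i)" by (simp flip: power_add)
   then show "(p ^ i * arc_moment i c) * (p ^ (k - i) * ratio_moment (k - i) c) = p ^ k * (arc_moment i c * ratio_moment (k - i) c)" by simp
  qed
  ultimately have "(%k. p ^ k * (SUM i<=k. arc_moment i c * ratio_moment (k - i) c)) sums (arc_power p c * (ratio_power p c - pi))" by simp
  from sums_divide[OF this, of c] show ?thesis by (simp flip: sum_divide_distrib)
 qed
 have ae: "AE c in posM. summable (%k. norm (?h k c))"
 proof (rule AE_I2)
  fix c assume "c : space posM"
  then have c: "c > 0" by simp
  show "summable (%k. norm (?h k c))"
   by (rule summable_comparison_test'[OF summable_mult2[OF geo]]) (simp only: real_norm_def abs_idempotent, rule b[OF c, unfolded real_norm_def])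
 qed
 have sm: "summable (%k. \<integral>c. norm (?h k c) \<partial>posM)"
 proof (rule summable_comparison_test'[OF summable_mult2[OF geo, of I]])
  fix k
  have "(\<integral>c. norm (?h k c) \<partial>posM) <= (\<integral>c. real (Suc k) * (4 * \<bar>p\<bar>) ^ k * (2000 * (c powr (- 3/4) / (1 + c))) \<partial>posM)"
   using b by (intro integral_mono integrable_norm int integrable_mult_right integrable_pos_weight) auto
  then show "norm (\<integral>c. norm (?h k c) \<partial>posM) <= real (Suc k) * (4 * \<bar>p\<bar>) ^ k * I"
   unfolding integral_mult_right_zero I_def by simp
 qed
 have ptc: "(\<Sum>k. ?h k c) = arc_power p c * (ratio_power p c - pi) / c" if "c : space posM" for c
  using pt[of c] that by (simp add: sums_iff)
 show "integrable posM (%c. arc_power p c * (ratio_power p c - pi) / c)"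
  by (rule iffD1[OF Bochner_Integration.integrable_cong[OF refl ptc] integrable_suminf[OF int ae sm]])
 have "(%k. \<integral>c. ?h k c \<partial>posM) sums (\<integral>c. (\<Sum>k. ?h k c) \<partial>posM)"
  by (rule sums_integral[OF int ae sm])
 also have "(%k. \<integral>c. ?h k c \<partial>posM) = (%k. p ^ k * (SUM i<=k. cross_moment i (k - i)))"
  unfolding cross_moment_def integral_mult_right_zero
  by (intro ext arg_cong2[where f = "(*)"] refl Bochner_Integration.integral_sum cross_moment_integrable)
 also have "(\<integral>c. (\<Sum>k. ?h k c) \<partial>posM) = (\<integral>c. arc_power p c * (ratio_power p c - pi) / c \<partial>posM)"
  by (intro Bochner_Integration.integral_cong refl ptc)
 finally show "(%k. p ^ k * (SUM i<=k. cross_moment i (k - i))) sums (\<integral>c. arc_power p c * (ratio_power p c - pi) / c \<partial>posM)" .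
qed

section \<open>The kernel identity\<close>

definition qco :: "real => nat => real" where "qco s n = pochhammer s n / fact n"

lemma qco_nonneg: "s > 0 ==> 0 <= qco s n"
 by (simp add: qco_def pochhammer_nonneg)

lemma qco_sums: "\<bar>w\<bar> < 1 ==> (%n. qco s n * w ^ n) sums (1 - w) powr (- s)"
proof -
 assume w: "\<bar>w\<bar> < 1"
 have "(- s gchoose n) * (- w) ^ n = ((- 1) ^ n * (- 1) ^ n) * (qco s n * w ^ n)" for n
  by (simp only: gbinomial_pochhammer power_minus[of w] qco_def minus_minus) simp
 then have "(- s gchoose n) * (- w) ^ n = qco s n * w ^ n" for n by (simp flip: power_mult_distrib)
 then show ?thesis using gen_binomial_real[of "- w" "- s"] w by simp
qed

lemma qco_complex_sums:
 "cmod w < 1 ==> (%n. complex_of_real ((-1) ^ n * qco s n) * w ^ n) sums ((1 + w) powr (- of_real s))"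
 using gen_binomial_complex[of w "- of_real s"]
 by (simp add: qco_def gbinomial_pochhammer pochhammer_of_real)

text \<open>Parseval for \<open>(1 + z)^(-s)\<close>: the average is the hypergeometric series
  2F1(s, s; 1; r^2).\<close>

lemma qco_square_sums:
 assumes r: "0 <= r" "r < 1"
 shows "(%x. exp (- s * ln (1 + 2 * r * cos x + r^2))) integrable_on {0..2 * pi}"
  and "(%n. (qco s n)\<^sup>2 * r ^ (2 * n)) sums (integral {0..2 * pi} (%x. exp (- s * ln (1 + 2 * r * cos x + r^2))) / (2 * pi))"
proof -
 note P = parseval[OF qco_complex_sums[of _ s] qco_complex_sums[of _ s] r]
 have q: "(1 + of_real r * cis x) powr (- of_real s) * (1 + of_real r * cis (- x)) powr (- of_real s)
   = complex_of_real (exp (- s * ln (1 + 2 * r * cos x + r^2)))" for x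
 proof -
  define z where "z = 1 + of_real r * cis x"
  have zd: "- (of_real r * cis x) : hpl_dom"
   using ball_subset_hpl_dom r by (auto simp: norm_mult)
  have z1: "z \<notin> \<real>\<^sub>\<le>\<^sub>0" using hpl_dom_one_minus[OF zd] by (simp add: z_def)
  then have nz: "z ~= 0" by auto
  have cz: "1 + of_real r * cis (- x) = cnj z" by (simp add: z_def cis_cnj)
  have "(cmod z)^2 = (1 + r * cos x)^2 + (r * sin x)^2" unfolding cmod_power2 by (simp add: z_def)
  also have "... = 1 + 2 * r * cos x + r^2 * ((sin x)^2 + (cos x)^2)" by algebra
  finally have "(cmod z)^2 = 1 + 2 * r * cos x + r^2 * ((sin x)^2 + (cos x)^2)" .
  then have "1 + 2 * r * cos x + r^2 = (cmod z)^2" by simp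
  then have l: "ln (1 + 2 * r * cos x + r^2) = 2 * Re (Ln z)" using nz by (simp only:) (simp add: ln_realpow)
  have cl: "Ln (cnj z) = cnj (Ln z)" using z1 by (intro cnj_Ln[symmetric]) auto
  have "z powr (- of_real s) * cnj z powr (- of_real s) = exp (- of_real s * (Ln z + cnj (Ln z)))"
   using nz by (simp add: powr_def cl algebra_simps flip: exp_add)
  also have "Ln z + cnj (Ln z) = of_real (2 * Re (Ln z))" by (simp add: complex_add_cnj)
  finally show ?thesis unfolding cz z_def[symmetric] l by (simp add: exp_of_real[symmetric])
 qed
 have i: "(%x. complex_of_real (exp (- s * ln (1 + 2 * r * cos x + r^2)))) integrable_on {0..2 * pi}"
  using P(1) unfolding q .
 have c: "continuous_on {0..2 * pi} (%x. exp (- s * ln (1 + 2 * r * cos x + r^2)))"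
 proof (intro continuous_intros ballI)
  show "1 + 2 * r * cos x + r^2 ~= 0" for x using seg_quadratic_pos[OF r cos_ge_minus_one[of x]] by simp
 qed
 show int: "(%x. exp (- s * ln (1 + 2 * r * cos x + r^2))) integrable_on {0..2 * pi}"
  by (rule integrable_continuous_interval[OF c])
 have "((%x. complex_of_real (exp (- s * ln (1 + 2 * r * cos x + r^2)))) has_integral
  of_real (integral {0..2 * pi} (%x. exp (- s * ln (1 + 2 * r * cos x + r^2))))) {0..2 * pi}"
  by (rule has_integral_of_real[OF integrable_integral[OF int]])
 then have e: "integral {0..2 * pi} (%x. complex_of_real (exp (- s * ln (1 + 2 * r * cos x + r^2)))) =
  of_real (integral {0..2 * pi} (%x. exp (- s * ln (1 + 2 * r * cos x + r^2))))" by (rule integral_unique)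
 have "(%n. complex_of_real ((qco s n)^2 * r ^ (2 * n))) sums
  of_real (integral {0..2 * pi} (%x. exp (- s * ln (1 + 2 * r * cos x + r^2))) / (2 * pi))"
  using P(2) unfolding q e by (simp add: power2_eq_square mult_ac flip: power_mult_distrib)
 then show "(%n. (qco s n)\<^sup>2 * r ^ (2 * n)) sums (integral {0..2 * pi} (%x. exp (- s * ln (1 + 2 * r * cos x + r^2))) / (2 * pi))"
  by (subst (asm) sums_of_real_iff)
qed

lemma Gamma_reflection_real:
 fixes s :: real
 assumes "0 < s" "s < 1"
 shows "Gamma s * Gamma (1 - s) = pi / sin (pi * s)"
proof -
 have "complex_of_real (Gamma s * Gamma (1 - s)) = Gamma (of_real s) * Gamma (1 - of_real s)"
  using Gamma_complex_of_real[of "1 - s"] by (simp add: Gamma_complex_of_real)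
 also have "... = of_real (pi / sin (pi * s))"
  unfolding Gamma_reflection_complex by (simp add: sin_of_real flip: of_real_mult)
 finally show ?thesis by (simp only: of_real_eq_iff)
qed

lemma Beta_qco:
 assumes "0 < s" "s < 1"
 shows "Beta (s + real n) (1 - s) = qco s n * (pi / sin (pi * s))"
proof -
 have "s \<notin> \<int>\<^sub>\<le>\<^sub>0" using assms by (auto elim!: nonpos_Ints_cases)
 then have "pochhammer s n = Gamma (s + real n) / Gamma s" by (rule pochhammer_Gamma)
 moreover have "Gamma s ~= 0" using Gamma_real_pos[OF assms(1)] by simp
 ultimately have "Gamma (s + real n) = pochhammer s n * Gamma s" by (simp add: field_simps)
 then have "Beta (s + real n) (1 - s) = qco s n * (Gamma s * Gamma (1 - s))"
  using Gamma_fact[of n, where 'a = real] by (simp add: Beta_def qco_def add.commute)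
 then show ?thesis by (simp add: Gamma_reflection_real[OF assms])
qed

text \<open>Euler's integral for 2F1(s, s; 1; z). The factor \<open>(1 - z x)^(-s)\<close> is
  expanded into nonnegative terms, and each Beta integral equals \<open>qco s n\<close> times
  \<open>pi / sin (pi s)\<close> by the reflection formula.\<close>

lemma hypergeometric_integral:
 assumes s: "0 < s" "s < 1" and z: "0 <= z" "z < 1" and S: "(%n. (qco s n)\<^sup>2 * z ^ n) sums S"
 shows "(\<integral>\<^sup>+x. ennreal (x powr (s - 1) * (1 - x) powr (- s) * (1 - z * x) powr (- s)) * indicator {0<..<1} x \<partial>lborel)
  = ennreal (pi / sin (pi * s) * S)"
proof -
 let ?g = "%n x. qco s n * z ^ n * (x powr (s + real n - 1) * (1 - x) powr ((1 - s) - 1))"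
 have sin: "0 < sin (pi * s)" using s by (intro sin_gt_zero) auto
 have "(\<integral>\<^sup>+x. ennreal (x powr (s - 1) * (1 - x) powr (- s) * (1 - z * x) powr (- s)) * indicator {0<..<1} x \<partial>lborel)
  = (\<integral>\<^sup>+x. (\<Sum>n. ennreal (?g n x) * indicator {0<..<1} x) \<partial>lborel)"
 proof (intro nn_integral_cong)
  fix x :: real
  show "ennreal (x powr (s - 1) * (1 - x) powr (- s) * (1 - z * x) powr (- s)) * indicator {0<..<1} x = (\<Sum>n. ennreal (?g n x) * indicator {0<..<1} x)"
  proof (cases "0 < x & x < 1")
   case True
   have "z * x < 1 * 1" using True z by (intro mult_strict_mono) auto
   then have "(%n. qco s n * (z * x) ^ n) sums (1 - z * x) powr (- s)"
    using True z by (intro qco_sums) auto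
   from sums_mult[OF this, of "x powr (s - 1) * (1 - x) powr (- s)"]
   have "(%n. ?g n x) sums (x powr (s - 1) * (1 - x) powr (- s) * (1 - z * x) powr (- s))"
    using True by (simp add: power_mult_distrib powr_add powr_diff powr_realpow mult_ac)
   then have "(\<Sum>n. ennreal (?g n x)) = ennreal (x powr (s - 1) * (1 - x) powr (- s) * (1 - z * x) powr (- s))"
    using z qco_nonneg[OF s(1)] by (intro suminf_ennreal_eq) auto
   then show ?thesis using True by simp
  qed auto
 qed
 also have "... = (\<Sum>n. \<integral>\<^sup>+x. ennreal (?g n x) * indicator {0<..<1} x \<partial>lborel)"
  by (rule nn_integral_suminf) measurable
 also have "... = (\<Sum>n. ennreal (pi / sin (pi * s) * ((qco s n)^2 * z ^ n)))"
 proof (intro suminf_cong)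
  fix n
  have "((%x. qco s n * z ^ n * (x powr (s + real n - 1) * (1 - x) powr ((1 - s) - 1))) has_integral
   qco s n * z ^ n * Beta (s + real n) (1 - s)) {0..1}"
   using s by (intro has_integral_mult_right has_integral_Beta_real) auto
  then have "(\<integral>\<^sup>+x. ennreal (?g n x) * indicator {0..1} x \<partial>lborel) = ennreal (qco s n * z ^ n * Beta (s + real n) (1 - s))"
   using qco_nonneg[OF s(1)] z by (intro nn_integral_has_integral_lebesgue') auto
  moreover have "(\<integral>\<^sup>+x. ennreal (?g n x) * indicator {0<..<1} x \<partial>lborel) = (\<integral>\<^sup>+x. ennreal (?g n x) * indicator {0..1} x \<partial>lborel)"
   by (intro nn_integral_cong_AE eventually_mono[OF eventually_conj[OF AE_lborel_singleton[of 0] AE_lborel_singleton[of 1]]])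
    (auto simp: indicator_def)
  ultimately show "(\<integral>\<^sup>+x. ennreal (?g n x) * indicator {0<..<1} x \<partial>lborel) = ennreal (pi / sin (pi * s) * ((qco s n)^2 * z ^ n))"
   unfolding Beta_qco[OF s] by (simp add: power2_eq_square mult_ac)
 qed
 also have "... = ennreal (pi / sin (pi * s) * S)"
  using sums_mult[OF S, of "pi / sin (pi * s)"] sin z by (intro suminf_ennreal_eq) auto
 finally show ?thesis .
qed

definition quad :: "real => real => real => real" where
 "quad e e' x = e + e' + 2 * sqrt (e * e') * cos x"

text \<open>The symmetric integrand \<open>((c-e)(c-e')/c)^p / c\<close>, written so that it splits
  into an arc factor in \<open>e\<close> and a ratio factor in \<open>e'\<close>.\<close>

definition kern :: "real => real => real => real => real" where
 "kern p e e' c = (if e < c & e' < c then exp (p * ln (c - e)) * exp (p * ln (1 - e' / c)) / c else 0)"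

text \<open>An integral over a full period without normalisation, hence the factor
  \<open>1 / (2 sin (pi s))\<close> in place of \<open>pi / sin (pi s)\<close> in the kernel
  identity.\<close>

definition quad_mean :: "real => real => real => ennreal" where
 "quad_mean p e e' = (\<integral>\<^sup>+x. ennreal (exp (p * ln (quad e e' x))) * indicator {0..2 * pi} x \<partial>lborel)"

lemma kern_commute: "c > 0 ==> 0 <= e ==> 0 <= e' ==> kern p e e' c = kern p e' e c"
proof -
 assume c: "c > 0" "0 <= e" "0 <= e'"
 have "ln (c - e) + ln (1 - e' / c) = ln (c - e') + ln (1 - e / c)" if "e < c" "e' < c"
  using that c by (simp add: diff_divide_distrib[symmetric] ln_div field_simps)
 then show ?thesis by (auto simp: kern_def simp flip: exp_add distrib_left)
qed

text \<open>The substitution \<open>c = e / x\<close> turns the left side into \<open>e^(-s)\<close>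
  times Euler's integral at \<open>z = e' / e\<close>. The right side is the same series by Parseval
  at \<open>r = sqrt z\<close>. The case \<open>e' = 0\<close> is included and later yields the
  two-step term.\<close>

lemma kernel_identity_ordered:
 assumes s: "0 < s" "s < 1" and e: "0 <= e'" "e' < e"
 shows "(\<integral>\<^sup>+c. ennreal (kern (- s) e e' c) \<partial>posM) =
  ennreal (1 / (2 * sin (pi * s))) * quad_mean (- s) e e'"
proof -
 define z where "z = e' / e"
 define r where "r = sqrt z"
 have z: "0 <= z" "z < 1" using e by (auto simp: z_def)
 have r: "0 <= r" "r < 1" "r^2 = z" using z by (auto simp: r_def)
 define S where "S = integral {0..2 * pi} (%x. exp (- s * ln (1 + 2 * r * cos x + r^2))) / (2 * pi)"
 have S: "(%n. (qco s n)\<^sup>2 * z ^ n) sums S"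
  using qco_square_sums(2)[OF r(1,2), of s] by (simp add: S_def power_mult r(3))
 have sin: "0 < sin (pi * s)" using s by (intro sin_gt_zero) auto
 have qe: "quad e e' x = e * (1 + 2 * r * cos x + r^2)" for x
 proof -
  have "sqrt (e * e') = sqrt (e^2 * z)" using e by (simp add: z_def power2_eq_square)
  then have "sqrt (e * e') = e * r" using e by (simp add: real_sqrt_mult r_def)
  then show ?thesis using e by (simp add: quad_def r(3) z_def field_simps)
 qed
 have qx: "exp (- s * ln (quad e e' x)) = e powr (- s) * exp (- s * ln (1 + 2 * r * cos x + r^2))" for x
 proof -
  have "ln (quad e e' x) = ln e + ln (1 + 2 * r * cos x + r^2)"
   unfolding qe using e seg_quadratic_pos[OF r(1,2) cos_ge_minus_one[of x]] by (intro ln_mult_pos) auto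
  then show ?thesis using e by (simp only: distrib_left exp_add powr_def) simp
 qed
 have rhs: "quad_mean (- s) e e' = ennreal (e powr (- s) * (S * (2 * pi)))"
  unfolding quad_mean_def qx
 proof (rule nn_integral_has_integral_lebesgue')
  have "S * (2 * pi) = integral {0..2 * pi} (%x. exp (- s * ln (1 + 2 * r * cos x + r^2)))" by (simp add: S_def)
  then show "((%x. e powr (- s) * exp (- s * ln (1 + 2 * r * cos x + r^2))) has_integral e powr (- s) * (S * (2 * pi))) {0..2 * pi}"
   by (simp only:) (rule has_integral_mult_right[OF integrable_integral[OF qco_square_sums(1)[OF r(1,2)]]])
 qed simp
 have S0: "0 <= S" by (rule sums_le[OF _ sums_zero S]) (use z in auto)
 let ?f = "%c. kern (- s) e e' c"
 let ?h = "%x. x powr (s - 1) * (1 - x) powr (- s) * (1 - z * x) powr (- s)"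
 have H: "(\<integral>\<^sup>+x. ennreal (?h x) * indicator {0<..<1} x \<partial>lborel) = ennreal (pi / sin (pi * s) * S)"
  by (rule hypergeometric_integral[OF s z S])
 have hb: "(%x. ?h x * indicator {0<..<1} x) : borel_measurable borel" by measurable
 have "(\<integral>\<^sup>+x. ennreal (?h x * indicator {0<..<1} x) \<partial>lborel) = ennreal (pi / sin (pi * s) * S)"
  unfolding H[symmetric] by (intro nn_integral_cong) (auto simp: indicator_def)
 then have HI: "integrable lborel (%x. ?h x * indicator {0<..<1} x) & (\<integral>x. ?h x * indicator {0<..<1} x \<partial>lborel) = pi / sin (pi * s) * S"
 proof (rule iffD1[OF nn_integral_eq_integrable, rotated 3])
  show "(%x. ?h x * indicator {0<..<1} x) : borel_measurable lborel" using hb by simp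
  show "AE x in lborel. 0 <= ?h x * indicator {0<..<1} x" by (intro AE_I2) simp
  show "0 <= pi / sin (pi * s) * S" using sin S0 by simp
 qed
 have si: "set_integrable lborel {0<..<1} ?h" using HI by (simp add: set_integrable_def mult_ac)
 have abs_h: "?h absolutely_integrable_on {0<..<1}"
  by (rule nonnegative_absolutely_integrable_1[OF set_borel_integral_eq_integral(1)[OF si]]) simp
 have int_h: "integral {0<..<1} ?h = pi / sin (pi * s) * S"
  using set_borel_integral_eq_integral(2)[OF si] HI by (simp add: set_lebesgue_integral_def mult_ac)
 have ch: "\<bar>- e / x\<^sup>2\<bar> * ?f (e / x) = e powr (- s) * ?h x" if x: "x : {0<..<1}" for x
 proof -
  have x0: "0 < x" "x < 1" "0 < e" using x e by auto
  have "e * x < e * 1" using x0 by (intro mult_strict_left_mono)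
  then have lt: "e < e / x" using x0 by (simp add: less_divide_eq)
  have zx: "z * x < 1 * 1" using x0 z by (intro mult_strict_mono) auto
  have "e / x - e = e * ((1 - x) / x)" using x0 by (simp add: field_simps)
  then have "ln (e / x - e) = ln e + (ln (1 - x) - ln x)" using x0 by (simp only:) (simp add: ln_mult_pos ln_div)
  moreover have "- s * (ln e + (ln (1 - x) - ln x)) = - s * ln e + (- s * ln (1 - x) + s * ln x)" by algebra
  ultimately have l1: "exp (- s * ln (e / x - e)) = e powr (- s) * ((1 - x) powr (- s) * x powr s)"
   using x0 by (simp only: exp_add powr_def) simp
  have "1 - e' / (e / x) = 1 - z * x" by (simp add: z_def)
  then have l2: "exp (- s * ln (1 - e' / (e / x))) = (1 - z * x) powr (- s)" using zx by (simp add: powr_def)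
  have l3: "x powr s = x powr (s - 1) * x" using x0 powr_add[of x "s - 1" 1] by simp
  have "\<bar>- e / x\<^sup>2\<bar> * (X / (e / x)) = X / x" for X using x0 by (simp add: power2_eq_square field_simps)
  then have "\<bar>- e / x\<^sup>2\<bar> * ?f (e / x) = exp (- s * ln (e / x - e)) * exp (- s * ln (1 - e' / (e / x))) / x"
   using lt e unfolding kern_def by simp
  then show ?thesis unfolding l1 l2 l3 using x0 by simp
 qed
 have img: "(%x. e / x) ` {0<..<1} = {e<..}"
 proof (intro equalityI subsetI)
  fix c assume "c : {e<..}"
  then show "c : (%x. e / x) ` {0<..<1}" using e by (intro image_eqI[of _ _ "e / c"]) (auto simp: field_simps)
 qed (use e in "auto simp: field_simps")
 have "?f absolutely_integrable_on (%x. e / x) ` {0<..<1} & integral ((%x. e / x) ` {0<..<1}) ?f = e powr (- s) * (pi / sin (pi * s) * S)"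
 proof (rule iffD1[OF has_absolute_integral_change_of_variables_1'])
  show "((%x. e / x) has_field_derivative - e / x^2) (at x within {0<..<1})" if "x : {0<..<1}" for x
   using that by (auto intro!: derivative_eq_intros simp: power2_eq_square)
  show "inj_on (%x. e / x) {0<..<1}" using e by (auto simp: inj_on_def field_simps)
  have c1: "(%x. \<bar>- e / x\<^sup>2\<bar> * ?f (e / x)) absolutely_integrable_on {0<..<1} \<longleftrightarrow> (%x. e powr (- s) * ?h x) absolutely_integrable_on {0<..<1}"
   by (intro set_integrable_cong refl ch)
  have c2: "integral {0<..<1} (%x. \<bar>- e / x\<^sup>2\<bar> * ?f (e / x)) = integral {0<..<1} (%x. e powr (- s) * ?h x)"
   by (intro integral_cong ch)
  have "(%x. e powr (- s) * ?h x) absolutely_integrable_on {0<..<1}" using abs_h by (rule set_integrable_mult_right)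
  moreover have "integral {0<..<1} (%x. e powr (- s) * ?h x) = e powr (- s) * (pi / sin (pi * s) * S)" by (simp add: int_h)
  ultimately show "(%x. \<bar>- e / x\<^sup>2\<bar> * ?f (e / x)) absolutely_integrable_on {0<..<1} &
   integral {0<..<1} (%x. \<bar>- e / x\<^sup>2\<bar> * ?f (e / x)) = e powr (- s) * (pi / sin (pi * s) * S)"
   unfolding c1 c2 by blast
 qed simp
 then have F: "?f absolutely_integrable_on {e<..}" "integral {e<..} ?f = e powr (- s) * (pi / sin (pi * s) * S)"
  unfolding img by (rule conjunct1, rule conjunct2)
 have "(?f has_integral e powr (- s) * (pi / sin (pi * s) * S)) {e<..}"
  using integrable_integral[OF set_lebesgue_integral_eq_integral(1)[OF F(1)]] unfolding F(2) .
 then have "(\<integral>\<^sup>+c. ennreal (?f c) * indicator {e<..} c \<partial>lborel) = ennreal (e powr (- s) * (pi / sin (pi * s) * S))"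
  using e by (intro nn_integral_has_integral_lebesgue') (simp_all add: kern_def)
 moreover have "(\<integral>\<^sup>+c. ennreal (?f c) \<partial>posM) = (\<integral>\<^sup>+c. ennreal (?f c) * indicator {e<..} c \<partial>lborel)"
  unfolding nn_integral_posM using e by (intro nn_integral_cong) (auto simp: kern_def indicator_def)
 moreover have "e powr (- s) * (pi / sin (pi * s) * S) = 1 / (2 * sin (pi * s)) * (e powr (- s) * (S * (2 * pi)))"
  using sin by (simp add: field_simps)
 ultimately show ?thesis unfolding rhs using sin S0 by (subst ennreal_mult[symmetric]) auto
qed

lemma kernel_identity:
 assumes s: "0 < s" "s < 1" and e: "0 <= e'" "0 <= e" "e ~= e'"
 shows "(\<integral>\<^sup>+c. ennreal (kern (- s) e e' c) \<partial>posM) =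
  ennreal (1 / (2 * sin (pi * s))) * quad_mean (- s) e e'"
proof (cases "e' < e")
 case True
 then show ?thesis by (rule kernel_identity_ordered[OF s e(1)])
next
 case False
 have "(\<integral>\<^sup>+c. ennreal (kern (- s) e e' c) \<partial>posM) = (\<integral>\<^sup>+c. ennreal (kern (- s) e' e c) \<partial>posM)"
  using e by (intro nn_integral_cong) (simp add: kern_commute[of _ e e'])
 moreover have "quad_mean (- s) e e' = quad_mean (- s) e' e" by (simp add: quad_mean_def quad_def mult.commute add.commute)
 ultimately show ?thesis using kernel_identity_ordered[OF s e(2), of e'] False e by simp
qed

lemma kern_measurable [measurable]:
 assumes [measurable]: "f : borel_measurable M" "g : borel_measurable M" "h : borel_measurable M"
 shows "(%x. kern p (f x) (g x) (h x)) : borel_measurable M"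
 unfolding kern_def by measurable

lemma arc_power_nn:
 assumes c: "c > 0" and p: "\<bar>p\<bar> <= 1/4"
 shows "ennreal (arc_power p c) = (\<integral>\<^sup>+th. ennreal (if chord th < c then exp (p * ln (c - chord th)) else 0) \<partial>arcM)"
  and "ennreal (ratio_power p c) = (\<integral>\<^sup>+th. ennreal (if chord th < c then exp (p * ln (1 - chord th / c)) else 0) \<partial>arcM)"
  and "0 <= arc_power p c" "0 <= ratio_power p c"
 unfolding arc_power_def ratio_power_def
 using nn_integral_eq_integral[OF arc_moment(3)[OF c p]] nn_integral_eq_integral[OF ratio_moment(3)[OF c p]]
 by (simp_all add: integral_nonneg)

lemma pair_sigma_finite_arc: "pair_sigma_finite arcM posM"
 by (simp add: pair_sigma_finite_def sigma_finite_arcM sigma_finite_posM)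

text \<open>All integrands are nonnegative, so the level integral can be moved inside by Tonelli
  before any finiteness is known.\<close>

lemma arc_ratio_product:
 assumes p: "\<bar>p\<bar> <= 1/4"
 shows "(\<integral>\<^sup>+c. ennreal (arc_power p c * ratio_power p c / c) \<partial>posM) =
  (\<integral>\<^sup>+th. \<integral>\<^sup>+th'. \<integral>\<^sup>+c. ennreal (kern p (chord th) (chord th') c) \<partial>posM \<partial>arcM \<partial>arcM)"
proof -
 interpret a: sigma_finite_measure arcM by (rule sigma_finite_arcM)
 interpret b: sigma_finite_measure posM by (rule sigma_finite_posM)
 interpret ab: pair_sigma_finite arcM posM by (rule pair_sigma_finite_arc)
 have ch [measurable]: "chord : borel_measurable arcM" by (rule borel_arcM) simp
 have "(\<integral>\<^sup>+c. ennreal (arc_power p c * ratio_power p c / c) \<partial>posM) =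
  (\<integral>\<^sup>+c. \<integral>\<^sup>+th. \<integral>\<^sup>+th'. ennreal (kern p (chord th) (chord th') c) \<partial>arcM \<partial>arcM \<partial>posM)"
 proof (intro nn_integral_cong)
  fix c assume "c : space posM"
  then have c: "c > 0" by simp
  let ?f = "%th. if chord th < c then exp (p * ln (c - chord th)) else 0"
  let ?g = "%th. if chord th < c then exp (p * ln (1 - chord th / c)) else 0"
  have k: "ennreal (kern p (chord th) (chord th') c) = ennreal (?f th / c) * ennreal (?g th')" for th th'
   using c by (subst ennreal_mult[symmetric]) (auto simp: kern_def)
  have "(\<integral>\<^sup>+th'. ennreal (kern p (chord th) (chord th') c) \<partial>arcM) = ennreal (?f th) * ennreal (1 / c * ratio_power p c)" for th
  proof -
   have "(\<integral>\<^sup>+th'. ennreal (kern p (chord th) (chord th') c) \<partial>arcM) = ennreal (?f th / c) * ennreal (ratio_power p c)"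
    unfolding k arc_power_nn(2)[OF c p] by (rule nn_integral_cmult) measurable
   also have "... = ennreal (?f th) * ennreal (1 / c * ratio_power p c)"
    using c arc_power_nn(4)[OF c p] by (simp flip: ennreal_mult)
   finally show ?thesis .
  qed
  then have "(\<integral>\<^sup>+th. \<integral>\<^sup>+th'. ennreal (kern p (chord th) (chord th') c) \<partial>arcM \<partial>arcM) = ennreal (arc_power p c) * ennreal (1 / c * ratio_power p c)"
   unfolding arc_power_nn(1)[OF c p] by (simp only:) (rule nn_integral_multc, measurable)
  then show "ennreal (arc_power p c * ratio_power p c / c) = (\<integral>\<^sup>+th. \<integral>\<^sup>+th'. ennreal (kern p (chord th) (chord th') c) \<partial>arcM \<partial>arcM)"
   using c arc_power_nn(3,4)[OF c p] by (simp flip: ennreal_mult)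
 qed
 also have "... = (\<integral>\<^sup>+th. \<integral>\<^sup>+c. \<integral>\<^sup>+th'. ennreal (kern p (chord th) (chord th') c) \<partial>arcM \<partial>posM \<partial>arcM)"
 proof (rule ab.Fubini')
  have [measurable]: "(%w. chord (fst (fst w))) : borel_measurable ((arcM \<Otimes>\<^sub>M posM) \<Otimes>\<^sub>M arcM)"
   "(%w. chord (snd w)) : borel_measurable ((arcM \<Otimes>\<^sub>M posM) \<Otimes>\<^sub>M arcM)"
   "(%w. snd (fst w)) : borel_measurable ((arcM \<Otimes>\<^sub>M posM) \<Otimes>\<^sub>M arcM)"
   by (rule measurable_compose[OF measurable_compose[OF measurable_fst snd_arcM(2)] chord_measurable]
    measurable_compose[OF snd_arcM(1) chord_measurable] measurable_compose[OF measurable_fst snd_posM(1)])+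
  have "(%w. \<integral>\<^sup>+th'. ennreal (kern p (chord (fst w)) (chord th') (snd w)) \<partial>arcM) : borel_measurable (arcM \<Otimes>\<^sub>M posM)"
   by (rule a.borel_measurable_nn_integral) (unfold split_beta', measurable)
  then show "(%(th, c). \<integral>\<^sup>+th'. ennreal (kern p (chord th) (chord th') c) \<partial>arcM) : borel_measurable (arcM \<Otimes>\<^sub>M posM)"
   unfolding split_beta' .
 qed
 also have "... = (\<integral>\<^sup>+th. \<integral>\<^sup>+th'. \<integral>\<^sup>+c. ennreal (kern p (chord th) (chord th') c) \<partial>posM \<partial>arcM \<partial>arcM)"
 proof (intro nn_integral_cong ab.Fubini')
  fix th
  have [measurable]: "(%w. chord (fst w)) : borel_measurable (arcM \<Otimes>\<^sub>M posM)" "snd : borel_measurable (arcM \<Otimes>\<^sub>M posM)"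
   by (rule measurable_compose[OF snd_arcM(2) chord_measurable] snd_posM(1))+
  show "(%(th', c). ennreal (kern p (chord th) (chord th') c)) : borel_measurable (arcM \<Otimes>\<^sub>M posM)"
   unfolding split_beta' by measurable
 qed
 finally show ?thesis .
qed

text \<open>For \<open>e' = 0\<close> the ratio factor of the kernel is 1; this is the counterpart
  for the subtracted constant \<open>pi\<close>.\<close>

lemma arc_power_total:
 assumes p: "\<bar>p\<bar> <= 1/4"
 shows "(\<integral>\<^sup>+c. ennreal (arc_power p c / c) \<partial>posM) = (\<integral>\<^sup>+th. \<integral>\<^sup>+c. ennreal (kern p (chord th) 0 c) \<partial>posM \<partial>arcM)"
proof -
 interpret ab: pair_sigma_finite arcM posM by (rule pair_sigma_finite_arc)
 have ch [measurable]: "chord : borel_measurable arcM" by (rule borel_arcM) simp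
 have "(\<integral>\<^sup>+c. ennreal (arc_power p c / c) \<partial>posM) = (\<integral>\<^sup>+c. \<integral>\<^sup>+th. ennreal (kern p (chord th) 0 c) \<partial>arcM \<partial>posM)"
 proof (intro nn_integral_cong)
  fix c assume "c : space posM"
  then have c: "c > 0" by simp
  let ?f = "%th. if chord th < c then exp (p * ln (c - chord th)) else 0"
  have k: "ennreal (kern p (chord th) 0 c) = ennreal (?f th) * ennreal (1 / c)" for th
   using c by (subst ennreal_mult[symmetric]) (auto simp: kern_def)
  have "(\<integral>\<^sup>+th. ennreal (kern p (chord th) 0 c) \<partial>arcM) = ennreal (arc_power p c) * ennreal (1 / c)"
   unfolding k arc_power_nn(1)[OF c p] by (rule nn_integral_multc) measurable
  then show "ennreal (arc_power p c / c) = (\<integral>\<^sup>+th. ennreal (kern p (chord th) 0 c) \<partial>arcM)"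
   using c arc_power_nn(3)[OF c p] by (simp flip: ennreal_mult)
 qed
 also have "... = (\<integral>\<^sup>+th. \<integral>\<^sup>+c. ennreal (kern p (chord th) 0 c) \<partial>posM \<partial>arcM)"
 proof (intro ab.Fubini')
  have [measurable]: "(%w. chord (fst w)) : borel_measurable (arcM \<Otimes>\<^sub>M posM)" "snd : borel_measurable (arcM \<Otimes>\<^sub>M posM)"
   by (rule measurable_compose[OF snd_arcM(2) chord_measurable] snd_posM(1))+
  show "(%(th, c). ennreal (kern p (chord th) 0 c)) : borel_measurable (arcM \<Otimes>\<^sub>M posM)"
   unfolding split_beta' by measurable
 qed
 finally show ?thesis .
qed

text \<open>Up to constants, the mean of the \<open>2p\<close>-th power of the distance after four
  unit steps in the plane; \<open>walk2\<close> is the analogue for two steps.\<close>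

definition walk4 :: "real => ennreal" where
 "walk4 p = (\<integral>\<^sup>+th. \<integral>\<^sup>+th'. quad_mean p (chord th) (chord th') \<partial>arcM \<partial>arcM)"

definition walk2 :: "real => ennreal" where
 "walk2 p = (\<integral>\<^sup>+th. ennreal (exp (p * ln (chord th))) \<partial>arcM)"

text \<open>The kernel identity is applied for distinct chords; on the open arc equal chords mean
  equal angles, and a single angle is a null set.\<close>

lemma walk4_eq:
 assumes s: "0 < s" "s <= 1/4"
 shows "(\<integral>\<^sup>+c. ennreal (arc_power (- s) c * ratio_power (- s) c / c) \<partial>posM) = ennreal (1 / (2 * sin (pi * s))) * walk4 (- s)"
proof -
 have m: "(%y. quad_mean (- s) (fst y) (snd y)) : borel_measurable (borel \<Otimes>\<^sub>M borel)"
  unfolding quad_mean_def quad_def by measurable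
 have m2: "(%th'. quad_mean (- s) (chord th) (chord th')) : borel_measurable arcM" for th
  by (rule borel_arcM) (use measurable_compose[OF _ m, of "%th'. (chord th, chord th')" borel] in simp)
 have m3: "(%th. \<integral>\<^sup>+th'. quad_mean (- s) (chord th) (chord th') \<partial>arcM) : borel_measurable arcM"
 proof (rule sigma_finite_measure.borel_measurable_nn_integral[OF sigma_finite_arcM])
  have "(%w. (chord (fst w), chord (snd w))) : (arcM \<Otimes>\<^sub>M arcM) \<rightarrow>\<^sub>M (borel \<Otimes>\<^sub>M borel)"
   by (intro measurable_Pair measurable_compose[OF snd_arcM(2) chord_measurable] measurable_compose[OF snd_arcM(1) chord_measurable])
  from measurable_compose[OF this m]
  show "(%(th, th'). quad_mean (- s) (chord th) (chord th')) : borel_measurable (arcM \<Otimes>\<^sub>M arcM)"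
   by (simp add: split_beta')
 qed
 have "(\<integral>\<^sup>+c. ennreal (arc_power (- s) c * ratio_power (- s) c / c) \<partial>posM) =
  (\<integral>\<^sup>+th. \<integral>\<^sup>+th'. \<integral>\<^sup>+c. ennreal (kern (- s) (chord th) (chord th') c) \<partial>posM \<partial>arcM \<partial>arcM)"
  using s by (intro arc_ratio_product) auto
 also have "... = (\<integral>\<^sup>+th. ennreal (1 / (2 * sin (pi * s))) * (\<integral>\<^sup>+th'. quad_mean (- s) (chord th) (chord th') \<partial>arcM) \<partial>arcM)"
 proof (intro nn_integral_cong)
  fix th assume t: "th : space arcM"
  have ae: "AE th' in arcM. th' ~= th"
   unfolding arcM_def using AE_lborel_singleton[of th] by (subst AE_restrict_space_iff) (auto elim: eventually_mono)
  have "(\<integral>\<^sup>+th'. \<integral>\<^sup>+c. ennreal (kern (- s) (chord th) (chord th') c) \<partial>posM \<partial>arcM) =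
   (\<integral>\<^sup>+th'. ennreal (1 / (2 * sin (pi * s))) * quad_mean (- s) (chord th) (chord th') \<partial>arcM)"
  proof (rule nn_integral_cong_AE)
   show "AE th' in arcM. (\<integral>\<^sup>+c. ennreal (kern (- s) (chord th) (chord th') c) \<partial>posM) =
    ennreal (1 / (2 * sin (pi * s))) * quad_mean (- s) (chord th) (chord th')"
    using ae AE_space
   proof eventually_elim
    case (elim th')
    have "chord th ~= chord th'" using cos_inj_pi[of th th'] t elim by (auto simp: chord_def)
    then show ?case using s t elim chord_bounds[of th] chord_bounds[of th'] by (intro kernel_identity) auto
   qed
  qed
  also have "... = ennreal (1 / (2 * sin (pi * s))) * (\<integral>\<^sup>+th'. quad_mean (- s) (chord th) (chord th') \<partial>arcM)"
   by (rule nn_integral_cmult[OF m2])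
  finally show "(\<integral>\<^sup>+th'. \<integral>\<^sup>+c. ennreal (kern (- s) (chord th) (chord th') c) \<partial>posM \<partial>arcM) =
   ennreal (1 / (2 * sin (pi * s))) * (\<integral>\<^sup>+th'. quad_mean (- s) (chord th) (chord th') \<partial>arcM)" .
 qed
 also have "... = ennreal (1 / (2 * sin (pi * s))) * walk4 (- s)"
  unfolding walk4_def by (rule nn_integral_cmult[OF m3])
 finally show ?thesis .
qed

lemma walk2_eq:
 assumes s: "0 < s" "s <= 1/4"
 shows "(\<integral>\<^sup>+c. ennreal (arc_power (- s) c / c) \<partial>posM) = ennreal (pi / sin (pi * s)) * walk2 (- s)"
proof -
 have sin: "0 < sin (pi * s)" using s by (intro sin_gt_zero) auto
 have "(\<integral>\<^sup>+c. ennreal (arc_power (- s) c / c) \<partial>posM) = (\<integral>\<^sup>+th. \<integral>\<^sup>+c. ennreal (kern (- s) (chord th) 0 c) \<partial>posM \<partial>arcM)"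
  using s by (intro arc_power_total) auto
 also have "... = (\<integral>\<^sup>+th. ennreal (pi / sin (pi * s)) * ennreal (exp (- s * ln (chord th))) \<partial>arcM)"
 proof (intro nn_integral_cong)
  fix th assume t: "th : space arcM"
  have "(\<integral>\<^sup>+c. ennreal (kern (- s) (chord th) 0 c) \<partial>posM) =
   ennreal (1 / (2 * sin (pi * s))) * quad_mean (- s) (chord th) 0"
   using s t chord_bounds[of th] by (intro kernel_identity) auto
  also have "quad_mean (- s) (chord th) 0 = ennreal (exp (- s * ln (chord th))) * ennreal (2 * pi)"
   by (simp add: quad_mean_def quad_def nn_integral_cmult_indicator)
  also have "ennreal (1 / (2 * sin (pi * s))) * (ennreal (exp (- s * ln (chord th))) * ennreal (2 * pi)) = ennreal (pi / sin (pi * s)) * ennreal (exp (- s * ln (chord th)))"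
   using sin by (simp flip: ennreal_mult)
  finally show "(\<integral>\<^sup>+c. ennreal (kern (- s) (chord th) 0 c) \<partial>posM) = ennreal (pi / sin (pi * s)) * ennreal (exp (- s * ln (chord th)))" .
 qed
 also have "... = ennreal (pi / sin (pi * s)) * walk2 (- s)"
  unfolding walk2_def by (rule nn_integral_cmult) (rule borel_arcM, measurable)
 finally show ?thesis .
qed

text \<open>Finiteness of the four-step integral is a conclusion: the product of the two averages is
  the absolutely convergent cross integrand plus \<open>pi\<close> times the two-step integrand. The
  two kernel identities then give the numerator.\<close>

lemma walk_identity:
 assumes s: "0 < s" "s < 1/4" and W2: "walk2 (- s) = ennreal w2" "0 <= w2"
 obtains w4 where "0 <= w4" "walk4 (- s) = ennreal w4"
  "(\<integral>c. arc_power (- s) c * (ratio_power (- s) c - pi) / c \<partial>posM) = (w4 / 2 - pi\<^sup>2 * w2) / sin (pi * s)"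
proof -
 have sin: "0 < sin (pi * s)" using s by (intro sin_gt_zero) auto
 have p: "\<bar>- s\<bar> <= 1/4" "\<bar>- s\<bar> < 1/4" using s by auto
 have nn: "0 <= arc_power (- s) c" "0 <= ratio_power (- s) c" if "c > 0" for c
  using arc_power_nn(3,4)[OF that p(1)] .
 have "(\<integral>\<^sup>+c. ennreal (arc_power (- s) c / c) \<partial>posM) = ennreal (pi / sin (pi * s) * w2)"
  using walk2_eq[OF s(1)] s W2 sin by (simp flip: ennreal_mult)
 then have A: "integrable posM (%c. arc_power (- s) c / c) & (\<integral>c. arc_power (- s) c / c \<partial>posM) = pi / sin (pi * s) * w2"
 proof (rule iffD1[OF nn_integral_eq_integrable, rotated 3])
  show "(%c. arc_power (- s) c / c) : borel_measurable posM" by (rule borel_posM) measurable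
  show "AE c in posM. 0 <= arc_power (- s) c / c" by (rule AE_I2) (use nn in simp)
  show "0 <= pi / sin (pi * s) * w2" using sin W2 by simp
 qed
 note D = cross_moment_sums(1)[OF p(2)]
 have "integrable posM (%c. arc_power (- s) c * (ratio_power (- s) c - pi) / c + pi * (arc_power (- s) c / c))"
  by (intro Bochner_Integration.integrable_add integrable_mult_right D conjunct1[OF A])
 moreover have "arc_power (- s) c * (ratio_power (- s) c - pi) / c + pi * (arc_power (- s) c / c) = arc_power (- s) c * ratio_power (- s) c / c" for c
  by (simp add: right_diff_distrib diff_divide_distrib mult_ac)
 ultimately have AB: "integrable posM (%c. arc_power (- s) c * ratio_power (- s) c / c)" by simp
 define J where "J = (\<integral>c. arc_power (- s) c * ratio_power (- s) c / c \<partial>posM)"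
 have J0: "0 <= J" unfolding J_def by (rule integral_nonneg_AE) (rule AE_I2, use nn in simp)
 have "ennreal J = (\<integral>\<^sup>+c. ennreal (arc_power (- s) c * ratio_power (- s) c / c) \<partial>posM)"
  unfolding J_def by (rule nn_integral_eq_integral[OF AB, symmetric]) (rule AE_I2, use nn in simp)
 also have "... = ennreal (1 / (2 * sin (pi * s))) * walk4 (- s)" using s by (intro walk4_eq) auto
 finally have J: "ennreal J = ennreal (1 / (2 * sin (pi * s))) * walk4 (- s)" .
 have "ennreal (2 * sin (pi * s) * J) = ennreal (2 * sin (pi * s)) * (ennreal (1 / (2 * sin (pi * s))) * walk4 (- s))"
  unfolding J[symmetric] using sin J0 by (simp flip: ennreal_mult)
 also have "... = (ennreal (2 * sin (pi * s)) * ennreal (1 / (2 * sin (pi * s)))) * walk4 (- s)" by (simp only: mult.assoc)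
 also have "ennreal (2 * sin (pi * s)) * ennreal (1 / (2 * sin (pi * s))) = 1" using sin by (simp flip: ennreal_mult)
 finally have w4: "walk4 (- s) = ennreal (2 * sin (pi * s) * J)" by simp
 show thesis
 proof (rule that[OF _ w4])
  show "0 <= 2 * sin (pi * s) * J" using sin J0 by simp
  have "(\<integral>c. arc_power (- s) c * (ratio_power (- s) c - pi) / c \<partial>posM) =
   (\<integral>c. arc_power (- s) c * ratio_power (- s) c / c - pi * (arc_power (- s) c / c) \<partial>posM)"
   by (simp add: right_diff_distrib diff_divide_distrib mult_ac)
  also have "... = J - pi * (\<integral>c. arc_power (- s) c / c \<partial>posM)"
   unfolding J_def by (subst Bochner_Integration.integral_diff[OF AB integrable_mult_right[OF conjunct1[OF A]]]) (simp only: integral_mult_right_zero)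
  also have "... = (2 * sin (pi * s) * J / 2 - pi\<^sup>2 * w2) / sin (pi * s)"
   using A sin by (simp add: diff_divide_distrib power2_eq_square)
  finally show "(\<integral>c. arc_power (- s) c * (ratio_power (- s) c - pi) / c \<partial>posM) = (2 * sin (pi * s) * J / 2 - pi\<^sup>2 * w2) / sin (pi * s)" .
 qed
qed

section \<open>Moments over the torus\<close>

definition unitM :: "real measure" where "unitM = restrict_space lborel {0..1}"

lemma space_unitM [simp]: "space unitM = {0..1}" by (simp add: unitM_def space_restrict_space)

lemma sigma_finite_unitM: "sigma_finite_measure unitM"
 unfolding unitM_def by (rule sigma_finite_measure_restrict_space) (auto simp: sigma_finite_lborel)

lemma borel_unitM: "f : borel \<rightarrow>\<^sub>M N ==> f : unitM \<rightarrow>\<^sub>M N"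
 unfolding unitM_def by (rule measurable_restrict_space1) simp

lemma borel_unitM2: "f : borel \<Otimes>\<^sub>M borel \<rightarrow>\<^sub>M N ==> f : unitM \<Otimes>\<^sub>M unitM \<rightarrow>\<^sub>M N"
proof -
 assume f: "f : borel \<Otimes>\<^sub>M borel \<rightarrow>\<^sub>M N"
 have "(%w. (fst w, snd w)) : unitM \<Otimes>\<^sub>M unitM \<rightarrow>\<^sub>M borel \<Otimes>\<^sub>M borel"
  by (intro measurable_Pair measurable_compose[OF measurable_fst] measurable_compose[OF measurable_snd] borel_unitM) simp_all
 from measurable_compose[OF this f] show ?thesis by simp
qed

lemma nn_integral_unitM: "(\<integral>\<^sup>+t. f t \<partial>unitM) = (\<integral>\<^sup>+t. f t * indicator {0..1} t \<partial>lborel)"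
 unfolding unitM_def by (simp add: nn_integral_restrict_space)

lemma nn_integral_periodic_shift:
 fixes g :: "real => ennreal"
 assumes [measurable]: "g : borel_measurable borel" and per: "!!t. g (t + 1) = g t"
 shows "(\<integral>\<^sup>+t. g (t + a) \<partial>unitM) = (\<integral>\<^sup>+t. g t \<partial>unitM)"
proof -
 have perN: "g (t + real n) = g t" for t n
  by (induction n) (simp_all add: per add.assoc[symmetric] add.commute[of 1])
 have perZ: "g (t + of_int k) = g t" for t k
 proof (cases "k >= 0")
  case True
  then show ?thesis using perN[of t "nat k"] by simp
 next
  case False
  then show ?thesis using perN[of "t + of_int k" "nat (- k)"] by simp
 qed
 define b where "b = frac a"
 have b: "0 <= b" "b < 1" by (auto simp: b_def frac_lt_1)
 have ga: "g (t + a) = g (b + 1 * t)" for t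
  using perZ[of "t + b" "\<lfloor>a\<rfloor>"] by (simp add: b_def frac_def add.assoc add.commute)
 have sp: "(\<integral>\<^sup>+u. g u * indicator {x..z} u \<partial>lborel) = (\<integral>\<^sup>+u. g u * indicator {x..y} u \<partial>lborel) + (\<integral>\<^sup>+u. g u * indicator {y..z} u \<partial>lborel)"
  if "x <= y" "y <= z" for x y z :: real
 proof -
  have "(\<integral>\<^sup>+u. g u * indicator {x..z} u \<partial>lborel) = (\<integral>\<^sup>+u. g u * indicator {x..y} u + g u * indicator {y..z} u \<partial>lborel)"
   using AE_lborel_singleton[of y] that by (intro nn_integral_cong_AE) (auto elim!: eventually_mono simp: indicator_def)
  also have "... = (\<integral>\<^sup>+u. g u * indicator {x..y} u \<partial>lborel) + (\<integral>\<^sup>+u. g u * indicator {y..z} u \<partial>lborel)"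
   by (rule nn_integral_add) measurable
  finally show ?thesis .
 qed
 have tr: "(\<integral>\<^sup>+u. g u * indicator {x + c..y + c} u \<partial>lborel) = (\<integral>\<^sup>+u. g (c + 1 * u) * indicator {x..y} u \<partial>lborel)" for x y c :: real
  by (subst nn_integral_real_affine[where c = 1 and t = c]) (auto intro!: nn_integral_cong simp: indicator_def)
 have "(\<integral>\<^sup>+t. g (t + a) \<partial>unitM) = (\<integral>\<^sup>+u. g u * indicator {0 + b..1 + b} u \<partial>lborel)"
  unfolding nn_integral_unitM tr ga ..
 also have "... = (\<integral>\<^sup>+u. g u * indicator {b..1} u \<partial>lborel) + (\<integral>\<^sup>+u. g u * indicator {0 + 1..b + 1} u \<partial>lborel)"
  using b sp[of b 1 "1 + b"] by (simp add: add.commute)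
 also have "(\<integral>\<^sup>+u. g u * indicator {0 + 1..b + 1} u \<partial>lborel) = (\<integral>\<^sup>+u. g u * indicator {0..b} u \<partial>lborel)"
  unfolding tr using per by (simp add: add.commute)
 also have "(\<integral>\<^sup>+u. g u * indicator {b..1} u \<partial>lborel) + (\<integral>\<^sup>+u. g u * indicator {0..b} u \<partial>lborel) = (\<integral>\<^sup>+t. g t \<partial>unitM)"
  unfolding nn_integral_unitM using b sp[of 0 b 1] by (simp add: add.commute)
 finally show ?thesis .
qed

lemma nn_integral_unit_angle:
 fixes k :: "real => ennreal"
 assumes [measurable]: "k : borel_measurable borel"
 shows "(\<integral>\<^sup>+t. k (2 * pi * t) \<partial>unitM) = ennreal (1 / (2 * pi)) * (\<integral>\<^sup>+x. k x * indicator {0..2 * pi} x \<partial>lborel)"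
proof -
 have "(\<integral>\<^sup>+x. k x * indicator {0..2 * pi} x \<partial>lborel) = ennreal (2 * pi) * (\<integral>\<^sup>+t. k (2 * pi * t) \<partial>unitM)"
 proof -
  have "indicator {0..2 * pi} (0 + 2 * pi * t) = (indicator {0..1} t :: ennreal)" for t :: real
   using mult_le_cancel_left_pos[of "2 * pi" t 1] by (simp add: indicator_def zero_le_mult_iff not_le)
  then show ?thesis unfolding nn_integral_unitM
   by (subst nn_integral_real_affine[where c = "2 * pi" and t = 0]) simp_all
 qed
 then have "ennreal (1 / (2 * pi)) * (\<integral>\<^sup>+x. k x * indicator {0..2 * pi} x \<partial>lborel) = (ennreal (1 / (2 * pi)) * ennreal (2 * pi)) * (\<integral>\<^sup>+t. k (2 * pi * t) \<partial>unitM)"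
  by (simp only: mult.assoc)
 also have "ennreal (1 / (2 * pi)) * ennreal (2 * pi) = 1" by (simp flip: ennreal_mult)
 finally show ?thesis by simp
qed

lemma nn_integral_arcM_reflect:
 fixes k :: "real => ennreal"
 assumes [measurable]: "k : borel_measurable borel"
 shows "(\<integral>\<^sup>+th. k (pi - th) \<partial>arcM) = (\<integral>\<^sup>+th. k th \<partial>arcM)"
proof -
 have "(\<integral>\<^sup>+th. k th * indicator {0<..<pi} th \<partial>lborel) = (\<integral>\<^sup>+th. k (pi - th) * indicator {0<..<pi} th \<partial>lborel)"
  by (subst nn_integral_real_affine[where c = "-1" and t = pi]) (auto intro!: nn_integral_cong simp: indicator_def)
 then show ?thesis by (simp add: nn_integral_arcM)
qed

lemma nn_integral_unit_chord:
 fixes k :: "real => ennreal"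
 assumes [measurable]: "k : borel_measurable borel"
 shows "(\<integral>\<^sup>+t. k (2 + 2 * cos (2 * pi * t)) \<partial>unitM) = ennreal (1 / pi) * (\<integral>\<^sup>+th. k (chord th) \<partial>arcM)"
proof -
 have lem: "(\<integral>\<^sup>+x. k (2 + 2 * cos x) * indicator {0..2 * pi} x \<partial>lborel) = ennreal 2 * (\<integral>\<^sup>+th. k (2 + 2 * cos th) \<partial>arcM)"
 proof -
  have r: "(\<integral>\<^sup>+x. k (2 + 2 * cos x) * indicator {pi<..<2 * pi} x \<partial>lborel) = (\<integral>\<^sup>+x. k (2 + 2 * cos x) * indicator {0<..<pi} x \<partial>lborel)"
   by (subst nn_integral_real_affine[where c = "-1" and t = "2 * pi"])
    (auto intro!: nn_integral_cong simp: indicator_def cos_diff)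
  have "(\<integral>\<^sup>+x. k (2 + 2 * cos x) * indicator {0..2 * pi} x \<partial>lborel) =
   (\<integral>\<^sup>+x. k (2 + 2 * cos x) * indicator {0<..<pi} x + k (2 + 2 * cos x) * indicator {pi<..<2 * pi} x \<partial>lborel)"
   by (rule nn_integral_cong_AE, rule eventually_mono[OF eventually_conj[OF AE_lborel_singleton[of 0]
      eventually_conj[OF AE_lborel_singleton[of pi] AE_lborel_singleton[of "2 * pi"]]]])
    (auto simp: indicator_def)
  also have "... = (\<integral>\<^sup>+x. k (2 + 2 * cos x) * indicator {0<..<pi} x \<partial>lborel) + (\<integral>\<^sup>+x. k (2 + 2 * cos x) * indicator {pi<..<2 * pi} x \<partial>lborel)"
   by (rule nn_integral_add) measurable
  finally show ?thesis unfolding r using nn_integral_arcM[of "%th. k (2 + 2 * cos th)"] by (simp only: ennreal_numeral mult_2) simp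
 qed
 have "(\<integral>\<^sup>+th. k (2 + 2 * cos th) \<partial>arcM) = (\<integral>\<^sup>+th. k (chord th) \<partial>arcM)"
  using nn_integral_arcM_reflect[of "%th. k (2 + 2 * cos th)"] by (simp add: chord_def cos_diff)
 then have "(\<integral>\<^sup>+t. k (2 + 2 * cos (2 * pi * t)) \<partial>unitM) = ennreal (1 / (2 * pi)) * (ennreal 2 * (\<integral>\<^sup>+th. k (chord th) \<partial>arcM))"
  using nn_integral_unit_angle[of "%x. k (2 + 2 * cos x)"] lem by simp
 also have "... = (ennreal (1 / (2 * pi)) * ennreal 2) * (\<integral>\<^sup>+th. k (chord th) \<partial>arcM)" by (simp only: mult.assoc)
 also have "ennreal (1 / (2 * pi)) * ennreal 2 = ennreal (1 / pi)" by (subst ennreal_mult[symmetric]) auto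
 finally show ?thesis .
qed

lemma Basis_cart: "(Basis :: (real ^ 'n) set) = (%i. axis i 1) ` UNIV"
 by (auto simp: Basis_vec_def)

lemma prod_Basis_cart: "(PROD b:(Basis :: (real ^ 'n) set). x \<bullet> b) = (PROD i:UNIV. x $ i)"
 unfolding Basis_cart by (subst prod.reindex) (auto simp: inj_on_def axis_eq_axis inner_axis)

lemma prod_3: "prod f (UNIV :: 3 set) = f 1 * f 2 * f 3"
 unfolding UNIV_3 by (simp add: ac_simps)

lemma vec3_measurable: "(%(x, y, z). vector [x, y, z] :: real ^ 3) : lborel \<Otimes>\<^sub>M (lborel \<Otimes>\<^sub>M lborel) \<rightarrow>\<^sub>M borel"
proof -
 have c: "continuous_on UNIV (%(x, y, z). vector [x, y, z] :: real ^ 3)"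
 proof -
  have "(%(x, y, z). vector [x, y, z] :: real ^ 3) = (%w. \<chi> i. if i = 1 then fst w else if i = 2 then fst (snd w) else snd (snd w))"
   by (auto simp: fun_eq_iff vec_eq_iff forall_3 split_beta)
  moreover have "continuous_on UNIV (%w::real \<times> real \<times> real. if i = 1 then fst w else if i = 2 then fst (snd w) else snd (snd w))" for i :: 3
   by (cases "i = 1"; cases "i = 2") (auto intro!: continuous_intros)
  ultimately show ?thesis by (simp only:) (intro continuous_on_vec_lambda)
 qed
 show ?thesis
  unfolding lborel_prod using borel_measurable_continuous_onI[OF c] by simp
qed

text \<open>Lebesgue measure is determined by its values on boxes. Writing it as the image of a
  product measure allows the torus integral to be iterated.\<close>

lemma lborel_vec3: "(lborel :: (real ^ 3) measure) = distr (lborel \<Otimes>\<^sub>M (lborel \<Otimes>\<^sub>M lborel)) borel (%(x, y, z). vector [x, y, z])"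
proof (rule lborel_eqI)
 note m = vec3_measurable
 fix l u :: "real ^ 3" assume lu: "!!b. b : Basis ==> l \<bullet> b <= u \<bullet> b"
 have le: "l $ i <= u $ i" for i using lu[of "axis i 1"] by (simp add: inner_axis Basis_cart)
 have "(%(x, y, z). vector [x, y, z]) -` box l u = {l $ 1<..<u $ 1} \<times> ({l $ 2<..<u $ 2} \<times> {l $ 3<..<u $ 3})"
  by (auto simp: mem_box_cart forall_3)
 then have "emeasure (distr (lborel \<Otimes>\<^sub>M (lborel \<Otimes>\<^sub>M lborel)) borel (%(x, y, z). vector [x, y, z])) (box l u)
  = emeasure (lborel \<Otimes>\<^sub>M (lborel \<Otimes>\<^sub>M lborel)) ({l $ 1<..<u $ 1} \<times> ({l $ 2<..<u $ 2} \<times> {l $ 3<..<u $ 3}))"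
  by (subst emeasure_distr[OF m]) (auto simp: space_pair_measure)
 also have "... = ennreal (u $ 1 - l $ 1) * (ennreal (u $ 2 - l $ 2) * ennreal (u $ 3 - l $ 3))"
  using le by (simp add: lborel.emeasure_pair_measure_Times sigma_finite_measure.emeasure_pair_measure_Times[OF lborel_pair.sigma_finite_measure_axioms])
 also have "... = ennreal (PROD b:Basis. (u - l) \<bullet> b)"
 proof -
  have "(PROD b:Basis. (u - l) \<bullet> b) = (u $ 1 - l $ 1) * ((u $ 2 - l $ 2) * (u $ 3 - l $ 3))"
   unfolding prod_Basis_cart prod_3 by (simp add: mult.assoc)
  then show ?thesis using le by (simp only: ennreal_mult diff_ge_0_iff_ge mult_nonneg_nonneg)
 qed
 finally show "emeasure (distr (lborel \<Otimes>\<^sub>M (lborel \<Otimes>\<^sub>M lborel)) borel (%(x, y, z). vector [x, y, z])) (box l u) = ennreal (PROD b:Basis. (u - l) \<bullet> b)" .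
qed simp

lemma lborel_vec1: "(lborel :: (real ^ 1) measure) = distr lborel borel vec"
proof (rule lborel_eqI)
 have m: "(vec :: real => real ^ 1) : lborel \<rightarrow>\<^sub>M borel"
  using borel_measurable_continuous_onI[of "vec :: real => real ^ 1"]
  by (simp add: vec_def continuous_on_vec_lambda)
 fix l u :: "real ^ 1" assume lu: "!!b. b : Basis ==> l \<bullet> b <= u \<bullet> b"
 have le: "l $ 1 <= u $ 1" using lu[of "axis 1 1"] by (simp add: inner_axis Basis_cart)
 have "(vec :: real => real ^ 1) -` box l u = {l $ 1<..<u $ 1}" by (auto simp: mem_box_cart forall_1)
 then show "emeasure (distr lborel borel vec) (box l u) = ennreal (PROD b:Basis. (u - l) \<bullet> b)"
  unfolding prod_Basis_cart using le by (subst emeasure_distr[OF m]) (auto simp: UNIV_1)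
qed simp

definition torM :: "(real ^ 'n) measure" where "torM = restrict_space lborel (cbox 0 1)"

lemma nn_integral_torM3:
 assumes [measurable]: "F : borel_measurable borel"
 shows "(\<integral>\<^sup>+t. F t \<partial>(torM :: (real ^ 3) measure)) = (\<integral>\<^sup>+x. \<integral>\<^sup>+y. \<integral>\<^sup>+z. F (vector [x, y, z]) \<partial>unitM \<partial>unitM \<partial>unitM)"
proof -
 note m [measurable] = vec3_measurable
 define G where "G w = F (case w of (x, y, z) => vector [x, y, z]) * (indicator {0..1} (fst w) * (indicator {0..1} (fst (snd w)) * indicator {0..1} (snd (snd w))))" for w :: "real \<times> real \<times> real"
 have Gm [measurable]: "G : borel_measurable (lborel \<Otimes>\<^sub>M (lborel \<Otimes>\<^sub>M lborel))" unfolding G_def[abs_def] by measurable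
 have "(\<integral>\<^sup>+t. F t \<partial>(torM :: (real ^ 3) measure)) = (\<integral>\<^sup>+t. F t * indicator (cbox 0 1) t \<partial>lborel)"
  unfolding torM_def by (simp add: nn_integral_restrict_space)
 also have "... = (\<integral>\<^sup>+w. G w \<partial>(lborel \<Otimes>\<^sub>M (lborel \<Otimes>\<^sub>M lborel)))"
  by (subst lborel_vec3, subst nn_integral_distr[OF m])
   (auto intro!: nn_integral_cong simp: G_def indicator_def mem_box_cart forall_3)
 also have "... = (\<integral>\<^sup>+x. \<integral>\<^sup>+y. \<integral>\<^sup>+z. G (x, y, z) \<partial>lborel \<partial>lborel \<partial>lborel)"
 proof -
  have "(\<integral>\<^sup>+w. G w \<partial>(lborel \<Otimes>\<^sub>M (lborel \<Otimes>\<^sub>M lborel))) = (\<integral>\<^sup>+x. \<integral>\<^sup>+w. G (x, w) \<partial>(lborel \<Otimes>\<^sub>M lborel) \<partial>lborel)"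
   using sigma_finite_measure.nn_integral_fst[OF lborel_pair.sigma_finite_measure_axioms Gm] by simp
  also have "... = (\<integral>\<^sup>+x. \<integral>\<^sup>+y. \<integral>\<^sup>+z. G (x, y, z) \<partial>lborel \<partial>lborel \<partial>lborel)"
  proof (intro nn_integral_cong)
   fix x :: real
   have "(%w. G (x, w)) : borel_measurable (lborel \<Otimes>\<^sub>M lborel)"
    by (rule measurable_compose[OF measurable_Pair1' Gm]) simp
   then show "(\<integral>\<^sup>+w. G (x, w) \<partial>(lborel \<Otimes>\<^sub>M lborel)) = (\<integral>\<^sup>+y. \<integral>\<^sup>+z. G (x, y, z) \<partial>lborel \<partial>lborel)"
    using lborel.nn_integral_fst[of "%w. G (x, w)" lborel] by simp
  qed
  finally show ?thesis .
 qed
 also have "... = (\<integral>\<^sup>+x. \<integral>\<^sup>+y. \<integral>\<^sup>+z. F (vector [x, y, z]) \<partial>unitM \<partial>unitM \<partial>unitM)"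
  unfolding nn_integral_unitM
 proof (intro nn_integral_cong)
  fix x :: real
  have y: "(\<integral>\<^sup>+z. G (x, y, z) \<partial>lborel) = (\<integral>\<^sup>+z. F (vector [x, y, z]) * indicator {0..1} z \<partial>lborel) * indicator {0..1} y" if "x : {0..1}" for y
   using that by (cases "y : {0..1}") (auto simp: G_def)
  show "(\<integral>\<^sup>+y. \<integral>\<^sup>+z. G (x, y, z) \<partial>lborel \<partial>lborel) =
   (\<integral>\<^sup>+y. (\<integral>\<^sup>+z. F (vector [x, y, z]) * indicator {0..1} z \<partial>lborel) * indicator {0..1} y \<partial>lborel) * indicator {0..1} x"
  proof (cases "x : {0..1}")
   case True
   then show ?thesis by (simp add: y)
  next
   case False
   then have "G (x, y, z) = 0" for y z by (simp add: G_def)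
   then show ?thesis using False by simp
  qed
 qed
 finally show ?thesis .
qed

lemma nn_integral_torM1:
 assumes [measurable]: "F : borel_measurable borel"
 shows "(\<integral>\<^sup>+t. F t \<partial>(torM :: (real ^ 1) measure)) = (\<integral>\<^sup>+x. F (vec x) \<partial>unitM)"
proof -
 have m: "(vec :: real => real ^ 1) : lborel \<rightarrow>\<^sub>M borel"
  using borel_measurable_continuous_onI[of "vec :: real => real ^ 1"]
  by (simp add: vec_def continuous_on_vec_lambda)
 have "(\<integral>\<^sup>+t. F t \<partial>(torM :: (real ^ 1) measure)) = (\<integral>\<^sup>+t. F t * indicator (cbox 0 1) t \<partial>lborel)"
  unfolding torM_def by (simp add: nn_integral_restrict_space)
 also have "... = (\<integral>\<^sup>+x. F (vec x) * indicator {0..1} x \<partial>lborel)"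
  by (subst lborel_vec1, subst nn_integral_distr[OF m])
   (auto intro!: nn_integral_cong simp: indicator_def mem_box_cart forall_1)
 finally show ?thesis unfolding nn_integral_unitM .
qed

lemma cmod_add_cis_square:
 assumes "0 <= a" "0 <= b"
 shows "(cmod (of_real a + of_real b * cis x))^2 = quad (a^2) (b^2) x"
proof -
 have "(cmod (of_real a + of_real b * cis x))^2 = (a + b * cos x)^2 + (b * sin x)^2" unfolding cmod_power2 by simp
 also have "... = a^2 + b^2 * ((sin x)^2 + (cos x)^2) + 2 * (a * b) * cos x" by algebra
 also have "a * b = sqrt (a^2 * b^2)" using assms by (simp add: real_sqrt_mult)
 finally show ?thesis by (simp add: quad_def)
qed

lemma cmod_one_plus_cis_square: "(cmod (1 + cis x))^2 = 2 + 2 * cos x"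
 using cmod_add_cis_square[of 1 1 x] by (simp add: quad_def)

lemma cis_periodic: "cis (2 * pi * (t + 1)) = cis (2 * pi * t)"
 by (simp add: distrib_left cis_mult[symmetric])

lemma cis_measurable [measurable]: "f : borel_measurable M ==> (%x. cis (f x)) : borel_measurable M"
 by (rule measurable_compose[OF _ borel_measurable_continuous_onI[of cis]]) (auto intro: continuous_intros)

text \<open>Shifting the third angle by the second gives
  \<open>(1 + cis x) + cis y (1 + cis z)\<close>. For fixed \<open>x\<close> and \<open>z\<close> a
  further shift of \<open>y\<close> leaves only the two moduli with a uniform relative angle, and
  their squares are \<open>2 + 2 cos\<close>, distributed like chords. The constant collects
  \<open>1 / (2 pi)\<close> for the angle and \<open>1 / pi\<close> for each modulus.\<close>

lemma walk_torus:
 fixes K :: "real => ennreal"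
 assumes K [measurable]: "K : borel_measurable borel"
 shows "(\<integral>\<^sup>+x. \<integral>\<^sup>+y. \<integral>\<^sup>+z. K ((cmod (1 + cis (2 * pi * x) + cis (2 * pi * y) + cis (2 * pi * z)))^2) \<partial>unitM \<partial>unitM \<partial>unitM) =
  ennreal (1 / (2 * pi ^ 3)) * (\<integral>\<^sup>+th. \<integral>\<^sup>+th'. \<integral>\<^sup>+x. K (quad (chord th) (chord th') x) * indicator {0..2 * pi} x \<partial>lborel \<partial>arcM \<partial>arcM)"
proof -
 interpret u: pair_sigma_finite unitM unitM by (simp add: pair_sigma_finite_def sigma_finite_unitM)
 define L where "L e e' = (\<integral>\<^sup>+x. K (quad e e' x) * indicator {0..2 * pi} x \<partial>lborel)" for e e'
 have Lm: "(%w. L (fst w) (snd w)) : borel_measurable (borel \<Otimes>\<^sub>M borel)"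
  unfolding L_def quad_def by measurable
 have L1 [measurable]: "L e : borel_measurable borel" for e
  using measurable_compose[OF _ Lm, of "%e'. (e, e')" borel] by simp
 have L2 [measurable]: "(%e. \<integral>\<^sup>+th'. L e (chord th') \<partial>arcM) : borel_measurable borel"
 proof (rule sigma_finite_measure.borel_measurable_nn_integral[OF sigma_finite_arcM])
  have "(%w. (fst w, chord (snd w))) : (borel \<Otimes>\<^sub>M arcM) \<rightarrow>\<^sub>M (borel \<Otimes>\<^sub>M borel)"
   by (intro measurable_Pair measurable_fst measurable_compose[OF snd_arcM(1) chord_measurable])
  from measurable_compose[OF this Lm]
  show "(%(e, th'). L e (chord th')) : borel_measurable (borel \<Otimes>\<^sub>M arcM)" by (simp add: split_beta')
 qed
 have "(\<integral>\<^sup>+y. \<integral>\<^sup>+z. K ((cmod (1 + cis (2 * pi * x) + cis (2 * pi * y) + cis (2 * pi * z)))^2) \<partial>unitM \<partial>unitM)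
  = ennreal (1 / (2 * pi ^ 2)) * (\<integral>\<^sup>+th'. L (2 + 2 * cos (2 * pi * x)) (chord th') \<partial>arcM)" for x
 proof -
  let ?u = "1 + cis (2 * pi * x)"
  have "(\<integral>\<^sup>+z. K ((cmod (?u + cis (2 * pi * y) + cis (2 * pi * z)))^2) \<partial>unitM) =
   (\<integral>\<^sup>+z. K ((cmod (?u + cis (2 * pi * y) * (1 + cis (2 * pi * z))))^2) \<partial>unitM)" for y
  proof -
   have "(\<integral>\<^sup>+z. K ((cmod (?u + cis (2 * pi * y) + cis (2 * pi * (z + y))))^2) \<partial>unitM) =
    (\<integral>\<^sup>+z. K ((cmod (?u + cis (2 * pi * y) + cis (2 * pi * z)))^2) \<partial>unitM)"
    by (rule nn_integral_periodic_shift) (measurable, simp add: cis_periodic)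
   moreover have "?u + cis (2 * pi * y) + cis (2 * pi * (z + y)) = ?u + cis (2 * pi * y) * (1 + cis (2 * pi * z))" for z
   proof -
    have "2 * pi * (z + y) = 2 * pi * y + 2 * pi * z" by algebra
    then show ?thesis by (simp only: cis_mult[symmetric]) (simp add: distrib_left)
   qed
   ultimately show ?thesis by simp
  qed
  then have "(\<integral>\<^sup>+y. \<integral>\<^sup>+z. K ((cmod (?u + cis (2 * pi * y) + cis (2 * pi * z)))^2) \<partial>unitM \<partial>unitM) =
   (\<integral>\<^sup>+y. \<integral>\<^sup>+z. K ((cmod (?u + cis (2 * pi * y) * (1 + cis (2 * pi * z))))^2) \<partial>unitM \<partial>unitM)" by simp
  also have "... = (\<integral>\<^sup>+z. \<integral>\<^sup>+y. K ((cmod (?u + cis (2 * pi * y) * (1 + cis (2 * pi * z))))^2) \<partial>unitM \<partial>unitM)"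
   by (rule u.Fubini') (rule borel_unitM2, unfold split_beta', measurable)
  also have "... = (\<integral>\<^sup>+z. ennreal (1 / (2 * pi)) * L (2 + 2 * cos (2 * pi * x)) (2 + 2 * cos (2 * pi * z)) \<partial>unitM)"
  proof (intro nn_integral_cong)
   fix z
   let ?v = "1 + cis (2 * pi * z)"
   obtain \<alpha> where a: "?u = of_real (cmod ?u) * cis \<alpha>" using rcis_cmod_Arg[of ?u] unfolding rcis_def by metis
   obtain \<beta> where b: "?v = of_real (cmod ?v) * cis \<beta>" using rcis_cmod_Arg[of ?v] unfolding rcis_def by metis
   let ?h = "%y. K ((cmod (of_real (cmod ?u) + of_real (cmod ?v) * cis (2 * pi * y)))^2)"
   have m: "cmod (?u + cis (2 * pi * y) * ?v) = cmod (of_real (cmod ?u) + of_real (cmod ?v) * cis (2 * pi * (y + (\<beta> - \<alpha>) / (2 * pi))))" for y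
   proof -
    have "cis (2 * pi * (y + (\<beta> - \<alpha>) / (2 * pi))) = cis (2 * pi * y) * cis \<beta> * cis (- \<alpha>)"
    proof -
     have "2 * pi * (y + (\<beta> - \<alpha>) / (2 * pi)) = 2 * pi * y + \<beta> + - \<alpha>" by (simp add: field_simps)
     then show ?thesis by (simp only: cis_mult)
    qed
    moreover have "cis \<alpha> * cis (- \<alpha>) = 1" by (simp add: cis_mult)
    moreover have "U * ca + c * (V * cb) = ca * (U + V * (c * cb * da))" if "ca * da = 1" for U V c ca cb da :: complex
     using that by algebra
    ultimately have "of_real (cmod ?u) * cis \<alpha> + cis (2 * pi * y) * (of_real (cmod ?v) * cis \<beta>) = cis \<alpha> * (of_real (cmod ?u) + of_real (cmod ?v) * cis (2 * pi * (y + (\<beta> - \<alpha>) / (2 * pi))))"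
     by (simp only:)
    then have "?u + cis (2 * pi * y) * ?v = cis \<alpha> * (of_real (cmod ?u) + of_real (cmod ?v) * cis (2 * pi * (y + (\<beta> - \<alpha>) / (2 * pi))))"
     by (simp only: a[symmetric] b[symmetric])
    then show ?thesis by (simp only: norm_mult norm_cis mult_1_left)
   qed
   have "(\<integral>\<^sup>+y. K ((cmod (?u + cis (2 * pi * y) * ?v))^2) \<partial>unitM) = (\<integral>\<^sup>+y. ?h (y + (\<beta> - \<alpha>) / (2 * pi)) \<partial>unitM)"
    by (simp only: m)
   also have "... = (\<integral>\<^sup>+y. ?h y \<partial>unitM)"
    by (rule nn_integral_periodic_shift) (measurable, simp only: cis_periodic)
   also have "... = (\<integral>\<^sup>+y. K (quad (2 + 2 * cos (2 * pi * x)) (2 + 2 * cos (2 * pi * z)) (2 * pi * y)) \<partial>unitM)"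
    by (simp only: cmod_add_cis_square[OF norm_ge_zero norm_ge_zero] cmod_one_plus_cis_square)
   also have "... = ennreal (1 / (2 * pi)) * L (2 + 2 * cos (2 * pi * x)) (2 + 2 * cos (2 * pi * z))"
    unfolding L_def by (rule nn_integral_unit_angle) (unfold quad_def, measurable)
   finally show "(\<integral>\<^sup>+y. K ((cmod (?u + cis (2 * pi * y) * ?v))^2) \<partial>unitM) = ennreal (1 / (2 * pi)) * L (2 + 2 * cos (2 * pi * x)) (2 + 2 * cos (2 * pi * z))" .
  qed
  also have "... = ennreal (1 / (2 * pi)) * (\<integral>\<^sup>+z. L (2 + 2 * cos (2 * pi * x)) (2 + 2 * cos (2 * pi * z)) \<partial>unitM)"
   by (rule nn_integral_cmult) (rule borel_unitM, measurable)
  also have "... = ennreal (1 / (2 * pi)) * (ennreal (1 / pi) * (\<integral>\<^sup>+th'. L (2 + 2 * cos (2 * pi * x)) (chord th') \<partial>arcM))"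
   by (subst nn_integral_unit_chord) simp_all
  also have "... = (ennreal (1 / (2 * pi)) * ennreal (1 / pi)) * (\<integral>\<^sup>+th'. L (2 + 2 * cos (2 * pi * x)) (chord th') \<partial>arcM)" by (simp only: mult.assoc)
  also have "ennreal (1 / (2 * pi)) * ennreal (1 / pi) = ennreal (1 / (2 * pi ^ 2))" by (simp add: power2_eq_square flip: ennreal_mult)
  finally show ?thesis .
 qed
 then have "(\<integral>\<^sup>+x. \<integral>\<^sup>+y. \<integral>\<^sup>+z. K ((cmod (1 + cis (2 * pi * x) + cis (2 * pi * y) + cis (2 * pi * z)))^2) \<partial>unitM \<partial>unitM \<partial>unitM)
  = (\<integral>\<^sup>+x. ennreal (1 / (2 * pi ^ 2)) * (\<integral>\<^sup>+th'. L (2 + 2 * cos (2 * pi * x)) (chord th') \<partial>arcM) \<partial>unitM)" by simp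
 also have "... = ennreal (1 / (2 * pi ^ 2)) * (\<integral>\<^sup>+x. (\<integral>\<^sup>+th'. L (2 + 2 * cos (2 * pi * x)) (chord th') \<partial>arcM) \<partial>unitM)"
  by (rule nn_integral_cmult, rule borel_unitM, rule measurable_compose[OF _ L2]) measurable
 also have "... = ennreal (1 / (2 * pi ^ 2)) * (ennreal (1 / pi) * (\<integral>\<^sup>+th. \<integral>\<^sup>+th'. L (chord th) (chord th') \<partial>arcM \<partial>arcM))"
  by (simp only: nn_integral_unit_chord[OF L2])
 also have "... = (ennreal (1 / (2 * pi ^ 2)) * ennreal (1 / pi)) * (\<integral>\<^sup>+th. \<integral>\<^sup>+th'. L (chord th) (chord th') \<partial>arcM \<partial>arcM)" by (simp only: mult.assoc)
 also have "ennreal (1 / (2 * pi ^ 2)) * ennreal (1 / pi) = ennreal (1 / (2 * pi ^ 3))" by (simp add: power2_eq_square power3_eq_cube flip: ennreal_mult)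
 finally show ?thesis unfolding L_def .
qed

section \<open>Generating series of the moments of 1 + x1 + x2 + x3 and 1 + x1\<close>

definition norm4 :: "real ^ 3 => real" where
 "norm4 t = cmod (1 + cis (2 * pi * t $ 1) + cis (2 * pi * t $ 2) + cis (2 * pi * t $ 3))"

definition norm2 :: "real ^ 1 => real" where
 "norm2 t = cmod (1 + cis (2 * pi * t $ 1))"

lemma nth_measurable [measurable]: "(%t :: real ^ 'n. t $ i) : borel_measurable borel"
 by (intro borel_measurable_continuous_onI continuous_intros)

lemma norm_measurable [measurable]: "norm4 : borel_measurable borel" "norm2 : borel_measurable borel"
 unfolding norm4_def norm2_def by measurable

lemma norm4_integral:
 assumes [measurable]: "K : borel_measurable borel"
 shows "(\<integral>\<^sup>+t. K ((norm4 t)^2) \<partial>torM) =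
  ennreal (1 / (2 * pi ^ 3)) * (\<integral>\<^sup>+th. \<integral>\<^sup>+th'. \<integral>\<^sup>+x. K (quad (chord th) (chord th') x) * indicator {0..2 * pi} x \<partial>lborel \<partial>arcM \<partial>arcM)"
proof -
 have "(%t. K ((norm4 t)^2)) : borel_measurable borel" by measurable
 from nn_integral_torM3[OF this] show ?thesis unfolding walk_torus[OF assms, symmetric] by (simp add: norm4_def)
qed

lemma norm2_integral:
 assumes [measurable]: "K : borel_measurable borel"
 shows "(\<integral>\<^sup>+t. K ((norm2 t)^2) \<partial>torM) = ennreal (1 / pi) * (\<integral>\<^sup>+th. K (chord th) \<partial>arcM)"
proof -
 have "(%t. K ((norm2 t)^2)) : borel_measurable borel" by measurable
 from nn_integral_torM1[OF this] show ?thesis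
  unfolding nn_integral_unit_chord[OF assms, symmetric] by (simp add: norm2_def cmod_one_plus_cis_square)
qed

text \<open>The reflection of the angle at \<open>pi / 2\<close> exchanges \<open>chord th\<close>
  and \<open>4 - chord th\<close>, so the two-step walk is the arc average at level 4.\<close>

lemma walk2_arc_power: "\<bar>p\<bar> <= 1/4 ==> walk2 p = ennreal (arc_power p 4)"
proof -
 assume p: "\<bar>p\<bar> <= 1/4"
 have "walk2 p = (\<integral>\<^sup>+th. ennreal (exp (p * ln (chord (pi - th)))) \<partial>arcM)"
  unfolding walk2_def by (rule nn_integral_arcM_reflect[symmetric]) measurable
 also have "... = (\<integral>\<^sup>+th. ennreal (if chord th < 4 then exp (p * ln (4 - chord th)) else 0) \<partial>arcM)"
  by (intro nn_integral_cong) (use chord_bounds in "simp add: chord_def cos_diff")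
 also have "... = ennreal (arc_power p 4)" using p by (intro arc_power_nn(1)[symmetric]) auto
 finally show ?thesis .
qed

lemma borel_torM: "f : borel \<rightarrow>\<^sub>M N ==> f : torM \<rightarrow>\<^sub>M N"
 unfolding torM_def by (rule measurable_restrict_space1) simp

lemma finite_measure_torM: "finite_measure torM"
 using emeasure_lborel_cbox_finite[of 0 1]
 by (intro finite_measureI) (simp add: torM_def emeasure_restrict_space space_restrict_space less_top)

text \<open>The exponent 1/8 on the square is 1/4 on the modulus, as the majorant requires. Where
  the logarithm is negative the finite integral \<open>fin\<close> is used; where it is nonnegative,
  \<open>N t <= 4\<close> gives a bound below 2.\<close>

lemma torus_moment_sums:
 fixes N :: "real ^ 'n => real"
 assumes N: "N : borel_measurable borel" "!!t. 0 <= N t" "!!t. N t <= 4"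
  and fin: "(\<integral>\<^sup>+t. ennreal (exp (- (1/8) * ln ((N t)^2))) \<partial>torM) < \<infinity>" and p: "\<bar>p\<bar> < 1/8"
 shows "(%k. p ^ k * (2 ^ k / fact k * (\<integral>t. ln (N t) ^ k \<partial>torM))) sums (\<integral>t. exp (p * ln ((N t)^2)) \<partial>torM)"
  and "ennreal (\<integral>t. exp (p * ln ((N t)^2)) \<partial>torM) = (\<integral>\<^sup>+t. ennreal (exp (p * ln ((N t)^2))) \<partial>torM)"
proof -
 have sq: "ln ((N t)^2) = 2 * ln (N t)" for t
  by (cases "N t = 0") (use N(2)[of t] in "auto simp: ln_realpow")
 define W where "W t = 2 + exp (- (1/8) * ln ((N t)^2))" for t
 have [measurable]: "N : borel_measurable torM" by (rule borel_torM[OF N(1)])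
 have "integrable torM (%t. exp (- (1/8) * ln ((N t)^2)))"
  by (rule integrableI_nonneg[OF _ _ fin]) auto
 then have W: "integrable torM W"
  unfolding W_def using finite_measure.integrable_const[OF finite_measure_torM] by (intro Bochner_Integration.integrable_add) auto
 have W0: "0 <= W t" for t unfolding W_def by (intro add_nonneg_nonneg) auto
 have Wb: "exp (\<bar>ln (N t)\<bar> / 4) <= W t" for t
 proof (cases "ln (N t) >= 0")
  case True
  have "ln (N t) <= ln 4" using N(2,3)[of t] by (cases "N t = 0") auto
  then have "exp (\<bar>ln (N t)\<bar> / 4) <= exp (ln 4 / 4)" using True by simp
  also have "... <= exp (ln 2)" using ln_realpow[of 2 2] by (simp del: exp_ln)
  finally have "exp (\<bar>ln (N t)\<bar> / 4) <= 2" by simp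
  then show ?thesis unfolding W_def by (rule order_trans) simp
 qed (auto simp: W_def sq)
 have m: "(%t. ln (N t)) : borel_measurable torM" "Measurable.pred torM (%t. True)" by measurable
 note * = exp_moment_expansion[OF m W W0 Wb, unfolded if_True]
 have "(%k. (2 * p) ^ k * (\<integral>t. ln (N t) ^ k / fact k \<partial>torM)) sums (\<integral>t. exp (2 * p * ln (N t)) \<partial>torM)"
  using p by (intro *(4)) simp
 then show "(%k. p ^ k * (2 ^ k / fact k * (\<integral>t. ln (N t) ^ k \<partial>torM))) sums (\<integral>t. exp (p * ln ((N t)^2)) \<partial>torM)"
  by (simp add: sq power_mult_distrib mult_ac)
 have "integrable torM (%t. exp (2 * p * ln (N t)))" using p by (intro *(3)) auto
 then have "integrable torM (%t. exp (p * ln ((N t)^2)))" by (simp add: sq mult_ac)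
 then show "ennreal (\<integral>t. exp (p * ln ((N t)^2)) \<partial>torM) = (\<integral>\<^sup>+t. ennreal (exp (p * ln ((N t)^2))) \<partial>torM)"
  by (intro nn_integral_eq_integral[symmetric]) auto
qed

text \<open>Zeros on one side of 0 already accumulate at 0, against isolation of zeros. Multiplying
  by \<open>x\<close> makes the function vanish at 0 and shifts indices, so that the constant
  coefficient is treated like the others.\<close>

lemma powser_zero_left:
 fixes a :: "nat => real"
 assumes "0 < r" "!!x. \<bar>x\<bar> < r ==> (%n. a n * x ^ n) sums f x" "!!x. - r < x ==> x < 0 ==> f x = 0"
 shows "a k = 0"
proof (rule ccontr)
 assume k: "a k ~= 0"
 define b where "b n = (case n of 0 => 0 | Suc m => a m)" for n
 have "(%n. b n * (x - 0) ^ n) sums (x * f x)" if "norm (x - 0) < r" for x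
 proof -
  have "(%n. b (Suc n) * x ^ Suc n) sums (x * f x)"
   using sums_mult[OF assms(2)[of x], of x] that by (simp add: b_def mult_ac)
  then show ?thesis by (subst (asm) sums_Suc_iff) (simp add: b_def)
 qed
 moreover have "b (Suc k) ~= 0" using k by (simp add: b_def)
 ultimately obtain s where s: "0 < s" "!!z. z : cball 0 s - {0} ==> z * f z ~= 0"
  using powser_0_nonzero[where r = r and a = b and \<xi> = 0 and f = "%x. x * f x" and m = "Suc k"] assms(1) by auto
 define x where "x = - min s (r / 2)"
 have "x : cball 0 s - {0}" "- r < x" "x < 0" using s(1) assms(1) by (auto simp: x_def)
 then show False using s(2)[of x] assms(3)[of x] by simp
qed

text \<open>Order \<open>k\<close> in \<open>p\<close> of
  \<open>sin (pi p) I(p) = - pi^3 (E4(p) - E2(p))\<close>. The equation is known for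
  \<open>-1/8 < p < 0\<close> from \<open>walk_identity\<close>, while both sides have power series
  for \<open>abs p < 1/8\<close>.\<close>

lemma torus_moments_cross:
 "pi ^ 3 * (2 ^ k / fact k * ((\<integral>t. ln (norm4 t) ^ k \<partial>torM) - (\<integral>t. ln (norm2 t) ^ k \<partial>torM))) =
  - (SUM i<=k. sin_coeff i * pi ^ i * (SUM j<=k - i. cross_moment j (k - i - j)))"
proof -
 let ?a = "%k. 2 ^ k / fact k * (\<integral>t. ln (norm4 t) ^ k \<partial>torM)"
 let ?b = "%k. 2 ^ k / fact k * (\<integral>t. ln (norm2 t) ^ k \<partial>torM)"
 let ?T = "%k. SUM j<=k. cross_moment j (k - j)"
 let ?E4 = "%p. \<integral>t. exp (p * ln ((norm4 t)^2)) \<partial>torM"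
 let ?E2 = "%p. \<integral>t. exp (p * ln ((norm2 t)^2)) \<partial>torM"
 let ?I = "%p. \<integral>c. arc_power p c * (ratio_power p c - pi) / c \<partial>posM"
 have n4: "(\<integral>\<^sup>+t. ennreal (exp (p * ln ((norm4 t)^2))) \<partial>torM) = ennreal (1 / (2 * pi ^ 3)) * walk4 p" for p
  unfolding walk4_def quad_mean_def by (rule norm4_integral) measurable
 have n2: "(\<integral>\<^sup>+t. ennreal (exp (p * ln ((norm2 t)^2))) \<partial>torM) = ennreal (1 / pi) * walk2 p" for p
  unfolding walk2_def by (rule norm2_integral) measurable
 \<comment> \<open>Finiteness at the single exponent -1/8 is what \<open>torus_moment_sums\<close>
   requires of both walks.\<close>
 define v2 where "v2 = arc_power (- (1/8)) 4"
 have v2: "0 <= v2" "walk2 (- (1/8)) = ennreal v2" using walk2_arc_power[of "- (1/8)"] arc_power_nn(3)[of 4 "- (1/8)"] by (simp_all add: v2_def)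
 obtain v4 where v4: "0 <= v4" "walk4 (- (1/8)) = ennreal v4" using walk_identity[OF _ _ v2(2,1)] by auto
 have f4: "(\<integral>\<^sup>+t. ennreal (exp (- (1/8) * ln ((norm4 t)^2))) \<partial>torM) < \<infinity>" unfolding n4 v4(2) using v4(1) by (subst ennreal_mult[symmetric]) auto
 have f2: "(\<integral>\<^sup>+t. ennreal (exp (- (1/8) * ln ((norm2 t)^2))) \<partial>torM) < \<infinity>" unfolding n2 v2(2) using v2(1) by (subst ennreal_mult[symmetric]) auto
 have b4: "norm4 t <= 4" for t
  unfolding norm4_def by (intro order_trans[OF norm_triangle_ineq] order_trans[OF add_mono[OF order_trans[OF norm_triangle_ineq add_mono[OF norm_triangle_ineq order_refl]] order_refl]]) simp
 have b2: "norm2 t <= 4" for t unfolding norm2_def by (intro order_trans[OF norm_triangle_ineq]) simp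
 have z: "0 <= norm4 t" "0 <= norm2 t'" for t t' by (simp_all add: norm4_def norm2_def)
 note s4 = torus_moment_sums[OF norm_measurable(1) z(1) b4 f4]
 note s2 = torus_moment_sums[OF norm_measurable(2) z(2) b2 f2]
 define D where "D k = (SUM i<=k. sin_coeff i * pi ^ i * ?T (k - i)) + pi ^ 3 * (?a k - ?b k)" for k
 have "(%k. D k * p ^ k) sums (sin (pi * p) * ?I p + pi ^ 3 * (?E4 p - ?E2 p))" if p: "\<bar>p\<bar> < 1/8" for p
 proof -
  have sinp: "(%i. sin_coeff i * pi ^ i * p ^ i) sums sin (pi * p)"
   using sin_converges[of "pi * p"] by (simp add: power_mult_distrib mult.assoc)
  have p4: "\<bar>p\<bar> < 1/4" using p by simp
  have sT: "(%k. p ^ k * ?T k) sums ?I q" if "q = p" for q using cross_moment_sums(2)[OF p4] that by simp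
  \<comment> \<open>The point 3/16 lies between 1/8 and the radius 1/4, so convergence there gives
    absolute convergence at \<open>p\<close>.\<close>
  have "summable (%k. norm (?T k * p ^ k))"
  proof (rule powser_insidea)
   show "summable (%k. ?T k * (3/16) ^ k)" using cross_moment_sums(2)[of "3/16"] by (simp add: sums_iff mult.commute)
   show "norm p < norm (3/16::real)" using p by simp
  qed
  then have aT: "summable (%k. norm (p ^ k * ?T k))" by (simp only: mult.commute)
  have aS: "summable (%i. norm (sin_coeff i * pi ^ i * p ^ i))"
   using summable_norm_sin[of "pi * p"] by (simp add: power_mult_distrib mult.assoc)
  have "(%k. SUM i<=k. (sin_coeff i * pi ^ i * p ^ i) * (p ^ (k - i) * ?T (k - i))) sums (sin (pi * p) * ?I p)"
   using Cauchy_product_sums[OF aS aT] sinp sT[OF refl] by (simp only: sums_unique[symmetric])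
  moreover have "(SUM i<=k. (sin_coeff i * pi ^ i * p ^ i) * (p ^ (k - i) * ?T (k - i))) = (SUM i<=k. sin_coeff i * pi ^ i * ?T (k - i)) * p ^ k" for k
   unfolding sum_distrib_right[of _ _ "p ^ k"]
  proof (intro sum.cong refl)
   fix i assume "i : {..k}"
   then have "p ^ k = p ^ i * p ^ (k - i)" by (simp flip: power_add)
   then show "(sin_coeff i * pi ^ i * p ^ i) * (p ^ (k - i) * ?T (k - i)) = sin_coeff i * pi ^ i * ?T (k - i) * p ^ k" by (simp only: mult_ac)
  qed
  ultimately have 1: "(%k. (SUM i<=k. sin_coeff i * pi ^ i * ?T (k - i)) * p ^ k) sums (sin (pi * p) * ?I p)" by (simp only:)
  have 2: "(%k. pi ^ 3 * (p ^ k * ?a k - p ^ k * ?b k)) sums (pi ^ 3 * (?E4 p - ?E2 p))"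
   by (intro sums_mult sums_diff s4(1) s2(1) p)
  have alg: "(S + c * (a - b)) * x = S * x + c * (x * a - x * b)" for S c a b x :: real by algebra
  have "D k * p ^ k = (SUM i<=k. sin_coeff i * pi ^ i * ?T (k - i)) * p ^ k + pi ^ 3 * (p ^ k * ?a k - p ^ k * ?b k)" for k
   unfolding D_def by (rule alg)
  then show ?thesis using sums_add[OF 1 2] by (simp only:)
 qed
 moreover have "sin (pi * p) * ?I p + pi ^ 3 * (?E4 p - ?E2 p) = 0" if p: "- (1/8) < p" "p < 0" for p
 proof -
  define s where "s = - p"
  have s: "0 < s" "s < 1/8" and ps: "p = - s" using p by (auto simp: s_def)
  define w2 where "w2 = arc_power (- s) 4"
  have w2: "0 <= w2" "walk2 (- s) = ennreal w2" using walk2_arc_power[of "- s"] arc_power_nn(3)[of 4 "- s"] s by (simp_all add: w2_def)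
  obtain w4 where w4: "0 <= w4" "walk4 (- s) = ennreal w4" "?I (- s) = (w4 / 2 - pi\<^sup>2 * w2) / sin (pi * s)"
   using walk_identity[OF s(1) _ w2(2,1)] s by auto
  have "ennreal (?E4 (- s)) = ennreal (w4 / (2 * pi ^ 3))"
   using s4(2)[of "- s"] s n4[of "- s"] w4 by (simp flip: ennreal_mult)
  then have E4: "?E4 (- s) = w4 / (2 * pi ^ 3)" using w4(1) by (subst (asm) ennreal_inj) (auto intro: integral_nonneg)
  have "ennreal (?E2 (- s)) = ennreal (w2 / pi)"
   using s2(2)[of "- s"] s n2[of "- s"] w2 by (simp flip: ennreal_mult)
  then have E2: "?E2 (- s) = w2 / pi" using w2(1) by (subst (asm) ennreal_inj) (auto intro: integral_nonneg)
  have sin: "0 < sin (pi * s)" using s by (intro sin_gt_zero) auto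
  have "sin (pi * - s) * ?I (- s) = - (w4 / 2 - pi\<^sup>2 * w2)" unfolding w4(3) using sin by simp
  moreover have "pi ^ 3 * (w4 / (2 * pi ^ 3) - w2 / pi) = w4 / 2 - pi\<^sup>2 * w2"
   by (simp add: field_simps power2_eq_square power3_eq_cube)
  ultimately show ?thesis unfolding ps E4 E2 by simp
 qed
 ultimately have "D k = 0" by (intro powser_zero_left[of "1/8" D "%p. sin (pi * p) * ?I p + pi ^ 3 * (?E4 p - ?E2 p)" k]) auto
 then show ?thesis by (simp add: D_def right_diff_distrib)
qed

section \<open>From the moments to the path integrals\<close>

lemma arcM_has_integral:
 fixes g :: "real => real"
 assumes "integrable arcM g"
 shows "(g has_integral (\<integral>th. g th \<partial>arcM)) {0<..<pi}"
proof -
 have s: "set_integrable lborel {0<..<pi} g"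
  using assms unfolding arcM_def set_integrable_def by (subst (asm) integrable_restrict_space) auto
 have "(\<integral>th. g th \<partial>arcM) = (LINT th:{0<..<pi}|lborel. g th)"
  unfolding arcM_def set_lebesgue_integral_def by (subst integral_restrict_space) auto
 then show ?thesis using set_borel_integral_eq_integral[OF s] by (simp add: has_integral_iff)
qed

text \<open>The hypothesis on \<open>ph\<close> covers both geometries: \<open>c = chord ph\<close>
  with \<open>ph < pi\<close> for the circle, and \<open>ph = pi\<close> with a level above 4 for
  the segment.\<close>

lemma moments_has_integral:
 assumes c: "c > 0" and p: "ph <= pi" "!!th. 0 < th ==> th < pi ==> chord th < c \<longleftrightarrow> th < ph"
 shows "((%th. lpow n (c - chord th)) has_integral arc_moment n c) {0..ph}"
  and "((%th. lpow n (1 - chord th / c)) has_integral ratio_moment n c + (if n = 0 then pi else 0)) {0..ph}"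
proof -
 have *: "(g has_integral (\<integral>th. (if chord th < c then g th else 0) \<partial>arcM)) {0..ph}"
  if "integrable arcM (%th. if chord th < c then g th else 0)" for g :: "real => real"
 proof -
  have "((%th. if th : {0<..<ph} then g th else 0) has_integral (\<integral>th. (if chord th < c then g th else 0) \<partial>arcM)) {0<..<pi}"
   by (rule has_integral_eq[OF _ arcM_has_integral[OF that]]) (use p in auto)
  then have "(g has_integral (\<integral>th. (if chord th < c then g th else 0) \<partial>arcM)) {0<..<ph}"
   by (subst (asm) has_integral_restrict) (use p in auto)
  then show ?thesis by (simp only: has_integral_Icc_iff_Ioo)
 qed
 show "((%th. lpow n (c - chord th)) has_integral arc_moment n c) {0..ph}"
  unfolding arc_moment_def by (rule *[OF arc_moment(1)[OF c]])
 show "((%th. lpow n (1 - chord th / c)) has_integral ratio_moment n c + (if n = 0 then pi else 0)) {0..ph}"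
  unfolding ratio_moment_def using *[OF ratio_moment(1)[OF c, of n]] by simp
qed

lemma lpow_inverse: "c > 0 ==> lpow i (1 / c) = fps_nth (fps_exp (- ln c)) i"
 by (simp add: lpow_eq_fps ln_div)

lemma ratio_moment_fps:
 assumes c: "c > 0"
 shows "ratio_moment m c = fps_nth (fps_exp (- ln c) * Abs_fps (%n. arc_moment n c) - fps_const pi) m"
proof -
 have "(\<integral>th. (if chord th < c then lpow m (1 - chord th / c) else 0) \<partial>arcM) =
  (\<integral>th. (SUM i<=m. lpow i (1 / c) * (if chord th < c then lpow (m - i) (c - chord th) else 0)) \<partial>arcM)"
 proof (intro Bochner_Integration.integral_cong refl)
  fix th
  have "1 - chord th / c = (1 / c) * (c - chord th)" using c by (simp add: field_simps)
  then show "(if chord th < c then lpow m (1 - chord th / c) else 0) = (SUM i<=m. lpow i (1 / c) * (if chord th < c then lpow (m - i) (c - chord th) else 0))"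
   using lpow_mult[of "1 / c" "c - chord th" m] c by simp
 qed
 also have "... = (SUM i<=m. lpow i (1 / c) * arc_moment (m - i) c)"
  unfolding arc_moment_def by (subst Bochner_Integration.integral_sum) (auto intro!: integrable_mult_right arc_moment(1) c)
 finally show ?thesis unfolding ratio_moment_def lpow_inverse[OF c] by (simp add: fps_mult_nth atLeast0AtMost)
qed

lemma chord_eq_sin: "chord ph = 4 * (sin (ph/2))^2"
 using cos_double_sin[of "ph/2"] by (simp add: chord_def)

lemma chord_less_iff: "0 < th ==> th < pi ==> 0 < ph ==> ph < pi ==> chord th < chord ph \<longleftrightarrow> th < ph"
 by (simp add: chord_def cos_mono_less_eq)

lemma arc_moment_chord:
 assumes p: "0 < ph" "ph < pi"
 shows "arc_moment n (chord ph) = fps_nth (arc_fps ph) n" "ratio_moment n (chord ph) = fps_nth (ratio_fps ph) n"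
proof -
 have c: "chord ph > 0" using chord_bounds[OF p] by simp
 show a: "arc_moment n (chord ph) = fps_nth (arc_fps ph) n" for n
 proof -
  have "((%th. lpow n (chord ph - chord th)) has_integral arc_moment n (chord ph)) {0..ph}"
   by (rule moments_has_integral(1)[OF c]) (use p chord_less_iff in auto)
  then have "((%th. lpow n (2 * cos th - 2 * cos ph)) has_integral arc_moment n (chord ph)) {0<..<ph}"
   by (simp add: has_integral_Icc_iff_Ioo chord_def)
  then show ?thesis using arc_integral(2)[OF p, of n] by (simp add: integral_unique)
 qed
 then have "Abs_fps (%n. arc_moment n (chord ph)) = arc_fps ph" by (simp add: fps_eq_iff)
 then show "ratio_moment n (chord ph) = fps_nth (ratio_fps ph) n"
  unfolding ratio_moment_fps[OF c] ratio_fps_def by (simp add: chord_eq_sin)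
qed

text \<open>The value of \<open>2 - tau - 1/tau\<close> at \<open>tau = - r\<close>.\<close>

definition seg_level :: "real => real" where "seg_level r = (1 + r)^2 / r"

lemma seg_level:
 assumes r: "0 < r" "r < 1"
 shows "4 < seg_level r" "seg_level r - chord th = 1 / r * (1 + 2 * r * cos th + r^2)" "ln (seg_level r) = 2 * ln (1 + r) - ln r"
proof -
 have "0 < (1 - r)^2" using r by simp
 then show "4 < seg_level r" using r by (simp add: seg_level_def less_divide_eq power2_eq_square algebra_simps)
 show "seg_level r - chord th = 1 / r * (1 + 2 * r * cos th + r^2)"
  using r by (simp add: seg_level_def chord_def power2_eq_square field_simps)
 show "ln (seg_level r) = 2 * ln (1 + r) - ln r" using r by (simp add: seg_level_def ln_div ln_realpow)
qed

lemma arc_moment_seg_level: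
 assumes r: "0 < r" "r < 1"
 shows "arc_moment n (seg_level r) = pi * fps_nth (seg_fps r) n" "ratio_moment n (seg_level r) = pi * fps_nth (seg_ratio_fps r) n"
proof -
 let ?Q = "%th. 1 + 2 * r * cos th + r^2"
 have Q: "0 < ?Q th" for th using seg_quadratic_pos[of r "cos th"] r by simp
 have c: "seg_level r > 0" using seg_level(1)[OF r] by simp
 have i: "(%th. lpow j (?Q th)) integrable_on {0..pi}" for j
  by (intro integrable_continuous_interval continuous_on_lpow continuous_intros Q)
 have a: "arc_moment n (seg_level r) = pi * fps_nth (seg_fps r) n" for n
 proof -
  have "((%th. lpow n (seg_level r - chord th)) has_integral arc_moment n (seg_level r)) {0..pi}"
   by (rule moments_has_integral(1)[OF c]) (use chord_bounds seg_level(1)[OF r] in force)+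
  then have "arc_moment n (seg_level r) = integral {0..pi} (%th. SUM i<=n. lpow i (1 / r) * lpow (n - i) (?Q th))"
   unfolding seg_level(2)[OF r] using lpow_mult[of "1 / r" "?Q _" n] Q r by (simp add: integral_unique)
  also have "... = (SUM i<=n. lpow i (1 / r) * integral {0..pi} (%th. lpow (n - i) (?Q th)))"
   by (subst integral_sum) (auto intro!: integrable_on_mult_right i)
  also have "... = (SUM i<=n. lpow i (1 / r) * (pi * seg_mean (n - i) r))" by (simp add: seg_mean_def)
  also have "... = pi * fps_nth (seg_fps r) n"
   using r by (simp add: seg_fps_def fps_mult_nth lpow_inverse atLeast0AtMost sum_distrib_left mult_ac)
  finally show ?thesis .
 qed
 show "arc_moment n (seg_level r) = pi * fps_nth (seg_fps r) n" by (rule a)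
 have "Abs_fps (%n. arc_moment n (seg_level r)) = fps_const pi * seg_fps r" by (simp add: fps_eq_iff a)
 then have "fps_exp (- ln (seg_level r)) * Abs_fps (%n. arc_moment n (seg_level r)) =
   fps_const pi * ((fps_exp (- ln (seg_level r)) * fps_exp (- ln r)) * Abs_fps (%n. seg_mean n r))"
  by (simp only: seg_fps_def mult_ac)
 also have "fps_exp (- ln (seg_level r)) * fps_exp (- ln r) = fps_exp (- (2 * ln (1 + r)))"
  unfolding seg_level(3)[OF r] by (simp flip: fps_exp_add_mult)
 finally have e: "fps_exp (- ln (seg_level r)) * Abs_fps (%n. arc_moment n (seg_level r)) - fps_const pi = fps_const pi * seg_ratio_fps r"
  by (simp only: seg_ratio_fps_def right_diff_distrib mult_1_right)
 show "ratio_moment n (seg_level r) = pi * fps_nth (seg_ratio_fps r) n"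
  unfolding ratio_moment_fps[OF c] e by simp
qed

section \<open>Splitting the level integral at 4 into circle and segment\<close>

definition circle_moment :: "nat => nat => real" where
 "circle_moment n m = integral {0..pi} (%ph. fps_nth (arc_fps ph) n * fps_nth (ratio_fps ph) m * cot (ph/2))"

definition segment_moment :: "nat => nat => real" where
 "segment_moment n m = integral {0..1} (%r. fps_nth (seg_fps r) n * fps_nth (seg_ratio_fps r) m * ((1 - r) / ((1 + r) * r)))"

text \<open>Below 4 the level is \<open>chord ph\<close> and \<open>dc / c\<close> becomes
  \<open>cot (ph/2) dph\<close>; above 4 it is \<open>(1 + r)^2 / r\<close>, with density
  \<open>(1 - r) / ((1 + r) r)\<close>. Above 4 each factor is \<open>pi\<close> times a normalised
  average, hence \<open>pi^2\<close>. The integrability claims are what the limit arguments for the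
  two moments rely on.\<close>

lemma cross_moment_split:
 shows "(%ph. fps_nth (arc_fps ph) n * fps_nth (ratio_fps ph) m * cot (ph/2)) integrable_on {0..pi}"
  and "(%r. fps_nth (seg_fps r) n * fps_nth (seg_ratio_fps r) m * ((1 - r) / ((1 + r) * r))) integrable_on {0..1}"
  and "cross_moment n m = circle_moment n m + pi^2 * segment_moment n m"
proof -
 let ?f = "%c. arc_moment n c * ratio_moment m c / c"
 have si: "set_integrable lborel {0<..} ?f"
  using cross_moment_integrable[of n m] unfolding posM_def set_integrable_def by (subst (asm) integrable_restrict_space) auto
 have sub: "?f absolutely_integrable_on S" if "S <= {0<..}" "S : sets borel" for S
  using set_integrable_subset[OF si, of S] that unfolding set_integrable_def by (auto intro: integrable_completion[THEN iffD2])
 have "cross_moment n m = integral {0<..} ?f"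
  unfolding cross_moment_def posM_def using set_borel_integral_eq_integral(2)[OF si]
  by (subst integral_restrict_space) (auto simp: set_lebesgue_integral_def)
 also have "... = integral ({0<..<4} \<union> {4<..}) ?f"
  by (rule integral_subset_negligible[symmetric]) (auto intro: negligible_subset[OF negligible_sing[of 4]])
 also have "... = integral {0<..<4} ?f + integral {4<..} ?f"
 proof (rule integral_Un)
  have "{0<..<4::real} \<inter> {4<..} = {}" by auto
  then show "negligible ({0<..<4::real} \<inter> {4<..})" by simp
 qed (auto intro!: set_lebesgue_integral_eq_integral(1)[OF sub])
 finally have cm: "cross_moment n m = integral {0<..<4} ?f + integral {4<..} ?f" .
 have cg: "G absolutely_integrable_on S & integral S G = v" if "!!x. x : S ==> F x = G x" "F absolutely_integrable_on S & integral S F = v"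
  for S :: "real set" and F G :: "real => real" and v
 proof -
  have "F absolutely_integrable_on S \<longleftrightarrow> G absolutely_integrable_on S" by (intro set_integrable_cong refl that(1))
  moreover have "integral S F = integral S G" by (intro integral_cong that(1))
  ultimately show ?thesis using that(2) by simp
 qed
 have i1: "chord ` {0<..<pi} = {0<..<4}"
 proof (intro equalityI subsetI)
  fix c :: real assume c: "c : {0<..<4}"
  let ?p = "arccos (1 - c / 2)"
  have "cos ?p = 1 - c / 2" "0 < ?p" "?p < pi" using c arccos_lt_bounded[of "1 - c / 2"] by (auto intro: cos_arccos)
  then show "c : chord ` {0<..<pi}" by (intro image_eqI[of _ _ ?p]) (auto simp: chord_def)
 qed (use chord_bounds in auto)
 have g1: "\<bar>2 * sin ph\<bar> * ?f (chord ph) = fps_nth (arc_fps ph) n * fps_nth (ratio_fps ph) m * cot (ph/2)" if p: "ph : {0<..<pi}" for ph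
 proof -
  have s: "0 < sin (ph/2)" "0 < sin ph" using p half_angle_bounds[of ph] by (auto intro: sin_gt_zero)
  have ct: "2 * sin ph / chord ph = cot (ph/2)"
   using s sin_double[of "ph/2"] by (simp add: chord_eq_sin cot_def power2_eq_square field_simps)
  have "\<bar>2 * sin ph\<bar> * ?f (chord ph) = arc_moment n (chord ph) * ratio_moment m (chord ph) * (2 * sin ph / chord ph)"
   using s by simp
  then show ?thesis unfolding ct using p arc_moment_chord[of ph] by simp
 qed
 have "(%ph. \<bar>2 * sin ph\<bar> * ?f (chord ph)) absolutely_integrable_on {0<..<pi} &
   integral {0<..<pi} (%ph. \<bar>2 * sin ph\<bar> * ?f (chord ph)) = integral {0<..<4} ?f"
 proof (rule iffD2[OF has_absolute_integral_change_of_variables_1'[where f = ?f and g = chord]])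
  show "(chord has_field_derivative 2 * sin ph) (at ph within {0<..<pi})" for ph
   unfolding chord_def[abs_def] by (auto intro!: derivative_eq_intros)
  show "inj_on chord {0<..<pi}" using cos_inj_pi by (auto simp: inj_on_def chord_def)
  show "?f absolutely_integrable_on chord ` {0<..<pi} & integral (chord ` {0<..<pi}) ?f = integral {0<..<4} ?f"
   unfolding i1 by (intro conjI refl sub) auto
 qed simp
 then have A0: "(%ph. fps_nth (arc_fps ph) n * fps_nth (ratio_fps ph) m * cot (ph/2)) absolutely_integrable_on {0<..<pi} &
  integral {0<..<pi} (%ph. fps_nth (arc_fps ph) n * fps_nth (ratio_fps ph) m * cot (ph/2)) = integral {0<..<4} ?f"
  by (rule cg[rotated]) (rule g1)
 note A = conjunct1[OF A0] conjunct2[OF A0]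
 have i2: "seg_level ` {0<..<1} = {4<..}"
 proof (intro equalityI subsetI)
  fix c :: real assume c: "c : {4<..}"
  \<comment> \<open>The preimage \<open>(d - q) / 2\<close> is the smaller root of
    \<open>r + 1/r = c - 2\<close>.\<close>
  define d where "d = c - 2"
  define q where "q = sqrt (d^2 - 4)"
  have d: "2 < d" using c by (simp add: d_def)
  have "2^2 < d^2" using d by (intro power_strict_mono) auto
  then have q: "0 < q" "q^2 = d^2 - 4" by (simp_all add: q_def)
  have "q < d" using q d by (intro power2_less_imp_less[of q d]) auto
  have "(d - 2)^2 < q^2" using q d by (simp add: power2_eq_square algebra_simps)
  then have "d - 2 < q" by (rule power2_less_imp_less) (use q(1) in simp)
  let ?r = "(d - q) / 2"
  have r: "?r : {0<..<1}" using \<open>q < d\<close> \<open>d - 2 < q\<close> by auto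
  have "(1 + ?r)^2 = c * ?r" using q(2) by (simp add: d_def power2_eq_square field_simps)
  then have "c = seg_level ?r" using r by (simp add: seg_level_def field_simps)
  then show "c : seg_level ` {0<..<1}" using r by blast
 qed (use seg_level(1) in auto)
 have g2: "\<bar>1 - 1 / r\<^sup>2\<bar> * ?f (seg_level r) = pi^2 * (fps_nth (seg_fps r) n * fps_nth (seg_ratio_fps r) m * ((1 - r) / ((1 + r) * r)))"
  if r: "r : {0<..<1}" for r
 proof -
  have r0: "0 < r" "r < 1" using r by auto
  have "r^2 < 1" using r0 by (simp add: power_less_one_iff)
  then have "\<bar>1 - 1 / r\<^sup>2\<bar> = 1 / r^2 - 1" using r0 by (simp add: field_simps)
  also have "... = seg_level r * ((1 - r) / ((1 + r) * r))"
   using r0 by (simp add: seg_level_def divide_simps) (simp add: power2_eq_square algebra_simps)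
  finally have "\<bar>1 - 1 / r\<^sup>2\<bar> = seg_level r * ((1 - r) / ((1 + r) * r))" .
  moreover have "seg_level r ~= 0" using seg_level(1)[OF r0] by simp
  ultimately show ?thesis using arc_moment_seg_level[OF r0] by (simp add: power2_eq_square mult_ac)
 qed
 have "(%r. \<bar>1 - 1 / r\<^sup>2\<bar> * ?f (seg_level r)) absolutely_integrable_on {0<..<1} &
   integral {0<..<1} (%r. \<bar>1 - 1 / r\<^sup>2\<bar> * ?f (seg_level r)) = integral {4<..} ?f"
 proof (rule iffD2[OF has_absolute_integral_change_of_variables_1'[where f = ?f and g = seg_level]])
  show d: "(seg_level has_field_derivative 1 - 1 / r^2) (at r within {0<..<1})" if "r : {0<..<1}" for r
  proof -
   have "((%r. (1 + r)\<^sup>2 / r) has_field_derivative ((2 * (1 + r)) * r - (1 + r)\<^sup>2) / r^2) (at r within {0<..<1})"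
    using that by (auto intro!: derivative_eq_intros simp: power2_eq_square)
   moreover have "((2 * (1 + r)) * r - (1 + r)\<^sup>2) / r^2 = 1 - 1 / r^2"
    using that by (simp add: divide_simps) (simp add: power2_eq_square algebra_simps)
   ultimately show ?thesis by (simp add: seg_level_def[abs_def])
  qed
  show "inj_on seg_level {0<..<1}"
  proof (rule inj_onI)
   fix x y assume xy: "x : {0<..<1}" "y : {0<..<1::real}" "seg_level x = seg_level y"
   then have "(1 + x)^2 * y = (1 + y)^2 * x" by (simp add: seg_level_def field_simps)
   then have "(x - y) * (x * y - 1) = 0" by (simp add: power2_eq_square algebra_simps)
   moreover have "x * y < 1 * 1" using xy by (intro mult_strict_mono) auto
   ultimately show "x = y" by simp
  qed
  show "?f absolutely_integrable_on seg_level ` {0<..<1} & integral (seg_level ` {0<..<1}) ?f = integral {4<..} ?f"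
   unfolding i2 by (intro conjI refl sub) auto
 qed simp
 then have B0: "(%r. pi\<^sup>2 * (fps_nth (seg_fps r) n * fps_nth (seg_ratio_fps r) m * ((1 - r) / ((1 + r) * r)))) absolutely_integrable_on {0<..<1} &
  integral {0<..<1} (%r. pi\<^sup>2 * (fps_nth (seg_fps r) n * fps_nth (seg_ratio_fps r) m * ((1 - r) / ((1 + r) * r)))) = integral {4<..} ?f"
  by (rule cg[rotated]) (rule g2)
 note B = conjunct1[OF B0] conjunct2[OF B0]
 show "(%ph. fps_nth (arc_fps ph) n * fps_nth (ratio_fps ph) m * cot (ph/2)) integrable_on {0..pi}"
  using set_lebesgue_integral_eq_integral(1)[OF A(1)] by (simp add: integrable_on_Icc_iff_Ioo)
 have "(%r. pi\<^sup>2 * (fps_nth (seg_fps r) n * fps_nth (seg_ratio_fps r) m * ((1 - r) / ((1 + r) * r)))) integrable_on {0..1}"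
  using set_lebesgue_integral_eq_integral(1)[OF B(1)] by (simp only: integrable_on_Icc_iff_Ioo)
 from integrable_on_mult_right[OF this, of "1 / pi^2"]
 show "(%r. fps_nth (seg_fps r) n * fps_nth (seg_ratio_fps r) m * ((1 - r) / ((1 + r) * r))) integrable_on {0..1}" by simp
 show "cross_moment n m = circle_moment n m + pi^2 * segment_moment n m"
  unfolding cm A(2)[symmetric] B(2)[symmetric] circle_moment_def segment_moment_def integral_open_interval_real by (simp only: integral_mult_right)
qed

lemma circle_moment_value: "of_real (circle_moment n m) : hpl_values (n + m + 3)"
 unfolding circle_moment_def by (rule arc_integral_value[OF cross_moment_split(1)])

lemma segment_moment_value: "of_real (segment_moment n m) : hpl_values (n + m + 1)"
 unfolding segment_moment_def by (rule segment_integral_value[OF cross_moment_split(2)])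

text \<open>Both sides are coefficients of the same series in \<open>p\<close>, because the two-step
  walk is the arc average at level 4.\<close>

lemma norm2_moment: "2 ^ k / fact k * (\<integral>t. ln (norm2 t) ^ k \<partial>torM) = arc_moment k 4 / pi"
proof -
 let ?b = "%k. 2 ^ k / fact k * (\<integral>t. ln (norm2 t) ^ k \<partial>torM)"
 let ?E = "%p. \<integral>t. exp (p * ln ((norm2 t)^2)) \<partial>torM"
 have n2: "(\<integral>\<^sup>+t. ennreal (exp (p * ln ((norm2 t)^2))) \<partial>torM) = ennreal (arc_power p 4 / pi)" if "\<bar>p\<bar> <= 1/4" for p
 proof -
  have "(\<integral>\<^sup>+t. ennreal (exp (p * ln ((norm2 t)^2))) \<partial>torM) = ennreal (1 / pi) * walk2 p"
   unfolding walk2_def by (rule norm2_integral) measurable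
  then show ?thesis using walk2_arc_power[OF that] arc_power_nn(3)[of 4 p] that by (simp flip: ennreal_mult)
 qed
 have f: "(\<integral>\<^sup>+t. ennreal (exp (- (1/8) * ln ((norm2 t)^2))) \<partial>torM) < \<infinity>" by (subst n2) auto
 have b: "norm2 t <= 4" "0 <= norm2 t" for t
  unfolding norm2_def by (intro order_trans[OF norm_triangle_ineq]) simp_all
 note s = torus_moment_sums[OF norm_measurable(2) b(2,1) f]
 have "(%k. (?b k - arc_moment k 4 / pi) * p ^ k) sums (?E p - arc_power p 4 / pi)" if "\<bar>p\<bar> < 1/8" for p
 proof -
  have "(%k. p ^ k * ?b k - p ^ k * arc_moment k 4 / pi) sums (?E p - arc_power p 4 / pi)"
   using that by (intro sums_diff sums_divide s(1) arc_moment(4)) auto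
  moreover have "p ^ k * x - p ^ k * y / pi = (x - y / pi) * p ^ k" for k x y by (simp add: algebra_simps)
  ultimately show ?thesis by (simp only:)
 qed
 moreover have "?E p - arc_power p 4 / pi = 0" if "\<bar>p\<bar> < 1/8" for p
 proof -
  have "ennreal (?E p) = ennreal (arc_power p 4 / pi)" using s(2)[OF that] n2[of p] that by simp
  then show ?thesis using arc_power_nn(3)[of 4 p] that by (subst (asm) ennreal_inj) (auto intro: integral_nonneg)
 qed
 ultimately have "?b k - arc_moment k 4 / pi = 0"
  by (intro powser_zero_left[of "1/8" "%k. ?b k - arc_moment k 4 / pi" "%p. ?E p - arc_power p 4 / pi" k]) auto
 then show ?thesis by simp
qed

text \<open>At level 4 the average is the limit of \<open>seg_mean\<close> as \<open>r\<close> tends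
  to 1, so it is a value of weight \<open>k\<close>. The passage to the limit is dominated because
  \<open>1 + 2 r cos th + r^2 >= (4 - chord th) / 2\<close> for \<open>r > 1/2\<close>, which the
  arc weight controls.\<close>

lemma arc_moment_4_value: "of_real (arc_moment k 4 / pi) : hpl_values k"
proof -
 let ?Q = "%r th. 1 + 2 * r * cos th + r^2"
 obtain h where h: "hpls k h" "!!r. 0 <= r ==> r < 1 ==> h (of_real r) = of_real (seg_mean k r)"
  using seg_mean_hpls[of k] by blast
 have "((%x. h (of_real x)) ---> of_real (arc_moment k 4 / pi)) (at_left 1)"
 proof (rule tendsto_at_left_sequentially[of "1/2"])
  fix S :: "nat => real" assume S: "!!n. S n < 1" "!!n. 1/2 < S n" "S \<longlonglongrightarrow> 1"
  have pos: "0 < S n" for n using S(2)[of n] by linarith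
  have Q: "0 < ?Q (S n) th" for n th using seg_quadratic_pos[of "S n" "cos th"] S(1)[of n] pos[of n] by simp
  define W where "W th = 4 ^ k * (2 + 2 * arc_weight 4 th)" for th
  have b: "norm (lpow k (?Q (S n) th)) <= W th" if t: "th : space arcM" for n th
  proof -
   have u: "0 < 4 - chord th" using chord_bounds[of th] t by simp
   have "?Q (S n) th = S n * (4 - chord th) + (1 - S n)^2" by (simp add: chord_def power2_eq_square algebra_simps)
   moreover have "1/2 * (4 - chord th) <= S n * (4 - chord th)" using S(2)[of n] u by (intro mult_right_mono) auto
   ultimately have lo: "(4 - chord th) / 2 <= ?Q (S n) th" using zero_le_power2[of "1 - S n"] by linarith
   have "S n * cos th <= 1" using mult_left_mono[OF cos_le_one[of th], of "S n"] pos[of n] S(1)[of n] by linarith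
   moreover have "(S n)^2 <= 1" using pos[of n] S(1)[of n] by (simp add: power_le_one)
   ultimately have hi: "?Q (S n) th <= 16" by linarith
   have p2: "(16::real) powr (1/4) = 2" using powr_powr[of 2 4 "1/4"] by simp
   have "?Q (S n) th powr (1/4) <= 16 powr (1/4)" using hi Q[of n th] by (intro powr_mono2) auto
   moreover have "?Q (S n) th powr (- (1/4)) <= ((4 - chord th) / 2) powr (- (1/4))" using lo u by (intro powr_mono2') auto
   moreover have "((4 - chord th) / 2) powr (- (1/4)) = 2 powr (1/4) * arc_weight 4 th"
    using u by (simp add: powr_divide arc_weight_def powr_minus field_simps)
   moreover have "2 powr (1/4) * arc_weight 4 th <= 2 * arc_weight 4 th"
    using powr_mono2[of "1/4" 2 "16::real"] p2 by (intro mult_right_mono arc_weight_nonneg) auto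
   ultimately have "?Q (S n) th powr (1/4) + ?Q (S n) th powr (- (1/4)) <= 2 + 2 * arc_weight 4 th" using p2 by linarith
   then have "(?Q (S n) th powr (1/4) + ?Q (S n) th powr (- (1/4))) * 4 ^ k <= (2 + 2 * arc_weight 4 th) * 4 ^ k" by (intro mult_right_mono) auto
   moreover have "\<bar>lpow k (?Q (S n) th)\<bar> <= (?Q (S n) th powr (1/4) + ?Q (S n) th powr (- (1/4))) * 4 ^ k"
    using abs_lpow_le[OF Q[of n th], of "1/4" k] by (simp add: power_divide)
   ultimately show ?thesis unfolding W_def real_norm_def mult.commute[of "4 ^ k"] by (rule order_trans[rotated])
  qed
  have lim: "(%n. lpow k (?Q (S n) th)) \<longlonglongrightarrow> (if chord th < 4 then lpow k (4 - chord th) else 0)" if t: "th : space arcM" for th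
  proof -
   have u: "chord th < 4" "2 + 2 * cos th = 4 - chord th" using chord_bounds[of th] t by (auto simp: chord_def)
   have "(%n. lpow k (?Q (S n) th)) \<longlonglongrightarrow> ln (1 + 2 * 1 * cos th + 1^2) ^ k / fact k"
    unfolding lpow_def using u by (intro tendsto_intros S(3)) auto
   then show ?thesis using u by (simp add: lpow_def)
  qed
  have m: "(%th. lpow k (?Q (S n) th)) : borel_measurable arcM" "(%th. if chord th < 4 then lpow k (4 - chord th) else 0) : borel_measurable arcM" for n
   by (rule borel_arcM, measurable)+
  have Wi: "integrable arcM W" unfolding W_def
   by (intro integrable_mult_right Bochner_Integration.integrable_add integrable_arcM_const arc_weight(1)) simp
  have ae: "AE th in arcM. (%n. lpow k (?Q (S n) th)) \<longlonglongrightarrow> (if chord th < 4 then lpow k (4 - chord th) else 0)"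
   "AE th in arcM. norm (lpow k (?Q (S n) th)) <= W th" for n
   by (rule AE_I2, erule lim, rule AE_I2, erule b)
  have dom: "(%n. \<integral>th. lpow k (?Q (S n) th) \<partial>arcM) \<longlonglongrightarrow> arc_moment k 4"
   unfolding arc_moment_def by (rule integral_dominated_convergence[OF m(2) m(1) Wi ae])
  have int: "integrable arcM (%th. lpow k (?Q (S n) th))" for n
   by (rule integrable_dominated_convergence2[OF m(2) m(1) Wi ae])
  have "h (of_real (S n)) = of_real ((\<integral>th. lpow k (?Q (S n) th) \<partial>arcM) / pi)" for n
   using h(2)[of "S n"] pos[of n] S(1)[of n] arcM_has_integral[OF int, of n]
   by (simp add: seg_mean_def integral_open_interval_real integral_unique)
  then show "(%n. h (of_real (S n))) \<longlonglongrightarrow> of_real (arc_moment k 4 / pi)"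
   by (simp only:) (intro tendsto_of_real tendsto_divide dom tendsto_const, simp)
 qed simp
 then show ?thesis by (rule hpl_valuesI[OF h(1)])
qed

section \<open>The path integrals of the statement in terms of the moments\<close>

lemma ccw_integral_eq:
 assumes "0 < ph" "ph < 2 * pi"
 shows "ccw_integral 1 (cis ph) f = integral {0<..<ph} (%t. f (cis t) * \<i> * cis t)"
proof -
 have "Arg2pi 1 = 0" by (rule Arg2pi_unique[of 1]) auto
 moreover have "Arg2pi (cis ph) = ph" using assms by (intro Arg2pi_unique[of 1]) (auto simp: cis_conv_exp)
 ultimately show ?thesis using assms
  by (simp add: ccw_integral_def contour_integral_part_circlepath_eq integral_open_interval_real)
qed

lemma A4_eq: "t ~= 0 ==> \<tau> ~= 0 ==> A4 t \<tau> = (t + 1 / t) - (\<tau> + 1 / \<tau>)"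
 by (simp add: A4_def field_simps)

lemma B4_eq: "\<tau> ~= 0 ==> \<tau> ~= 1 ==> B4 \<tau> = 1 / (2 - (\<tau> + 1 / \<tau>))"
proof -
 assume t: "\<tau> ~= 0" "\<tau> ~= 1"
 have "2 - (\<tau> + 1 / \<tau>) = - ((1 - \<tau>)^2 / \<tau>)" using t by (simp add: field_simps power2_eq_square)
 then show ?thesis using t by (simp add: B4_def)
qed

lemma cis_plus_inverse: "cis th + 1 / cis th = of_real (2 * cos th)"
 by (simp add: complex_eq_iff inverse_eq_divide[symmetric] cis_inverse)

text \<open>The inner integrals see \<open>tau\<close> only through
  \<open>c = 2 - tau - 1/tau\<close>, so one computation serves both paths. The parameter
  \<open>x\<close> is 0 on the circle and the Kronecker delta on the segment.\<close>

lemma path_moments: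
 assumes c: "c > 0" and p: "0 < ph" "ph <= pi" "!!th. 0 < th ==> th < pi ==> chord th < c \<longleftrightarrow> th < ph"
  and \<tau>: "\<tau> ~= 0" "\<tau> ~= 1" "\<tau> + 1 / \<tau> = of_real (2 - c)"
 shows "ccw_integral 1 (cis ph) (%t. Ln (A4 t \<tau>) ^ n / t) = \<i> * of_real (fact n * arc_moment n c)"
  and "ccw_integral 1 (cis ph) (%t. ((Ln (A4 t \<tau>) + Ln (B4 \<tau>)) ^ n - x) / t) =
   \<i> * (of_real (fact n * (ratio_moment n c + (if n = 0 then pi else 0))) - of_real ph * x)"
proof -
 have A: "A4 (cis th) \<tau> = of_real (c - chord th)" for th
  using A4_eq[of "cis th" \<tau>] \<tau> cis_plus_inverse[of th] by (simp add: chord_def)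
 have B: "Ln (B4 \<tau>) = of_real (ln (1 / c))"
  using B4_eq[OF \<tau>(1,2)] \<tau>(3) c Ln_of_real[of "1 / c"] by simp
 have lA: "Ln (A4 (cis th) \<tau>) = of_real (ln (c - chord th))" if "th : {0<..<ph}" for th
  using p(3)[of th] p(2) that unfolding A by (intro Ln_of_real) auto
 have lAB: "ln (c - chord th) + ln (1 / c) = ln (1 - chord th / c)" if "th : {0<..<ph}" for th
 proof -
  have "0 < c - chord th" using p(3)[of th] p(2) that by auto
  then have "ln (c - chord th) + ln (1 / c) = ln ((c - chord th) * (1 / c))" using c by (intro ln_mult_pos[symmetric]) auto
  also have "(c - chord th) * (1 / c) = 1 - chord th / c" using c by (simp add: field_simps)
  finally show ?thesis .
 qed
 have lt: "ph < 2 * pi" using p pi_gt_zero by linarith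
 have fl: "ln y ^ n = fact n * lpow n y" for y by (simp add: lpow_def)
 have "((%th. \<i> * of_real (fact n * lpow n (c - chord th))) has_integral \<i> * of_real (fact n * arc_moment n c)) {0<..<ph}"
  using moments_has_integral(1)[OF c p(2,3), of n] unfolding has_integral_Icc_iff_Ioo
  by (intro has_integral_mult_right has_integral_of_real)
 then have "integral {0<..<ph} (%t. Ln (A4 (cis t) \<tau>) ^ n / cis t * \<i> * cis t) = \<i> * of_real (fact n * arc_moment n c)"
  by (intro trans[OF integral_cong integral_unique]) (auto simp: lA fl simp flip: of_real_power)
 then show "ccw_integral 1 (cis ph) (%t. Ln (A4 t \<tau>) ^ n / t) = \<i> * of_real (fact n * arc_moment n c)"
  by (simp only: ccw_integral_eq[OF p(1) lt])
 have "((%th. \<i> * (of_real (fact n * lpow n (1 - chord th / c)) - x)) has_integral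
   \<i> * (of_real (fact n * (ratio_moment n c + (if n = 0 then pi else 0))) - of_real ph * x)) {0<..<ph}"
 proof (intro has_integral_mult_right has_integral_diff has_integral_of_real)
  show "((%th. lpow n (1 - chord th / c)) has_integral ratio_moment n c + (if n = 0 then pi else 0)) {0<..<ph}"
   using moments_has_integral(2)[OF c p(2,3), of n] unfolding has_integral_Icc_iff_Ioo .
  show "((%th. x) has_integral of_real ph * x) {0<..<ph}"
   using has_integral_const_real[of x 0 ph] p(1) unfolding has_integral_Icc_iff_Ioo by (simp add: scaleR_conv_of_real)
 qed
 moreover have "((Ln (A4 (cis t) \<tau>) + Ln (B4 \<tau>)) ^ n - x) / cis t * \<i> * cis t = \<i> * (of_real (fact n * lpow n (1 - chord t / c)) - x)" if "t : {0<..<ph}" for t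
 proof -
  have "Ln (A4 (cis t) \<tau>) + Ln (B4 \<tau>) = of_real (ln (1 - chord t / c))"
   unfolding lA[OF that] B lAB[OF that, symmetric] by simp
  then show ?thesis by (simp only: fl flip: of_real_power) simp
 qed
 ultimately show "ccw_integral 1 (cis ph) (%t. ((Ln (A4 t \<tau>) + Ln (B4 \<tau>)) ^ n - x) / t) =
   \<i> * (of_real (fact n * (ratio_moment n c + (if n = 0 then pi else 0))) - of_real ph * x)"
  unfolding ccw_integral_eq[OF p(1) lt] by (intro trans[OF integral_cong integral_unique])
qed

lemma X4_cis:
 assumes p: "0 < ph" "ph < pi"
 shows "X4_tilde n (cis ph) = \<i> * of_real (fact n * fps_nth (arc_fps ph) n)"
  and "X4 n (cis ph) = \<i> * of_real (fact n * fps_nth (ratio_fps ph) n)"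
proof -
 have c: "0 < chord ph" using chord_bounds[OF p] by simp
 have t: "cis ph + 1 / cis ph = of_real (2 - chord ph)" unfolding cis_plus_inverse by (simp add: chord_def)
 have n1: "cis ph ~= 1" using c by (auto simp: chord_def complex_eq_iff)
 note P = path_moments[OF c p(1) less_imp_le[OF p(2)] chord_less_iff[OF _ _ p] cis_neq_zero n1 t]
 show "X4_tilde n (cis ph) = \<i> * of_real (fact n * fps_nth (arc_fps ph) n)"
  unfolding X4_tilde_def arc_moment_chord(1)[OF p, symmetric] by (rule P(1)) assumption+
 have "ccw_integral 1 (cis ph) (%t. ((Ln (A4 t (cis ph)) + Ln (B4 (cis ph))) ^ n - 0) / t) =
   \<i> * (of_real (fact n * (ratio_moment n (chord ph) + (if n = 0 then pi else 0))) - of_real ph * 0)"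
  by (rule P(2)) assumption+
 then show "X4 n (cis ph) = \<i> * of_real (fact n * fps_nth (ratio_fps ph) n)"
  unfolding X4_def arc_moment_chord(2)[OF p, symmetric] by (cases n) (auto simp: kdelta_def algebra_simps)
qed

lemma Xi4_seg:
 assumes r: "0 < r" "r < 1"
 shows "Xi4_tilde n (- of_real r) = \<i> * of_real (pi * (fact n * fps_nth (seg_fps r) n))"
  and "Xi4 n (- of_real r) = \<i> * of_real (pi * (fact n * fps_nth (seg_ratio_fps r) n))"
proof -
 have c: "0 < seg_level r" using seg_level(1)[OF r] by simp
 have "2 - seg_level r = - r - 1 / r" using r by (simp add: seg_level_def field_simps power2_eq_square)
 then have t: "- complex_of_real r + 1 / (- of_real r) = of_real (2 - seg_level r)" by simp
 have n: "- complex_of_real r ~= 0" using r by simp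
 have n1: "- complex_of_real r ~= 1" using r by (metis of_real_1 of_real_eq_iff of_real_minus neg_less_0_iff_less not_one_less_zero)
 have m: "cis pi = -1" by simp
 have h: "chord th < seg_level r \<longleftrightarrow> th < pi" if "0 < th" "th < pi" for th
  using chord_bounds[OF that] seg_level(1)[OF r] that by simp
 note P = path_moments[OF c pi_gt_zero order_refl h n n1 t, unfolded m]
 have "ccw_integral 1 (- 1) (%t. Ln (A4 t (- of_real r)) ^ n / t) = \<i> * of_real (fact n * arc_moment n (seg_level r))"
  by (rule P(1)) assumption+
 then show "Xi4_tilde n (- of_real r) = \<i> * of_real (pi * (fact n * fps_nth (seg_fps r) n))"
  unfolding Xi4_tilde_def arc_moment_seg_level[OF r] by (simp add: mult_ac)
 have "ccw_integral 1 (- 1) (%t. ((Ln (A4 t (- of_real r)) + Ln (B4 (- of_real r))) ^ n - kdelta n 0) / t) =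
  \<i> * (of_real (fact n * (ratio_moment n (seg_level r) + (if n = 0 then pi else 0))) - of_real pi * kdelta n 0)"
  by (rule P(2)) assumption+
 then show "Xi4 n (- of_real r) = \<i> * of_real (pi * (fact n * fps_nth (seg_ratio_fps r) n))"
  unfolding Xi4_def arc_moment_seg_level[OF r] by (cases n) (auto simp: kdelta_def algebra_simps)
qed

lemma integral_of_real_eq: "f integrable_on S ==> integral S (%x. complex_of_real (f x)) = of_real (integral S f)"
 by (rule integral_unique[OF has_integral_of_real[OF integrable_integral]])

text \<open>The two inner integrals contribute \<open>i^2 = -1\<close>, and the outer form is
  \<open>cot (ph/2) dph\<close>. The factorials undo those in \<open>lpow\<close>.\<close>

lemma circle_integral_eq:
 "ccw_integral 1 (-1) (%\<tau>. X4_tilde n \<tau> * X4 m \<tau> * ((\<tau> + 1) / (\<tau> - 1)) / \<tau>) = - of_real (fact n * fact m * circle_moment n m)"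
proof -
 let ?F = "%\<tau>. X4_tilde n \<tau> * X4 m \<tau> * ((\<tau> + 1) / (\<tau> - 1)) / \<tau>"
 let ?g = "%ph. fps_nth (arc_fps ph) n * fps_nth (ratio_fps ph) m * cot (ph/2)"
 have "?F (cis ph) * \<i> * cis ph = - (fact n * fact m) * of_real (?g ph)" if "ph : {0<..<pi}" for ph
 proof -
  have p: "0 < ph" "ph < pi" using that by auto
  have s: "0 < sin (ph/2)" using half_angle_bounds[OF p] by simp
  have "cis ((ph - pi) / 2) = cis (ph/2) * - \<i>" by (simp add: diff_divide_distrib cis_divide[symmetric])
  then have m1: "cis ph - 1 = cis (ph/2) * (of_real (2 * sin (ph/2)) * \<i>)"
   using one_minus_cis[of ph] by (simp add: algebra_simps)
  have p1: "cis ph + 1 = cis (ph/2) * of_real (2 * cos (ph/2))" using one_plus_cis[of ph] by (simp add: algebra_simps)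
  have "(cis ph + 1) / (cis ph - 1) = of_real (2 * cos (ph/2)) / (of_real (2 * sin (ph/2)) * \<i>)"
   unfolding m1 p1 by (rule mult_divide_mult_cancel_left) (rule cis_neq_zero)
  also have "... = - \<i> * of_real (cot (ph/2))" using s by (simp add: cot_def field_simps)
  finally have e: "(cis ph + 1) / (cis ph - 1) = - \<i> * of_real (cot (ph/2))" .
  show ?thesis unfolding e X4_cis[OF p] by (simp add: field_simps)
 qed
 then have "integral {0<..<pi} (%ph. ?F (cis ph) * \<i> * cis ph) = integral {0<..<pi} (%ph. - (fact n * fact m) * of_real (?g ph))"
  by (rule integral_cong)
 also have "... = - (fact n * fact m) * of_real (integral {0<..<pi} ?g)"
  using integral_of_real_eq[of ?g "{0<..<pi}"] cross_moment_split(1)[of n m] by (simp add: integrable_on_Icc_iff_Ioo)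
 finally show ?thesis using ccw_integral_eq[of pi ?F] by (simp add: circle_moment_def integral_open_interval_real)
qed

text \<open>With \<open>tau = - r\<close> the outer form has density
  \<open>(1 - r) / ((1 + r) r)\<close>; reversing the direction of \<open>r\<close> accounts for
  \<open>dtau = - dr\<close>. The two inner integrals give \<open>(i pi)^2\<close>.\<close>

lemma segment_integral_eq:
 "contour_integral (linepath (-1) 0) (%\<tau>. Xi4_tilde n \<tau> * Xi4 m \<tau> * ((\<tau> + 1) / (\<tau> - 1)) / \<tau>) = - of_real (fact n * fact m * (pi^2 * segment_moment n m))"
proof -
 let ?F = "%\<tau>. Xi4_tilde n \<tau> * Xi4 m \<tau> * ((\<tau> + 1) / (\<tau> - 1)) / \<tau>"
 let ?g = "%r. fps_nth (seg_fps r) n * fps_nth (seg_ratio_fps r) m * ((1 - r) / ((1 + r) * r))"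
 have F: "of_real (- (fact n * fact m * pi^2) * ?g r) = ?F (- of_real r)" if r: "r : {0<..<1}" for r
 proof -
  have r0: "0 < r" "r < 1" using r by auto
  have "((- complex_of_real r + 1) / (- of_real r - 1)) / (- of_real r) = of_real ((- r + 1) / (- r - 1) / (- r))" by simp
  also have "(- r + 1) / (- r - 1) / (- r) = (1 - r) / ((1 + r) * r)" using r0 by (simp add: divide_simps) (simp add: algebra_simps)
  finally have e: "((- complex_of_real r + 1) / (- of_real r - 1)) / (- of_real r) = of_real ((1 - r) / ((1 + r) * r))" .
  have "?F (- of_real r) = Xi4_tilde n (- of_real r) * Xi4 m (- of_real r) * of_real ((1 - r) / ((1 + r) * r))" unfolding e[symmetric] by simp
  also have "... = of_real (- (fact n * fact m * pi^2) * ?g r)"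
  proof -
   have "\<i> * (P * (x * a)) * (\<i> * (P * (y * b))) * R = - (x * y * P^2) * (a * b * R)" for P x a y b R :: complex
    using i_squared by algebra
   then show ?thesis unfolding Xi4_seg[OF r0] by (simp only: of_real_mult of_real_minus of_real_fact of_real_power)
  qed
  finally show ?thesis by simp
 qed
 have "((%r. - (fact n * fact m * pi^2) * ?g r) has_integral - (fact n * fact m * pi^2) * segment_moment n m) {0<..<1}"
  unfolding segment_moment_def has_integral_Icc_iff_Ioo[symmetric] by (intro has_integral_mult_right integrable_integral cross_moment_split(2))
 from has_integral_of_real[OF this]
 have "((%r. complex_of_real (- (fact n * fact m * pi^2) * ?g r)) has_integral of_real (- (fact n * fact m * pi^2) * segment_moment n m)) {0<..<1}" .
 then have "((%r. ?F (- of_real r)) has_integral of_real (- (fact n * fact m * pi^2) * segment_moment n m)) {0<..<1}"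
  by (rule has_integral_eq[rotated]) (rule F)
 then have "((%r. ?F (- of_real r)) has_integral of_real (- (fact n * fact m * pi^2) * segment_moment n m)) (cbox 0 1)"
  by (simp only: has_integral_Icc_iff_Ioo cbox_interval)
 from has_integral_affinity[OF this, of "-1" 1]
 have "((%x. ?F (- of_real (1 - x))) has_integral of_real (- (fact n * fact m * pi^2) * segment_moment n m)) ((%x. 1 - x) ` {0..1})"
  by simp
 moreover have "(%x. 1 - x) ` {0..1::real} = {0..1}" by (auto intro: image_eqI[of _ _ "1 - _"])
 ultimately have "((%x. ?F (linepath (-1) 0 x) * (0 - (-1))) has_integral of_real (- (fact n * fact m * pi^2) * segment_moment n m)) {0..1}"
  by (simp add: linepath_def scaleR_conv_of_real)
 then have "(?F has_contour_integral of_real (- (fact n * fact m * pi^2) * segment_moment n m)) (linepath (-1) 0)"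
  unfolding has_contour_integral_linepath .
 then show ?thesis by (simp add: contour_integral_unique mult_ac)
qed

lemma subspace_cyclotomic: "rat_complex.subspace (cyclotomic_mzv_space n N)"
 by (rule rat_complex.subspaceI) (auto intro: cyclotomic_mzv_space_0 cyclotomic_mzv_space_add cyclotomic_mzv_space_scale)

lemma fact_hpl_values: "v : hpl_values n ==> - (fact i * fact j * v) : hpl_values n"
 using hpl_values_scale[of v n "- (fact i * fact j)"] by (simp add: of_rat_minus of_rat_mult of_rat_fact)

text \<open>The weights add up to \<open>2 n1 + (n2 + n3 + 3) = k + 2\<close>.\<close>

lemma circle_span_subset: "circle_span k <= cyclotomic_mzv_space (k + 2) 2"
 unfolding circle_span_def
proof (rule rat_complex.span_minimal[OF _ subspace_cyclotomic], clarify)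
 fix n1 n2 n3
 have "of_real pi ^ (2 * n1) * (- (fact n2 * fact n3 * of_real (circle_moment n2 n3))) : hpl_values (2 * n1 + (n2 + n3 + 3))"
  by (intro hpl_values_pi_power fact_hpl_values circle_moment_value)
 moreover have "2 * n1 + (n2 + n3 + 3) = 2 * n1 + 1 + n2 + n3 + 2" by simp
 ultimately show "of_real pi ^ (2 * n1) * ccw_integral 1 (-1) (%\<tau>. X4_tilde n2 \<tau> * X4 n3 \<tau> * ((\<tau> + 1) / (\<tau> - 1)) / \<tau>)
   : cyclotomic_mzv_space (2 * n1 + 1 + n2 + n3 + 2) 2"
  unfolding circle_integral_eq using hpl_values_subset by (simp only: of_real_mult of_real_fact) blast
qed

text \<open>The segment moment has weight \<open>n2 + n3 + 1\<close> only; the factor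
  \<open>pi^2\<close> from the two inner integrals supplies the missing 2.\<close>

lemma segment_span_subset: "segment_span k <= cyclotomic_mzv_space (k + 2) 2"
 unfolding segment_span_def
proof (rule rat_complex.span_minimal[OF _ subspace_cyclotomic], clarify)
 fix n1 n2 n3
 have "of_real pi ^ (2 * Suc n1) * (- (fact n2 * fact n3 * of_real (segment_moment n2 n3))) : hpl_values (2 * Suc n1 + (n2 + n3 + 1))"
  by (intro hpl_values_pi_power fact_hpl_values segment_moment_value)
 moreover have "2 * Suc n1 + (n2 + n3 + 1) = 2 * n1 + 1 + n2 + n3 + 2" by simp
 moreover have "of_real pi ^ (2 * Suc n1) * (- (fact n2 * fact n3 * complex_of_real (segment_moment n2 n3))) =
  of_real pi ^ (2 * n1) * - of_real (fact n2 * fact n3 * (pi^2 * segment_moment n2 n3))" by (simp add: power2_eq_square mult_ac)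
 ultimately show "of_real pi ^ (2 * n1) * contour_integral (linepath (-1) 0) (%\<tau>. Xi4_tilde n2 \<tau> * Xi4 n3 \<tau> * ((\<tau> + 1) / (\<tau> - 1)) / \<tau>)
   : cyclotomic_mzv_space (2 * n1 + 1 + n2 + n3 + 2) 2"
  unfolding segment_integral_eq using hpl_values_subset by (simp only:) blast
qed

lemma mahler_moment_norm:
 "mahler_moment k (%x :: complex ^ 3. 1 + x $ 1 + x $ 2 + x $ 3) = (\<integral>t. ln (norm4 t) ^ k \<partial>torM)"
 "mahler_moment k (%x :: complex ^ 1. 1 + x $ 1) = (\<integral>t. ln (norm2 t) ^ k \<partial>torM)"
proof -
 have e: "exp (2 * of_real pi * \<i> * of_real t) = cis (2 * pi * t)" for t by (simp add: cis_conv_exp mult_ac)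
 have i: "(\<integral>t. f t \<partial>torM) = (LINT t:cbox 0 1|lborel. f t)" for f :: "real ^ 'n => real"
  unfolding torM_def set_lebesgue_integral_def by (subst integral_restrict_space) auto
 show "mahler_moment k (%x :: complex ^ 3. 1 + x $ 1 + x $ 2 + x $ 3) = (\<integral>t. ln (norm4 t) ^ k \<partial>torM)"
  unfolding mahler_moment_def i norm4_def by (simp add: e)
 show "mahler_moment k (%x :: complex ^ 1. 1 + x $ 1) = (\<integral>t. ln (norm2 t) ^ k \<partial>torM)"
  unfolding mahler_moment_def i norm2_def by (simp add: e)
qed

text \<open>The sine has only odd coefficients. For \<open>i = 2 a + 1\<close> the quotient
  \<open>pi^i / pi\<close> is \<open>pi^(2 a)\<close> and the remaining factor is rational, which is
  the shape of the generators.\<close>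

lemma sum_in_rational_span:
 assumes I: "!!a j l. 2 * a + 1 + j + l = k ==> of_real pi ^ (2 * a) * I j l : rat_complex.span V"
 shows "(SUM i<=k. SUM j<=k - i. of_real (fact k / 2 ^ k * (sin_coeff i * (pi ^ i / pi)) / (fact j * fact (k - i - j))) * I j (k - i - j)) : rat_complex.span V"
proof (intro rat_complex.span_sum)
 fix i j assume i: "i : {..k}" and j: "j : {..k - i}"
 let ?l = "k - i - j"
 show "of_real (fact k / 2 ^ k * (sin_coeff i * (pi ^ i / pi)) / (fact j * fact ?l)) * I j ?l : rat_complex.span V"
 proof (cases "even i")
  case True
  then show ?thesis using rat_complex.span_zero by (simp add: sin_coeff_def)
 next
  case False
  then obtain a where a: "i = 2 * a + 1" by (auto elim: oddE)
  have "of_rat (fact k / 2 ^ k * ((-1) ^ a / fact i) / (fact j * fact ?l)) * (of_real pi ^ (2 * a) * I j ?l) : rat_complex.span V"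
   using i j a by (intro rat_complex.span_scale I) auto
  moreover have "complex_of_rat (fact k / 2 ^ k * ((-1) ^ a / fact i) / (fact j * fact ?l)) * of_real pi ^ (2 * a)
   = of_real (fact k / 2 ^ k * (sin_coeff i * (pi ^ i / pi)) / (fact j * fact ?l))"
  proof -
   have "pi ^ i / pi = pi ^ (2 * a)" "sin_coeff i = (-1) ^ a / fact i" using a by (simp_all add: sin_coeff_def)
   then show ?thesis by (simp add: of_rat_divide of_rat_mult of_rat_power of_rat_minus of_rat_fact)
  qed
  ultimately show ?thesis by (simp only: mult.assoc[symmetric])
 qed
qed

theorem mainTheorem4:
  fixes k :: nat
  assumes "k > 0"
  shows
    "complex_of_real (pi\<^sup>2 * mahler_moment k (\<lambda>x :: complex ^ 3. 1 + x $ 1 + x $ 2 + x $ 3)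
                      - pi\<^sup>2 * mahler_moment k (\<lambda>x :: complex ^ 1. 1 + x $ 1))
       \<in> circle_span k + segment_span k
     \<and> circle_span k + segment_span k \<subseteq> cyclotomic_mzv_space (k + 2) 2
     \<and> complex_of_real (pi\<^sup>2 * mahler_moment k (\<lambda>x :: complex ^ 3. 1 + x $ 1 + x $ 2 + x $ 3))
       \<in> cyclotomic_mzv_space (k + 2) 2"
proof -
 let ?m4 = "mahler_moment k (%x :: complex ^ 3. 1 + x $ 1 + x $ 2 + x $ 3)"
 let ?m2 = "mahler_moment k (%x :: complex ^ 1. 1 + x $ 1)"
 let ?C = "%n m. ccw_integral 1 (-1) (%\<tau>. X4_tilde n \<tau> * X4 m \<tau> * ((\<tau> + 1) / (\<tau> - 1)) / \<tau>)"
 let ?S = "%n m. contour_integral (linepath (-1) 0) (%\<tau>. Xi4_tilde n \<tau> * Xi4 m \<tau> * ((\<tau> + 1) / (\<tau> - 1)) / \<tau>)"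
 \<comment> \<open>\<open>fact k / 2 ^ k\<close> undoes the normalisation of the moment series, the
   factorials below cancel those of the path integrals, and the division by \<open>pi\<close> turns
   \<open>pi^3\<close> into \<open>pi^2\<close>.\<close>
 let ?q = "%i j. fact k / 2 ^ k * (sin_coeff i * (pi ^ i / pi)) / (fact j * fact (k - i - j))"
 have C: "(SUM i<=k. SUM j<=k - i. of_real (?q i j) * ?C j (k - i - j)) : circle_span k"
  unfolding circle_span_def by (rule sum_in_rational_span) (auto intro!: rat_complex.span_base)
 have S: "(SUM i<=k. SUM j<=k - i. of_real (?q i j) * ?S j (k - i - j)) : segment_span k"
  unfolding segment_span_def by (rule sum_in_rational_span) (auto intro!: rat_complex.span_base)
 have CS: "of_real (?q i j) * ?C j l + of_real (?q i j) * ?S j l = - of_real (fact k / 2 ^ k / pi * (sin_coeff i * pi ^ i * cross_moment j l))"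
  if "l = k - i - j" for i j l
  unfolding circle_integral_eq segment_integral_eq cross_moment_split(3) that by (simp add: field_simps)
 have "(SUM i<=k. SUM j<=k - i. of_real (?q i j) * ?C j (k - i - j)) + (SUM i<=k. SUM j<=k - i. of_real (?q i j) * ?S j (k - i - j)) =
  complex_of_real (fact k / 2 ^ k / pi * (- (SUM i<=k. sin_coeff i * pi ^ i * (SUM j<=k - i. cross_moment j (k - i - j)))))"
  unfolding sum.distrib[symmetric] CS[OF refl] by (simp add: sum_distrib_left sum_negf)
 also have "... = of_real (pi^2 * ?m4 - pi\<^sup>2 * ?m2)"
  unfolding torus_moments_cross[symmetric] mahler_moment_norm by (simp add: power2_eq_square power3_eq_cube algebra_simps)
 finally have in_sum: "complex_of_real (pi^2 * ?m4 - pi\<^sup>2 * ?m2) : circle_span k + segment_span k"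
  using set_plus_intro[OF C S] by simp
 have sub: "circle_span k + segment_span k <= cyclotomic_mzv_space (k + 2) 2"
  using circle_span_subset segment_span_subset by (auto elim!: set_plus_elim intro!: cyclotomic_mzv_space_add)
 \<comment> \<open>The moment of \<open>1 + x1\<close> has weight \<open>k\<close>, so times
   \<open>pi^2\<close> it lies in the same space and can be added back.\<close>
 have "of_rat (fact k / 2 ^ k) * (of_real pi ^ (2 * 1) * of_real (arc_moment k 4 / pi)) : hpl_values (2 * 1 + k)"
  by (intro hpl_values_scale hpl_values_pi_power arc_moment_4_value)
 moreover have "of_rat (fact k / 2 ^ k) * (of_real pi ^ (2 * 1) * of_real (arc_moment k 4 / pi)) = complex_of_real (pi^2 * ?m2)"
  unfolding norm2_moment[symmetric] mahler_moment_norm by (simp add: of_rat_divide of_rat_fact of_rat_power)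
 ultimately have "complex_of_real (pi^2 * ?m2) : cyclotomic_mzv_space (k + 2) 2"
  using hpl_values_subset[of "k + 2"] by (auto simp: add.commute)
 from cyclotomic_mzv_space_add[OF subsetD[OF sub in_sum] this]
 have "complex_of_real (pi^2 * ?m4) : cyclotomic_mzv_space (k + 2) 2" by simp
 with in_sum sub show ?thesis by blast
qed

end
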